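(* Let $(V,\cdot,\delta_V)$ be a commutative, not necessarily unitary, bialgebra over a field $\mathbb{K}$. Let $(\mathbf{P},m,\Delta)$ be a twisted bialgebra with a compatible contraction-extraction coproduct (in the sense of the context), and let $\mathbf{P}'=\mathbf{P}\circ\mathbf{Com}$ be the associated double twisted bialgebra $(\mathbf{P}',m',\Delta',\delta')$. There exists a unique coproduct $\delta$ on $\mathcal{F}_V[\mathbf{P}]$ making $(\mathcal{F}_V[\mathbf{P}],m,\Delta,\delta)$ a double bialgebra and such that $\pi:\mathcal{F}_V[\mathbf{P}']\to\mathcal{F}_V[\mathbf{P}]$ is a morphism of double bialgebras.
   Context: A species $\mathbf{P}$ is a functor from the category of finite sets with bijections to $\mathbb{K}$-vector spaces, written $X\mapsto\mathbf{P}[X]$, $\sigma\mapsto\mathbf{P}[\sigma]$; $[n]=\{1,\ldots,n\}$ and $\mathbf{P}[n]=\mathbf{P}[\{1,\ldots,n\}]$. $\sqcup$ is disjoint union, $c$ is the flip, $m_{1,3,24}(a\otimes b\otimes a'\otimes b')=a\otimes a'\otimes m(b\otimes b')$. A not necessarily unitary bialgebra $(V,\cdot,\delta_V)$ is an associative algebra (possibly without unit) with a coassociative coproduct $\delta_V$ with counit $\epsilon_V$, both $\delta_V$ and $\epsilon_V$ being multiplicative. Twisted algebra $(\mathbf{P},m)$: linear maps $m_{X,Y}:\mathbf{P}[X]\otimes\mathbf{P}[Y]\to\mathbf{P}[X\sqcup Y]$, natural in bijections, associative, with unit $1_{\mathbf{P}}\in\mathbf{P}[\emptyset]$. Twisted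 coalgebra $(\mathbf{P},\Delta)$: linear maps $\Delta_{X,Y}:\mathbf{P}[X\sqcup Y]\to\mathbf{P}[X]\otimes\mathbf{P}[Y]$, natural in bijections, with $(\Delta_{X,Y}\otimes\mathrm{Id})\circ\Delta_{X\sqcup Y,Z}=(\mathrm{Id}\otimes\Delta_{Y,Z})\circ\Delta_{X,Y\sqcup Z}$ and a counit $\varepsilon_\Delta:\mathbf{P}[\emptyset]\to\mathbb{K}$. Twisted bialgebra: both, such that whenever $I\sqcup J=I'\sqcup J'$, $\Delta_{I,J}\circ m_{I',J'}=(m_{I'\cap I,J'\cap I}\otimes m_{I'\cap J,J'\cap J})\circ(\mathrm{Id}\otimes c\otimes\mathrm{Id})\circ(\Delta_{I'\cap I,I'\cap J}\otimes\Delta_{J'\cap I,J'\cap J})$, $\Delta_{\emptyset,\emptyset}(1_{\mathbf{P}})=1_{\mathbf{P}}\otimes1_{\mathbf{P}}$, and $\varepsilon_\Delta$ is multiplicative and unital on $\mathbf{P}[\emptyset]$. Equivalences. $\mathcal{E}[X]$ is the set of equivalence relations on $X$, ordered by: $\sim\leq\sim'$ iff ($x\sim'y\Rightarrow x\sim y$). One identifies $\mathcal{E}[X/\sim']$ with $\{\sim\in\mathcal{E}[X]:\sim\leq\sim'\}$ and $(X/\sim')/\sim$ with $X/\sim$. For a bijection $\sigma:X\to Y$, $\sim_\sigma$ is the transported equivalence and $\sigma/\sim:X/\sim\to Y/\sim_\sigma$ the induced bijection. $\sim_X\sqcup\sim_Y$ is the equivalence on $X\sqcup Y$ whose classes are those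 of $\sim_X$ and those of $\sim_Y$. Contraction-extraction coproduct $\delta$ on $\mathbf{P}$: linear maps $\delta_\sim:\mathbf{P}[X]\to\mathbf{P}[X/\sim]\otimes\mathbf{P}[X]$ for every finite $X$ and $\sim\in\mathcal{E}[X]$, with: (i) $\delta_{\sim_\sigma}\circ\mathbf{P}[\sigma]=(\mathbf{P}[\sigma/\sim]\otimes\mathbf{P}[\sigma])\circ\delta_\sim$ for bijections $\sigma:X\to Y$; (ii) if $\sim\leq\sim'$, $(\delta_\sim\otimes\mathrm{Id})\circ\delta_{\sim'}=(\mathrm{Id}\otimes\delta_{\sim'})\circ\delta_\sim$ (on the left $\delta_\sim$ is applied to $\mathbf{P}[X/\sim']$), and if $\sim\leq\sim'$ fails, $(\mathrm{Id}\otimes\delta_{\sim'})\circ\delta_\sim=0$; (iii) there are linear maps $\epsilon_\delta[X]:\mathbf{P}[X]\to\mathbb{K}$, invariant under bijections, such that $(\mathrm{Id}\otimes\epsilon_\delta[X])\circ\delta_\sim$ is $\mathrm{Id}$ if $\sim$ is the equality and $0$ otherwise, and $\sum_{\sim\in\mathcal{E}[X]}(\epsilon_\delta[X/\sim]\otimes\mathrm{Id})\circ\delta_\sim=\mathrm{Id}_{\mathbf{P}[X]}$. It is compatible with $(m,\Delta)$ if for all finite $X,Y$ and $\sim\in\mathcal{E}[X\sqcup Y]$, with $\sim_X=\sim\cap X^2$, $\sim_Y=\sim\cap Y^2$: $\delta_\sim\circ m_{X,Y}$ equals $(m_{X/\sim_X,Y/\sim_Y}\otimes m_{X,Y})\circ(\mathrm{Id}\otimes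 c\otimes\mathrm{Id})\circ(\delta_{\sim_X}\otimes\delta_{\sim_Y})$ if $\sim=\sim_X\sqcup\sim_Y$ and $0$ otherwise; $(\Delta_{X/\sim_X,Y/\sim_Y}\otimes\mathrm{Id})\circ\delta_\sim=m_{1,3,24}\circ(\delta_{\sim_X}\otimes\delta_{\sim_Y})\circ\Delta_{X,Y}$ if $\sim=\sim_X\sqcup\sim_Y$; and, $\sim_\emptyset$ being the equivalence on $\emptyset$, $\delta_{\sim_\emptyset}(1_{\mathbf{P}})=1_{\mathbf{P}}\otimes1_{\mathbf{P}}$ and $(\varepsilon_\Delta\otimes\mathrm{Id})\circ\delta_{\sim_\emptyset}(x)=\varepsilon_\Delta(x)1_{\mathbf{P}}$ for $x\in\mathbf{P}[\emptyset]$. $\mathbf{P}'=\mathbf{P}\circ\mathbf{Com}$: $\mathbf{P}'[X]=\bigoplus_{\sim\in\mathcal{E}[X]}\mathbf{P}[X/\sim]$, $\mathbf{P}'[\sigma]$ being $\mathbf{P}[\sigma/\sim]$ on $\mathbf{P}[X/\sim]$. $m'_{X,Y}$ on $\mathbf{P}[X/\sim_X]\otimes\mathbf{P}[Y/\sim_Y]$ is $m_{X/\sim_X,Y/\sim_Y}$, with unit $1_{\mathbf{P}}$; $\Delta'_{X,Y}$ on $\mathbf{P}[(X\sqcup Y)/\sim]$ is $\Delta_{X/\sim_X,Y/\sim_Y}$ if $\sim=\sim_X\sqcup\sim_Y$ and $0$ otherwise, with counit $\varepsilon_\Delta$; $\delta'_X$ on $\mathbf{P}[X/\sim']$ is $\sum_{\sim\leq\sim'}\delta_\sim$,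 with values in $\mathbf{P}'[X]\otimes\mathbf{P}'[X]$. Coloured Fock functor: for a species $\mathbf{Q}$, $\mathcal{F}_V[\mathbf{Q}]=\bigoplus_{n\geq0}V^{\otimes n}\otimes_{\mathfrak{S}_n}\mathbf{Q}[n]$, the quotient of $\bigoplus_nV^{\otimes n}\otimes\mathbf{Q}[n]$ by the relations $v_1\ldots v_n\otimes\mathbf{Q}[\sigma](q)=v_{\sigma(1)}\ldots v_{\sigma(n)}\otimes q$, $\sigma\in\mathfrak{S}_n$; classes are denoted by a bar and $v_1\ldots v_n$ means $v_1\otimes\cdots\otimes v_n$. If $\mathbf{Q}$ is a twisted bialgebra, $\mathcal{F}_V[\mathbf{Q}]$ is a bialgebra with $\overline{v_1\ldots v_k\otimes p}\cdot\overline{v_{k+1}\ldots v_{k+l}\otimes q}=\overline{v_1\ldots v_{k+l}\otimes\mathbf{Q}[\sigma_{k,l}]\circ m_{[k],[l]}(p\otimes q)}$, where $\sigma_{k,l}:[k]\sqcup[l]\to[k+l]$ is $i\in[k]\mapsto i$, $j\in[l]\mapsto k+j$, and $\Delta(\overline{v_1\ldots v_n\otimes p})=\sum_{A\sqcup B=[n]}\overline{v_A\otimes\mathbf{Q}[\sigma_A](p^{(1)})}\otimes\overline{v_B\otimes\mathbf{Q}[\sigma_B](p^{(2)})}$, where $\Delta_{A,B}(p)=p^{(1)}\otimes p^{(2)}$, $\sigma_A:A\to[|A|]$ is the increasing bijection and $v_A$ is the tensor of the $v_i$, $i\in A$, in increasing order of indices. If moreover $(\mathbf{Q},m,\Delta,\delta)$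 is a double twisted bialgebra (such as $\mathbf{P}'$), $\mathcal{F}_V[\mathbf{Q}]$ is a double bialgebra with $\delta(\overline{v_1\ldots v_n\otimes p})=\overline{v'_1\ldots v'_n\otimes p^{(1)}}\otimes\overline{v''_1\ldots v''_n\otimes p^{(2)}}$, where $\delta_{[n]}(p)=p^{(1)}\otimes p^{(2)}$ and $\delta_V(v)=v'\otimes v''$. Double bialgebra $(A,m,\Delta,\delta)$: $(A,m,\Delta)$ is a bialgebra with unit $1$ and counit $\varepsilon_\Delta$, $\delta:A\to A\otimes A$ is coassociative with a counit $\epsilon_\delta$, $\delta$ is a unital algebra morphism, and $\Delta$, $\varepsilon_\Delta$ are comodule morphisms: $(\Delta\otimes\mathrm{Id})\circ\delta=m_{1,3,24}\circ(\delta\otimes\delta)\circ\Delta$ and $(\varepsilon_\Delta\otimes\mathrm{Id})\circ\delta(x)=\varepsilon_\Delta(x)1$. A morphism of double bialgebras is a linear map compatible with products, units, both coproducts and both counits. The map $\pi:\mathcal{F}_V[\mathbf{P}']\to\mathcal{F}_V[\mathbf{P}]$ is the linear map such that, for $v_1,\ldots,v_n\in V$, $\sim\in\mathcal{E}[[n]]$, $p\in\mathbf{P}[[n]/\sim]\subseteq\mathbf{P}'[n]$ and any bijection $\sigma:[n]/\sim\to[k]$, $\pi(\overline{v_1\ldots v_n\otimes p})=\overline{w_1\ldots w_k\otimes\mathbf{P}[\sigma](p)}$, where $w_j=\prod_{i\in\sigma^{-1}(j)}v_i$ is the product in $(V,\cdot)$ over the class $\sigma^{-1}(j)\subseteq[n]$.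 *)

theory Defs
  imports Complex_Main "HOL-Library.FSet" "HOL-Library.FuncSet" "HOL-Library.Poly_Mapping"
begin

section \<open>Vector spaces with carriers\<close>

text \<open>
  A vector space over the field \<open>'k\<close> is a linear subspace \<open>carr A\<close> of some ambient vector space
  \<open>(UNIV :: 'v set, smul A)\<close>. Maps between vector spaces are functions on the ambient types of
  which only the restriction to the carrier is meaningful.
\<close>

record ('k, 'v) vsp =
  carr :: "'v set"
  smul :: "'k \<Rightarrow> 'v \<Rightarrow> 'v"

definition vspace :: "('k::field, 'v::ab_group_add) vsp \<Rightarrow> bool" where
  "vspace A \<longleftrightarrow> vector_space (smul A) \<and> module.subspace (smul A) (carr A)"

definition linmap ::
  "('k::field, 'v::ab_group_add) vsp \<Rightarrow> ('k, 'w::ab_group_add) vsp \<Rightarrow> ('v \<Rightarrow> 'w) \<Rightarrow> bool" where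
  "linmap A B f \<longleftrightarrow>
     (\<forall>x\<in>carr A. f x \<in> carr B) \<and>
     (\<forall>x\<in>carr A. \<forall>y\<in>carr A. f (x + y) = f x + f y) \<and>
     (\<forall>c. \<forall>x\<in>carr A. f (smul A c x) = smul B c (f x))"

definition bilin ::
  "('k::field, 'v::ab_group_add) vsp \<Rightarrow> ('k, 'w::ab_group_add) vsp \<Rightarrow> ('k, 'z::ab_group_add) vsp
     \<Rightarrow> ('v \<Rightarrow> 'w \<Rightarrow> 'z) \<Rightarrow> bool" where
  "bilin A B C f \<longleftrightarrow>
     (\<forall>x\<in>carr A. linmap B C (f x)) \<and> (\<forall>y\<in>carr B. linmap A C (\<lambda>x. f x y))"

definition ground :: "('k::field, 'k) vsp" where
  "ground = \<lparr>carr = UNIV, smul = (*)\<rparr>"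

definition dsum :: "('k::field \<Rightarrow> 'v::ab_group_add \<Rightarrow> 'v) \<Rightarrow> 'i set \<Rightarrow> ('i \<Rightarrow> 'v set) \<Rightarrow> ('k, 'i \<Rightarrow>\<^sub>0 'v) vsp"
  where
  "dsum s I C = \<lparr>carr = {f. Poly_Mapping.keys f \<subseteq> I \<and> (\<forall>i\<in>I. Poly_Mapping.lookup f i \<in> C i)},
                 smul = (\<lambda>c. Poly_Mapping.map (s c))\<rparr>"

definition freev :: "'b set \<Rightarrow> ('k::field, 'b \<Rightarrow>\<^sub>0 'k) vsp" where
  "freev B = dsum (*) B (\<lambda>_. UNIV)"

text \<open>
  The quotient of \<open>A\<close> by a subspace \<open>R\<close> is realised on a linear complement of \<open>R\<close>: the canonical
  surjection is a (chosen) linear projection \<open>qproj (smul A) R\<close> whose kernel is exactly \<open>R\<close>, see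
  \<open>qproj_eq_iff\<close> below. Since \<open>x - qproj (smul A) R x \<in> R\<close>, it maps \<open>carr A\<close> to itself when
  \<open>R \<subseteq> carr A\<close>.
\<close>

definition qproj :: "('k::field \<Rightarrow> 'v::ab_group_add \<Rightarrow> 'v) \<Rightarrow> 'v set \<Rightarrow> 'v \<Rightarrow> 'v" where
  "qproj s R = (SOME p. Vector_Spaces.linear s s p \<and> (\<forall>x. p (p x) = p x) \<and> (\<forall>x. p x = 0 \<longleftrightarrow> x \<in> R))"

definition vquot :: "('k::field, 'v::ab_group_add) vsp \<Rightarrow> 'v set \<Rightarrow> ('k, 'v) vsp" where
  "vquot A R = \<lparr>carr = qproj (smul A) R ` carr A, smul = smul A\<rparr>"

lemma qproj:
  assumes "vector_space s" and R: "module.subspace s R"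
  shows linear_qproj: "Vector_Spaces.linear s s (qproj s R)"
    and qproj_idem: "qproj s R (qproj s R x) = qproj s R x"
    and qproj_eq_0_iff: "qproj s R x = 0 \<longleftrightarrow> x \<in> R"
proof -
  interpret vector_space s by fact
  interpret vector_space_pair s s by unfold_locales
  have "Vector_Spaces.linear s s (\<lambda>x. x)"
    by (simp add: Vector_Spaces.linear_iff vector_space_axioms)
  then obtain g where g: "range g \<subseteq> R" "Vector_Spaces.linear s s g" "\<forall>v\<in>R. g v = v"
    using linear_exists_left_inverse_on[of "\<lambda>x. x" R] R by (auto simp: inj_on_def)
  interpret g: Vector_Spaces.linear s s g by fact
  have "Vector_Spaces.linear s s (\<lambda>x. x - g x)"
    by (simp add: Vector_Spaces.linear_iff vector_space_axioms g.add g.scale algebra_simps)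
  moreover have "g (g x) = g x" for x
    using g by auto
  moreover have "x - g x = 0 \<longleftrightarrow> x \<in> R" for x
    using g by (metis eq_iff_diff_eq_0 rangeI subsetD)
  ultimately have "\<exists>p. Vector_Spaces.linear s s p \<and> (\<forall>x. p (p x) = p x) \<and> (\<forall>x. p x = 0 \<longleftrightarrow> x \<in> R)"
    by (intro exI[of _ "\<lambda>x. x - g x"]) (auto simp: g.diff)
  from someI_ex[OF this]
  show "Vector_Spaces.linear s s (qproj s R)" "qproj s R (qproj s R x) = qproj s R x"
    "qproj s R x = 0 \<longleftrightarrow> x \<in> R"
    unfolding qproj_def by blast+
qed

lemma qproj_eq_iff:
  assumes "vector_space s" "module.subspace s R"
  shows "qproj s R x = qproj s R y \<longleftrightarrow> x - y \<in> R"
proof -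
  interpret Vector_Spaces.linear s s "qproj s R"
    using assms by (rule linear_qproj)
  show ?thesis
    using qproj_eq_0_iff[OF assms, of "x - y"] by (simp add: diff)
qed

lemma diff_qproj_mem:
  assumes "vector_space s" "module.subspace s R"
  shows "x - qproj s R x \<in> R"
  using qproj_eq_iff[OF assms, of x "qproj s R x"] qproj_idem[OF assms, of x] by simp

lemma vspace_vquot:
  assumes "vspace A" "module.subspace (smul A) R"
  shows "vspace (vquot A R)"
proof -
  have v: "vector_space (smul A)" and s: "module.subspace (smul A) (carr A)"
    using assms by (auto simp: vspace_def)
  interpret Vector_Spaces.linear "smul A" "smul A" "qproj (smul A) R"
    using v assms(2) by (rule linear_qproj)
  show ?thesis
    using v subspace_image[OF s] by (simp add: vspace_def vquot_def)
qed

lemma lookup_map_smul: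
  assumes "vector_space s"
  shows "Poly_Mapping.lookup (Poly_Mapping.map (s c) f) i = s c (Poly_Mapping.lookup f i)"
proof -
  interpret vector_space s by fact
  show ?thesis by (simp add: Poly_Mapping.map.rep_eq when_def)
qed

lemma vspace_dsum:
  assumes s: "vector_space s" and C: "\<And>i. i \<in> I \<Longrightarrow> module.subspace s (C i)"
  shows "vspace (dsum s I C)"
proof -
  interpret vector_space s by fact
  have v: "vector_space (\<lambda>c. Poly_Mapping.map (s c))"
    by unfold_locales
      (auto intro!: poly_mapping_eqI simp: lookup_map_smul[OF s] lookup_add algebra_simps)
  interpret d: vector_space "\<lambda>c. Poly_Mapping.map (s c)" by (rule v)
  have "d.subspace (carr (dsum s I C))"
    unfolding d.subspace_def dsum_def
    using C by (auto simp: subspace_def lookup_map_smul[OF s] lookup_add in_keys_iff subset_iff)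
      (metis add.right_neutral)
  with v show ?thesis
    by (simp add: vspace_def dsum_def)
qed

lemma vector_space_ground: "vector_space ((*) :: 'k::field \<Rightarrow> 'k \<Rightarrow> 'k)"
  by unfold_locales (auto simp: algebra_simps)

lemma vspace_freev: "vspace (freev B)"
proof -
  interpret vector_space "(*) :: 'k::field \<Rightarrow> 'k \<Rightarrow> 'k" by (rule vector_space_ground)
  show ?thesis
    unfolding freev_def by (rule vspace_dsum) (auto simp: vector_space_ground)
qed


section \<open>Tensor products\<close>

definition tensor_rel ::
  "('k::field, 'a::ab_group_add) vsp \<Rightarrow> ('k, 'b::ab_group_add) vsp \<Rightarrow> ('a \<times> 'b \<Rightarrow>\<^sub>0 'k) set" where
  "tensor_rel A B = module.span (\<lambda>c. Poly_Mapping.map ((*) c))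
     ({Poly_Mapping.single (x + y, b) 1 - Poly_Mapping.single (x, b) 1 - Poly_Mapping.single (y, b) 1
         |x y b. x \<in> carr A \<and> y \<in> carr A \<and> b \<in> carr B}
    \<union> {Poly_Mapping.single (a, x + y) 1 - Poly_Mapping.single (a, x) 1 - Poly_Mapping.single (a, y) 1
         |a x y. a \<in> carr A \<and> x \<in> carr B \<and> y \<in> carr B}
    \<union> {Poly_Mapping.single (smul A c a, b) 1 - Poly_Mapping.single (a, b) c
         |c a b. a \<in> carr A \<and> b \<in> carr B}
    \<union> {Poly_Mapping.single (a, smul B c b) 1 - Poly_Mapping.single (a, b) c
         |c a b. a \<in> carr A \<and> b \<in> carr B})"

definition tensor ::
  "('k::field, 'a::ab_group_add) vsp \<Rightarrow> ('k, 'b::ab_group_add) vsp \<Rightarrow> ('k, 'a \<times> 'b \<Rightarrow>\<^sub>0 'k) vsp"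
  (infixr \<open>\<otimes>\<^sub>v\<close> 75) where
  "A \<otimes>\<^sub>v B = vquot (freev (carr A \<times> carr B)) (tensor_rel A B)"

definition tens ::
  "('k::field, 'a::ab_group_add) vsp \<Rightarrow> ('k, 'b::ab_group_add) vsp \<Rightarrow> 'a \<Rightarrow> 'b \<Rightarrow> ('a \<times> 'b \<Rightarrow>\<^sub>0 'k)" where
  "tens A B a b = qproj (\<lambda>c. Poly_Mapping.map ((*) c)) (tensor_rel A B) (Poly_Mapping.single (a, b) 1)"

text \<open>
  For bilinear \<open>\<beta>\<close>, \<open>tlift Z \<beta>\<close> is the linear map with \<open>tens A B a b \<mapsto> \<beta> a b\<close>, see
  \<open>tlift_tens\<close> and \<open>linmap_tlift\<close> below; the sum is over the chosen representative of a class.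
\<close>

definition tlift :: "('k::field, 'z::ab_group_add) vsp \<Rightarrow> ('a \<Rightarrow> 'b \<Rightarrow> 'z) \<Rightarrow> ('a \<times> 'b \<Rightarrow>\<^sub>0 'k) \<Rightarrow> 'z" where
  "tlift Z \<beta> t = (\<Sum>(a, b)\<in>Poly_Mapping.keys t. smul Z (Poly_Mapping.lookup t (a, b)) (\<beta> a b))"

lemma smul_freev: "smul (freev B) = (\<lambda>c. Poly_Mapping.map ((*) c))"
  by (simp add: freev_def dsum_def)

lemma vector_space_free: "vector_space (\<lambda>c::'k::field. Poly_Mapping.map ((*) c) :: ('b \<Rightarrow>\<^sub>0 'k) \<Rightarrow> _)"
  using vspace_freev[of "UNIV :: 'b set", where ?'a = 'k] by (simp add: vspace_def smul_freev)

lemma subspace_tensor_rel: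
  fixes A :: "('k::field, 'a::ab_group_add) vsp" and B :: "('k, 'b::ab_group_add) vsp"
  shows "module.subspace (\<lambda>c. Poly_Mapping.map ((*) c)) (tensor_rel A B)"
proof -
  interpret vector_space "\<lambda>c::'k. Poly_Mapping.map ((*) c) :: ('a \<times> 'b \<Rightarrow>\<^sub>0 'k) \<Rightarrow> _"
    by (rule vector_space_free)
  show ?thesis
    unfolding tensor_rel_def by (rule subspace_span)
qed

lemma vspace_tensor: "vspace (A \<otimes>\<^sub>v B)"
  unfolding tensor_def by (intro vspace_vquot vspace_freev) (simp add: smul_freev subspace_tensor_rel)

lemma tensor_rel_subset:
  fixes A :: "('k::field, 'a::ab_group_add) vsp" and B :: "('k, 'b::ab_group_add) vsp"
  assumes "vspace A" "vspace B"
  shows "tensor_rel A B \<subseteq> carr (freev (carr A \<times> carr B))"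
proof -
  interpret f: vector_space "\<lambda>c::'k. Poly_Mapping.map ((*) c) :: ('a \<times> 'b \<Rightarrow>\<^sub>0 'k) \<Rightarrow> _"
    by (rule vector_space_free)
  interpret a: vector_space "smul A" using assms by (simp add: vspace_def)
  interpret b: vector_space "smul B" using assms by (simp add: vspace_def)
  let ?F = "carr (freev (carr A \<times> carr B) :: ('k, 'a \<times> 'b \<Rightarrow>\<^sub>0 'k) vsp)"
  have F: "f.subspace ?F"
    using vspace_freev[of "carr A \<times> carr B", where ?'a = 'k] by (simp add: vspace_def smul_freev)
  have single: "Poly_Mapping.single (x, y) c \<in> ?F" if "x \<in> carr A" "y \<in> carr B" for x y c
    using that by (auto simp: freev_def dsum_def)
  have A: "a.subspace (carr A)" and B: "b.subspace (carr B)"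
    using assms by (simp_all add: vspace_def)
  show ?thesis
    unfolding tensor_rel_def
    by (rule f.span_minimal[OF _ F])
      (auto intro!: f.subspace_diff[OF F] single
         a.subspace_add[OF A] a.subspace_scale[OF A] b.subspace_add[OF B] b.subspace_scale[OF B])
qed

lemma tensor_subset_free:
  fixes A :: "('k::field, 'a::ab_group_add) vsp" and B :: "('k, 'b::ab_group_add) vsp"
  assumes "vspace A" "vspace B"
  shows "carr (A \<otimes>\<^sub>v B) \<subseteq> carr (freev (carr A \<times> carr B))"
proof
  fix t assume "t \<in> carr (A \<otimes>\<^sub>v B)"
  then obtain x where x: "x \<in> carr (freev (carr A \<times> carr B))"
    and t: "t = qproj (\<lambda>c. Poly_Mapping.map ((*) c)) (tensor_rel A B) x"
    by (auto simp: tensor_def vquot_def smul_freev)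
  interpret f: vector_space "\<lambda>c::'k. Poly_Mapping.map ((*) c) :: ('a \<times> 'b \<Rightarrow>\<^sub>0 'k) \<Rightarrow> _"
    by (rule vector_space_free)
  have F: "f.subspace (carr (freev (carr A \<times> carr B) :: ('k, 'a \<times> 'b \<Rightarrow>\<^sub>0 'k) vsp))"
    using vspace_freev[of "carr A \<times> carr B", where ?'a = 'k] by (simp add: vspace_def smul_freev)
  have "x - t \<in> carr (freev (carr A \<times> carr B))"
    using diff_qproj_mem[OF vector_space_free subspace_tensor_rel[of A B], of x]
      tensor_rel_subset[OF assms] t by auto
  from f.subspace_diff[OF F x this] show "t \<in> carr (freev (carr A \<times> carr B))"
    by simp
qed

lemma tlift_superset:
  assumes "vector_space (smul Z)" "finite S" "Poly_Mapping.keys t \<subseteq> S"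
  shows "tlift Z \<beta> t = (\<Sum>(a, b)\<in>S. smul Z (Poly_Mapping.lookup t (a, b)) (\<beta> a b))"
proof -
  interpret vector_space "smul Z" by fact
  show ?thesis
    unfolding tlift_def
    by (rule sum.mono_neutral_left) (use assms in \<open>auto simp: in_keys_iff\<close>)
qed

lemma linear_tlift:
  assumes "vector_space (smul Z)"
  shows "Vector_Spaces.linear (\<lambda>c. Poly_Mapping.map ((*) c)) (smul Z) (tlift Z \<beta>)"
proof -
  interpret vector_space "smul Z" by fact
  have add: "tlift Z \<beta> (s + t) = tlift Z \<beta> s + tlift Z \<beta> t" for s t
  proof -
    let ?S = "Poly_Mapping.keys s \<union> Poly_Mapping.keys t"
    have "tlift Z \<beta> u = (\<Sum>(a, b)\<in>?S. smul Z (Poly_Mapping.lookup u (a, b)) (\<beta> a b))"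
      if "Poly_Mapping.keys u \<subseteq> ?S" for u
      by (rule tlift_superset[OF assms _ that]) simp
    from this[of s] this[of t] this[of "s + t"] show ?thesis
      by (simp add: Poly_Mapping.keys_add lookup_add algebra_simps sum.distrib case_prod_beta)
  qed
  have scale: "tlift Z \<beta> (Poly_Mapping.map ((*) c) t) = smul Z c (tlift Z \<beta> t)" for c t
  proof -
    have "Poly_Mapping.keys (Poly_Mapping.map ((*) c) t) \<subseteq> Poly_Mapping.keys t"
      by (auto simp: in_keys_iff lookup_map_smul[OF vector_space_ground])
    from tlift_superset[OF assms _ this, of \<beta>] show ?thesis
      by (simp add: tlift_def scale_sum_right lookup_map_smul[OF vector_space_ground] case_prod_beta)
  qed
  show ?thesis
    by (simp add: Vector_Spaces.linear_iff assms vector_space_free add scale)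
qed

lemma tlift_single:
  assumes "vector_space (smul Z)"
  shows "tlift Z \<beta> (Poly_Mapping.single (a, b) c) = smul Z c (\<beta> a b)"
proof -
  interpret vector_space "smul Z" by fact
  show ?thesis by (simp add: tlift_def)
qed

lemma tlift_qproj:
  assumes Z: "vspace Z" and \<beta>: "bilin A B Z \<beta>"
  shows "tlift Z \<beta> (qproj (\<lambda>c. Poly_Mapping.map ((*) c)) (tensor_rel A B) x) = tlift Z \<beta> x"
proof -
  have z: "vector_space (smul Z)" using Z by (simp add: vspace_def)
  interpret vector_space "smul Z" by (rule z)
  interpret l: Vector_Spaces.linear "\<lambda>c. Poly_Mapping.map ((*) c)" "smul Z" "tlift Z \<beta>"
    by (rule linear_tlift[OF z])
  have "tlift Z \<beta> r = 0" if "r \<in> tensor_rel A B" for r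
    using that unfolding tensor_rel_def
    by (rule l.vs1.span_induct)
      (use \<beta> in \<open>auto simp: l.subspace_kernel l.diff tlift_single[OF z] bilin_def linmap_def\<close>)
  from this[OF diff_qproj_mem[OF vector_space_free subspace_tensor_rel, of x]] show ?thesis
    by (simp add: l.diff)
qed

lemma tlift_tens:
  assumes "vspace Z" "bilin A B Z \<beta>"
  shows "tlift Z \<beta> (tens A B a b) = \<beta> a b"
proof -
  interpret vector_space "smul Z" using assms by (simp add: vspace_def)
  show ?thesis
    using vector_space_axioms by (simp add: tens_def tlift_qproj[OF assms] tlift_single)
qed

lemma linmap_tlift:
  assumes "vspace A" "vspace B" "vspace Z" "bilin A B Z \<beta>"
  shows "linmap (A \<otimes>\<^sub>v B) Z (tlift Z \<beta>)"
proof -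
  have z: "vector_space (smul Z)" and Zs: "module.subspace (smul Z) (carr Z)"
    using assms by (simp_all add: vspace_def)
  interpret vector_space "smul Z" by (rule z)
  interpret l: Vector_Spaces.linear "\<lambda>c. Poly_Mapping.map ((*) c)" "smul Z" "tlift Z \<beta>"
    by (rule linear_tlift[OF z])
  have "tlift Z \<beta> t \<in> carr Z" if "t \<in> carr (A \<otimes>\<^sub>v B)" for t
  proof -
    have "Poly_Mapping.keys t \<subseteq> carr A \<times> carr B"
      using tensor_subset_free[OF assms(1,2)] that by (auto simp: freev_def dsum_def)
    then show ?thesis
      using assms(4) unfolding tlift_def
      by (intro subspace_sum[OF Zs]) (auto intro!: subspace_scale[OF Zs] simp: bilin_def linmap_def)
  qed
  then show ?thesis
    by (auto simp: linmap_def l.add l.scale tensor_def vquot_def smul_freev)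
qed

text \<open>\<open>tmap C D f g\<close> is the map \<open>f \<otimes> g\<close> with values in \<open>C \<otimes>\<^sub>v D\<close>.\<close>

definition tmap ::
  "('k::field, 'c::ab_group_add) vsp \<Rightarrow> ('k, 'd::ab_group_add) vsp \<Rightarrow> ('a \<Rightarrow> 'c) \<Rightarrow> ('b \<Rightarrow> 'd)
     \<Rightarrow> ('a \<times> 'b \<Rightarrow>\<^sub>0 'k) \<Rightarrow> ('c \<times> 'd \<Rightarrow>\<^sub>0 'k)" where
  "tmap C D f g = tlift (C \<otimes>\<^sub>v D) (\<lambda>a b. tens C D (f a) (g b))"

text \<open>\<open>tmul E F \<mu> \<nu> s t\<close> is \<open>(\<mu> \<otimes> \<nu>) \<circ> (Id \<otimes> c \<otimes> Id)\<close> applied to \<open>s \<otimes> t\<close>, with values in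
  \<open>E \<otimes>\<^sub>v F\<close>, for bilinear \<open>\<mu>\<close> and \<open>\<nu>\<close> with values in \<open>E\<close> and \<open>F\<close>.\<close>

definition tmul ::
  "('k::field, 'e::ab_group_add) vsp \<Rightarrow> ('k, 'f::ab_group_add) vsp
     \<Rightarrow> ('a \<Rightarrow> 'c \<Rightarrow> 'e) \<Rightarrow> ('b \<Rightarrow> 'd \<Rightarrow> 'f)
     \<Rightarrow> ('a \<times> 'b \<Rightarrow>\<^sub>0 'k) \<Rightarrow> ('c \<times> 'd \<Rightarrow>\<^sub>0 'k) \<Rightarrow> ('e \<times> 'f \<Rightarrow>\<^sub>0 'k)" where
  "tmul E F \<mu> \<nu> s t =
     tlift (E \<otimes>\<^sub>v F) (\<lambda>a b. tlift (E \<otimes>\<^sub>v F) (\<lambda>c d. tens E F (\<mu> a c) (\<nu> b d)) t) s"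

text \<open>The map \<open>a \<otimes> b \<otimes> a' \<otimes> b' \<mapsto> a \<otimes> a' \<otimes> \<nu> b b'\<close>, with values in \<open>(A \<otimes>\<^sub>v C) \<otimes>\<^sub>v F\<close>.\<close>

definition m1324 ::
  "('k::field, 'a::ab_group_add) vsp \<Rightarrow> ('k, 'c::ab_group_add) vsp \<Rightarrow> ('k, 'f::ab_group_add) vsp
     \<Rightarrow> ('b \<Rightarrow> 'd \<Rightarrow> 'f) \<Rightarrow> (('a \<times> 'b \<Rightarrow>\<^sub>0 'k) \<times> ('c \<times> 'd \<Rightarrow>\<^sub>0 'k) \<Rightarrow>\<^sub>0 'k)
     \<Rightarrow> ('a \<times> 'c \<Rightarrow>\<^sub>0 'k) \<times> 'f \<Rightarrow>\<^sub>0 'k" where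
  "m1324 A C F \<nu> = tlift ((A \<otimes>\<^sub>v C) \<otimes>\<^sub>v F) (tmul (A \<otimes>\<^sub>v C) F (tens A C) \<nu>)"

definition tassoc ::
  "('k::field, 'a::ab_group_add) vsp \<Rightarrow> ('k, 'b::ab_group_add) vsp \<Rightarrow> ('k, 'c::ab_group_add) vsp
     \<Rightarrow> (('a \<times> 'b \<Rightarrow>\<^sub>0 'k) \<times> 'c \<Rightarrow>\<^sub>0 'k) \<Rightarrow> ('a \<times> ('b \<times> 'c \<Rightarrow>\<^sub>0 'k) \<Rightarrow>\<^sub>0 'k)" where
  "tassoc A B C = tlift (A \<otimes>\<^sub>v B \<otimes>\<^sub>v C)
     (\<lambda>t c. tlift (A \<otimes>\<^sub>v B \<otimes>\<^sub>v C) (\<lambda>a b. tens A (B \<otimes>\<^sub>v C) a (tens B C b c)) t)"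

text \<open>In \<open>V\<^sup>\<otimes>\<^sup>n\<close>, the word \<open>v\<^sub>1 \<otimes> \<dots> \<otimes> v\<^sub>n\<close> is given by the list of its letters.\<close>

definition tpow_rel :: "('k::field, 'v::ab_group_add) vsp \<Rightarrow> nat \<Rightarrow> ('v list \<Rightarrow>\<^sub>0 'k) set" where
  "tpow_rel V n = module.span (\<lambda>c. Poly_Mapping.map ((*) c))
     ({Poly_Mapping.single (us @ (x + y) # ws) 1 - Poly_Mapping.single (us @ x # ws) 1
         - Poly_Mapping.single (us @ y # ws) 1
         |us ws x y. set us \<union> {x, y} \<union> set ws \<subseteq> carr V \<and> length us + 1 + length ws = n}
    \<union> {Poly_Mapping.single (us @ smul V c x # ws) 1 - Poly_Mapping.single (us @ x # ws) c
         |us ws c x. set us \<union> {x} \<union> set ws \<subseteq> carr V \<and> length us + 1 + length ws = n})"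

definition tpow :: "('k::field, 'v::ab_group_add) vsp \<Rightarrow> nat \<Rightarrow> ('k, 'v list \<Rightarrow>\<^sub>0 'k) vsp" where
  "tpow V n = vquot (freev {vs. set vs \<subseteq> carr V \<and> length vs = n}) (tpow_rel V n)"

definition tword :: "('k::field, 'v::ab_group_add) vsp \<Rightarrow> 'v list \<Rightarrow> ('v list \<Rightarrow>\<^sub>0 'k)" where
  "tword V vs = qproj (\<lambda>c. Poly_Mapping.map ((*) c)) (tpow_rel V (length vs)) (Poly_Mapping.single vs 1)"


section \<open>Algebras, coalgebras, double bialgebras\<close>

definition coalgebra_on ::
  "('k::field, 'a::ab_group_add) vsp \<Rightarrow> ('a \<Rightarrow> ('a \<times> 'a \<Rightarrow>\<^sub>0 'k)) \<Rightarrow> ('a \<Rightarrow> 'k) \<Rightarrow> bool" where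
  "coalgebra_on A \<Delta> \<epsilon> \<longleftrightarrow>
     vspace A \<and> linmap A (A \<otimes>\<^sub>v A) \<Delta> \<and> linmap A ground \<epsilon> \<and>
     (\<forall>x\<in>carr A. tassoc A A A (tmap (A \<otimes>\<^sub>v A) A \<Delta> id (\<Delta> x)) = tmap A (A \<otimes>\<^sub>v A) id \<Delta> (\<Delta> x)) \<and>
     (\<forall>x\<in>carr A. tlift A (\<lambda>a b. smul A (\<epsilon> a) b) (\<Delta> x) = x) \<and>
     (\<forall>x\<in>carr A. tlift A (\<lambda>a b. smul A (\<epsilon> b) a) (\<Delta> x) = x)"

record (overloaded) ('k, 'v) nbialg =
  nsp :: "('k, 'v) vsp"
  nmul :: "'v \<Rightarrow> 'v \<Rightarrow> 'v"
  ncop :: "'v \<Rightarrow> ('v \<times> 'v \<Rightarrow>\<^sub>0 'k)"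
  ncou :: "'v \<Rightarrow> 'k"

definition comm_nbialgebra :: "('k::field, 'v::ab_group_add) nbialg \<Rightarrow> bool" where
  "comm_nbialgebra V \<longleftrightarrow> (let A = nsp V in
     coalgebra_on A (ncop V) (ncou V) \<and>
     bilin A A A (nmul V) \<and>
     (\<forall>x\<in>carr A. \<forall>y\<in>carr A. \<forall>z\<in>carr A. nmul V (nmul V x y) z = nmul V x (nmul V y z)) \<and>
     (\<forall>x\<in>carr A. \<forall>y\<in>carr A. nmul V x y = nmul V y x) \<and>
     (\<forall>x\<in>carr A. \<forall>y\<in>carr A.
        ncop V (nmul V x y) = tmul A A (nmul V) (nmul V) (ncop V x) (ncop V y)) \<and>
     (\<forall>x\<in>carr A. \<forall>y\<in>carr A. ncou V (nmul V x y) = ncou V x * ncou V y))"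

record (overloaded) ('k, 'a) dbialg =
  dsp :: "('k, 'a) vsp"
  dmul :: "'a \<Rightarrow> 'a \<Rightarrow> 'a"
  dunit :: 'a
  dDel :: "'a \<Rightarrow> ('a \<times> 'a \<Rightarrow>\<^sub>0 'k)"
  dEps :: "'a \<Rightarrow> 'k"
  ddel :: "'a \<Rightarrow> ('a \<times> 'a \<Rightarrow>\<^sub>0 'k)"
  deps :: "'a \<Rightarrow> 'k"

definition double_bialgebra :: "('k::field, 'a::ab_group_add) dbialg \<Rightarrow> bool" where
  "double_bialgebra D \<longleftrightarrow> (let A = dsp D; m = dmul D in
     bilin A A A m \<and> dunit D \<in> carr A \<and>
     (\<forall>x\<in>carr A. \<forall>y\<in>carr A. \<forall>z\<in>carr A. m (m x y) z = m x (m y z)) \<and>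
     (\<forall>x\<in>carr A. m (dunit D) x = x \<and> m x (dunit D) = x) \<and>
     coalgebra_on A (dDel D) (dEps D) \<and>
     dDel D (dunit D) = tens A A (dunit D) (dunit D) \<and>
     (\<forall>x\<in>carr A. \<forall>y\<in>carr A. dDel D (m x y) = tmul A A m m (dDel D x) (dDel D y)) \<and>
     dEps D (dunit D) = 1 \<and>
     (\<forall>x\<in>carr A. \<forall>y\<in>carr A. dEps D (m x y) = dEps D x * dEps D y) \<and>
     coalgebra_on A (ddel D) (deps D) \<and>
     ddel D (dunit D) = tens A A (dunit D) (dunit D) \<and>
     (\<forall>x\<in>carr A. \<forall>y\<in>carr A. ddel D (m x y) = tmul A A m m (ddel D x) (ddel D y)) \<and>
     (\<forall>x\<in>carr A. tmap (A \<otimes>\<^sub>v A) A (dDel D) id (ddel D x) =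
        m1324 A A A m (tmap (A \<otimes>\<^sub>v A) (A \<otimes>\<^sub>v A) (ddel D) (ddel D) (dDel D x))) \<and>
     (\<forall>x\<in>carr A. tlift A (\<lambda>a b. smul A (dEps D a) b) (ddel D x) = smul A (dEps D x) (dunit D)))"

definition double_morphism ::
  "('k::field, 'a::ab_group_add) dbialg \<Rightarrow> ('k, 'b::ab_group_add) dbialg \<Rightarrow> ('a \<Rightarrow> 'b) \<Rightarrow> bool" where
  "double_morphism D E f \<longleftrightarrow>
     double_bialgebra D \<and> double_bialgebra E \<and>
     linmap (dsp D) (dsp E) f \<and>
     (\<forall>x\<in>carr (dsp D). \<forall>y\<in>carr (dsp D). f (dmul D x y) = dmul E (f x) (f y)) \<and>
     f (dunit D) = dunit E \<and>
     (\<forall>x\<in>carr (dsp D).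
        dDel E (f x) = tmap (dsp E) (dsp E) f f (dDel D x) \<and>
        dEps E (f x) = dEps D x \<and>
        ddel E (f x) = tmap (dsp E) (dsp E) f f (ddel D x) \<and>
        deps E (f x) = deps D x)"


section \<open>Finite sets, equivalences and quotients\<close>

text \<open>
  Species are evaluated on finite sets of labels. The labels are closed under formation of finite
  sets of labels, so that the quotient \<open>X/\<sim>\<close>, i.e. the set of classes, is again a finite set of
  labels (with the class \<open>C\<close> coded as \<open>Cls C\<close>). Every finite set is in bijection with a finite set
  of labels.
\<close>

datatype lbl = At nat | Cls "lbl fset"

definition nset :: "nat \<Rightarrow> lbl set" where
  "nset n = At ` {1..n}"

definition quo :: "lbl set \<Rightarrow> (lbl \<times> lbl) set \<Rightarrow> lbl set" where
  "quo X r = (\<lambda>C. Cls (Abs_fset C)) ` (X // r)"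

definition cls :: "(lbl \<times> lbl) set \<Rightarrow> lbl \<Rightarrow> lbl" where
  "cls r x = Cls (Abs_fset (r `` {x}))"

definition eqvs :: "lbl set \<Rightarrow> (lbl \<times> lbl) set set" where
  "eqvs X = {r. equiv X r}"

text \<open>The order on equivalences: \<open>r \<le> r'\<close> iff \<open>r\<close> is coarser than \<open>r'\<close>.\<close>

definition eqv_le :: "(lbl \<times> lbl) set \<Rightarrow> (lbl \<times> lbl) set \<Rightarrow> bool" where
  "eqv_le r r' \<longleftrightarrow> (\<forall>x y. (x, y) \<in> r' \<longrightarrow> (x, y) \<in> r)"

definition eqv_map :: "(lbl \<Rightarrow> lbl) \<Rightarrow> (lbl \<times> lbl) set \<Rightarrow> (lbl \<times> lbl) set" where
  "eqv_map \<sigma> r = map_prod \<sigma> \<sigma> ` r"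

text \<open>The bijection \<open>\<sigma>/\<sim>\<close> from \<open>X/\<sim>\<close> to \<open>Y/\<sim>\<^sub>\<sigma>\<close> induced by \<open>\<sigma>\<close> (and a dummy value on atoms).\<close>

primrec cls_map :: "(lbl \<Rightarrow> lbl) \<Rightarrow> lbl \<Rightarrow> lbl" where
  "cls_map \<sigma> (At n) = At n"
| "cls_map \<sigma> (Cls C) = Cls (\<sigma> |`| C)"

text \<open>For \<open>\<sim> \<le> \<sim>'\<close>, \<open>eqv_quo \<sim>' \<sim>\<close> is \<open>\<sim>\<close> viewed as an equivalence on \<open>X/\<sim>'\<close>, and \<open>cls_flat\<close>
  is the identification of \<open>(X/\<sim>')/\<sim>\<close> with \<open>X/\<sim>\<close>: the union of a class of classes.\<close>

definition eqv_quo :: "(lbl \<times> lbl) set \<Rightarrow> (lbl \<times> lbl) set \<Rightarrow> (lbl \<times> lbl) set" where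
  "eqv_quo r' r = map_prod (cls r') (cls r') ` r"

primrec cls_members :: "lbl \<Rightarrow> lbl fset" where
  "cls_members (At n) = {||}"
| "cls_members (Cls C) = C"

definition cls_flat :: "lbl \<Rightarrow> lbl" where
  "cls_flat l = Cls (ffUnion (cls_members |`| cls_members l))"


section \<open>Twisted bialgebras and contraction-extraction coproducts\<close>

text \<open>
  A species: \<open>scar P X\<close> is the underlying set of \<open>P[X]\<close> and \<open>smor P X \<sigma>\<close> is \<open>P[\<sigma>]\<close> for the
  bijection from \<open>X\<close> to \<open>\<sigma> ` X\<close> induced by \<open>\<sigma>\<close>. All \<open>P[X]\<close> are realised inside one ambient vector
  space, with no condition on how they intersect. Disjoint unions are unions of disjoint sets, and
  linear maps on \<open>P[X] \<otimes> P[Y]\<close> are given as bilinear maps.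
\<close>

record (overloaded) ('k, 'p) tbialg =
  sscl :: "'k \<Rightarrow> 'p \<Rightarrow> 'p"
  scar :: "lbl set \<Rightarrow> 'p set"
  smor :: "lbl set \<Rightarrow> (lbl \<Rightarrow> lbl) \<Rightarrow> 'p \<Rightarrow> 'p"
  tmlt :: "lbl set \<Rightarrow> lbl set \<Rightarrow> 'p \<Rightarrow> 'p \<Rightarrow> 'p"
  tone :: 'p
  tcop :: "lbl set \<Rightarrow> lbl set \<Rightarrow> 'p \<Rightarrow> ('p \<times> 'p \<Rightarrow>\<^sub>0 'k)"
  tcou :: "'p \<Rightarrow> 'k"

definition sp :: "('k, 'p, 'z) tbialg_scheme \<Rightarrow> lbl set \<Rightarrow> ('k, 'p) vsp" where
  "sp P X = \<lparr>carr = scar P X, smul = sscl P\<rparr>"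

definition species :: "('k::field, 'p::ab_group_add, 'z) tbialg_scheme \<Rightarrow> bool" where
  "species P \<longleftrightarrow>
     (\<forall>X. finite X \<longrightarrow> vspace (sp P X)) \<and>
     (\<forall>X \<sigma>. finite X \<longrightarrow> inj_on \<sigma> X \<longrightarrow> linmap (sp P X) (sp P (\<sigma> ` X)) (smor P X \<sigma>)) \<and>
     (\<forall>X \<sigma> \<tau>. finite X \<longrightarrow> inj_on \<sigma> X \<longrightarrow> (\<forall>x\<in>X. \<sigma> x = \<tau> x) \<longrightarrow>
        (\<forall>p\<in>scar P X. smor P X \<sigma> p = smor P X \<tau> p)) \<and>
     (\<forall>X. finite X \<longrightarrow> (\<forall>p\<in>scar P X. smor P X id p = p)) \<and>
     (\<forall>X \<sigma> \<tau>. finite X \<longrightarrow> inj_on \<sigma> X \<longrightarrow> inj_on \<tau> (\<sigma> ` X) \<longrightarrow>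
        (\<forall>p\<in>scar P X. smor P X (\<tau> \<circ> \<sigma>) p = smor P (\<sigma> ` X) \<tau> (smor P X \<sigma> p)))"

definition twisted_algebra :: "('k::field, 'p::ab_group_add, 'z) tbialg_scheme \<Rightarrow> bool" where
  "twisted_algebra P \<longleftrightarrow>
     (\<forall>X Y. finite X \<longrightarrow> finite Y \<longrightarrow> X \<inter> Y = {} \<longrightarrow> bilin (sp P X) (sp P Y) (sp P (X \<union> Y)) (tmlt P X Y)) \<and>
     (\<forall>X Y \<sigma>. finite X \<longrightarrow> finite Y \<longrightarrow> X \<inter> Y = {} \<longrightarrow> inj_on \<sigma> (X \<union> Y) \<longrightarrow>
        (\<forall>p\<in>scar P X. \<forall>q\<in>scar P Y.
           smor P (X \<union> Y) \<sigma> (tmlt P X Y p q) = tmlt P (\<sigma> ` X) (\<sigma> ` Y) (smor P X \<sigma> p) (smor P Y \<sigma> q))) \<and>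
     (\<forall>X Y Z. finite X \<longrightarrow> finite Y \<longrightarrow> finite Z \<longrightarrow> X \<inter> Y = {} \<longrightarrow> X \<inter> Z = {} \<longrightarrow> Y \<inter> Z = {} \<longrightarrow>
        (\<forall>p\<in>scar P X. \<forall>q\<in>scar P Y. \<forall>r\<in>scar P Z.
           tmlt P (X \<union> Y) Z (tmlt P X Y p q) r = tmlt P X (Y \<union> Z) p (tmlt P Y Z q r))) \<and>
     tone P \<in> scar P {} \<and>
     (\<forall>X. finite X \<longrightarrow> (\<forall>p\<in>scar P X. tmlt P {} X (tone P) p = p \<and> tmlt P X {} p (tone P) = p))"

definition twisted_coalgebra :: "('k::field, 'p::ab_group_add, 'z) tbialg_scheme \<Rightarrow> bool" where
  "twisted_coalgebra P \<longleftrightarrow>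
     (\<forall>X Y. finite X \<longrightarrow> finite Y \<longrightarrow> X \<inter> Y = {} \<longrightarrow>
        linmap (sp P (X \<union> Y)) (sp P X \<otimes>\<^sub>v sp P Y) (tcop P X Y)) \<and>
     (\<forall>X Y \<sigma>. finite X \<longrightarrow> finite Y \<longrightarrow> X \<inter> Y = {} \<longrightarrow> inj_on \<sigma> (X \<union> Y) \<longrightarrow>
        (\<forall>p\<in>scar P (X \<union> Y).
           tcop P (\<sigma> ` X) (\<sigma> ` Y) (smor P (X \<union> Y) \<sigma> p) =
           tmap (sp P (\<sigma> ` X)) (sp P (\<sigma> ` Y)) (smor P X \<sigma>) (smor P Y \<sigma>) (tcop P X Y p))) \<and>
     (\<forall>X Y Z. finite X \<longrightarrow> finite Y \<longrightarrow> finite Z \<longrightarrow> X \<inter> Y = {} \<longrightarrow> X \<inter> Z = {} \<longrightarrow> Y \<inter> Z = {} \<longrightarrow>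
        (\<forall>p\<in>scar P (X \<union> Y \<union> Z).
           tassoc (sp P X) (sp P Y) (sp P Z)
             (tmap (sp P X \<otimes>\<^sub>v sp P Y) (sp P Z) (tcop P X Y) id (tcop P (X \<union> Y) Z p)) =
           tmap (sp P X) (sp P Y \<otimes>\<^sub>v sp P Z) id (tcop P Y Z) (tcop P X (Y \<union> Z) p))) \<and>
     linmap (sp P {}) ground (tcou P) \<and>
     (\<forall>X. finite X \<longrightarrow> (\<forall>p\<in>scar P X.
        tlift (sp P X) (\<lambda>a b. sscl P (tcou P a) b) (tcop P {} X p) = p \<and>
        tlift (sp P X) (\<lambda>a b. sscl P (tcou P b) a) (tcop P X {} p) = p))"

definition twisted_bialgebra :: "('k::field, 'p::ab_group_add, 'z) tbialg_scheme \<Rightarrow> bool" where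
  "twisted_bialgebra P \<longleftrightarrow>
     species P \<and> twisted_algebra P \<and> twisted_coalgebra P \<and>
     (\<forall>I J I' J'. finite (I \<union> J) \<longrightarrow> I \<union> J = I' \<union> J' \<longrightarrow> I \<inter> J = {} \<longrightarrow> I' \<inter> J' = {} \<longrightarrow>
        (\<forall>p\<in>scar P I'. \<forall>q\<in>scar P J'.
           tcop P I J (tmlt P I' J' p q) =
           tmul (sp P I) (sp P J) (tmlt P (I' \<inter> I) (J' \<inter> I)) (tmlt P (I' \<inter> J) (J' \<inter> J))
             (tcop P (I' \<inter> I) (I' \<inter> J) p) (tcop P (J' \<inter> I) (J' \<inter> J) q))) \<and>
     tcop P {} {} (tone P) = tens (sp P {}) (sp P {}) (tone P) (tone P) \<and>
     (\<forall>p\<in>scar P {}. \<forall>q\<in>scar P {}. tcou P (tmlt P {} {} p q) = tcou P p * tcou P q) \<and>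
     tcou P (tone P) = 1"

record (overloaded) ('k, 'p) ctbialg = "('k, 'p) tbialg" +
  cdel :: "lbl set \<Rightarrow> (lbl \<times> lbl) set \<Rightarrow> 'p \<Rightarrow> ('p \<times> 'p \<Rightarrow>\<^sub>0 'k)"
  ceps :: "lbl set \<Rightarrow> 'p \<Rightarrow> 'k"

text \<open>For \<open>\<sim> \<le> \<sim>'\<close> in \<open>\<E>[X]\<close>, \<open>cdel_quo P X \<sim>' \<sim>\<close> is \<open>\<delta>\<^sub>\<sim>\<close> on \<open>P[X/\<sim>']\<close>, with values in
  \<open>P[X/\<sim>] \<otimes> P[X/\<sim>']\<close> after identification of \<open>(X/\<sim>')/\<sim>\<close> with \<open>X/\<sim>\<close>.\<close>

definition cdel_quo ::
  "('k::field, 'p::ab_group_add, 'z) ctbialg_scheme \<Rightarrow> lbl set \<Rightarrow> (lbl \<times> lbl) set \<Rightarrow> (lbl \<times> lbl) set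
     \<Rightarrow> 'p \<Rightarrow> ('p \<times> 'p \<Rightarrow>\<^sub>0 'k)" where
  "cdel_quo P X r' r p =
     tmap (sp P (quo X r)) (sp P (quo X r')) (smor P (quo (quo X r') (eqv_quo r' r)) cls_flat) id
       (cdel P (quo X r') (eqv_quo r' r) p)"

definition contraction_extraction :: "('k::field, 'p::ab_group_add, 'z) ctbialg_scheme \<Rightarrow> bool" where
  "contraction_extraction P \<longleftrightarrow>
     (\<forall>X. finite X \<longrightarrow> (\<forall>r\<in>eqvs X. linmap (sp P X) (sp P (quo X r) \<otimes>\<^sub>v sp P X) (cdel P X r))) \<and>
     (\<forall>X \<sigma>. finite X \<longrightarrow> inj_on \<sigma> X \<longrightarrow> (\<forall>r\<in>eqvs X. \<forall>p\<in>scar P X.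
        cdel P (\<sigma> ` X) (eqv_map \<sigma> r) (smor P X \<sigma> p) =
        tmap (sp P (quo (\<sigma> ` X) (eqv_map \<sigma> r))) (sp P (\<sigma> ` X))
          (smor P (quo X r) (cls_map \<sigma>)) (smor P X \<sigma>) (cdel P X r p))) \<and>
     (\<forall>X. finite X \<longrightarrow> (\<forall>r\<in>eqvs X. \<forall>r'\<in>eqvs X. \<forall>p\<in>scar P X.
        (eqv_le r r' \<longrightarrow>
           tassoc (sp P (quo X r)) (sp P (quo X r')) (sp P X)
             (tmap (sp P (quo X r) \<otimes>\<^sub>v sp P (quo X r')) (sp P X) (cdel_quo P X r' r) id (cdel P X r' p)) =
           tmap (sp P (quo X r)) (sp P (quo X r') \<otimes>\<^sub>v sp P X) id (cdel P X r') (cdel P X r p)) \<and>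
        (\<not> eqv_le r r' \<longrightarrow>
           tmap (sp P (quo X r)) (sp P (quo X r') \<otimes>\<^sub>v sp P X) id (cdel P X r') (cdel P X r p) = 0))) \<and>
     (\<forall>X. finite X \<longrightarrow> linmap (sp P X) ground (ceps P X)) \<and>
     (\<forall>X \<sigma>. finite X \<longrightarrow> inj_on \<sigma> X \<longrightarrow> (\<forall>p\<in>scar P X. ceps P (\<sigma> ` X) (smor P X \<sigma> p) = ceps P X p)) \<and>
     \<comment> \<open>for the equality \<open>Id_on X\<close>, \<open>X\<close> is identified with its set of singletons\<close>
     (\<forall>X. finite X \<longrightarrow> (\<forall>r\<in>eqvs X. \<forall>p\<in>scar P X.
        tlift (sp P (quo X r)) (\<lambda>a b. sscl P (ceps P X b) a) (cdel P X r p) =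
        (if r = Id_on X then smor P X (\<lambda>x. Cls {|x|}) p else 0))) \<and>
     (\<forall>X. finite X \<longrightarrow> (\<forall>p\<in>scar P X.
        (\<Sum>r\<in>eqvs X. tlift (sp P X) (\<lambda>a b. sscl P (ceps P (quo X r) a) b) (cdel P X r p)) = p))"

definition ce_compatible :: "('k::field, 'p::ab_group_add, 'z) ctbialg_scheme \<Rightarrow> bool" where
  "ce_compatible P \<longleftrightarrow>
     (\<forall>X Y. finite X \<longrightarrow> finite Y \<longrightarrow> X \<inter> Y = {} \<longrightarrow>
       (\<forall>r\<in>eqvs (X \<union> Y). let rX = r \<inter> X \<times> X; rY = r \<inter> Y \<times> Y in
          (\<forall>p\<in>scar P X. \<forall>q\<in>scar P Y.
             cdel P (X \<union> Y) r (tmlt P X Y p q) =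
             (if r = rX \<union> rY
              then tmul (sp P (quo (X \<union> Y) r)) (sp P (X \<union> Y))
                     (tmlt P (quo X rX) (quo Y rY)) (tmlt P X Y) (cdel P X rX p) (cdel P Y rY q)
              else 0)) \<and>
          (r = rX \<union> rY \<longrightarrow> (\<forall>p\<in>scar P (X \<union> Y).
             tmap (sp P (quo X rX) \<otimes>\<^sub>v sp P (quo Y rY)) (sp P (X \<union> Y))
               (tcop P (quo X rX) (quo Y rY)) id (cdel P (X \<union> Y) r p) =
             m1324 (sp P (quo X rX)) (sp P (quo Y rY)) (sp P (X \<union> Y)) (tmlt P X Y)
               (tmap (sp P (quo X rX) \<otimes>\<^sub>v sp P X) (sp P (quo Y rY) \<otimes>\<^sub>v sp P Y)
                  (cdel P X rX) (cdel P Y rY) (tcop P X Y p)))))) \<and>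
     cdel P {} {} (tone P) = tens (sp P {}) (sp P {}) (tone P) (tone P) \<and>
     (\<forall>p\<in>scar P {}. tlift (sp P {}) (\<lambda>a b. sscl P (tcou P a) b) (cdel P {} {} p) =
                     sscl P (tcou P p) (tone P))"


section \<open>The species \<open>P' = P \<circ> Com\<close>\<close>

text \<open>Twisted bialgebras with a second coproduct \<open>\<delta>\<^sub>X : Q[X] \<rightarrow> Q[X] \<otimes> Q[X]\<close> and its counit.\<close>

record (overloaded) ('k, 'q) dtbialg = "('k, 'q) tbialg" +
  tdel :: "lbl set \<Rightarrow> 'q \<Rightarrow> ('q \<times> 'q \<Rightarrow>\<^sub>0 'k)"
  teps :: "lbl set \<Rightarrow> 'q \<Rightarrow> 'k"

definition com_sp ::
  "('k::field, 'p::ab_group_add, 'z) tbialg_scheme \<Rightarrow> lbl set \<Rightarrow> ('k, (lbl \<times> lbl) set \<Rightarrow>\<^sub>0 'p) vsp" where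
  "com_sp P X = dsum (sscl P) (eqvs X) (\<lambda>r. scar P (quo X r))"

text \<open>An element of the summand \<open>P[X/\<sim>]\<close> of \<open>P'[X]\<close> is \<open>Poly_Mapping.single \<sim> p\<close>. The counit of
  \<open>\<delta>'\<close> is \<open>\<epsilon>\<^sub>\<delta>[X/\<sim>]\<close> on this summand.\<close>

definition com_species ::
  "('k::field, 'p::ab_group_add, 'z) ctbialg_scheme \<Rightarrow> ('k, (lbl \<times> lbl) set \<Rightarrow>\<^sub>0 'p) dtbialg" where
  "com_species P = \<lparr>
     sscl = (\<lambda>c. Poly_Mapping.map (sscl P c)),
     scar = (\<lambda>X. carr (com_sp P X)),
     smor = (\<lambda>X \<sigma> f. \<Sum>r\<in>eqvs X.
       Poly_Mapping.single (eqv_map \<sigma> r) (smor P (quo X r) (cls_map \<sigma>) (Poly_Mapping.lookup f r))),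
     tmlt = (\<lambda>X Y f g. \<Sum>r\<in>eqvs X. \<Sum>s\<in>eqvs Y.
       Poly_Mapping.single (r \<union> s)
         (tmlt P (quo X r) (quo Y s) (Poly_Mapping.lookup f r) (Poly_Mapping.lookup g s))),
     tone = Poly_Mapping.single {} (tone P),
     tcop = (\<lambda>X Y f. \<Sum>r\<in>eqvs X. \<Sum>s\<in>eqvs Y.
       tmap (com_sp P X) (com_sp P Y) (Poly_Mapping.single r) (Poly_Mapping.single s)
         (tcop P (quo X r) (quo Y s) (Poly_Mapping.lookup f (r \<union> s)))),
     tcou = (\<lambda>f. tcou P (Poly_Mapping.lookup f {})),
     tdel = (\<lambda>X f. \<Sum>r'\<in>eqvs X. \<Sum>r\<in>{r\<in>eqvs X. eqv_le r r'}.
       tmap (com_sp P X) (com_sp P X) (Poly_Mapping.single r) (Poly_Mapping.single r')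
         (cdel_quo P X r' r (Poly_Mapping.lookup f r'))),
     teps = (\<lambda>X f. \<Sum>r\<in>eqvs X. ceps P (quo X r) (Poly_Mapping.lookup f r))\<rparr>"


section \<open>The coloured Fock functor\<close>

definition fock_pre ::
  "('k::field, 'v::ab_group_add) vsp \<Rightarrow> ('k, 'q::ab_group_add, 'z) tbialg_scheme
     \<Rightarrow> ('k, nat \<Rightarrow>\<^sub>0 (('v list \<Rightarrow>\<^sub>0 'k) \<times> 'q \<Rightarrow>\<^sub>0 'k)) vsp" where
  "fock_pre V Q = dsum (\<lambda>c. Poly_Mapping.map ((*) c)) UNIV (\<lambda>n. carr (tpow V n \<otimes>\<^sub>v sp Q (nset n)))"

definition fock_gen ::
  "('k::field, 'v::ab_group_add) vsp \<Rightarrow> ('k, 'q::ab_group_add, 'z) tbialg_scheme \<Rightarrow> 'v list \<Rightarrow> 'q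
     \<Rightarrow> (nat \<Rightarrow>\<^sub>0 (('v list \<Rightarrow>\<^sub>0 'k) \<times> 'q \<Rightarrow>\<^sub>0 'k))" where
  "fock_gen V Q vs q = (let n = length vs in
     Poly_Mapping.single n (tens (tpow V n) (sp Q (nset n)) (tword V vs) q))"

primrec relabel :: "(nat \<Rightarrow> nat) \<Rightarrow> lbl \<Rightarrow> lbl" where
  "relabel \<sigma> (At i) = At (\<sigma> i)"
| "relabel \<sigma> (Cls C) = Cls C"

text \<open>The letters \<open>v\<^sub>1, \<dots>, v\<^sub>n\<close> of a word are numbered from \<open>1\<close>.\<close>

definition letter :: "'v list \<Rightarrow> nat \<Rightarrow> 'v" where
  "letter vs i = vs ! (i - 1)"

definition fock_rel ::
  "('k::field, 'v::ab_group_add) vsp \<Rightarrow> ('k, 'q::ab_group_add, 'z) tbialg_scheme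
     \<Rightarrow> (nat \<Rightarrow>\<^sub>0 (('v list \<Rightarrow>\<^sub>0 'k) \<times> 'q \<Rightarrow>\<^sub>0 'k)) set" where
  "fock_rel V Q = module.span (smul (fock_pre V Q))
     {fock_gen V Q vs (smor Q (nset n) (relabel \<sigma>) q)
        - fock_gen V Q (map (\<lambda>i. letter vs (\<sigma> i)) [1..<Suc n]) q
        |n vs \<sigma> q. length vs = n \<and> set vs \<subseteq> carr V \<and> bij_betw \<sigma> {1..n} {1..n} \<and> q \<in> scar Q (nset n)}"

definition fock ::
  "('k::field, 'v::ab_group_add) vsp \<Rightarrow> ('k, 'q::ab_group_add, 'z) tbialg_scheme
     \<Rightarrow> ('k, nat \<Rightarrow>\<^sub>0 (('v list \<Rightarrow>\<^sub>0 'k) \<times> 'q \<Rightarrow>\<^sub>0 'k)) vsp" where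
  "fock V Q = vquot (fock_pre V Q) (fock_rel V Q)"

definition fock_bar ::
  "('k::field, 'v::ab_group_add) vsp \<Rightarrow> ('k, 'q::ab_group_add, 'z) tbialg_scheme \<Rightarrow> 'v list \<Rightarrow> 'q
     \<Rightarrow> (nat \<Rightarrow>\<^sub>0 (('v list \<Rightarrow>\<^sub>0 'k) \<times> 'q \<Rightarrow>\<^sub>0 'k))" where
  "fock_bar V Q vs q = qproj (smul (fock_pre V Q)) (fock_rel V Q) (fock_gen V Q vs q)"

definition fock_one ::
  "('k::field, 'v::ab_group_add) vsp \<Rightarrow> ('k, 'q::ab_group_add, 'z) tbialg_scheme
     \<Rightarrow> (nat \<Rightarrow>\<^sub>0 (('v list \<Rightarrow>\<^sub>0 'k) \<times> 'q \<Rightarrow>\<^sub>0 'k))" where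
  "fock_one V Q = fock_bar V Q [] (tone Q)"

text \<open>
  The structure maps of the Fock spaces are the linear maps with prescribed values on the
  generators \<open>fock_bar V Q vs q\<close>; these determine them on the carrier, the choice \<open>SOME\<close> only
  affecting irrelevant values outside of it. In the product, \<open>[k] \<squnion> [l]\<close> is realised as \<open>[k] \<union> (k + [l])\<close>, so that \<open>\<sigma>\<^sub>k\<^sub>,\<^sub>l\<close> is the identity and
  \<open>q \<in> Q[l]\<close> is first transported along \<open>j \<mapsto> k + j\<close>.
\<close>

definition fock_mul ::
  "('k::field, 'v::ab_group_add) vsp \<Rightarrow> ('k, 'q::ab_group_add, 'z) tbialg_scheme
     \<Rightarrow> (nat \<Rightarrow>\<^sub>0 (('v list \<Rightarrow>\<^sub>0 'k) \<times> 'q \<Rightarrow>\<^sub>0 'k)) \<Rightarrow> (nat \<Rightarrow>\<^sub>0 (('v list \<Rightarrow>\<^sub>0 'k) \<times> 'q \<Rightarrow>\<^sub>0 'k))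
     \<Rightarrow> (nat \<Rightarrow>\<^sub>0 (('v list \<Rightarrow>\<^sub>0 'k) \<times> 'q \<Rightarrow>\<^sub>0 'k))" where
  "fock_mul V Q = (SOME \<mu>. bilin (fock V Q) (fock V Q) (fock V Q) \<mu> \<and>
     (\<forall>vs ws p q. let k = length vs; l = length ws in
        set vs \<subseteq> carr V \<longrightarrow> set ws \<subseteq> carr V \<longrightarrow> p \<in> scar Q (nset k) \<longrightarrow> q \<in> scar Q (nset l) \<longrightarrow>
        \<mu> (fock_bar V Q vs p) (fock_bar V Q ws q) =
        fock_bar V Q (vs @ ws)
          (tmlt Q (nset k) (relabel ((+) k) ` nset l) p (smor Q (nset l) (relabel ((+) k)) q))))"

text \<open>The letters \<open>v\<^sub>i\<close>, \<open>i \<in> I\<close>, in increasing order of indices, and the increasing bijection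
  from \<open>I\<close> to \<open>[|I|]\<close>.\<close>

definition subword :: "'v list \<Rightarrow> nat set \<Rightarrow> 'v list" where
  "subword vs I = map (letter vs) (sorted_list_of_set I)"

definition incr_pos :: "nat set \<Rightarrow> nat \<Rightarrow> nat" where
  "incr_pos I i = card {j\<in>I. j \<le> i}"

definition fock_Delta ::
  "('k::field, 'v::ab_group_add) vsp \<Rightarrow> ('k, 'q::ab_group_add, 'z) tbialg_scheme
     \<Rightarrow> (nat \<Rightarrow>\<^sub>0 (('v list \<Rightarrow>\<^sub>0 'k) \<times> 'q \<Rightarrow>\<^sub>0 'k))
     \<Rightarrow> ((nat \<Rightarrow>\<^sub>0 (('v list \<Rightarrow>\<^sub>0 'k) \<times> 'q \<Rightarrow>\<^sub>0 'k)) \<times> (nat \<Rightarrow>\<^sub>0 (('v list \<Rightarrow>\<^sub>0 'k) \<times> 'q \<Rightarrow>\<^sub>0 'k)) \<Rightarrow>\<^sub>0 'k)" where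
  "fock_Delta V Q = (SOME D. linmap (fock V Q) (fock V Q \<otimes>\<^sub>v fock V Q) D \<and>
     (\<forall>vs p. set vs \<subseteq> carr V \<longrightarrow> p \<in> scar Q (nset (length vs)) \<longrightarrow>
        D (fock_bar V Q vs p) =
        (\<Sum>(A, B)\<in>{(A, B). A \<union> B = {1..length vs} \<and> A \<inter> B = {}}.
           tmap (fock V Q) (fock V Q)
             (\<lambda>p1. fock_bar V Q (subword vs A) (smor Q (At ` A) (relabel (incr_pos A)) p1))
             (\<lambda>p2. fock_bar V Q (subword vs B) (smor Q (At ` B) (relabel (incr_pos B)) p2))
             (tcop Q (At ` A) (At ` B) p))))"

definition fock_Eps ::
  "('k::field, 'v::ab_group_add) vsp \<Rightarrow> ('k, 'q::ab_group_add, 'z) tbialg_scheme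
     \<Rightarrow> (nat \<Rightarrow>\<^sub>0 (('v list \<Rightarrow>\<^sub>0 'k) \<times> 'q \<Rightarrow>\<^sub>0 'k)) \<Rightarrow> 'k" where
  "fock_Eps V Q = (SOME e. linmap (fock V Q) ground e \<and>
     (\<forall>vs p. set vs \<subseteq> carr V \<longrightarrow> p \<in> scar Q (nset (length vs)) \<longrightarrow>
        e (fock_bar V Q vs p) = (if vs = [] then tcou Q p else 0)))"

text \<open>\<open>sweedler Z \<delta>\<^sub>V \<Phi> [v\<^sub>1, \<dots>, v\<^sub>n]\<close> is \<open>\<Phi> [v'\<^sub>1, \<dots>, v'\<^sub>n] [v''\<^sub>1, \<dots>, v''\<^sub>n]\<close> in Sweedler's notation
  \<open>\<delta>\<^sub>V(v) = v' \<otimes> v''\<close>, for multilinear \<open>\<Phi>\<close> with values in \<open>Z\<close>.\<close>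

primrec sweedler ::
  "('k::field, 'z::ab_group_add) vsp \<Rightarrow> ('v \<Rightarrow> ('v \<times> 'v \<Rightarrow>\<^sub>0 'k)) \<Rightarrow> 'v list
     \<Rightarrow> ('v list \<Rightarrow> 'v list \<Rightarrow> 'z) \<Rightarrow> 'z" where
  "sweedler Z D [] \<Phi> = \<Phi> [] []"
| "sweedler Z D (v # vs) \<Phi> =
     tlift Z (\<lambda>v' v''. sweedler Z D vs (\<lambda>as bs. \<Phi> (v' # as) (v'' # bs))) (D v)"

definition fock_delta ::
  "('k::field, 'v::ab_group_add) nbialg \<Rightarrow> ('k, 'q::ab_group_add, 'z) dtbialg_scheme
     \<Rightarrow> (nat \<Rightarrow>\<^sub>0 (('v list \<Rightarrow>\<^sub>0 'k) \<times> 'q \<Rightarrow>\<^sub>0 'k))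
     \<Rightarrow> ((nat \<Rightarrow>\<^sub>0 (('v list \<Rightarrow>\<^sub>0 'k) \<times> 'q \<Rightarrow>\<^sub>0 'k)) \<times> (nat \<Rightarrow>\<^sub>0 (('v list \<Rightarrow>\<^sub>0 'k) \<times> 'q \<Rightarrow>\<^sub>0 'k)) \<Rightarrow>\<^sub>0 'k)" where
  "fock_delta V Q = (let F = fock (nsp V) Q in SOME d. linmap F (F \<otimes>\<^sub>v F) d \<and>
     (\<forall>vs p. set vs \<subseteq> carr (nsp V) \<longrightarrow> p \<in> scar Q (nset (length vs)) \<longrightarrow>
        d (fock_bar (nsp V) Q vs p) =
        sweedler (F \<otimes>\<^sub>v F) (ncop V) vs
          (\<lambda>as bs. tmap F F (fock_bar (nsp V) Q as) (fock_bar (nsp V) Q bs) (tdel Q (nset (length vs)) p))))"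

definition fock_eps ::
  "('k::field, 'v::ab_group_add) nbialg \<Rightarrow> ('k, 'q::ab_group_add, 'z) dtbialg_scheme
     \<Rightarrow> (nat \<Rightarrow>\<^sub>0 (('v list \<Rightarrow>\<^sub>0 'k) \<times> 'q \<Rightarrow>\<^sub>0 'k)) \<Rightarrow> 'k" where
  "fock_eps V Q = (SOME e. linmap (fock (nsp V) Q) ground e \<and>
     (\<forall>vs p. set vs \<subseteq> carr (nsp V) \<longrightarrow> p \<in> scar Q (nset (length vs)) \<longrightarrow>
        e (fock_bar (nsp V) Q vs p) = (\<Prod>v\<leftarrow>vs. ncou V v) * teps Q (nset (length vs)) p))"

text \<open>\<open>\<F>\<^sub>V[Q]\<close> with its product and first coproduct, and a second coproduct \<open>d\<close> with counit \<open>e\<close>.\<close>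

definition fock_dbialg where
  "fock_dbialg V Q d e =
     \<lparr>dsp = fock (nsp V) Q, dmul = fock_mul (nsp V) Q, dunit = fock_one (nsp V) Q,
      dDel = fock_Delta (nsp V) Q, dEps = fock_Eps (nsp V) Q, ddel = d, deps = e\<rparr>"

text \<open>The product of a nonempty word; the value on the empty word is irrelevant.\<close>

fun wprod :: "('v \<Rightarrow> 'v \<Rightarrow> 'v) \<Rightarrow> 'v list \<Rightarrow> 'v" where
  "wprod m [] = undefined"
| "wprod m [v] = v"
| "wprod m (v # w # ws) = m v (wprod m (w # ws))"

definition fock_pi ::
  "('k::field, 'v::ab_group_add) nbialg \<Rightarrow> ('k, 'p::ab_group_add, 'z) ctbialg_scheme
     \<Rightarrow> (nat \<Rightarrow>\<^sub>0 (('v list \<Rightarrow>\<^sub>0 'k) \<times> ((lbl \<times> lbl) set \<Rightarrow>\<^sub>0 'p) \<Rightarrow>\<^sub>0 'k))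
     \<Rightarrow> (nat \<Rightarrow>\<^sub>0 (('v list \<Rightarrow>\<^sub>0 'k) \<times> 'p \<Rightarrow>\<^sub>0 'k))" where
  "fock_pi V P = (SOME f. linmap (fock (nsp V) (com_species P)) (fock (nsp V) P) f \<and>
     (\<forall>vs r p k \<sigma>. let X = nset (length vs) in
        set vs \<subseteq> carr (nsp V) \<longrightarrow> r \<in> eqvs X \<longrightarrow> p \<in> scar P (quo X r) \<longrightarrow>
        bij_betw \<sigma> (quo X r) {1..k} \<longrightarrow>
        f (fock_bar (nsp V) (com_species P) vs (Poly_Mapping.single r p)) =
        fock_bar (nsp V) P
          (map (\<lambda>j. wprod (nmul V) (subword vs {i\<in>{1..length vs}. \<sigma> (cls r (At i)) = j})) [1..<Suc k])
          (smor P (quo X r) (\<lambda>c. At (\<sigma> c)) p)))"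

end

theory Submission
  imports Defs "HOL-Algebra.FiniteProduct"
begin

text \<open>
 Instead of words on \<open>[n]\<close>, generators \<open>gen X v p\<close> of the Fock space are used, for any finite set \<open>X\<close> of
 labels, colouring \<open>v : X \<rightarrow> V\<close> and \<open>p \<in> P[X]\<close>, multilinear in \<open>v\<close> and natural in \<open>X\<close>; this removes all
 renumberings. \<open>\<pi>\<close> sends the generator of \<open>X\<close>, \<open>v\<close>, \<open>p \<in> P[X/~]\<close> to that of \<open>X/~\<close>, \<open>p\<close> and the products
 of \<open>v\<close> over classes. On the Fock space of \<open>P\<close> one puts
 \<open>\<delta> (gen X v p) = sum over ~ of gen (X/~) (products of v' over classes) p' \<otimes> gen X v'' p''\<close>,
 with \<open>p' \<otimes> p'' = \<delta>[~] p\<close> and \<open>v' \<otimes> v''\<close> the Sweedler components of \<open>v\<close>.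
 As \<open>\<delta>\<^sub>V\<close> is multiplicative and \<open>V\<close> commutative, \<open>\<pi>\<close> is compatible with \<open>\<delta>\<close>. As \<open>\<pi>\<close> is
 surjective, the axioms of a double bialgebra descend along it and \<open>\<delta>\<close> is unique.
\<close>

text \<open>The structure maps of a Fock space are chosen by \<open>SOME\<close> and matter only on
  carriers, so each must be shown to exist before it can be computed with. This is done through a
  universal property: natural multilinear families extend uniquely to the Fock space. The explicit
  formula is what makes \<delta> well defined. Descending \<delta>' along \<pi> directly would need
  that \<delta>' respects the kernel of \<pi>, whereas the formula is itself a natural multilinear
  family. The axioms of \<delta> are verified only for \<delta>', which stays on one label set and
  never multiplies colours. The price is that P' must be shown to be a double twisted bialgebra.
  There the axioms of \<delta> are used on X/~' and have to be carried across the flattening of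
  (X/~')/~ to X/~; the vanishing half of coassociativity completes the index set of one double sum.
  Identities in triple tensor products are contracted with an arbitrary trilinear map, which makes
  the associator disappear. \<pi> is surjective because dividing by the equality relation only
  replaces labels by their singletons.\<close>

notation tensor (infixr \<open>><\<close> 75)
abbreviation "lk \<equiv> Poly_Mapping.lookup"
abbreviation "pk \<equiv> Poly_Mapping.keys"
abbreviation "sgl \<equiv> Poly_Mapping.single"
abbreviation "pm \<equiv> Poly_Mapping.map"
abbreviation "tL \<equiv> tlift"

section \<open>Linear and bilinear maps between carriers\<close>

lemma vspace_vector_space: "vspace A ==> vector_space (smul A)"
 by (simp add: vspace_def)

lemma vspace_module: "vspace A ==> module (smul A)"
 by (simp add: vspace_def module_iff_vector_space)

lemma vspace_subspace: "vspace A ==> module.subspace (smul A) (carr A)"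
 by (simp add: vspace_def)

lemma vspace_zero: "vspace A ==> 0 : carr A"
 and vspace_add: "vspace A ==> x : carr A ==> y : carr A ==> x + y : carr A"
 and vspace_diff: "vspace A ==> x : carr A ==> y : carr A ==> x - y : carr A"
 and vspace_scale: "vspace A ==> x : carr A ==> smul A c x : carr A"
 by (blast intro: vspace_module vspace_subspace module.subspace_0 module.subspace_add
   module.subspace_diff module.subspace_scale)+

lemma vspace_sum: "vspace A ==> (!!i. i : I ==> f i : carr A) ==> sum f I : carr A"
 by (induction I rule: infinite_finite_induct) (auto simp: vspace_zero vspace_add)

lemma linmapI:
 assumes "!!x. x : carr A ==> f x : carr B"
  and "!!x y. x : carr A ==> y : carr A ==> f (x + y) = f x + f y"
  and "!!c x. x : carr A ==> f (smul A c x) = smul B c (f x)"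
 shows "linmap A B f"
 using assms by (simp add: linmap_def)

lemma linmap_in: "linmap A B f ==> x : carr A ==> f x : carr B"
 by (simp add: linmap_def)

lemma linmap_add: "linmap A B f ==> x : carr A ==> y : carr A ==> f (x + y) = f x + f y"
 by (simp add: linmap_def)

lemma linmap_scale: "linmap A B f ==> x : carr A ==> f (smul A c x) = smul B c (f x)"
 by (simp add: linmap_def)

lemma linmap_zero: "linmap A B f ==> vspace A ==> f 0 = 0"
 using linmap_add[of A B f 0 0] by (simp add: vspace_zero)

lemma linmap_sum:
 "linmap A B f ==> vspace A ==> (!!i. i : I ==> g i : carr A) ==> f (sum g I) = (SUM i:I. f (g i))"
 by (induction I rule: infinite_finite_induct) (simp_all add: linmap_zero linmap_add vspace_sum)

lemma linmap_diff:
 assumes f: "linmap A B f" "vspace A" "x : carr A" "y : carr A"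
 shows "f (x - y) = f x - f y"
 using linmap_add[OF f(1), of "x - y" y] assms by (simp add: vspace_diff)

text \<open>Lets a formula known only on \<open>carr A\<close>, for instance the restriction of a
  map to its carrier, inherit linearity.\<close>

lemma linmap_cong:
 assumes "linmap A B f" "vspace A" "!!x. x : carr A ==> g x = f x"
 shows "linmap A B g"
 using assms by (auto simp: linmap_def vspace_add vspace_scale)

lemma linmap_id: "linmap A A (%x. x)"
 by (simp add: linmap_def)

lemma linmap_comp: "linmap B C g ==> linmap A B f ==> linmap A C (%x. g (f x))"
 by (simp add: linmap_def)

lemma linmap_0: "vspace B ==> linmap A B (%x. 0)"
 by (intro linmapI) (simp_all add: vspace_zero module.scale_zero_right vspace_module)

lemma linmap_setsum:
 assumes "vspace B" "!!i. i : I ==> linmap A B (f i)"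
 shows "linmap A B (%x. SUM i:I. f i x)"
proof -
 interpret vector_space "smul B" using assms(1) by (rule vspace_vector_space)
 show ?thesis
  by (intro linmapI vspace_sum assms(1) linmap_in[OF assms(2)])
   (simp_all add: linmap_add[OF assms(2)] linmap_scale[OF assms(2)] sum.distrib scale_sum_right)
qed

lemma linmap_scaled:
 assumes "vspace B" "linmap A B f"
 shows "linmap A B (%x. smul B c (f x))"
proof -
 interpret vector_space "smul B" using assms(1) by (rule vspace_vector_space)
 show ?thesis
  using assms(2) by (intro linmapI)
   (auto simp: linmap_in linmap_add linmap_scale vspace_scale assms(1) algebra_simps)
qed

lemma vspace_ground: "vspace ground"
proof -
 interpret vector_space "(*) :: 'a::field => 'a => 'a" by (rule vector_space_ground)
 show ?thesis by (simp add: vspace_def ground_def vector_space_axioms)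
qed

lemma carr_ground [simp]: "carr ground = UNIV"
 and smul_ground [simp]: "smul ground = (*)"
 by (simp_all add: ground_def)

lemma linmap_scale_left:
 assumes "vspace B" "linmap A ground f" "b : carr B"
 shows "linmap A B (%x. smul B (f x) b)"
proof -
 interpret vector_space "smul B" using assms(1) by (rule vspace_vector_space)
 show ?thesis
  using assms by (intro linmapI)
   (auto simp: linmap_add[OF assms(2)] linmap_scale[OF assms(2)] vspace_scale algebra_simps)
qed

lemma linmap_mult:
 assumes "linmap A ground f"
 shows "linmap A ground (%x. f x * c)" "linmap A ground (%x. c * f x)"
 using linmap_scaled[OF vspace_ground assms, of c] by (simp_all add: mult.commute)

lemma bilinI:
 "(!!x. x : carr A ==> linmap B C (f x)) ==> (!!y. y : carr B ==> linmap A C (%x. f x y)) ==> bilin A B C f"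
 by (simp add: bilin_def)

lemma bilin_right: "bilin A B C f ==> x : carr A ==> linmap B C (f x)"
 and bilin_left: "bilin A B C f ==> y : carr B ==> linmap A C (%x. f x y)"
 by (simp_all add: bilin_def)

lemma bilin_in: "bilin A B C f ==> x : carr A ==> y : carr B ==> f x y : carr C"
 by (metis bilin_right linmap_in)

lemma bilin_comp:
 assumes "bilin A B C be" "linmap A' A f" "linmap B' B g"
 shows "bilin A' B' C (%x y. be (f x) (g y))"
 using assms by (auto simp: bilin_def linmap_def)

lemma linmap_bilin:
 assumes "linmap C D f" "bilin A B C be"
 shows "bilin A B D (%x y. f (be x y))"
 using assms by (auto simp: bilin_def linmap_def)

lemma bilin_left_comp: "bilin A B C be ==> linmap A' A f ==> y : carr B ==> linmap A' C (%x. be (f x) y)"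
 by (auto simp: bilin_def linmap_def)

lemma bilin_right_comp: "bilin A B C be ==> x : carr A ==> linmap B' B f ==> linmap B' C (%y. be x (f y))"
 by (auto simp: bilin_def linmap_def)

lemma bilin_zero:
 assumes "bilin A B C be" "vspace A" "vspace B"
 shows "y : carr B ==> be 0 y = 0" "x : carr A ==> be x 0 = 0"
 using linmap_zero[OF bilin_left[OF assms(1)] assms(2)] linmap_zero[OF bilin_right[OF assms(1)] assms(3)]
 by auto

text \<open>These are the maps contracted with a coproduct in the two counit axioms.\<close>

lemma bilin_ground_scale:
 assumes "vspace A" "linmap B ground f"
 shows "bilin B A A (%x y. smul A (f x) y)" "bilin A B A (%y x. smul A (f x) y)"
 by (auto intro!: bilinI linmap_scale_left linmap_scaled linmap_id simp: assms)

lemma bilin_sum: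
 assumes "vspace C" "!!i. i : I ==> bilin A B C (be i)"
 shows "bilin A B C (%x y. SUM i:I. be i x y)"
 by (intro bilinI linmap_setsum assms(1)) (auto dest!: assms(2) intro: bilin_left bilin_right)

lemma vspace_qproj:
 assumes "vspace A" "module.subspace (smul A) R" "R <= carr A" "x : carr A"
 shows "qproj (smul A) R x : carr A"
proof -
 have "x - qproj (smul A) R x : carr A"
  using diff_qproj_mem[OF vspace_vector_space[OF assms(1)] assms(2)] assms(3) by blast
 from vspace_diff[OF assms(1,4) this] show ?thesis by simp
qed

lemma linmap_qproj:
 assumes "vspace A" "module.subspace (smul A) R"
 shows "linmap A (vquot A R) (qproj (smul A) R)"
proof -
 interpret Vector_Spaces.linear "smul A" "smul A" "qproj (smul A) R"
  by (rule linear_qproj[OF vspace_vector_space[OF assms(1)] assms(2)])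
 show ?thesis by (intro linmapI) (auto simp: vquot_def add scale)
qed

text \<open>The quotient sits inside \<open>carr A\<close> as a complement of \<open>R\<close>, so
  the induced map is \<open>f\<close> itself. Since \<open>x\<close> and its projection differ by an
  element of \<open>R\<close>, a map killing \<open>R\<close> does not see which complement was
  chosen.\<close>

lemma linmap_vquot:
 assumes A: "vspace A" and R: "module.subspace (smul A) R" "R <= carr A"
  and f: "linmap A B f" and 0: "!!x. x : R ==> f x = 0"
 shows "linmap (vquot A R) B f" "x : carr A ==> f (qproj (smul A) R x) = f x"
proof -
 have sub: "carr (vquot A R) <= carr A"
  using vspace_qproj[OF A R] by (auto simp: vquot_def)
 then show "linmap (vquot A R) B f"
  using f by (auto simp: linmap_def vquot_def image_subset_iff)
 assume x: "x : carr A"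
 have "f (x - qproj (smul A) R x) = 0"
  by (intro 0 diff_qproj_mem vspace_vector_space A R)
 then show "f (qproj (smul A) R x) = f x"
  using linmap_diff[OF f A x vspace_qproj[OF A R x]] by simp
qed

section \<open>Free vector spaces and tensor products\<close>

lemma sum_single_lookup:
 "(SUM k:pk t. sgl k (lk t k)) = t"
 by (rule poly_mapping_eqI) (simp add: lookup_sum lookup_single when_def in_keys_iff)

text \<open>Linear extension from a basis with an arbitrary index type. \<open>tlift\<close> is the
  case of pairs; words, being lists, need the general one.\<close>

definition flift :: "('k::field, 'z::ab_group_add) vsp => ('b => 'z) => ('b \<Rightarrow>\<^sub>0 'k) => 'z" where
 "flift Z \<psi> t = (SUM b:pk t. smul Z (lk t b) (\<psi> b))"

lemma flift_superset:
 assumes "vspace Z" "finite S" "pk t <= S"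
 shows "flift Z \<psi> t = (SUM b:S. smul Z (lk t b) (\<psi> b))"
proof -
 interpret vector_space "smul Z" using assms(1) by (rule vspace_vector_space)
 show ?thesis
  unfolding flift_def
  by (rule sum.mono_neutral_left) (use assms in \<open>auto simp: in_keys_iff\<close>)
qed

lemma flift_add:
 assumes "vspace Z"
 shows "flift Z \<psi> (s + t) = flift Z \<psi> s + flift Z \<psi> t"
proof -
 interpret vector_space "smul Z" using assms(1) by (rule vspace_vector_space)
 let ?S = "pk s Un pk t"
 have "flift Z \<psi> u = (SUM b:?S. smul Z (lk u b) (\<psi> b))"
  if "pk u <= ?S" for u
  by (rule flift_superset[OF assms _ that]) simp
 from this[of s] this[of t] this[of "s + t"] show ?thesis
  by (simp add: Poly_Mapping.keys_add lookup_add algebra_simps sum.distrib)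
qed

lemma flift_scale:
 assumes "vspace Z"
 shows "flift Z \<psi> (pm ((*) c) t) = smul Z c (flift Z \<psi> t)"
proof -
 interpret vector_space "smul Z" using assms(1) by (rule vspace_vector_space)
 have "pk (pm ((*) c) t) <= pk t"
  by (auto simp: in_keys_iff lookup_map_smul[OF vector_space_ground])
 from flift_superset[OF assms _ this, of \<psi>] show ?thesis
  by (simp add: flift_def scale_sum_right lookup_map_smul[OF vector_space_ground])
qed

lemma flift_single:
 assumes "vspace Z"
 shows "flift Z \<psi> (sgl b c) = smul Z c (\<psi> b)"
proof -
 interpret vector_space "smul Z" using assms(1) by (rule vspace_vector_space)
 show ?thesis by (simp add: flift_def)
qed

lemma flift_in:
 assumes "vspace Z" "!!b. b : pk t ==> \<psi> b : carr Z"
 shows "flift Z \<psi> t : carr Z"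
 unfolding flift_def by (intro vspace_sum vspace_scale assms)

lemma linmap_flift:
 assumes "vspace Z" "!!b. b : B ==> \<psi> b : carr Z"
 shows "linmap (freev B) Z (flift Z \<psi>)"
 using assms by (intro linmapI)
  (auto simp: flift_add smul_freev flift_scale intro!: flift_in, auto simp: freev_def dsum_def)

lemma linear_flift:
 assumes "vspace Z"
 shows "Vector_Spaces.linear (%c. pm ((*) c)) (smul Z) (flift Z \<psi>)"
 by (simp add: Vector_Spaces.linear_iff vspace_vector_space[OF assms] vector_space_free
   flift_add flift_scale assms)

lemma tlift_flift: "tL Z be = flift Z (%(a, b). be a b)"
 by (auto simp: tlift_def flift_def case_prod_beta)

text \<open>An element of a tensor product is its own chosen representative, hence a finite
  combination of pairs taken from the carriers. This is why the rules for \<open>tlift\<close> below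
  can restrict their hypotheses to carriers.\<close>

lemma tensor_keys:
 assumes "vspace A" "vspace B" "t : carr (A >< B)" "(a, b) : pk t"
 shows "a : carr A" "b : carr B"
 using tensor_subset_free[OF assms(1,2)] assms(3,4) by (auto simp: freev_def dsum_def)

lemma tlift_in:
 assumes "vspace A" "vspace B" "vspace Z" "t : carr (A >< B)"
  "!!a b. a : carr A ==> b : carr B ==> be a b : carr Z"
 shows "tL Z be t : carr Z"
 unfolding tlift_flift
 by (rule flift_in[OF assms(3)]) (auto intro!: assms(5) dest: tensor_keys[OF assms(1,2,4)])

lemma tlift_cong:
 assumes "vspace A" "vspace B" "t : carr (A >< B)"
  "!!a b. a : carr A ==> b : carr B ==> be a b = \<beta>' a b"
 shows "tL Z be t = tL Z \<beta>' t"
 unfolding tlift_def by (rule sum.cong) (use tensor_keys[OF assms(1-3)] assms(4) in auto)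

lemma linmap_of_tlift:
 assumes "vspace A" "vspace B" "t : carr (A >< B)" "linmap Y Z f" "vspace Y"
  "!!a b. a : carr A ==> b : carr B ==> be a b : carr Y"
 shows "f (tL Y be t) = tL Z (%a b. f (be a b)) t"
proof -
 have 1: "be a b : carr Y" if "(a, b) : pk t" for a b
  using tensor_keys[OF assms(1-3) that] by (rule assms(6))
 show ?thesis
  unfolding tlift_def
  by (subst linmap_sum[OF assms(4,5)]) (auto intro!: sum.cong vspace_scale assms(5) 1 linmap_scale[OF assms(4)])
qed

lemma linmap_tlift_param:
 assumes "vspace A" "vspace B" "vspace Z" "t : carr (A >< B)"
  "!!a b. a : carr A ==> b : carr B ==> linmap C Z (%x. be x a b)"
 shows "linmap C Z (%x. tL Z (be x) t)"
 unfolding tlift_def case_prod_beta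
 by (intro linmap_setsum linmap_scaled assms(3,5)) (use tensor_keys[OF assms(1,2,4)] in auto)

lemma linmap_tlift_arg:
 assumes "vspace A" "vspace B" "vspace Z" "bilin A B Z be" "linmap C (A >< B) g"
 shows "linmap C Z (%x. tL Z be (g x))"
 by (rule linmap_comp[OF linmap_tlift assms(5)]) (simp_all add: assms)

lemma tlift_sum_param:
 assumes "vspace Z"
 shows "tL Z (%a b. SUM i:I. be i a b) t = (SUM i:I. tL Z (be i) t)"
proof -
 interpret vector_space "smul Z" using assms(1) by (rule vspace_vector_space)
 show ?thesis
  unfolding tlift_def case_prod_beta scale_sum_right by (rule sum.swap)
qed

lemma tlift_scale_param:
 assumes "vspace Z"
 shows "tL Z (%a b. smul Z c (be a b)) t = smul Z c (tL Z be t)"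
proof -
 interpret vector_space "smul Z" using assms(1) by (rule vspace_vector_space)
 show ?thesis
  unfolding tlift_def by (simp add: scale_sum_right case_prod_beta mult.commute)
qed

lemma tlift_zero_param: "vspace Z ==> tL Z (%a b. 0) t = 0"
 using tlift_sum_param[of Z "%_ _ _. 0" "{}" t] by simp

lemma tlift_zero [simp]: "tL Z be 0 = 0"
 by (simp add: tlift_def)

lemma tlift_sum_arg:
 assumes "vspace Z"
 shows "tL Z be (SUM i:I. t i) = (SUM i:I. tL Z be (t i))"
 by (induction I rule: infinite_finite_induct) (simp_all add: tlift_flift flift_add assms flift_def[of _ _ 0])

lemma bilin_tens:
 assumes "vspace A" "vspace B"
 shows "bilin A B (A >< B) (tens A B)"
proof -
 let ?s = "%c::'a. pm ((*) c) :: ('b \<times> 'c \<Rightarrow>\<^sub>0 'a) => _"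
 interpret f: vector_space ?s by (rule vector_space_free)
 interpret l: Vector_Spaces.linear ?s ?s "qproj ?s (tensor_rel A B)"
  by (rule linear_qproj[OF vector_space_free subspace_tensor_rel])
 have eq: "qproj ?s (tensor_rel A B) x = qproj ?s (tensor_rel A B) y" if "x - y : tensor_rel A B" for x y
  using that by (simp add: qproj_eq_iff[OF vector_space_free subspace_tensor_rel])
 have scale: "sgl k c = ?s c (sgl k 1)" for k c
  by (rule poly_mapping_eqI) (simp add: lookup_map_smul[OF vector_space_ground] lookup_single when_def)
 have smul: "smul (A >< B) = ?s" by (simp add: tensor_def vquot_def smul_freev)
 have carr: "tens A B a b : carr (A >< B)" if "a : carr A" "b : carr B" for a b
  using that by (auto simp: tens_def tensor_def vquot_def smul_freev freev_def dsum_def intro!: imageI)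
 show ?thesis
 proof (intro bilinI linmapI carr)
  fix a x y assume "a : carr A" "x : carr B" "y : carr B"
  then show "tens A B a (x + y) = tens A B a x + tens A B a y"
   unfolding tens_def l.add[symmetric]
   by (intro eq) (auto simp: tensor_rel_def diff_diff_eq[symmetric] intro!: f.span_base)
 next
  fix b x y assume "b : carr B" "x : carr A" "y : carr A"
  then show "tens A B (x + y) b = tens A B x b + tens A B y b"
   unfolding tens_def l.add[symmetric]
   by (intro eq) (auto simp: tensor_rel_def diff_diff_eq[symmetric] intro!: f.span_base)
 next
  fix a b c assume "a : carr A" "b : carr B"
  then show "tens A B a (smul B c b) = smul (A >< B) c (tens A B a b)"
   unfolding tens_def smul l.scale[symmetric] scale[symmetric]
   by (intro eq) (unfold tensor_rel_def, rule f.span_base, blast)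
 next
  fix a b c assume "b : carr B" "a : carr A"
  then show "tens A B (smul A c a) b = smul (A >< B) c (tens A B a b)"
   unfolding tens_def smul l.scale[symmetric] scale[symmetric]
   by (intro eq) (unfold tensor_rel_def, rule f.span_base, blast)
 qed
qed

lemma tens_in:
 "vspace A ==> vspace B ==> a : carr A ==> b : carr B ==> tens A B a b : carr (A >< B)"
 by (rule bilin_in[OF bilin_tens])

lemma tens_zero [simp]:
 assumes "vspace A" "vspace B"
 shows "b : carr B ==> tens A B 0 b = 0" "a : carr A ==> tens A B a 0 = 0"
 using bilin_zero[OF bilin_tens[OF assms] assms] by auto

text \<open>Projecting the basis vectors of the representative \<open>t\<close> and summing gives
  the projection of \<open>t\<close>, which \<open>qproj\<close> fixes. Read backwards, this turns
  any tensor into a contraction, to which the formulas for contracted coproducts apply.\<close>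

lemma tlift_tens_id:
 assumes "vspace A" "vspace B" "t : carr (A >< B)"
 shows "tL (A >< B) (tens A B) t = t"
proof -
 let ?s = "%c::'a. pm ((*) c) :: ('b \<times> 'c \<Rightarrow>\<^sub>0 'a) => _"
 interpret l: Vector_Spaces.linear ?s ?s "qproj ?s (tensor_rel A B)"
  by (rule linear_qproj[OF vector_space_free subspace_tensor_rel])
 have smul: "smul (A >< B) = ?s" by (simp add: tensor_def vquot_def smul_freev)
 obtain x where t: "t = qproj ?s (tensor_rel A B) x"
  using assms(3) by (auto simp: tensor_def vquot_def smul_freev)
 have 1: "?s (lk t k) (sgl k 1) = sgl k (lk t k)" for k
  by (rule poly_mapping_eqI) (simp add: lookup_map_smul[OF vector_space_ground] lookup_single when_def)
 have "tL (A >< B) (tens A B) t = qproj ?s (tensor_rel A B)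
   (SUM k:pk t. sgl k (lk t k))"
  unfolding tlift_def l.sum smul
  by (rule sum.cong) (auto simp: tens_def l.scale[symmetric] 1)
 also have "(SUM k:pk t. sgl k (lk t k)) = t"
  by (rule sum_single_lookup)
 also have "qproj ?s (tensor_rel A B) t = t"
  unfolding t by (rule qproj_idem[OF vector_space_free subspace_tensor_rel])
 finally show ?thesis .
qed

lemma linmap_tensor_ext:
 assumes "vspace A" "vspace B" "linmap (A >< B) Z f" "linmap (A >< B) Z g"
  "!!a b. a : carr A ==> b : carr B ==> f (tens A B a b) = g (tens A B a b)" "t : carr (A >< B)"
 shows "f t = g t"
proof -
 have "f (tL (A >< B) (tens A B) t) = tL Z (%a b. f (tens A B a b)) t"
  by (rule linmap_of_tlift[OF assms(1,2,6,3)]) (auto intro: vspace_tensor tens_in assms)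
 also have "... = tL Z (%a b. g (tens A B a b)) t"
  by (rule tlift_cong[OF assms(1,2,6)]) (rule assms(5))
 also have "... = g (tL (A >< B) (tens A B) t)"
  by (rule linmap_of_tlift[OF assms(1,2,6,4), symmetric]) (auto intro: vspace_tensor tens_in assms)
 finally show ?thesis
  by (simp add: tlift_tens_id assms)
qed

lemma tlift_tlift:
 assumes "vspace C" "vspace D" "t : carr (C >< D)" "vspace A" "vspace B" "vspace Z" "bilin A B Z be"
  "!!c d. c : carr C ==> d : carr D ==> \<gamma> c d : carr (A >< B)"
 shows "tL Z be (tL (A >< B) \<gamma> t) = tL Z (%c d. tL Z be (\<gamma> c d)) t"
 by (rule linmap_of_tlift[OF assms(1-3) linmap_tlift[OF assms(4-7)] vspace_tensor assms(8)])

lemma tmap_in: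
 assumes "vspace C" "vspace D" "t : carr (C >< D)" "vspace A" "vspace B"
  "!!c. c : carr C ==> f c : carr A" "!!d. d : carr D ==> g d : carr B"
 shows "tmap A B f g t : carr (A >< B)"
 unfolding tmap_def by (rule tlift_in[OF assms(1,2) vspace_tensor assms(3)]) (auto intro: tens_in assms)

lemma tlift_tmap:
 assumes "vspace C" "vspace D" "t : carr (C >< D)" "vspace A" "vspace B" "vspace Z" "bilin A B Z be"
  "!!c. c : carr C ==> f c : carr A" "!!d. d : carr D ==> g d : carr B"
 shows "tL Z be (tmap A B f g t) = tL Z (%c d. be (f c) (g d)) t"
 unfolding tmap_def
 by (subst tlift_tlift[OF assms(1-7)]) (auto intro: tens_in assms simp: tlift_tens[OF assms(6,7)])

lemma linmap_tmap:
 assumes "vspace C" "vspace D" "vspace A" "vspace B" "linmap C A f" "linmap D B g"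
 shows "linmap (C >< D) (A >< B) (tmap A B f g)"
 unfolding tmap_def
 by (intro linmap_tlift vspace_tensor bilin_comp[OF bilin_tens] assms)

lemma tmap_cong:
 assumes "vspace C" "vspace D" "t : carr (C >< D)"
  "!!c. c : carr C ==> f c = f' c" "!!d. d : carr D ==> g d = g' d"
 shows "tmap A B f g t = tmap A B f' g' t"
 unfolding tmap_def by (rule tlift_cong[OF assms(1-3)]) (simp add: assms)

lemma tmap_tmap:
 assumes "vspace C" "vspace D" "t : carr (C >< D)" "vspace A" "vspace B" "vspace A'" "vspace B'"
  "linmap A A' f'" "linmap B B' g'"
  "!!c. c : carr C ==> f c : carr A" "!!d. d : carr D ==> g d : carr B"
 shows "tmap A' B' f' g' (tmap A B f g t) = tmap A' B' (%x. f' (f x)) (%x. g' (g x)) t"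
 unfolding tmap_def[of A' B']
 by (rule tlift_tmap[OF assms(1-5) vspace_tensor]) (auto intro: bilin_comp[OF bilin_tens] assms)

lemma tmap_ident:
 assumes "vspace A" "vspace B" "t : carr (A >< B)"
  "!!c. c : carr A ==> f c = c" "!!d. d : carr B ==> g d = d"
 shows "tmap A B f g t = t"
proof -
 have "tmap A B f g t = tL (A >< B) (tens A B) t"
  unfolding tmap_def by (rule tlift_cong[OF assms(1-3)]) (simp add: assms)
 then show ?thesis by (simp add: tlift_tens_id assms)
qed

lemma tmap_tens:
 assumes "vspace A" "vspace B" "vspace C" "vspace D" "linmap A C f" "linmap B D g"
 shows "tmap C D f g (tens A B a b) = tens C D (f a) (g b)"
 unfolding tmap_def
 by (rule tlift_tens[OF vspace_tensor]) (rule bilin_comp[OF bilin_tens assms(5,6)], rule assms, rule assms)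

lemma bilin_tlift2:
 assumes "vspace A" "vspace B" "vspace C" "vspace D" "vspace Z"
  "!!a b. a : carr A ==> b : carr B ==> bilin C D Z (be a b)"
  "!!c d. c : carr C ==> d : carr D ==> bilin A B Z (%a b. be a b c d)"
 shows "bilin (A >< B) (C >< D) Z (%s t. tL Z (%a b. tL Z (be a b) t) s)"
proof (intro bilinI)
 fix s assume s: "s : carr (A >< B)"
 show "linmap (C >< D) Z (%t. tL Z (%a b. tL Z (be a b) t) s)"
  by (rule linmap_tlift_param[OF assms(1,2,5) s]) (intro linmap_tlift assms)
next
 fix t assume t: "t : carr (C >< D)"
 have "bilin A B Z (%a b. tL Z (be a b) t)"
  by (intro bilinI linmap_tlift_param[OF assms(3,4,5) t])
   (auto intro: bilin_right[OF assms(7)] bilin_left[OF assms(7)])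
 then show "linmap (A >< B) Z (%s. tL Z (%a b. tL Z (be a b) t) s)"
  by (intro linmap_tlift assms)
qed

lemma bilin_pair:
 assumes be: "bilin E F Z be" and \<mu>: "bilin A C E \<mu>" and \<nu>: "bilin B D F \<nu>"
 shows "a : carr A ==> b : carr B ==> bilin C D Z (%c d. be (\<mu> a c) (\<nu> b d))"
  and "c : carr C ==> d : carr D ==> bilin A B Z (%a b. be (\<mu> a c) (\<nu> b d))"
 by (auto intro!: bilin_comp[OF be] intro: bilin_left[OF \<mu>] bilin_right[OF \<mu>] bilin_left[OF \<nu>] bilin_right[OF \<nu>])

lemma bilin_tmul:
 assumes vs: "vspace A" "vspace B" "vspace C" "vspace D" "vspace E" "vspace F"
  and \<mu>: "bilin A C E \<mu>" and \<nu>: "bilin B D F \<nu>"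
 shows "bilin (A >< B) (C >< D) (E >< F) (tmul E F \<mu> \<nu>)"
 unfolding tmul_def
 by (intro bilin_tlift2 vspace_tensor vs) (auto intro: bilin_pair[OF bilin_tens[OF vs(5,6)] \<mu> \<nu>])

text \<open>Under a contraction the interchange of the two middle factors is no longer visible: it
  only decides which bound variables are passed to \<open>\<mu>\<close> and which to
  \<open>\<nu>\<close>.\<close>

lemma tlift_tmul:
 assumes vs: "vspace A" "vspace B" "vspace C" "vspace D" "vspace E" "vspace F" "vspace Z"
  and \<mu>: "bilin A C E \<mu>" and \<nu>: "bilin B D F \<nu>" and be: "bilin E F Z be"
  and st: "s : carr (A >< B)" "t : carr (C >< D)"
 shows "tL Z be (tmul E F \<mu> \<nu> s t) = tL Z (%a b. tL Z (%c d. be (\<mu> a c) (\<nu> b d)) t) s"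
proof -
 have in1: "tens E F (\<mu> a c) (\<nu> b d) : carr (E >< F)"
  if "a : carr A" "b : carr B" "c : carr C" "d : carr D" for a b c d
  using that by (intro tens_in vs bilin_in[OF \<mu>] bilin_in[OF \<nu>])
 have "tL Z be (tmul E F \<mu> \<nu> s t) =
   tL Z (%a b. tL Z be (tL (E >< F) (%c d. tens E F (\<mu> a c) (\<nu> b d)) t)) s"
  unfolding tmul_def
  by (intro tlift_tlift[OF vs(1,2) st(1)] vs be tlift_in[OF vs(3,4) vspace_tensor st(2)] in1)
 also have "... = tL Z (%a b. tL Z (%c d. tL Z be (tens E F (\<mu> a c) (\<nu> b d))) t) s"
  by (intro tlift_cong[OF vs(1,2) st(1)] tlift_tlift[OF vs(3,4) st(2)] vs be in1)
 finally show ?thesis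
  by (simp add: tlift_tens[OF vs(7) be])
qed

text \<open>Test maps for triple tensor products. An identity there is handled by contracting both
  sides with an arbitrary trilinear \<open>T\<close>; the universal \<open>T\<close>, built from
  \<open>tens\<close>, gives back the identity of tensors.\<close>

definition trilin where
 "trilin A B C Z T \<longleftrightarrow> (ALL a:carr A. bilin B C Z (T a)) & (ALL b:carr B. ALL c:carr C. linmap A Z (%a. T a b c))"

lemma trilinI:
 assumes "!!b c. b : carr B ==> c : carr C ==> linmap A Z (%a. T a b c)"
  "!!a c. a : carr A ==> c : carr C ==> linmap B Z (%b. T a b c)"
  "!!a b. a : carr A ==> b : carr B ==> linmap C Z (%c. T a b c)"
 shows "trilin A B C Z T"
 unfolding trilin_def by (auto intro!: bilinI assms)

lemma trilinD:
 assumes "trilin A B C Z T"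
 shows "b : carr B ==> c : carr C ==> linmap A Z (%a. T a b c)"
  "a : carr A ==> c : carr C ==> linmap B Z (%b. T a b c)"
  "a : carr A ==> b : carr B ==> linmap C Z (T a b)"
  "a : carr A ==> bilin B C Z (T a)"
  "b : carr B ==> bilin A C Z (%a. T a b)"
  "c : carr C ==> bilin A B Z (%a b. T a b c)"
  "a : carr A ==> b : carr B ==> c : carr C ==> T a b c : carr Z"
 using assms unfolding trilin_def bilin_def linmap_def by auto

lemma trilin_comp:
 assumes "trilin A B C Z T" "linmap A' A f" "linmap B' B g" "linmap C' C h"
 shows "trilin A' B' C' Z (%a b c. T (f a) (g b) (h c))"
 using assms unfolding trilin_def bilin_def linmap_def by auto

lemma trilin_tens:
 assumes "vspace A" "vspace B" "vspace C"
 shows "trilin A B C (A >< B >< C) (%a b c. tens A (B >< C) a (tens B C b c))"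
 by (intro trilinI bilin_left[OF bilin_tens] bilin_right_comp[OF bilin_tens] vspace_tensor tens_in
   bilin_right[OF bilin_tens] assms)

lemma linmap_tlift_trilin:
 assumes "vspace A" "vspace B" "vspace C" "vspace Z" "trilin A B C Z T"
 shows "bilin (A >< B) C Z (%t c. tL Z (%a b. T a b c) t)"
  and "bilin A (B >< C) Z (%a t. tL Z (T a) t)"
 by (auto intro!: bilinI linmap_tlift linmap_tlift_param[OF assms(1,2,4)] linmap_tlift_param[OF assms(2,3,4)] assms
   trilinD[OF assms(5)])

text \<open>The levels at which the nested contraction belonging to \<open>m1324\<close> is
  bilinear: in the inner pair, in the outer pair, and in the arguments \<open>x\<close>,
  \<open>y\<close> whose images under \<open>f\<close> and \<open>g\<close>, in practice two
  coproducts, are contracted.\<close>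

lemma bilin_m1324:
 assumes vs: "vspace A" "vspace B" "vspace C" "vspace D" "vspace Z"
  and T: "trilin A C F Z T" and \<nu>: "bilin B D F \<nu>"
 shows "a : carr A ==> b : carr B ==> bilin C D Z (%c d. T a c (\<nu> b d))"
  and "t : carr (C >< D) ==> bilin A B Z (%a b. tL Z (%c d. T a c (\<nu> b d)) t)"
  and "linmap X (A >< B) f ==> linmap Y (C >< D) g ==>
   bilin X Y Z (%x y. tL Z (%a b. tL Z (%c d. T a c (\<nu> b d)) (g y)) (f x))"
proof -
 have q1: "bilin C D Z (%c d. T a c (\<nu> b d))" if "a : carr A" "b : carr B" for a b
  using bilin_comp[OF trilinD(4)[OF T that(1)] linmap_id bilin_right[OF \<nu> that(2)]] .
 then show "a : carr A ==> b : carr B ==> bilin C D Z (%c d. T a c (\<nu> b d))" .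
 have q2: "bilin A B Z (%a b. T a c (\<nu> b d))" if "c : carr C" "d : carr D" for c d
  using bilin_comp[OF trilinD(5)[OF T that(1)] linmap_id bilin_left[OF \<nu> that(2)]] .
 show "bilin A B Z (%a b. tL Z (%c d. T a c (\<nu> b d)) t)" if "t : carr (C >< D)"
  by (intro bilinI linmap_tlift_param[OF vs(3,4,5) that]) (auto intro: bilin_left[OF q2] bilin_right[OF q2])
 show "linmap X (A >< B) f ==> linmap Y (C >< D) g ==>
   bilin X Y Z (%x y. tL Z (%a b. tL Z (%c d. T a c (\<nu> b d)) (g y)) (f x))"
  by (rule bilin_comp[OF bilin_tlift2[OF vs q1 q2]])
qed

lemma trilin_tens':
 assumes "vspace A" "vspace B" "vspace C"
 shows "trilin A B C ((A >< B) >< C) (%a b c. tens (A >< B) C (tens A B a b) c)"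
 by (intro trilinI bilin_left_comp[OF bilin_tens] bilin_left[OF bilin_tens] bilin_right[OF bilin_tens] vspace_tensor tens_in assms)

text \<open>One bracketing of a coassociativity law as a nested contraction.
  \<open>tlift_tmap_id\<close> treats the other bracketing, so a law stated with
  \<open>tassoc\<close> becomes an equation between nested contractions with the same
  \<open>T\<close>.\<close>

lemma tlift_tassoc:
 assumes vs: "vspace A" "vspace B" "vspace C" "vspace Z" "vspace X" and T: "trilin A B C Z T"
  and f: "!!x. x : carr X ==> f x : carr (A >< B)" and t: "t : carr (X >< C)"
 shows "tL Z (%a. tL Z (T a)) (tassoc A B C (tmap (A >< B) C f id t)) =
  tL Z (%x c. tL Z (%a b. T a b c) (f x)) t"
proof -
 note vst = vs vspace_tensor
 have "tassoc A B C (tmap (A >< B) C f id t) =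
   tL (A >< B >< C) (%x c. tL (A >< B >< C) (%a b. tens A (B >< C) a (tens B C b c)) (f x)) t"
  unfolding tassoc_def
  by (subst tlift_tmap[OF vs(5,3) t])
   (auto intro: vst f linmap_tlift_trilin(1)[OF vs(1-3) vspace_tensor trilin_tens[OF vs(1-3)]])
 moreover have "tL Z (%a. tL Z (T a)) ... =
   tL Z (%x c. tL Z (%a. tL Z (T a)) (tL (A >< B >< C) (%a b. tens A (B >< C) a (tens B C b c)) (f x))) t"
  by (rule tlift_tlift[OF vs(5,3) t])
   (auto intro!: vst f linmap_tlift_trilin T tens_in tlift_in[OF vs(1,2)])
 moreover have "... = tL Z (%x c. tL Z (%a b. tL Z (%a. tL Z (T a)) (tens A (B >< C) a (tens B C b c))) (f x)) t"
  by (intro tlift_cong[OF vs(5,3) t] tlift_tlift[OF vs(1,2)])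
   (auto intro!: vst f linmap_tlift_trilin T tens_in)
 moreover have "... = tL Z (%x c. tL Z (%a b. T a b c) (f x)) t"
  by (intro tlift_cong[OF vs(5,3) t] tlift_cong[OF vs(1,2) f])
   (auto simp: tlift_tens[OF vs(4) linmap_tlift_trilin(2)[OF vs(1-4) T]] tlift_tens[OF vs(4) trilinD(4)[OF T]])
 ultimately show ?thesis by simp
qed

lemma tlift_tmap_id:
 assumes vs: "vspace A" "vspace B" "vspace C" "vspace Z" "vspace X" and T: "trilin A B C Z T"
  and f: "!!x. x : carr X ==> f x : carr (B >< C)" and t: "t : carr (A >< X)"
 shows "tL Z (%a. tL Z (T a)) (tmap A (B >< C) id f t) =
  tL Z (%a x. tL Z (T a) (f x)) t"
 by (subst tlift_tmap[OF vs(1,5) t]) (auto intro!: vs vspace_tensor f linmap_tlift_trilin T)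

text \<open>The way back: for the universal trilinear map the nested contraction is the tensor
  itself. Together with \<open>tmap_id_eq\<close> it recovers a law with \<open>tassoc\<close> from
  an equation of contractions.\<close>

lemma tassoc_tmap_eq:
 assumes vs: "vspace A" "vspace B" "vspace C" "vspace X"
  and f: "!!x. x : carr X ==> f x : carr (A >< B)" and t: "t : carr (X >< C)"
 shows "tassoc A B C (tmap (A >< B) C f id t) =
   tL (A >< B >< C) (%x c. tL (A >< B >< C) (%a b. tens A (B >< C) a (tens B C b c)) (f x)) t"
 unfolding tassoc_def
 by (subst tlift_tmap[OF vs(4,3) t]) (auto intro: vs vspace_tensor f linmap_tlift_trilin(1)[OF vs(1-3) vspace_tensor trilin_tens[OF vs(1-3)]])

lemma tmap_id_eq:
 assumes vs: "vspace A" "vspace B" "vspace C" "vspace X"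
  and f: "!!x. x : carr X ==> f x : carr (B >< C)" and t: "t : carr (A >< X)"
 shows "tmap A (B >< C) id f t =
   tL (A >< B >< C) (%a x. tL (A >< B >< C) (%b c. tens A (B >< C) a (tens B C b c)) (f x)) t"
 unfolding tmap_def id_apply
proof (rule tlift_cong[OF vs(1,4) t])
 fix a x assume a: "a : carr A" and x: "x : carr X"
 have "tens A (B >< C) a (tL (B >< C) (tens B C) (f x)) =
   tL (A >< B >< C) (%b c. tens A (B >< C) a (tens B C b c)) (f x)"
  by (rule linmap_of_tlift[OF vs(2,3) f[OF x] bilin_right[OF bilin_tens a]])
   (auto intro: vs vspace_tensor tens_in)
 then show "tens A (B >< C) a (f x) = ..."
  by (simp add: tlift_tens_id vs f x)
qed

lemma m1324_tmap_eq:
 assumes vs: "vspace A" "vspace B" "vspace C" "vspace D" "vspace F" "vspace X" "vspace Y"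
  and f: "!!x. x : carr X ==> f x : carr (A >< B)" and g: "!!y. y : carr Y ==> g y : carr (C >< D)"
  and \<nu>: "bilin B D F \<nu>" and t: "t : carr (X >< Y)"
 shows "m1324 A C F \<nu> (tmap (A >< B) (C >< D) f g t) =
  tL ((A >< C) >< F) (%x y. tL ((A >< C) >< F) (%a b. tL ((A >< C) >< F)
   (%c d. tens (A >< C) F (tens A C a c) (\<nu> b d)) (g y)) (f x)) t"
 unfolding m1324_def
 by (subst tlift_tmap[OF vs(6,7) t])
  (auto intro!: vs vspace_tensor f g bilin_tmul bilin_tens \<nu> simp: tmul_def)

text \<open>Contracts the right side of the comodule law relating two coproducts. The left side is
  \<open>tlift_tmap_tens_id\<close>, and \<open>m1324_tmap_eq\<close> with
  \<open>tmap_tens_id_eq\<close> lead back from contractions to tensors.\<close>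

lemma tlift_m1324:
 assumes vs: "vspace A" "vspace B" "vspace C" "vspace D" "vspace F" "vspace X" "vspace Y" "vspace Z"
  and f: "!!x. x : carr X ==> f x : carr (A >< B)" and g: "!!y. y : carr Y ==> g y : carr (C >< D)"
  and \<nu>: "bilin B D F \<nu>" and t: "t : carr (X >< Y)" and T: "trilin A C F Z T"
 shows "tL Z (%s z. tL Z (%a c. T a c z) s) (m1324 A C F \<nu> (tmap (A >< B) (C >< D) f g t)) =
  tL Z (%x y. tL Z (%a b. tL Z (%c d. T a c (\<nu> b d)) (g y)) (f x)) t"
proof -
 let ?Z = "(A >< C) >< F" and ?T = "%s z. tL Z (%a c. T a c z) s"
 note vst = vs vspace_tensor
 note b = linmap_tlift_trilin(1)[OF vs(1,3,5,8) T]
 have *: "tL Z ?T (tmul (A >< C) F (tens A C) \<nu> (f x) (g y)) =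
   tL Z (%a b. tL Z (%c d. T a c (\<nu> b d)) (g y)) (f x)" if xy: "x : carr X" "y : carr Y" for x y
  by (subst tlift_tmul[OF vs(1-4) vspace_tensor vs(5,8) bilin_tens[OF vs(1,3)] \<nu> b f[OF xy(1)] g[OF xy(2)]])
   (intro tlift_cong[OF vs(1,2) f[OF xy(1)]] tlift_cong[OF vs(3,4) g[OF xy(2)]] tlift_tens[OF vs(8)] trilinD(6)[OF T] bilin_in[OF \<nu>])
 have "m1324 A C F \<nu> (tmap (A >< B) (C >< D) f g t) = tL ?Z (%x y. tmul (A >< C) F (tens A C) \<nu> (f x) (g y)) t"
  unfolding m1324_def
  by (subst tlift_tmap[OF vs(6,7) t]) (auto intro!: vst f g bilin_tmul bilin_tens \<nu>)
 then have "tL Z ?T (m1324 A C F \<nu> (tmap (A >< B) (C >< D) f g t)) =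
   tL Z (%x y. tL Z ?T (tmul (A >< C) F (tens A C) \<nu> (f x) (g y))) t"
  by (simp only:) (rule tlift_tlift[OF vs(6,7) t vspace_tensor vs(5,8) b],
   rule bilin_in[OF bilin_tmul[OF vs(1-4) vspace_tensor vs(5) bilin_tens[OF vs(1,3)] \<nu>]], rule f, assumption, rule g)
 also have "... = tL Z (%x y. tL Z (%a b. tL Z (%c d. T a c (\<nu> b d)) (g y)) (f x)) t"
  by (rule tlift_cong[OF vs(6,7) t]) (rule *)
 finally show ?thesis .
qed

lemma tmap_tens_id_eq:
 assumes vs: "vspace A" "vspace C" "vspace F" "vspace X"
  and f: "!!x. x : carr X ==> f x : carr (A >< C)" and t: "t : carr (X >< F)"
 shows "tmap (A >< C) F f id t =
   tL ((A >< C) >< F) (%x z. tL ((A >< C) >< F) (%a c. tens (A >< C) F (tens A C a c) z) (f x)) t"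
 unfolding tmap_def id_apply
proof (rule tlift_cong[OF vs(4,3) t])
 fix x z assume z: "z : carr F" and x: "x : carr X"
 have "tens (A >< C) F (tL (A >< C) (tens A C) (f x)) z =
   tL ((A >< C) >< F) (%a c. tens (A >< C) F (tens A C a c) z) (f x)"
  by (rule linmap_of_tlift[OF vs(1,2) f[OF x] bilin_left[OF bilin_tens z]])
   (auto intro: vs vspace_tensor tens_in)
 then show "tens (A >< C) F (f x) z = ..."
  by (simp add: tlift_tens_id vs f x)
qed

lemma dsum_carr: "x : carr (dsum s I C) \<longleftrightarrow> pk x <= I & (ALL i:I. lk x i : C i)"
 and dsum_smul: "smul (dsum s I C) = (%c. pm (s c))"
 by (simp_all add: dsum_def)

lemma linmap_single:
 assumes s: "vector_space s" and C: "!!i. i : I ==> module.subspace s (C i)" and i: "i : I"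
 shows "linmap \<lparr>carr = C i, smul = s\<rparr> (dsum s I C) (sgl i)"
proof -
 interpret vector_space s by fact
 show ?thesis
 proof (rule linmapI)
  fix x assume "x : carr \<lparr>carr = C i, smul = s\<rparr>"
  then show "sgl i x : carr (dsum s I C)"
   using i C by (auto simp: dsum_carr lookup_single when_def subspace_0)
 qed (auto simp: dsum_smul single_add lookup_map_smul[OF s] lookup_single when_def intro!: poly_mapping_eqI)
qed

lemma linmap_lookup:
 assumes s: "vector_space s" and i: "i : I"
 shows "linmap (dsum s I C) \<lparr>carr = C i, smul = s\<rparr> (%x. lk x i)"
 using i by (intro linmapI) (auto simp: dsum_carr dsum_smul lookup_map_smul[OF s] lookup_add)

lemma linmap_dsum_ext:
 assumes s: "vector_space s" and C: "!!i. i : I ==> module.subspace s (C i)"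
  and f: "linmap (dsum s I C) Z f" and g: "linmap (dsum s I C) Z g"
  and eq: "!!i x. i : I ==> x : C i ==> f (sgl i x) = g (sgl i x)"
  and x: "x : carr (dsum s I C)"
 shows "f x = g x"
proof -
 have 1: "sgl i (lk x i) : carr (dsum s I C)" if "i : pk x" for i
  using linmap_in[OF linmap_single[where C = C and I = I, OF s C]] x that by (auto simp: dsum_carr)
 have "f (SUM i:pk x. sgl i (lk x i)) =
  g (SUM i:pk x. sgl i (lk x i))"
  using x by (simp add: linmap_sum[OF f vspace_dsum[OF s C] 1] linmap_sum[OF g vspace_dsum[OF s C] 1])
   (auto intro!: sum.cong eq simp: dsum_carr)
 then show ?thesis by (simp add: sum_single_lookup)
qed

lemma dsum_lift:
 assumes s: "vector_space s" and C: "!!i. i : I ==> module.subspace s (C i)" and Z: "vspace Z"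
  and f: "!!i. i : I ==> linmap \<lparr>carr = C i, smul = s\<rparr> Z (f i)"
 shows "linmap (dsum s I C) Z (%x. SUM i:pk x. f i (lk x i))"
  and "i : I ==> y : C i ==>
   (SUM j:pk (sgl i y). f j (lk (sgl i y) j)) = f i y"
proof -
 have v: "vspace \<lparr>carr = C i, smul = s\<rparr>" if "i : I" for i
  using s C[OF that] by (simp add: vspace_def)
 have f0: "f i 0 = 0" if "i : I" for i
  by (rule linmap_zero[OF f[OF that] v[OF that]])
 \<comment> \<open>As \<open>f i\<close> sends 0 to 0, the sum may run over any finite superset of
   the keys. The superset must stay inside \<open>I\<close>, since \<open>f i\<close> is linear only
   there. This gives the sums for \<open>x\<close>, \<open>y\<close> and \<open>x + y\<close> a
   common index set.\<close>
 have sup: "(SUM i:pk x. f i (lk x i)) = (SUM i:S. f i (lk x i))"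
  if "pk x <= S" "finite S" "S <= I" for x S
  using that by (intro sum.mono_neutral_left) (auto simp: in_keys_iff f0)
 show "linmap (dsum s I C) Z (%x. SUM i:pk x. f i (lk x i))"
 proof (rule linmapI)
  fix x assume "x : carr (dsum s I C)"
  then show "(SUM i:pk x. f i (lk x i)) : carr Z"
   by (intro vspace_sum Z linmap_in[OF f]) (auto simp: dsum_carr)
 next
  fix x y assume xy: "x : carr (dsum s I C)" "y : carr (dsum s I C)"
  let ?S = "pk x Un pk y"
  have S: "?S <= I" "finite ?S" using xy by (auto simp: dsum_carr)
  have "(SUM i:?S. f i (lk (x + y) i)) =
   (SUM i:?S. f i (lk x i) + f i (lk y i))"
  proof (rule sum.cong)
   fix i assume "i : ?S"
   then have "i : I" using S by blast
   then show "f i (lk (x + y) i) = f i (lk x i) + f i (lk y i)"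
    using linmap_add[OF f[OF \<open>i : I\<close>]] xy by (simp add: lookup_add dsum_carr)
  qed simp
  then show "(SUM i:pk (x + y). f i (lk (x + y) i)) =
   (SUM i:pk x. f i (lk x i)) + (SUM i:pk y. f i (lk y i))"
   by (simp add: sup[OF Poly_Mapping.keys_add S(2,1)] sup[of x ?S, OF _ S(2,1)] sup[of y ?S, OF _ S(2,1)] sum.distrib)
 next
  interpret z: vector_space "smul Z" using Z by (rule vspace_vector_space)
  interpret s: vector_space s by (rule s)
  fix c x assume x: "x : carr (dsum s I C)"
  have k: "pk (smul (dsum s I C) c x) <= pk x"
   by (auto simp: dsum_smul in_keys_iff lookup_map_smul[OF s])
  have xI: "pk x <= I" using x by (simp add: dsum_carr)
  show "(SUM i:pk (smul (dsum s I C) c x). f i (lk (smul (dsum s I C) c x) i)) =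
   smul Z c (SUM i:pk x. f i (lk x i))"
   unfolding sup[OF k finite_keys xI] z.scale_sum_right
  proof (rule sum.cong)
   fix i assume "i : pk x"
   then have "i : I" using xI by blast
   then show "f i (lk (smul (dsum s I C) c x) i) = smul Z c (f i (lk x i))"
    using linmap_scale[OF f[OF \<open>i : I\<close>]] x by (simp add: dsum_smul lookup_map_smul[OF s] dsum_carr)
  qed simp
 qed
 show "(SUM j:pk (sgl i y). f j (lk (sgl i y) j)) = f i y"
  if "i : I" "y : C i"
  using that by (cases "y = 0") (auto simp: f0)
qed

section \<open>Tensor powers\<close>

definition wmult :: "('k::field, 'v::ab_group_add) vsp => nat => ('k, 'z::ab_group_add) vsp => ('v list => 'z) => bool" where
 "wmult V n Z \<psi> \<longleftrightarrow> (\<forall>vs. set vs <= carr V --> length vs = n --> \<psi> vs : carr Z) \<and>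
   (\<forall>us ws. set us <= carr V --> set ws <= carr V --> length us + 1 + length ws = n \<longrightarrow>
    linmap V Z (%x. \<psi> (us @ x # ws)))"

lemma wmultD:
 "wmult V n Z \<psi> ==> set vs <= carr V ==> length vs = n ==> \<psi> vs : carr Z"
 "wmult V n Z \<psi> ==> set us <= carr V ==> set ws <= carr V ==> length us + 1 + length ws = n ==>
    linmap V Z (%x. \<psi> (us @ x # ws))"
 by (simp_all add: wmult_def)

lemma linmap_wmult: "linmap Z Z' f ==> wmult V n Z \<psi> ==> wmult V n Z' (%vs. f (\<psi> vs))"
 by (auto simp: wmult_def intro: linmap_comp linmap_in)

lemma subspace_tpow_rel: "module.subspace (%c. pm ((*) c)) (tpow_rel V n)"
 for V :: "('k::field, 'v::ab_group_add) vsp"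
proof -
 interpret vector_space "%c::'k. pm ((*) c) :: ('v list \<Rightarrow>\<^sub>0 'k) => _"
  by (rule vector_space_free)
 show ?thesis unfolding tpow_rel_def by (rule subspace_span)
qed

lemma vspace_tpow: "vspace (tpow V n)"
 unfolding tpow_def by (intro vspace_vquot vspace_freev) (simp add: smul_freev subspace_tpow_rel)

lemma smul_tpow: "smul (tpow V n) = (%c. pm ((*) c))"
 by (simp add: tpow_def vquot_def smul_freev)

lemma smul_tensor: "smul (A >< B) = (%c. pm ((*) c))"
 by (simp add: tensor_def vquot_def smul_freev)

lemma tpow_rel_subset:
 fixes V :: "('k::field, 'v::ab_group_add) vsp"
 assumes "vspace V"
 shows "tpow_rel V n <= carr (freev {vs. set vs <= carr V & length vs = n})"
proof -
 interpret f: vector_space "%c::'k. pm ((*) c) :: ('v list \<Rightarrow>\<^sub>0 'k) => _"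
  by (rule vector_space_free)
 have F: "f.subspace (carr (freev B))" for B
  using vspace_freev[of B, where ?'a = 'k] by (simp add: vspace_def smul_freev)
 have single: "sgl x c : carr (freev B)" if "x : B" for x B and c :: 'k
  using that by (auto simp: freev_def dsum_def)
 show ?thesis
  unfolding tpow_rel_def
  by (rule f.span_minimal[OF _ F])
   (auto intro!: f.subspace_diff[OF F] single vspace_add vspace_scale assms)
qed

text \<open>The relations spanning \<open>tpow_rel\<close> express additivity and homogeneity in one
  letter, so multilinearity of \<psi> is exactly what makes its linear extension vanish on
  them.\<close>

lemma linmap_wlift:
 fixes V :: "('k::field, 'v::ab_group_add) vsp"
 assumes V: "vspace V" and Z: "vspace Z" and \<psi>: "wmult V n Z \<psi>"
 shows "linmap (tpow V n) Z (flift Z \<psi>)"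
  and "set vs <= carr V ==> length vs = n ==> flift Z \<psi> (tword V vs) = \<psi> vs"
proof -
 let ?B = "{vs. set vs <= carr V & length vs = n}"
 interpret z: vector_space "smul Z" using Z by (rule vspace_vector_space)
 interpret l: Vector_Spaces.linear "%c. pm ((*) c)" "smul Z" "flift Z \<psi>"
  by (rule linear_flift[OF Z])
 have 0: "flift Z \<psi> r = 0" if "r : tpow_rel V n" for r
  using that unfolding tpow_rel_def
 proof (rule l.vs1.span_induct)
  show "l.vs1.subspace {x. flift Z \<psi> x = 0}" by (rule l.subspace_kernel)
  fix x assume "x : ({sgl (us @ (x + y) # ws) 1 - sgl (us @ x # ws) 1
     - sgl (us @ y # ws) 1
     |us ws x y. set us Un {x, y} Un set ws <= carr V & length us + 1 + length ws = n}
  Un {sgl (us @ smul V c x # ws) 1 - sgl (us @ x # ws) c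
     |us ws c x. set us Un {x} Un set ws <= carr V & length us + 1 + length ws = n})"
  then show "flift Z \<psi> x = 0"
   by (auto simp: l.diff flift_single[OF Z] linmap_add[OF wmultD(2)[OF \<psi>]] linmap_scale[OF wmultD(2)[OF \<psi>]])
 qed
 have lin: "linmap (freev ?B) Z (flift Z \<psi>)"
  by (rule linmap_flift[OF Z]) (use \<psi> in \<open>auto simp: wmult_def\<close>)
 note q = linmap_vquot[where A = "freev ?B" and R = "tpow_rel V n" and B = Z and f = "flift Z \<psi>",
  OF vspace_freev, unfolded smul_freev, OF subspace_tpow_rel tpow_rel_subset[OF V] lin 0]
 show "linmap (tpow V n) Z (flift Z \<psi>)" unfolding tpow_def by (rule q)
 assume vs: "set vs <= carr V" "length vs = n"
 show "flift Z \<psi> (tword V vs) = \<psi> vs"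
  unfolding tword_def vs(2)
  by (subst q(2)) (use vs in \<open>auto simp: flift_single[OF Z] freev_def dsum_def\<close>)
qed

lemma wmult_tword:
 fixes V :: "('k::field, 'v::ab_group_add) vsp"
 assumes V: "vspace V"
 shows "wmult V n (tpow V n) (tword V)"
proof -
 let ?s = "%c::'k. pm ((*) c) :: ('v list \<Rightarrow>\<^sub>0 'k) => _"
 interpret f: vector_space ?s by (rule vector_space_free)
 interpret l: Vector_Spaces.linear ?s ?s "qproj ?s (tpow_rel V n)"
  by (rule linear_qproj[OF vector_space_free subspace_tpow_rel])
 have eq: "qproj ?s (tpow_rel V n) x = qproj ?s (tpow_rel V n) y" if "x - y : tpow_rel V n" for x y
  using that by (simp add: qproj_eq_iff[OF vector_space_free subspace_tpow_rel])
 have scale: "sgl k c = ?s c (sgl k 1)" for k c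
  by (rule poly_mapping_eqI) (simp add: lookup_map_smul[OF vector_space_ground] lookup_single when_def)
 have tw: "tword V vs = qproj ?s (tpow_rel V n) (sgl vs 1)" if "length vs = n" for vs
  using that by (simp add: tword_def)
 have carr: "tword V vs : carr (tpow V n)" if "set vs <= carr V" "length vs = n" for vs
  using that by (auto simp: tword_def tpow_def vquot_def smul_freev freev_def dsum_def intro!: imageI)
 show ?thesis
  unfolding wmult_def
 proof (intro conjI allI impI carr linmapI)
  fix us ws x y assume *: "set us <= carr V" "set ws <= carr V" "length us + 1 + length ws = n"
   "x : carr V" "y : carr V"
  then have len: "length (us @ (x + y) # ws) = n" "length (us @ x # ws) = n" "length (us @ y # ws) = n" by auto
  then show "tword V (us @ (x + y) # ws) = tword V (us @ x # ws) + tword V (us @ y # ws)"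
   unfolding tw[OF len(1)] tw[OF len(2)] tw[OF len(3)] l.add[symmetric] using *
   by (intro eq, unfold tpow_rel_def diff_diff_eq[symmetric]) (rule f.span_base, blast)
 next
  fix us ws x c assume *: "set us <= carr V" "set ws <= carr V" "length us + 1 + length ws = n" "x : carr V"
  then have len: "length (us @ smul V c x # ws) = n" "length (us @ x # ws) = n" by auto
  then show "tword V (us @ smul V c x # ws) = smul (tpow V n) c (tword V (us @ x # ws))"
   unfolding tw[OF len(1)] tw[OF len(2)] smul_tpow l.scale[symmetric] scale[symmetric] using *
   by (intro eq, unfold tpow_rel_def) (rule f.span_base, blast)
 qed auto
qed

lemma tpow_keys:
 fixes V :: "('k::field, 'v::ab_group_add) vsp"
 assumes V: "vspace V" and w: "w : carr (tpow V n)" and "vs : pk w"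
 shows "set vs <= carr V" "length vs = n"
proof -
 let ?B = "{vs. set vs <= carr V & length vs = n}"
 have "w : carr (freev ?B)"
  using w vspace_qproj[where A = "freev ?B" and R = "tpow_rel V n", OF vspace_freev, unfolded smul_freev,
   OF subspace_tpow_rel tpow_rel_subset[OF V]] by (auto simp: tpow_def vquot_def smul_freev)
 then show "set vs <= carr V" "length vs = n" using assms(3) by (auto simp: freev_def dsum_def)
qed

lemma flift_tword:
 fixes V :: "('k::field, 'v::ab_group_add) vsp"
 assumes V: "vspace V" and w: "w : carr (tpow V n)"
 shows "flift (tpow V n) (tword V) w = w"
proof -
 let ?s = "%c::'k. pm ((*) c) :: ('v list \<Rightarrow>\<^sub>0 'k) => _"
 let ?q = "qproj ?s (tpow_rel V n)"
 interpret l: Vector_Spaces.linear ?s ?s ?q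
  by (rule linear_qproj[OF vector_space_free subspace_tpow_rel])
 have 1: "?s (lk w k) (sgl k 1) = sgl k (lk w k)" for k
  by (rule poly_mapping_eqI) (simp add: lookup_map_smul[OF vector_space_ground] lookup_single when_def)
 obtain x where x: "w = ?q x"
  using w by (auto simp: tpow_def vquot_def smul_freev)
 have "flift (tpow V n) (tword V) w = ?q (SUM k:pk w. sgl k (lk w k))"
  unfolding flift_def l.sum smul_tpow
  by (rule sum.cong) (auto simp: tword_def l.scale[symmetric] 1 tpow_keys(2)[OF V w])
 also have "... = w"
  unfolding sum_single_lookup unfolding x by (rule qproj_idem[OF vector_space_free subspace_tpow_rel])
 finally show ?thesis .
qed

lemma linmap_tpow_ext:
 assumes V: "vspace V" and f: "linmap (tpow V n) Z f" and g: "linmap (tpow V n) Z g"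
  and eq: "!!vs. set vs <= carr V ==> length vs = n ==> f (tword V vs) = g (tword V vs)"
  and w: "w : carr (tpow V n)"
 shows "f w = g w"
proof -
 have 1: "tword V vs : carr (tpow V n)" if "vs : pk w" for vs
  using wmultD(1)[OF wmult_tword[OF V] tpow_keys[OF V w that]] .
 have "f (flift (tpow V n) (tword V) w) = g (flift (tpow V n) (tword V) w)"
  unfolding flift_def
  by (subst linmap_sum[OF f vspace_tpow], (intro vspace_scale vspace_tpow 1, assumption),
    subst linmap_sum[OF g vspace_tpow], (intro vspace_scale vspace_tpow 1, assumption))
   (auto intro!: sum.cong simp: linmap_scale[OF f 1] linmap_scale[OF g 1] eq tpow_keys[OF V w])
 then show ?thesis by (simp add: flift_tword V w)
qed

section \<open>Coloured Fock spaces\<close>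

lemma finite_nset [simp]: "finite (nset n)"
 by (simp add: nset_def)

lemma sp_sel [simp]: "carr (sp P X) = scar P X" "smul (sp P X) = sscl P"
 by (simp_all add: sp_def)

lemma species_vspace: "species P ==> finite X ==> vspace (sp P X)"
 and smor_linmap: "species P ==> finite X ==> inj_on h X ==> linmap (sp P X) (sp P (h ` X)) (smor P X h)"
 and smor_cong: "species P ==> finite X ==> inj_on h X ==> (!!x. x : X ==> h x = \<tau> x) ==> p : scar P X ==>
  smor P X h p = smor P X \<tau> p"
 and smor_id: "species P ==> finite X ==> p : scar P X ==> smor P X id p = p"
 and smor_comp: "species P ==> finite X ==> inj_on h X ==> inj_on \<tau> (h ` X) ==> p : scar P X ==>
  smor P X (\<tau> o h) p = smor P (h ` X) \<tau> (smor P X h p)"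
 by (simp_all add: species_def)

lemma smor_in: "species P ==> finite X ==> inj_on h X ==> p : scar P X ==> smor P X h p : scar P (h ` X)"
 using linmap_in[OF smor_linmap] by simp

lemma smor_ident:
 assumes "species P" "finite X" "p : scar P X" "!!x. x : X ==> h x = x"
 shows "smor P X h p = p"
 using smor_cong[of P X h id p] assms by (simp add: smor_id inj_on_def)

lemma smor_smor:
 assumes "species P" "finite X" "inj_on h X" "inj_on \<tau> Y" "Y = h ` X" "p : scar P X" "!!x. x : X ==> \<tau> (h x) = \<rho> x"
 shows "smor P Y \<tau> (smor P X h p) = smor P X \<rho> p"
proof -
 have "smor P Y \<tau> (smor P X h p) = smor P X (\<tau> o h) p"
  using assms by (simp add: smor_comp)
 also have "... = smor P X \<rho> p"
  using assms by (intro smor_cong comp_inj_on) auto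
 finally show ?thesis .
qed

text \<open>Colourings are total functions on labels. Hence, besides linearity in each slot, it has
  to be demanded that only the values on \<open>X\<close> matter.\<close>

definition mlin :: "('k::field, 'v::ab_group_add) vsp => lbl set => ('k, 'z::ab_group_add) vsp => ((lbl => 'v) => 'z) => bool" where
 "mlin V X Z \<Psi> \<longleftrightarrow> (\<forall>v. v : X \<rightarrow> carr V --> \<Psi> v : carr Z) \<and>
   (\<forall>v w. v : X \<rightarrow> carr V --> (ALL x:X. v x = w x) --> \<Psi> v = \<Psi> w) \<and>
   (\<forall>v. v : X \<rightarrow> carr V --> (ALL x:X. linmap V Z (%a. \<Psi> (v(x := a)))))"

lemma mlinI:
 assumes "!!v. v : X \<rightarrow> carr V ==> \<Psi> v : carr Z"
  "!!v w. v : X \<rightarrow> carr V ==> w : X \<rightarrow> carr V ==> (!!x. x : X ==> v x = w x) ==> \<Psi> v = \<Psi> w"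
  "!!v x. v : X \<rightarrow> carr V ==> x : X ==> linmap V Z (%a. \<Psi> (v(x := a)))"
 shows "mlin V X Z \<Psi>"
proof -
 have "w : X \<rightarrow> carr V" if "v : X \<rightarrow> carr V" "ALL x:X. v x = w x" for v w
  unfolding Pi_iff
 proof
  fix x assume "x : X"
  then show "w x : carr V" using that by (metis Pi_mem)
 qed
 note col = this
 show ?thesis
  unfolding mlin_def
 proof (intro conjI allI impI ballI)
  show "\<Psi> v = \<Psi> w" if "v : X \<rightarrow> carr V" "ALL x:X. v x = w x" for v w
   using that by (intro assms(2) col[OF that]) auto
 qed (rule assms; assumption)+
qed

lemma mlinD:
 assumes "mlin V X Z \<Psi>"
 shows "v : X \<rightarrow> carr V ==> \<Psi> v : carr Z"
  and "v : X \<rightarrow> carr V ==> (!!x. x : X ==> v x = w x) ==> \<Psi> v = \<Psi> w"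
  and "v : X \<rightarrow> carr V ==> x : X ==> linmap V Z (%a. \<Psi> (v(x := a)))"
 using assms by (auto simp: mlin_def)

lemma linmap_mlin: "linmap Z Z' f ==> mlin V X Z \<Psi> ==> mlin V X Z' (%v. f (\<Psi> v))"
 unfolding mlin_def linmap_def by simp metis

lemma mlin_setsum:
 assumes "vspace Z" "!!i. i : I ==> mlin V X Z (\<Psi> i)"
 shows "mlin V X Z (%v. SUM i:I. \<Psi> i v)"
 by (intro mlinI vspace_sum linmap_setsum sum.cong refl) (auto intro: mlinD assms(2) assms(1))

lemma mlin_tlift:
 assumes vs: "vspace B" "vspace C" "vspace Z" and t: "t : carr (B >< C)"
  and be: "!!a b. a : carr B ==> b : carr C ==> mlin V X Z (%v. be v a b)"
 shows "mlin V X Z (%v. tL Z (be v) t)"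
proof (rule mlinI)
 fix v assume v: "v : X \<rightarrow> carr V"
 show "tL Z (be v) t : carr Z" by (rule tlift_in[OF vs t mlinD(1)[OF be v]])
 show "tL Z (be v) t = tL Z (be w) t" if "!!x. x : X ==> v x = w x" for w
  by (rule tlift_cong[OF vs(1,2) t mlinD(2)[OF be v that]])
 show "linmap V Z (%a. tL Z (be (v(x := a))) t)" if "x : X" for x
  by (rule linmap_tlift_param[OF vs t mlinD(3)[OF be v that]])
qed

lemma mlin_bilin:
 assumes be: "bilin B C Z be" and f: "mlin V X B f" and g: "mlin V Y C g" and d: "X Int Y = {}"
 shows "mlin V (X Un Y) Z (%v. be (f v) (g v))"
proof (rule mlinI)
 fix v assume "v : X Un Y \<rightarrow> carr V"
 then have v: "v : X \<rightarrow> carr V" "v : Y \<rightarrow> carr V" by auto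
 note fg = mlinD(1)[OF f v(1)] mlinD(1)[OF g v(2)]
 show "be (f v) (g v) : carr Z" by (rule bilin_in[OF be fg])
 show "be (f v) (g v) = be (f w) (g w)" if "!!x. x : X Un Y ==> v x = w x" for w
  using mlinD(2)[OF f v(1), of w] mlinD(2)[OF g v(2), of w] that by simp
 fix x assume "x : X Un Y"
 then consider "x : X" "x ~: Y" | "x : Y" "x ~: X" using d by auto
 then show "linmap V Z (%a. be (f (v(x := a))) (g (v(x := a))))"
 proof cases
  case 1
  have "g (v(x := a)) = g v" for a by (rule mlinD(2)[OF g v(2), symmetric]) (use 1 in auto)
  then show ?thesis using bilin_left_comp[OF be mlinD(3)[OF f v(1) 1(1)] fg(2)] by simp
 next
  case 2
  have "f (v(x := a)) = f v" for a by (rule mlinD(2)[OF f v(1), symmetric]) (use 2 in auto)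
  then show ?thesis using bilin_right_comp[OF be fg(1) mlinD(3)[OF g v(2) 2(1)]] by simp
 qed
qed

definition lab :: "'v list => lbl => 'v" where
 "lab vs l = (case l of At i => letter vs i | Cls C => undefined)"

lemma lab_At [simp]: "lab vs (At i) = letter vs i"
 by (simp add: lab_def)

lemma letter_in: "set vs <= A ==> 1 \<le> i ==> i \<le> length vs ==> letter vs i : A"
 by (auto simp: letter_def subset_iff)

lemma lab_in: "set vs <= A ==> length vs = n ==> lab vs : nset n \<rightarrow> A"
 by (auto simp: nset_def intro!: letter_in)

lemma letter_map: "1 \<le> i ==> i \<le> n ==> letter (map f [1..<Suc n]) i = f i"
 unfolding letter_def by (subst nth_map) (auto simp del: upt_Suc)

lemma mlin_wmult:
 assumes "mlin V (nset n) Z \<Psi>" "vspace V"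
 shows "wmult V n Z (%vs. \<Psi> (lab vs))"
 unfolding wmult_def
proof (intro conjI allI impI)
 fix us ws assume *: "set us <= carr V" "set ws <= carr V" "length us + 1 + length ws = n"
 have in1: "lab (us @ x # ws) : nset n \<rightarrow> carr V" if "x : carr V" for x
  using that * by (intro lab_in) auto
 note in0 = in1[OF vspace_zero[OF assms(2)]]
 \<comment> \<open>The letter after the prefix \<open>us\<close> has this label because letters are
   numbered from 1.\<close>
 have "At (Suc (length us)) : nset n" using * by (auto simp: nset_def)
 from mlinD(3)[OF assms(1) in0 this]
 show "linmap V Z (%x. \<Psi> (lab (us @ x # ws)))"
 proof (rule linmap_cong[OF _ assms(2)])
  fix x assume x: "x : carr V"
  show "\<Psi> (lab (us @ x # ws)) = \<Psi> ((lab (us @ 0 # ws))(At (Suc (length us)) := x))"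
   by (rule mlinD(2)[OF assms(1) in1[OF x]])
    (auto simp: nset_def letter_def nth_append nth_Cons' split: if_splits)
 qed
qed (intro mlinD(1)[OF assms(1)] lab_in)

lemma list_upd_split:
 assumes "1 \<le> j" "j \<le> n"
 shows "map (f(j := a)) [1..<Suc n] = map f [1..<j] @ a # map f [Suc j..<Suc n]"
proof -
 have "[1..<Suc n] = [1..<j] @ j # [Suc j..<Suc n]"
  using assms upt_add_eq_append[of 1 j "Suc n - j"] by (simp add: upt_conv_Cons del: upt_Suc)
 then show ?thesis by (simp del: upt_Suc)
qed

text \<open>The colouring is read as a word along the enumeration \<open>e\<close>. Changing the
  colour of \<open>x\<close> changes precisely the letter at position \<open>e x\<close>, so
  linearity in a slot is linearity in a letter.\<close>

lemma wmult_mlin: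
 assumes \<psi>: "wmult V n Z \<psi>" and e: "bij_betw e X {1..n}"
 shows "mlin V X Z (%v. \<psi> (map (v o inv_into X e) [1..<Suc n]))"
proof -
 note inv = bij_betw_apply[OF bij_betw_inv_into[OF e]]
 have in1: "set (map (v o inv_into X e) [i..<j]) <= carr V" if "v : X \<rightarrow> carr V" "1 \<le> i" "j \<le> Suc n" for v i j
  using that inv by (fastforce simp: Pi_iff)
 show ?thesis
 proof (rule mlinI)
  fix v x assume v: "v : X \<rightarrow> carr V" and x: "x : X"
  have ex: "1 \<le> e x" "e x \<le> n" using bij_betw_apply[OF e x] by auto
  have "map (v(x := a) o inv_into X e) [1..<Suc n] = map ((v o inv_into X e)(e x := a)) [1..<Suc n]" for a
  proof (rule map_cong[OF refl])
   fix i assume "i : set [1..<Suc n]"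
   then have "i = e x \<longleftrightarrow> inv_into X e i = x"
    using bij_betw_inv_into_left[OF e x] bij_betw_inv_into_right[OF e, of i] by auto
   then show "(v(x := a) o inv_into X e) i = ((v o inv_into X e)(e x := a)) i" by simp
  qed
  then show "linmap V Z (%a. \<psi> (map (v(x := a) o inv_into X e) [1..<Suc n]))"
   using ex unfolding list_upd_split[OF ex]
   by (simp only:, intro wmultD(2)[OF \<psi>] in1 v) (auto simp del: upt_Suc)
 next
  fix v w :: "lbl => 'b" assume "!!x. x : X ==> v x = w x"
  then have "map (v o inv_into X e) [1..<Suc n] = map (w o inv_into X e) [1..<Suc n]"
   using inv by (auto simp del: upt_Suc)
  then show "\<psi> (map (v o inv_into X e) [1..<Suc n]) = \<psi> (map (w o inv_into X e) [1..<Suc n])"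
   by (simp only:)
 qed (intro wmultD(1)[OF \<psi>] in1, auto)
qed

text \<open>The generator for an arbitrary finite label set. The chosen enumeration is irrelevant by
  \<open>fgen_eq\<close>: two enumerations differ by a permutation of [n], and the coinvariants
  identify the results.\<close>

definition fgen ::
 "('k::field, 'v::ab_group_add) vsp => ('k, 'q::ab_group_add, 'z) tbialg_scheme => lbl set => (lbl => 'v) => 'q
   => (nat \<Rightarrow>\<^sub>0 (('v list \<Rightarrow>\<^sub>0 'k) \<times> 'q \<Rightarrow>\<^sub>0 'k))" where
 "fgen V Q X v p = (let e = SOME e. bij_betw e X {1..card X} in
   fock_bar V Q (map (v o inv_into X e) [1..<Suc (card X)]) (smor Q X (At o e) p))"

text \<open>The data represented by the Fock space: linear maps from it to \<open>Z\<close> are the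
  same as such families. Existence of the map is \<open>fock_lift\<close>, uniqueness is
  \<open>fock_ext\<close>.\<close>

definition fform ::
 "('k::field, 'v::ab_group_add) vsp => ('k, 'q::ab_group_add, 'z) tbialg_scheme => ('k, 'y::ab_group_add) vsp
   => (lbl set => (lbl => 'v) => 'q => 'y) => bool" where
 "fform V Q Z \<phi> \<longleftrightarrow> (\<forall>X. finite X \<longrightarrow>
   (ALL p:scar Q X. mlin V X Z (%v. \<phi> X v p)) \<and>
   (\<forall>v. v : X \<rightarrow> carr V --> linmap (sp Q X) Z (\<phi> X v)) \<and>
   (\<forall>h v. ALL p:scar Q X. inj_on h X --> v : h ` X \<rightarrow> carr V --> \<phi> (h ` X) v (smor Q X h p) = \<phi> X (v o h) p))"

lemma fformD:
 assumes "fform V Q Z \<phi>" "finite X"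
 shows "p : scar Q X ==> mlin V X Z (%v. \<phi> X v p)"
  and "v : X \<rightarrow> carr V ==> linmap (sp Q X) Z (\<phi> X v)"
  and "p : scar Q X ==> inj_on h X ==> v : h ` X \<rightarrow> carr V ==> \<phi> (h ` X) v (smor Q X h p) = \<phi> X (v o h) p"
  and "p : scar Q X ==> v : X \<rightarrow> carr V ==> \<phi> X v p : carr Z"
  and "p : scar Q X ==> v : X \<rightarrow> carr V ==> (!!x. x : X ==> v x = w x) ==> \<phi> X v p = \<phi> X w p"
proof -
 show 1: "mlin V X Z (%v. \<phi> X v p)" if "p : scar Q X" for p
  using assms that by (simp add: fform_def)
 show "v : X \<rightarrow> carr V ==> linmap (sp Q X) Z (\<phi> X v)"
  "p : scar Q X ==> inj_on h X ==> v : h ` X \<rightarrow> carr V ==> \<phi> (h ` X) v (smor Q X h p) = \<phi> X (v o h) p"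
  using assms by (simp_all add: fform_def)
 show "p : scar Q X ==> v : X \<rightarrow> carr V ==> \<phi> X v p : carr Z"
  "p : scar Q X ==> v : X \<rightarrow> carr V ==> (!!x. x : X ==> v x = w x) ==> \<phi> X v p = \<phi> X w p"
  by (rule mlinD[OF 1]; assumption)+
qed

lemma fform_nat:
 assumes "fform V Q Z \<phi>" "finite X" "p : scar Q X" "inj_on h X" "v : Y \<rightarrow> carr V" "Y = h ` X"
  "!!x. x : X ==> v (h x) = w x"
 shows "\<phi> Y v (smor Q X h p) = \<phi> X w p"
proof -
 have "\<phi> Y v (smor Q X h p) = \<phi> X (v o h) p"
  using assms by (simp add: fformD(3))
 also have "... = \<phi> X w p"
  by (intro fformD(5)[OF assms(1-3)]) (use assms(5,6) in auto, use assms(7) in simp)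
 finally show ?thesis .
qed

section \<open>The universal property of the coloured Fock space\<close>

locale colour_species =
 fixes V :: "('k::field, 'v::ab_group_add) vsp" and Q :: "('k, 'q::ab_group_add, 'z) tbialg_scheme"
 assumes V: "vspace V" and Q: "species Q"
begin

abbreviation "F \<equiv> fock V Q"
abbreviation "col X \<equiv> X \<rightarrow> carr V"

lemma Qv: "finite X ==> vspace (sp Q X)"
 by (rule species_vspace[OF Q])

lemma vspace_fock_pre: "vspace (fock_pre V Q)"
proof -
 have "module.subspace (%c. pm ((*) c)) (carr (tpow V n >< sp Q (nset n)))" for n
  using vspace_subspace[OF vspace_tensor[of "tpow V n" "sp Q (nset n)"]] by (simp add: smul_tensor)
 then show ?thesis
  unfolding fock_pre_def by (intro vspace_dsum vector_space_free)
qed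

lemma tensor_eta: "\<lparr>carr = carr (A >< B), smul = (%c. pm ((*) c))\<rparr> = A >< B"
 by (simp add: smul_tensor[symmetric])

lemma subspace_C: "module.subspace (%c. pm ((*) c)) (carr (tpow V n >< sp Q (nset n)))"
 using vspace_subspace[OF vspace_tensor[of "tpow V n" "sp Q (nset n)"]] by (simp add: smul_tensor)

lemma linmap_single_fock: "linmap (tpow V n >< sp Q (nset n)) (fock_pre V Q) (sgl n)"
 using linmap_single[OF vector_space_free subspace_C, where I = UNIV and i = n, unfolded tensor_eta]
 unfolding fock_pre_def by simp

lemma fock_gen_lin:
 assumes "set vs <= carr V" "length vs = n"
 shows "linmap (sp Q (nset n)) (fock_pre V Q) (fock_gen V Q vs)"
 using assms unfolding fock_gen_def Let_def
 by (auto intro!: linmap_comp[OF linmap_single_fock] bilin_right[OF bilin_tens] vspace_tpow Qv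
   wmultD[OF wmult_tword] V)

lemma fock_gen_wmult:
 assumes "q : scar Q (nset n)"
 shows "wmult V n (fock_pre V Q) (%vs. fock_gen V Q vs q)"
proof -
 have "wmult V n (fock_pre V Q) (%vs. sgl n (tens (tpow V n) (sp Q (nset n)) (tword V vs) q))"
  by (rule linmap_wmult[OF linmap_comp[OF linmap_single_fock bilin_left[OF bilin_tens]] wmult_tword])
   (auto intro: vspace_tpow Qv V assms)
 then show ?thesis by (auto simp: wmult_def fock_gen_def linmap_def)
qed

lemma fock_gen_in:
 "set vs <= carr V ==> length vs = n ==> q : scar Q (nset n) ==> fock_gen V Q vs q : carr (fock_pre V Q)"
 by (rule wmultD(1)[OF fock_gen_wmult])

lemma subspace_fock_rel: "module.subspace (smul (fock_pre V Q)) (fock_rel V Q)"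
proof -
 interpret vector_space "smul (fock_pre V Q)" by (rule vspace_vector_space[OF vspace_fock_pre])
 show ?thesis unfolding fock_rel_def by (rule subspace_span)
qed

lemma relabel_inj:
 assumes "bij_betw h {1..n} {1..n}"
 shows "inj_on (relabel h) (nset n)"
proof -
 have "inj_on h {1..n}" using assms by (simp add: bij_betw_def)
 then show ?thesis unfolding nset_def by (intro inj_onI) (auto simp: inj_on_eq_iff)
qed

lemma relabel_image:
 assumes "bij_betw h {1..n} {1..n}"
 shows "relabel h ` nset n = nset n"
proof -
 have "relabel h ` nset n = At ` h ` {1..n}" by (simp add: nset_def image_image)
 also have "h ` {1..n} = {1..n}" using assms by (simp add: bij_betw_def)
 finally show ?thesis by (simp add: nset_def)
qed

lemma fock_rel_subset: "fock_rel V Q <= carr (fock_pre V Q)"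
proof -
 interpret f: vector_space "smul (fock_pre V Q)" by (rule vspace_vector_space[OF vspace_fock_pre])
 have *: "smor Q (nset n) (relabel h) q : scar Q (nset n)"
  if "bij_betw h {1..n} {1..n}" "q : scar Q (nset n)" for n h q
  using smor_in[OF Q finite_nset relabel_inj[OF that(1)] that(2)] by (simp only: relabel_image[OF that(1)])
 show ?thesis
  unfolding fock_rel_def
 proof (rule f.span_minimal[OF _ vspace_subspace[OF vspace_fock_pre]], safe)
  fix h q and vs :: "'v list"
  assume a: "set vs <= carr V" "bij_betw h {1..length vs} {1..length vs}" "q : scar Q (nset (length vs))"
  have "letter vs (h i) : carr V" if "1 \<le> i" "i \<le> length vs" for i
   using bij_betw_apply[OF a(2), of i] that by (intro letter_in a) auto
  then have "fock_gen V Q (map (%i. letter vs (h i)) [1..<Suc (length vs)]) q : carr (fock_pre V Q)"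
   by (intro fock_gen_in[OF _ _ a(3)]) (auto simp del: upt_Suc)
  then show "fock_gen V Q vs (smor Q (nset (length vs)) (relabel h) q) -
    fock_gen V Q (map (%i. letter vs (h i)) [1..<Suc (length vs)]) q : carr (fock_pre V Q)"
   by (intro vspace_diff vspace_fock_pre fock_gen_in[OF a(1) refl *[OF a(2,3)]])
 qed
qed

lemma vspace_fock: "vspace F"
 unfolding fock_def by (intro vspace_vquot vspace_fock_pre subspace_fock_rel)

lemma linmap_fock_proj: "linmap (fock_pre V Q) F (qproj (smul (fock_pre V Q)) (fock_rel V Q))"
 unfolding fock_def by (rule linmap_qproj[OF vspace_fock_pre subspace_fock_rel])

lemma fock_bar_lin:
 assumes "set vs <= carr V" "length vs = n"
 shows "linmap (sp Q (nset n)) F (fock_bar V Q vs)"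
 unfolding fock_bar_def[abs_def] by (rule linmap_comp[OF linmap_fock_proj fock_gen_lin[OF assms]])

lemma fock_bar_wmult:
 assumes "q : scar Q (nset n)"
 shows "wmult V n F (%vs. fock_bar V Q vs q)"
 unfolding fock_bar_def by (rule linmap_wmult[OF linmap_fock_proj fock_gen_wmult[OF assms]])

lemma fock_bar_in:
 "set vs <= carr V ==> length vs = n ==> q : scar Q (nset n) ==> fock_bar V Q vs q : carr F"
 by (rule wmultD(1)[OF fock_bar_wmult])

lemma fock_bar_rel:
 assumes "set vs <= carr V" "length vs = n" "bij_betw h {1..n} {1..n}" "q : scar Q (nset n)"
 shows "fock_bar V Q vs (smor Q (nset n) (relabel h) q) = fock_bar V Q (map (%i. letter vs (h i)) [1..<Suc n]) q"
proof -
 interpret vector_space "smul (fock_pre V Q)" by (rule vspace_vector_space[OF vspace_fock_pre])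
 show ?thesis
  unfolding fock_bar_def qproj_eq_iff[OF vspace_vector_space[OF vspace_fock_pre] subspace_fock_rel]
  unfolding fock_rel_def by (rule span_base) (use assms in blast)
qed

text \<open>The layers of the construction are lifted in turn: multilinear functions of words,
  bilinear maps on a tensor power and Q[n], the direct sum over n. The last hypothesis says that the
  coinvariant relations are killed, so the map survives the quotient.\<close>

lemma fock_lift_word:
 assumes Z: "vspace Z"
  and 1: "!!n q. q : scar Q (nset n) ==> wmult V n Z (%vs. \<phi> vs q)"
  and 2: "!!n vs. set vs <= carr V ==> length vs = n ==> linmap (sp Q (nset n)) Z (\<phi> vs)"
  and 3: "!!n vs h q. set vs <= carr V ==> length vs = n ==> bij_betw h {1..n} {1..n} ==> q : scar Q (nset n) ==>
   \<phi> vs (smor Q (nset n) (relabel h) q) = \<phi> (map (%i. letter vs (h i)) [1..<Suc n]) q"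
 shows "\<exists>f. linmap F Z f & (\<forall>vs q. set vs <= carr V --> q : scar Q (nset (length vs)) --> f (fock_bar V Q vs q) = \<phi> vs q)"
proof -
 define g where "g n = tL Z (%w q. flift Z (%vs. \<phi> vs q) w)" for n :: nat
 have bil: "bilin (tpow V n) (sp Q (nset n)) Z (%w q. flift Z (%vs. \<phi> vs q) w)" for n
 proof (rule bilinI)
  fix w assume w: "w : carr (tpow V n)"
  show "linmap (sp Q (nset n)) Z (%q. flift Z (%vs. \<phi> vs q) w)"
   unfolding flift_def
   by (intro linmap_setsum linmap_scaled Z 2 tpow_keys[OF V w])
 next
  fix q assume "q : carr (sp Q (nset n))"
  then show "linmap (tpow V n) Z (flift Z (%vs. \<phi> vs q))"
   by (intro linmap_wlift V Z 1) simp
 qed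
 define f where "f x = (SUM n:pk x. g n (lk x n))" for x
 note dl = dsum_lift[where I = UNIV and f = g and C = "%n. carr (tpow V n >< sp Q (nset n))", OF vector_space_free subspace_C Z, unfolded tensor_eta,
   folded fock_pre_def f_def]
 have g: "linmap (tpow V n >< sp Q (nset n)) Z (g n)" for n
  unfolding g_def by (intro linmap_tlift vspace_tpow Qv Z bil finite_nset)
 have f: "linmap (fock_pre V Q) Z f"
  by (rule dl(1)) (rule g)
 have gen: "f (fock_gen V Q vs q) = \<phi> vs q" if vs: "set vs <= carr V" and q: "q : scar Q (nset (length vs))" for vs q
 proof -
  let ?n = "length vs"
  have "f (fock_gen V Q vs q) = g ?n (tens (tpow V ?n) (sp Q (nset ?n)) (tword V vs) q)"
   unfolding fock_gen_def Let_def
   by (rule dl(2)) (use q in \<open>auto intro!: g tens_in vspace_tpow Qv wmultD(1)[OF wmult_tword] V vs\<close>)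
  also have "... = flift Z (%vs. \<phi> vs q) (tword V vs)"
   unfolding g_def by (rule tlift_tens[OF Z bil])
  also have "... = \<phi> vs q"
   using q by (intro linmap_wlift[OF V Z] 1 vs) auto
  finally show ?thesis .
 qed
 have 0: "f x = 0" if "x : fock_rel V Q" for x
 proof -
  interpret s: vector_space "smul (fock_pre V Q)" by (rule vspace_vector_space[OF vspace_fock_pre])
  interpret z: vector_space "smul Z" by (rule vspace_vector_space[OF Z])
  note [simp] = linmap_add[OF f] linmap_scale[OF f]
  \<comment> \<open>The kernel has to be cut down to the carrier, because \<open>f\<close> is known
    to be linear only there.\<close>
  let ?K = "{x : carr (fock_pre V Q). f x = 0}"
  have K: "s.subspace ?K"
   unfolding s.subspace_def
   by (auto simp: vspace_zero vspace_add vspace_scale vspace_fock_pre linmap_zero[OF f])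
  have "fock_rel V Q <= ?K"
   unfolding fock_rel_def
  proof (rule s.span_minimal[OF _ K], clarify, rule conjI)
   fix h q and vs :: "'v list"
   assume a: "set vs <= carr V" "bij_betw h {1..length vs} {1..length vs}" "q : scar Q (nset (length vs))"
   let ?x = "fock_gen V Q vs (smor Q (nset (length vs)) (relabel h) q)"
   let ?y = "fock_gen V Q (map (%i. letter vs (h i)) [1..<Suc (length vs)]) q"
   have l: "letter vs (h i) : carr V" if "1 \<le> i" "i \<le> length vs" for i
    using bij_betw_apply[OF a(2), of i] that by (intro letter_in a) auto
   have sm: "smor Q (nset (length vs)) (relabel h) q : scar Q (nset (length vs))"
    using smor_in[OF Q finite_nset relabel_inj[OF a(2)] a(3)] by (simp only: relabel_image[OF a(2)])
   have y: "?y : carr (fock_pre V Q)"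
    by (rule fock_gen_in[OF _ _ a(3)]) (use l in \<open>auto simp del: upt_Suc\<close>)
   have x: "?x : carr (fock_pre V Q)"
    by (rule fock_gen_in[OF a(1) refl sm])
   show "?x - ?y : carr (fock_pre V Q)"
    by (rule vspace_diff[OF vspace_fock_pre x y])
   have "f ?y = \<phi> (map (%i. letter vs (h i)) [1..<Suc (length vs)]) q"
    by (rule gen) (use l a in \<open>auto simp del: upt_Suc\<close>)
   then show "f (?x - ?y) = 0"
    using 3[OF a(1) refl a(2,3)] gen[OF a(1) sm] by (simp add: linmap_diff[OF f vspace_fock_pre x y] del: upt_Suc One_nat_def)
  qed
  then show ?thesis using that by blast
 qed
 note q = linmap_vquot[OF vspace_fock_pre subspace_fock_rel fock_rel_subset f 0]
 have "f (fock_bar V Q vs p) = \<phi> vs p" if "set vs <= carr V" "p : scar Q (nset (length vs))" for vs p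
  using q(2)[OF _ fock_gen_in[OF that(1) refl that(2)]] gen[OF that] by (simp add: fock_bar_def)
 moreover have "linmap F Z f" unfolding fock_def by (rule q(1))
 ultimately show ?thesis by blast
qed

lemma fock_ext_word:
 assumes f: "linmap F Z f" and g: "linmap F Z g"
  and eq: "!!vs q. set vs <= carr V ==> q : scar Q (nset (length vs)) ==> f (fock_bar V Q vs q) = g (fock_bar V Q vs q)"
  and x: "x : carr F"
 shows "f x = g x"
proof -
 let ?q = "qproj (smul (fock_pre V Q)) (fock_rel V Q)"
 obtain y where y: "y : carr (fock_pre V Q)" "x = ?q y"
  using x by (auto simp: fock_def vquot_def)
 have fq: "linmap (fock_pre V Q) Z (%x. f (?q x))" and gq: "linmap (fock_pre V Q) Z (%x. g (?q x))"
  by (rule linmap_comp[OF f linmap_fock_proj], rule linmap_comp[OF g linmap_fock_proj])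
 have "f (?q y) = g (?q y)"
 proof (rule linmap_dsum_ext[OF vector_space_free subspace_C fq[unfolded fock_pre_def] gq[unfolded fock_pre_def], folded fock_pre_def])
  fix n t assume t: "t : carr (tpow V n >< sp Q (nset n))"
  have f1: "linmap (tpow V n >< sp Q (nset n)) Z (%x. f (?q (sgl n x)))"
   by (rule linmap_comp[OF fq linmap_single_fock])
  have g1: "linmap (tpow V n >< sp Q (nset n)) Z (%x. g (?q (sgl n x)))"
   by (rule linmap_comp[OF gq linmap_single_fock])
  show "f (?q (sgl n t)) = g (?q (sgl n t))"
  proof (rule linmap_tensor_ext[OF vspace_tpow Qv[OF finite_nset] f1 g1 _ t])
   fix w p assume w: "w : carr (tpow V n)" and p: "p : carr (sp Q (nset n))"
   let ?T = "tens (tpow V n) (sp Q (nset n))"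
   have T: "linmap (tpow V n) (tpow V n >< sp Q (nset n)) (%w. ?T w p)"
    by (rule bilin_left[OF bilin_tens p]) (auto intro: vspace_tpow Qv)
   show "f (?q (sgl n (?T w p))) = g (?q (sgl n (?T w p)))"
   proof (rule linmap_tpow_ext[OF V linmap_comp[OF f1 T] linmap_comp[OF g1 T] _ w])
    fix vs assume "set vs <= carr V" "length vs = n"
    with eq[of vs p] p show "f (?q (sgl n (?T (tword V vs) p))) = g (?q (sgl n (?T (tword V vs) p)))"
     by (simp add: fock_bar_def fock_gen_def)
   qed
  qed
 qed (use y in auto)
 then show ?thesis by (simp add: y)
qed

abbreviation "gen \<equiv> fgen V Q"

text \<open>Independence of the enumeration. This is the one place where the relations of
  \<open>fock_rel\<close> are used on generators; afterwards only naturality in \<open>X\<close> is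
  needed.\<close>

lemma fgen_eq:
 assumes X: "finite X" and e: "bij_betw e X {1..n}" and v: "v : col X" and p: "p : scar Q X"
 shows "gen X v p = fock_bar V Q (map (v o inv_into X e) [1..<Suc n]) (smor Q X (At o e) p)"
proof -
 have n: "n = card X" using bij_betw_same_card[OF e] by simp
 define e0 where "e0 = (SOME e. bij_betw e X {1..card X})"
 have e0: "bij_betw e0 X {1..n}"
  unfolding e0_def n using e n by (metis someI_ex)
 have img: "(At o d) ` X = nset n" and inj: "inj_on (At o d) X" if "bij_betw d X {1..n}" for d
  using that by (auto simp: bij_betw_def nset_def inj_on_def)
 \<comment> \<open>The permutation of [n] that compares the chosen enumeration \<open>e0\<close>
   with the given \<open>e\<close>.\<close>
 define h where "h = e o inv_into X e0"
 have h: "bij_betw h {1..n} {1..n}"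
  unfolding h_def by (rule bij_betw_trans[OF bij_betw_inv_into[OF e0] e])
 let ?q = "smor Q X (At o e0) p"
 have q: "?q : scar Q (nset n)"
  using smor_in[OF Q X inj[OF e0] p] by (simp only: img[OF e0])
 have 1: "smor Q X (At o e) p = smor Q (nset n) (relabel h) ?q"
  by (rule smor_smor[OF Q X inj[OF e0] relabel_inj[OF h] img[OF e0, symmetric] p, symmetric])
   (simp add: h_def bij_betw_inv_into_left[OF e0])
 let ?vs = "map (v o inv_into X e) [1..<Suc n]"
 have vs: "set ?vs <= carr V"
  using v bij_betw_apply[OF bij_betw_inv_into[OF e]] by (fastforce simp: Pi_iff)
 have "fock_bar V Q ?vs (smor Q (nset n) (relabel h) ?q) = fock_bar V Q (map (%i. letter ?vs (h i)) [1..<Suc n]) ?q"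
  by (rule fock_bar_rel[OF vs _ h q]) simp
 also have "map (%i. letter ?vs (h i)) [1..<Suc n] = map (v o inv_into X e0) [1..<Suc n]"
 proof (rule map_cong[OF refl])
  fix i assume "i : set [1..<Suc n]"
  then have i: "i : {1..n}" by auto
  then have "h i : {1..n}" by (rule bij_betw_apply[OF h])
  moreover have "inv_into X e (h i) = inv_into X e0 i"
   using bij_betw_inv_into_left[OF e] bij_betw_apply[OF bij_betw_inv_into[OF e0] i] by (simp add: h_def)
  ultimately show "letter ?vs (h i) = (v o inv_into X e0) i"
   by (subst letter_map) auto
 qed
 also have "fock_bar V Q (map (v o inv_into X e0) [1..<Suc n]) ?q = gen X v p"
  unfolding fgen_def e0_def Let_def n ..
 finally show ?thesis
  unfolding 1 by (rule sym)
qed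

lemma obtain_enum:
 assumes "finite X"
 obtains e n where "bij_betw e X {1..n::nat}" "(At o e) ` X = nset n" "inj_on (At o e) X" "n = card X"
proof -
 obtain e where e: "bij_betw e X {1..card X}"
  using finite_same_card_bij[of X "{1..card X}"] assms by auto
 moreover have "(At o e) ` X = nset (card X)" "inj_on (At o e) X"
  using e by (auto simp: bij_betw_def nset_def inj_on_def)
 ultimately show ?thesis using that by blast
qed

lemma fform_fgen: "fform V Q F gen"
 unfolding fform_def
proof (intro allI impI conjI ballI)
 fix X :: "lbl set" assume X: "finite X"
 obtain e n where e: "bij_betw e X {1..n::nat}" "(At o e) ` X = nset n" "inj_on (At o e) X"
  using obtain_enum[OF X] by metis
 note inv = bij_betw_apply[OF bij_betw_inv_into[OF e(1)]]
 have vs: "set (map (v o inv_into X e) [1..<Suc n]) <= carr V" if "v : col X" for v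
  using that inv by (fastforce simp: Pi_iff)
 have sm: "linmap (sp Q X) (sp Q (nset n)) (smor Q X (At o e))"
  using smor_linmap[OF Q X e(3)] by (simp only: e(2))
 {
  fix p assume p: "p : scar Q X"
  have ml: "mlin V X F (%v. fock_bar V Q (map (v o inv_into X e) [1..<Suc n]) (smor Q X (At o e) p))"
   by (rule wmult_mlin[OF fock_bar_wmult e(1)]) (use linmap_in[OF sm] p in simp)
  note eq = fgen_eq[OF X e(1) _ p]
  show "mlin V X F (%v. gen X v p)"
  proof (rule mlinI)
   fix v x assume v: "v : col X" "x : X"
   show "linmap V F (%a. gen X (v(x := a)) p)"
    by (rule linmap_cong[OF mlinD(3)[OF ml v] V]) (rule eq, use v in \<open>auto simp: Pi_iff\<close>)
  next
   fix v w assume v: "v : col X" "w : col X" "!!x. x : X ==> v x = w x"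
   show "gen X v p = gen X w p"
    unfolding eq[OF v(1)] eq[OF v(2)] by (rule mlinD(2)[OF ml v(1,3)])
  qed (use mlinD(1)[OF ml] eq in simp)
 }
 show "linmap (sp Q X) F (gen X v)" if "v : col X" for v
  by (rule linmap_cong[OF linmap_comp[OF fock_bar_lin[OF vs[OF that]] sm] Qv[OF X]])
   (auto simp: fgen_eq[OF X e(1) that] simp del: upt_Suc)
 fix h :: "lbl => lbl" and v p assume p: "p : scar Q X" and h: "inj_on h X" and v: "v : h ` X \<rightarrow> carr V"
 let ?e = "e o inv_into X h"
 have e': "bij_betw ?e (h ` X) {1..n}"
  by (rule bij_betw_trans[OF _ e(1)]) (use h in \<open>auto intro: bij_betw_inv_into simp: bij_betw_def inj_on_inv_into\<close>)
 have i1: "inv_into (h ` X) ?e i = h (inv_into X e i)" if "i : {1..n}" for i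
  by (rule inv_into_f_eq) (use that inv[OF that] e' h bij_betw_inv_into_right[OF e(1)] in \<open>auto simp: bij_betw_def\<close>)
 have i2: "inj_on (At o ?e) (h ` X)"
  using e' by (auto simp: bij_betw_def inj_on_def)
 have v': "v o h : col X" using v by auto
 show "gen (h ` X) v (smor Q X h p) = gen X (v o h) p"
  unfolding fgen_eq[OF X e(1) v' p] fgen_eq[OF finite_imageI[OF X] e' v smor_in[OF Q X h p]]
 proof (rule arg_cong2[where f = "fock_bar V Q"])
  show "map (v o inv_into (h ` X) (e o inv_into X h)) [1..<Suc n] = map (v o h o inv_into X e) [1..<Suc n]"
   by (rule map_cong[OF refl]) (use i1 in auto)
  show "smor Q (h ` X) (At o (e o inv_into X h)) (smor Q X h p) = smor Q X (At o e) p"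
   by (rule smor_smor[OF Q X h i2 refl p]) (use h in auto)
 qed
qed

lemma fgen_in: "finite X ==> v : col X ==> p : scar Q X ==> gen X v p : carr F"
 using fformD(4)[OF fform_fgen] .

lemma fgen_cong: "finite X ==> v : col X ==> p : scar Q X ==> (!!x. x : X ==> v x = w x) ==> gen X v p = gen X w p"
 using fformD(5)[OF fform_fgen] .

lemma fgen_linmap: "finite X ==> v : col X ==> linmap (sp Q X) F (gen X v)"
 using fformD(2)[OF fform_fgen] .

lemma fgen_mlin: "finite X ==> p : scar Q X ==> mlin V X F (%v. gen X v p)"
 using fformD(1)[OF fform_fgen] .

lemmas fgen_nat = fform_nat[OF fform_fgen]

lemma fgen_nset:
 assumes vs: "set vs <= carr V" "length vs = n" and q: "q : scar Q (nset n)"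
 shows "gen (nset n) (lab vs) q = fock_bar V Q vs q"
proof -
 define e where "e l = (case l of At i => i | Cls C => 0)" for l
 have e: "bij_betw e (nset n) {1..n}"
  by (rule bij_betw_byWitness[where f' = At]) (auto simp: nset_def e_def)
 have "inv_into (nset n) e i = At i" if "i : {1..n}" for i
  by (rule inv_into_f_eq) (use that e in \<open>auto simp: bij_betw_def nset_def e_def\<close>)
 then have "map (lab vs o inv_into (nset n) e) [1..<Suc n] = map (letter vs) [1..<Suc n]"
  by (intro map_cong) auto
 also have "... = vs"
  by (rule nth_equalityI) (use vs in \<open>auto simp: letter_def simp del: upt_Suc\<close>)
 finally show ?thesis
  unfolding fgen_eq[OF finite_nset e lab_in[OF vs] q]
  by (simp only:) (subst smor_ident[OF Q finite_nset q], auto simp: nset_def e_def)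
qed

text \<open>The lift is determined on the label sets [n], where generators are words. Its value on a
  general \<open>X\<close> follows by transporting \<phi> along an enumeration of
  \<open>X\<close>.\<close>

lemma fock_lift:
 assumes Z: "vspace Z" and \<phi>: "fform V Q Z \<phi>"
 obtains f where "linmap F Z f"
  "!!X v p. finite X ==> v : col X ==> p : scar Q X ==> f (gen X v p) = \<phi> X v p"
proof -
 have "\<exists>f. linmap F Z f & (\<forall>vs q. set vs <= carr V --> q : scar Q (nset (length vs)) \<longrightarrow>
   f (fock_bar V Q vs q) = \<phi> (nset (length vs)) (lab vs) q)"
 proof (rule fock_lift_word[OF Z])
  fix n q assume q: "q : scar Q (nset n)"
  show "wmult V n Z (%vs. \<phi> (nset (length vs)) (lab vs) q)"
   using mlin_wmult[OF fformD(1)[OF \<phi> finite_nset q] V] by (auto simp: wmult_def linmap_def)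
 next
  fix n and vs :: "'v list" assume "set vs <= carr V" "length vs = n"
  then show "linmap (sp Q (nset n)) Z (\<phi> (nset (length vs)) (lab vs))"
   using fformD(2)[OF \<phi> finite_nset lab_in] by simp
 next
  fix n h q and vs :: "'v list" assume a: "set vs <= carr V" "length vs = n" "bij_betw h {1..n} {1..n}" "q : scar Q (nset n)"
  let ?ws = "map (%i. letter vs (h i)) [1..<Suc n]"
  have "\<phi> (nset n) (lab vs) (smor Q (nset n) (relabel h) q) = \<phi> (nset n) (lab ?ws) q"
   by (rule fform_nat[OF \<phi> finite_nset a(4) relabel_inj[OF a(3)] lab_in[OF a(1,2)] relabel_image[OF a(3), symmetric]])
    (auto simp: nset_def letter_map simp del: upt_Suc One_nat_def)
  then show "\<phi> (nset (length vs)) (lab vs) (smor Q (nset n) (relabel h) q) = \<phi> (nset (length ?ws)) (lab ?ws) q"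
   using a by (simp del: upt_Suc)
 qed
 then obtain f where f: "linmap F Z f" and eq: "!!vs q. set vs <= carr V ==> q : scar Q (nset (length vs)) ==>
   f (fock_bar V Q vs q) = \<phi> (nset (length vs)) (lab vs) q" by blast
 have "f (gen X v p) = \<phi> X v p" if X: "finite X" and v: "v : col X" and p: "p : scar Q X" for X v p
 proof -
  obtain e n where e: "bij_betw e X {1..n::nat}" "(At o e) ` X = nset n" "inj_on (At o e) X"
   using obtain_enum[OF X] by metis
  let ?vs = "map (v o inv_into X e) [1..<Suc n]"
  have vs: "set ?vs <= carr V"
   using v bij_betw_apply[OF bij_betw_inv_into[OF e(1)]] by (fastforce simp: Pi_iff)
  have len: "length ?vs = n" by simp
  have sm: "smor Q X (At o e) p : scar Q (nset n)"
   using smor_in[OF Q X e(3) p] by (simp only: e(2))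
  have "f (gen X v p) = \<phi> (nset n) (lab ?vs) (smor Q X (At o e) p)"
   unfolding fgen_eq[OF X e(1) v p] using eq[OF vs] sm by (simp only: len)
  also have "... = \<phi> X v p"
  proof (rule fform_nat[OF \<phi> X p e(3) lab_in[OF vs len] e(2)[symmetric]])
   fix x assume x: "x : X"
   then show "lab ?vs ((At o e) x) = v x"
    using bij_betw_apply[OF e(1) x] by (simp add: letter_map bij_betw_inv_into_left[OF e(1)] del: upt_Suc One_nat_def)
  qed
  finally show ?thesis .
 qed
 with f that show ?thesis by blast
qed

lemma fock_ext:
 assumes f: "linmap F Z f" and g: "linmap F Z g"
  and eq: "!!X v p. finite X ==> v : col X ==> p : scar Q X ==> f (gen X v p) = g (gen X v p)"
  and x: "x : carr F"
 shows "f x = g x"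
proof (rule fock_ext_word[OF f g _ x])
 fix vs q assume *: "set vs <= carr V" "q : scar Q (nset (length vs))"
 show "f (fock_bar V Q vs q) = g (fock_bar V Q vs q)"
  using eq[OF finite_nset lab_in[OF *(1) refl] *(2)] by (simp add: fgen_nset[OF *(1) refl *(2)])
qed

text \<open>For fixed parameters both sides of additivity and homogeneity in the parameter are
  linear in \<open>x\<close>, so it is enough to compare them on generators.\<close>

lemma linmap_fock_param:
 assumes A: "vspace A" and Z: "vspace Z" and G: "!!a. a : carr A ==> linmap F Z (G a)"
  and gen: "!!X v p. finite X ==> v : col X ==> p : scar Q X ==> linmap A Z (%a. G a (gen X v p))"
  and x: "x : carr F"
 shows "linmap A Z (%a. G a x)"
proof (rule linmapI)
 fix a b c assume a: "a : carr A"
 show "G a x : carr Z" by (rule linmap_in[OF G[OF a] x])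
 show "G (smul A c a) x = smul Z c (G a x)"
  by (rule fock_ext[OF G[OF vspace_scale[OF A a]] linmap_scaled[OF Z G[OF a]] _ x]) (rule linmap_scale[OF gen a])
 assume b: "b : carr A"
 \<comment> \<open>The sum of two linear maps is obtained as a sum over the two-element index set of
   Booleans.\<close>
 have "linmap F Z (%x. G a x + G b x)"
  using linmap_setsum[OF Z, of "{True, False}" F "%i. if i then G a else G b"] G[OF a] G[OF b] by simp
 then show "G (a + b) x = G a x + G b x"
  by (rule fock_ext[OF G[OF vspace_add[OF A a b]] _ _ x]) (rule linmap_add[OF gen a b])
qed

text \<open>One variable at a time: the first is lifted for each fixed second generator, then the
  result is lifted in the second variable. What must be checked in between is that the first lift
  still depends on the second generator naturally and multilinearly.\<close>

lemma fock_lift2: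
 assumes Z: "vspace Z"
  and 1: "!!Y w q. finite Y ==> w : col Y ==> q : scar Q Y ==> fform V Q Z (%X v p. \<phi> X v p Y w q)"
  and 2: "!!X v p. finite X ==> v : col X ==> p : scar Q X ==> fform V Q Z (\<phi> X v p)"
 obtains \<mu> where "bilin F F Z \<mu>"
  "!!X v p Y w q. finite X ==> v : col X ==> p : scar Q X ==>
   finite Y ==> w : col Y ==> q : scar Q Y ==> \<mu> (gen X v p) (gen Y w q) = \<phi> X v p Y w q"
proof -
 have "\<exists>f. linmap F Z f & (\<forall>X v p. finite X --> v : col X --> p : scar Q X --> f (gen X v p) = \<phi> X v p Y w q)"
  if "finite Y" "w : col Y" "q : scar Q Y" for Y w q
  using fock_lift[OF Z 1[OF that]] by metis
 then obtain g where g: "!!Y w q. finite Y ==> w : col Y ==> q : scar Q Y ==> linmap F Z (g Y w q)"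
  and gg: "!!Y w q X v p. finite Y ==> w : col Y ==> q : scar Q Y ==>
   finite X ==> v : col X ==> p : scar Q X ==> g Y w q (gen X v p) = \<phi> X v p Y w q"
  by metis
 \<comment> \<open>All requirements are identities in \<open>x\<close>, or linearity with
   \<open>x\<close> fixed. The identities are tested on generators, and linearity in a parameter
   comes from \<open>linmap_fock_param\<close>.\<close>
 have ff: "fform V Q Z (%Y w q. g Y w q x)" if x: "x : carr F" for x
  unfolding fform_def
 proof (intro allI impI conjI ballI)
  fix Y :: "lbl set" assume Y: "finite Y"
  show "g (\<sigma> ` Y) w (smor Q Y \<sigma> q) x = g Y (w o \<sigma>) q x"
   if s: "q : scar Q Y" "inj_on \<sigma> Y" "w : \<sigma> ` Y \<rightarrow> carr V" for \<sigma> w q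
  proof (rule fock_ext[OF g g _ x])
   fix X v p assume X: "finite X" "v : col X" "p : scar Q X"
   then show "g (\<sigma> ` Y) w (smor Q Y \<sigma> q) (gen X v p) = g Y (w o \<sigma>) q (gen X v p)"
    using s Y smor_in[OF Q Y s(2,1)] by (simp add: gg Pi_iff fformD(3)[OF 2[OF X] Y])
  qed (use s Y smor_in[OF Q Y s(2,1)] in auto)
  show "linmap (sp Q Y) Z (%q. g Y w q x)" if w: "w : col Y" for w
  proof (rule linmap_fock_param[OF Qv[OF Y] Z g[OF Y w] _ x])
   fix X v p assume X: "finite X" "v : col X" "p : scar Q X"
   show "linmap (sp Q Y) Z (%q. g Y w q (gen X v p))"
    by (rule linmap_cong[OF fformD(2)[OF 2[OF X] Y w] Qv[OF Y]]) (simp add: gg[OF Y w] X)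
  qed simp
  fix q assume q: "q : scar Q Y"
  show "mlin V Y Z (%w. g Y w q x)"
  proof (rule mlinI)
   show "g Y w q x : carr Z" if "w : col Y" for w by (rule linmap_in[OF g[OF Y that q] x])
   fix w w' assume w: "w : col Y" "w' : col Y" "!!y. y : Y ==> w y = w' y"
   show "g Y w q x = g Y w' q x"
   proof (rule fock_ext[OF g g _ x, OF Y w(1) q Y w(2) q])
    fix X v p assume X: "finite X" "v : col X" "p : scar Q X"
    show "g Y w q (gen X v p) = g Y w' q (gen X v p)"
     using fformD(5)[OF 2[OF X] Y q w(1,3)] by (simp add: gg X Y q w(1,2))
   qed
  next
   fix w y assume w: "w : col Y" and y: "y : Y"
   have up: "w(y := a) : col Y" if "a : carr V" for a
    using w that by (auto simp: Pi_iff)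
   show "linmap V Z (%a. g Y (w(y := a)) q x)"
   proof (rule linmap_fock_param[OF V Z g[OF Y up q] _ x])
    fix X v p assume X: "finite X" "v : col X" "p : scar Q X"
    show "linmap V Z (%a. g Y (w(y := a)) q (gen X v p))"
     by (rule linmap_cong[OF mlinD(3)[OF fformD(1)[OF 2[OF X] Y q] w y] V]) (rule gg[OF Y up q X])
   qed
  qed
 qed
 have "\<exists>f. linmap F Z f & (\<forall>Y w q. finite Y --> w : col Y --> q : scar Q Y --> f (gen Y w q) = g Y w q x)"
  if "x : carr F" for x
  using fock_lift[OF Z ff[OF that]] by metis
 then obtain h where h: "!!x. x : carr F ==> linmap F Z (h x)" and hg: "!!x Y w q. x : carr F ==> finite Y ==> w : col Y ==>
   q : scar Q Y ==> h x (gen Y w q) = g Y w q x"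
  by metis
 have "bilin F F Z h"
 proof (rule bilinI[OF h])
  fix y assume y: "y : carr F"
  show "linmap F Z (%x. h x y)"
  proof (rule linmap_fock_param[OF vspace_fock Z h _ y])
   fix Y w q assume Y: "finite Y" "w : col Y" "q : scar Q Y"
   show "linmap F Z (%x. h x (gen Y w q))"
    by (rule linmap_cong[OF g[OF Y] vspace_fock]) (rule hg[OF _ Y])
  qed
 qed
 moreover have "h (gen X v p) (gen Y w q) = \<phi> X v p Y w q"
  if "finite X" "v : col X" "p : scar Q X" "finite Y" "w : col Y" "q : scar Q Y" for X v p Y w q
  using that by (simp add: hg[OF fgen_in] gg)
 ultimately show ?thesis by (rule that)
qed

text \<open>The maps chosen by \<open>SOME\<close> are prescribed on words only. The lift of \<phi>
  shows that the prescription can be met, and since words determine a linear map, the chosen map has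
  the values of \<phi> on all generators.\<close>

lemma fock_some:
 assumes Z: "vspace Z" and \<phi>: "fform V Q Z \<phi>"
  and w: "!!vs p. set vs <= carr V ==> p : scar Q (nset (length vs)) ==> \<phi> (nset (length vs)) (lab vs) p = \<psi> vs p"
  and D: "D = (SOME f. linmap F Z f & (\<forall>vs p. set vs <= carr V --> p : scar Q (nset (length vs)) --> f (fock_bar V Q vs p) = \<psi> vs p))"
 shows "linmap F Z D" and "finite X ==> v : col X ==> p : scar Q X ==> D (gen X v p) = \<phi> X v p"
proof -
 obtain f where f: "linmap F Z f" "!!X v p. finite X ==> v : col X ==> p : scar Q X ==> f (gen X v p) = \<phi> X v p"
  by (rule fock_lift[OF Z \<phi>]) auto
 have fb: "f (fock_bar V Q vs p) = \<psi> vs p" if vs: "set vs <= carr V" "p : scar Q (nset (length vs))" for vs p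
  using f(2)[OF finite_nset lab_in[OF vs(1) refl] vs(2)] w[OF vs] fgen_nset[OF vs(1) refl vs(2)] by simp
 have P: "linmap F Z D & (\<forall>vs p. set vs <= carr V --> p : scar Q (nset (length vs)) --> D (fock_bar V Q vs p) = \<psi> vs p)"
  unfolding D by (rule someI[of _ f]) (use f(1) fb in blast)
 then show L: "linmap F Z D" by blast
 assume X: "finite X" "v : col X" "p : scar Q X"
 have "D (gen X v p) = f (gen X v p)"
  by (rule fock_ext_word[OF L f(1) _ fgen_in[OF X]]) (use P fb in auto)
 then show "D (gen X v p) = \<phi> X v p" using f(2)[OF X] by simp
qed

end

section \<open>The bialgebra structure of a Fock space\<close>

lemma infinite_lbl: "infinite (UNIV :: lbl set)"
 using infinite_iff_countable_subset[of "UNIV :: lbl set"] by (auto simp: inj_def intro!: exI[of _ At])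

text \<open>Labels are infinitely many, so any two generators can be given disjoint label sets; the
  product then needs no relabelling.\<close>

lemma ex_inj_away:
 assumes "finite X" "finite Y"
 obtains \<rho> :: "lbl => lbl" where "inj_on \<rho> Y" "\<rho> ` Y Int X = {}"
proof -
 have "infinite (- X)"
  using infinite_lbl assms(1) by (metis Compl_eq_Diff_UNIV Diff_infinite_finite)
 then obtain B where B: "finite B" "card B = card Y" "B <= - X"
  using infinite_arbitrarily_large by blast
 then obtain \<rho> where "bij_betw \<rho> Y B"
  using finite_same_card_bij[OF assms(2) B(1)] by auto
 then have "inj_on \<rho> Y" "\<rho> ` Y Int X = {}"
  using B(3) by (auto simp: bij_betw_def)
 then show ?thesis by (rule that)
qed

text \<open>Two disjoint copies of the type of labels inside itself.\<close>

definition inl :: "lbl => lbl" where "inl x = Cls {|Cls {|x|}|}"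
definition inr :: "lbl => lbl" where "inr x = Cls {|Cls {|x|}, At 0|}"

lemma inj_inl: "inl x = inl y \<longleftrightarrow> x = y"
 by (auto simp: inl_def)

lemma inj_inr: "inr x = inr y \<longleftrightarrow> x = y"
 by (auto simp: inr_def finsert_eq_iff)

lemma inl_inr: "inl x ~= inr y" "inr x ~= inl y"
 by (auto simp: inl_def inr_def)

text \<open>List positions start at 0 while \<open>incr_pos\<close> counts from 1, hence the
  successor.\<close>

lemma sorted_list_incr_pos:
 assumes "finite A" "j < card A"
 shows "incr_pos A (sorted_list_of_set A ! j) = Suc j"
proof -
 let ?xs = "sorted_list_of_set A"
 have xs: "set ?xs = A" "distinct ?xs" "sorted ?xs" "length ?xs = card A"
  using assms by auto
 have lt: "?xs ! j < ?xs ! k" if "j < k" "k < card A" for k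
  using that xs(4) sorted_nth_mono[OF xs(3), of j k] nth_eq_iff_index_eq[OF xs(2), of j k]
  by (simp add: less_le)
 have "{i:A. i \<le> ?xs ! j} = (%i. ?xs ! i) ` {..j}"
 proof safe
  fix i assume "i : A" "i \<le> ?xs ! j"
  then obtain k where k: "k < card A" "i = ?xs ! k" using xs by (metis in_set_conv_nth)
  then have "k \<le> j" using lt[of k] \<open>i \<le> ?xs ! j\<close> by (meson leD le_less_linear)
  then show "i : (!) ?xs ` {..j}" using k by auto
 next
  fix i assume "i \<le> j"
  then show "?xs ! i : A" using xs assms(2) by (metis le_less_trans nth_mem)
  show "?xs ! i \<le> ?xs ! j" by (rule sorted_nth_mono[OF xs(3) \<open>i \<le> j\<close>]) (use assms xs in simp)
 qed
 moreover have "card ((%i. ?xs ! i) ` {..j}) = Suc j"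
  using xs assms(2) by (subst card_image) (auto intro!: inj_onI simp: nth_eq_iff_index_eq)
 ultimately show ?thesis by (simp add: incr_pos_def)
qed

lemma incr_pos_bij:
 assumes "finite A"
 shows "bij_betw (incr_pos A) A {1..card A}"
  and "i : A ==> letter (subword vs A) (incr_pos A i) = letter vs i"
proof -
 let ?xs = "sorted_list_of_set A"
 have xs: "set ?xs = A" "length ?xs = card A"
  using assms by auto
 have A: "\<exists>j. j < card A & i = ?xs ! j" if "i : A" for i
  using that xs by (metis in_set_conv_nth)
 show "bij_betw (incr_pos A) A {1..card A}"
 proof (rule bij_betw_byWitness[where f' = "%i. ?xs ! (i - 1)"])
  show "ALL a:A. ?xs ! (incr_pos A a - 1) = a"
   using A sorted_list_incr_pos[OF assms] by fastforce
  show "ALL a':{1..card A}. incr_pos A (?xs ! (a' - 1)) = a'"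
   using sorted_list_incr_pos[OF assms] by auto
  show "incr_pos A ` A <= {1..card A}"
   using A sorted_list_incr_pos[OF assms] by fastforce
  show "(%i. ?xs ! (i - 1)) ` {1..card A} <= A"
   using xs nth_mem[of _ ?xs] by force
 qed
 assume "i : A"
 then obtain j where "j < card A" "i = ?xs ! j" using A by blast
 then show "letter (subword vs A) (incr_pos A i) = letter vs i"
  using sorted_list_incr_pos[OF assms] xs by (simp add: letter_def subword_def)
qed

text \<open>A chain of subsets of \<open>X\<close> of length two is the same as two disjoint
  subsets. This matches the two iterated coproducts, both of which are indexed by ordered
  decompositions of \<open>X\<close> into three blocks.\<close>

lemma sum_Pow_Pow:
 assumes "finite X"
 shows "(SUM A:Pow X. SUM B:Pow A. f B (A - B)) = (SUM B:Pow X. SUM C:Pow (X - B). f B C)"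
proof -
 have "(SUM A:Pow X. SUM B:Pow A. f B (A - B)) = (SUM (A, B):Sigma (Pow X) Pow. f B (A - B))"
  using assms by (subst sum.Sigma) (auto intro: finite_subset)
 also have "... = (SUM (B, C):Sigma (Pow X) (%B. Pow (X - B)). f B C)"
  by (rule sum.reindex_bij_witness[of _ "%(B, C). (B Un C, B)" "%(A, B). (B, A - B)"])
   (auto intro!: arg_cong2[where f = f])
 also have "... = (SUM B:Pow X. SUM C:Pow (X - B). f B C)"
  using assms by (subst sum.Sigma) auto
 finally show ?thesis .
qed

lemma sum_Pow_Un:
 assumes "finite X" "finite Y" "X Int Y = {}"
 shows "(SUM A:Pow (X Un Y). f (X Int A) (Y Int A)) = (SUM B:Pow X. SUM C:Pow Y. f B C)"
proof -
 have "(SUM A:Pow (X Un Y). f (X Int A) (Y Int A)) = (SUM (B, C):Pow X \<times> Pow Y. f B C)"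
  by (rule sum.reindex_bij_witness[of _ "%(B, C). B Un C" "%A. (X Int A, Y Int A)"])
   (use assms in \<open>auto intro!: arg_cong2[where f = f]\<close>)
 then show ?thesis by (simp add: sum.cartesian_product)
qed

locale twisted_bialg =
 fixes Q :: "('k::field, 'q::ab_group_add, 'z) tbialg_scheme"
 assumes TB: "twisted_bialgebra Q"
begin

lemma tw_species: "species Q"
 using TB by (simp add: twisted_bialgebra_def)

lemma tw_vs: "finite X ==> vspace (sp Q X)"
 by (rule species_vspace[OF tw_species])

lemma m_bilin: "finite X ==> finite Y ==> X Int Y = {} ==> bilin (sp Q X) (sp Q Y) (sp Q (X Un Y)) (tmlt Q X Y)"
 and m_nat: "finite X ==> finite Y ==> X Int Y = {} ==> inj_on h (X Un Y) ==> p : scar Q X ==> q : scar Q Y ==>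
   smor Q (X Un Y) h (tmlt Q X Y p q) = tmlt Q (h ` X) (h ` Y) (smor Q X h p) (smor Q Y h q)"
 and m_assoc: "finite X ==> finite Y ==> finite Z ==> X Int Y = {} ==> X Int Z = {} ==> Y Int Z = {} ==>
   p : scar Q X ==> q : scar Q Y ==> r : scar Q Z ==>
   tmlt Q (X Un Y) Z (tmlt Q X Y p q) r = tmlt Q X (Y Un Z) p (tmlt Q Y Z q r)"
 and one_in: "tone Q : scar Q {}"
 and m_one: "finite X ==> p : scar Q X ==> tmlt Q {} X (tone Q) p = p"
   "finite X ==> p : scar Q X ==> tmlt Q X {} p (tone Q) = p"
 and D_lin: "finite X ==> finite Y ==> X Int Y = {} ==> linmap (sp Q (X Un Y)) (sp Q X >< sp Q Y) (tcop Q X Y)"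
 and D_nat: "finite X ==> finite Y ==> X Int Y = {} ==> inj_on h (X Un Y) ==> p : scar Q (X Un Y) ==>
   tcop Q (h ` X) (h ` Y) (smor Q (X Un Y) h p) =
   tmap (sp Q (h ` X)) (sp Q (h ` Y)) (smor Q X h) (smor Q Y h) (tcop Q X Y p)"
 and D_coassoc: "finite X ==> finite Y ==> finite Z ==> X Int Y = {} ==> X Int Z = {} ==> Y Int Z = {} ==>
   p : scar Q (X Un Y Un Z) ==>
   tassoc (sp Q X) (sp Q Y) (sp Q Z)
    (tmap (sp Q X >< sp Q Y) (sp Q Z) (tcop Q X Y) id (tcop Q (X Un Y) Z p)) =
   tmap (sp Q X) (sp Q Y >< sp Q Z) id (tcop Q Y Z) (tcop Q X (Y Un Z) p)"
 and cou_lin: "linmap (sp Q {}) ground (tcou Q)"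
 and D_counit: "finite X ==> p : scar Q X ==> tL (sp Q X) (%a b. sscl Q (tcou Q a) b) (tcop Q {} X p) = p"
   "finite X ==> p : scar Q X ==> tL (sp Q X) (%a b. sscl Q (tcou Q b) a) (tcop Q X {} p) = p"
 and D_one: "tcop Q {} {} (tone Q) = tens (sp Q {}) (sp Q {}) (tone Q) (tone Q)"
 and cou_m: "a : scar Q {} ==> b : scar Q {} ==> tcou Q (tmlt Q {} {} a b) = tcou Q a * tcou Q b"
 and cou_one: "tcou Q (tone Q) = 1"
 using TB unfolding twisted_bialgebra_def twisted_algebra_def twisted_coalgebra_def by simp_all

lemma D_m: "finite (I Un J) ==> I Un J = I' Un J' ==> I Int J = {} ==> I' Int J' = {} ==>
   p' : scar Q I' ==> q' : scar Q J' ==>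
   tcop Q I J (tmlt Q I' J' p' q') =
    tmul (sp Q I) (sp Q J) (tmlt Q (I' Int I) (J' Int I)) (tmlt Q (I' Int J) (J' Int J))
     (tcop Q (I' Int I) (I' Int J) p') (tcop Q (J' Int I) (J' Int J) q')"
 by (rule TB[unfolded twisted_bialgebra_def, THEN conjunct2, THEN conjunct2, THEN conjunct2, THEN conjunct1, rule_format])

lemma m_in: "finite X ==> finite Y ==> X Int Y = {} ==> p : scar Q X ==> q : scar Q Y ==> tmlt Q X Y p q : scar Q (X Un Y)"
 using bilin_in[OF m_bilin] by simp

lemma D_in: "finite X ==> finite Y ==> X Int Y = {} ==> p : scar Q (X Un Y) ==> tcop Q X Y p : carr (sp Q X >< sp Q Y)"
 using linmap_in[OF D_lin] by simp

text \<open>The contracted form of an axiom, marked by the suffix \<open>_int\<close> here and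
  later, is the one that can be substituted inside sums of nested contractions.\<close>

lemma D_coassoc_int:
 assumes "finite X" "finite Y" "finite Z" "X Int Y = {}" "X Int Z = {}" "Y Int Z = {}" "p : scar Q (X Un Y Un Z)"
  "vspace W" "trilin (sp Q X) (sp Q Y) (sp Q Z) W T"
 shows "tL W (%x c. tL W (%a b. T a b c) (tcop Q X Y x)) (tcop Q (X Un Y) Z p) =
  tL W (%a x. tL W (T a) (tcop Q Y Z x)) (tcop Q X (Y Un Z) p)"
proof -
 have u: "finite (X Un Y)" "finite (Y Un Z)" using assms by auto
 have d: "(X Un Y) Int Z = {}" "X Int (Y Un Z) = {}" using assms by auto
 have p': "p : scar Q (X Un (Y Un Z))" using assms(7) by (simp add: Un_assoc)
 note vs = tw_vs[OF assms(1)] tw_vs[OF assms(2)] tw_vs[OF assms(3)] assms(8)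
 have "tL W (%a. tL W (T a)) (tassoc (sp Q X) (sp Q Y) (sp Q Z)
    (tmap (sp Q X >< sp Q Y) (sp Q Z) (tcop Q X Y) id (tcop Q (X Un Y) Z p))) =
  tL W (%x c. tL W (%a b. T a b c) (tcop Q X Y x)) (tcop Q (X Un Y) Z p)"
  by (rule tlift_tassoc[OF vs tw_vs[OF u(1)] assms(9)])
   (use D_in[OF assms(1,2,4)] D_in[OF u(1) assms(3) d(1) assms(7)] in auto)
 moreover have "tL W (%a. tL W (T a)) (tmap (sp Q X) (sp Q Y >< sp Q Z) id (tcop Q Y Z) (tcop Q X (Y Un Z) p)) =
  tL W (%a x. tL W (T a) (tcop Q Y Z x)) (tcop Q X (Y Un Z) p)"
  by (rule tlift_tmap_id[OF vs tw_vs[OF u(2)] assms(9)])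
   (use D_in[OF assms(2,3,6)] D_in[OF assms(1) u(2) d(2) p'] in auto)
 ultimately show ?thesis using D_coassoc[OF assms(1-7)] by simp
qed

end

locale fock_twisted = colour_species V Q + twisted_bialg Q
 for V :: "('k::field, 'v::ab_group_add) vsp" and Q :: "('k, 'q::ab_group_add, 'z) tbialg_scheme"
begin

abbreviation "FF \<equiv> F >< F"

section \<open>Product and unit of the Fock space\<close>

definition merge :: "(lbl => 'v) => (lbl => 'v) => lbl => 'v" where
 "merge v w l = (if l : range inl then v (inv_into UNIV inl l) else if l : range inr then w (inv_into UNIV inr l) else undefined)"

lemma inv_inl_inr [simp]: "inv_into UNIV inl (inl x) = x" "inv_into UNIV inr (inr x) = x"
 by (simp_all add: inv_f_f inj_def inj_inl inj_inr)

lemma merge_simps [simp]: "merge v w (inl x) = v x" "merge v w (inr x) = w x"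
 by (auto simp: merge_def inl_inr)

text \<open>The universal property asks for a formula on all pairs of generators, including those
  whose label sets meet. Both are therefore moved to disjoint copies first.\<close>

definition mform where
 "mform X v p Y w q = gen (inl ` X Un inr ` Y) (merge v w) (tmlt Q (inl ` X) (inr ` Y) (smor Q X inl p) (smor Q Y inr q))"

lemma inl_inr_disj: "inl ` X Int inr ` Y = {}"
 by (auto simp: inl_inr)

lemma inj_on_inl: "inj_on inl X" and inj_on_inr: "inj_on inr X"
 by (auto simp: inj_on_def inj_inl inj_inr)

lemma merge_in: "v : X \<rightarrow> A ==> w : Y \<rightarrow> A ==> merge v w : inl ` X Un inr ` Y \<rightarrow> A"
 by auto

text \<open>The result does not depend on how the label sets are made disjoint: two ways of doing so
  differ by a bijection of the unions, under which product and generators are natural.\<close>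

lemma mform_any:
 assumes XY: "finite X" "finite Y" and ij: "inj_on i X" "inj_on j Y" "i ` X Int j ` Y = {}"
  and u: "u : i ` X Un j ` Y \<rightarrow> carr V" "!!x. x : X ==> u (i x) = v x" "!!y. y : Y ==> u (j y) = w y"
  and pq: "p : scar Q X" "q : scar Q Y"
 shows "mform X v p Y w q = gen (i ` X Un j ` Y) u (tmlt Q (i ` X) (j ` Y) (smor Q X i p) (smor Q Y j q))"
proof -
 \<comment> \<open>The bijection from the given disjoint union to the standard one.\<close>
 define \<rho> where "\<rho> l = (if l : i ` X then inl (inv_into X i l) else inr (inv_into Y j l))" for l
 have \<rho>: "\<rho> (i x) = inl x" if "x : X" for x using that ij(1) by (simp add: \<rho>_def)
 have \<rho>': "\<rho> (j y) = inr y" if "y : Y" for y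
 proof -
  have "j y ~: i ` X" using that ij(3) by auto
  then show ?thesis using that ij(2) by (simp add: \<rho>_def)
 qed
 have im: "\<rho> ` i ` X = inl ` X" "\<rho> ` j ` Y = inr ` Y" by (auto simp: \<rho> \<rho>' image_iff)
 have \<rho>i: "inj_on \<rho> (i ` X Un j ` Y)"
  by (auto intro!: inj_onI simp: \<rho> \<rho>' inj_inl inj_inr inl_inr)
 then have \<rho>j: "inj_on \<rho> (i ` X)" "inj_on \<rho> (j ` Y)" by (auto intro: inj_on_subset)
 have f: "finite (i ` X)" "finite (j ` Y)" "finite (i ` X Un j ` Y)" using XY by auto
 note pq' = smor_in[OF Q XY(1) ij(1) pq(1)] smor_in[OF Q XY(2) ij(2) pq(2)]
 have m: "smor Q (i ` X) \<rho> (smor Q X i p) = smor Q X inl p" "smor Q (j ` Y) \<rho> (smor Q Y j q) = smor Q Y inr q"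
  by (rule smor_smor[OF Q XY(1) ij(1) \<rho>j(1) refl pq(1) \<rho>], assumption, rule smor_smor[OF Q XY(2) ij(2) \<rho>j(2) refl pq(2) \<rho>'])
 have "mform X v p Y w q = gen (inl ` X Un inr ` Y) (merge v w)
   (smor Q (i ` X Un j ` Y) \<rho> (tmlt Q (i ` X) (j ` Y) (smor Q X i p) (smor Q Y j q)))"
  unfolding mform_def m_nat[OF f(1,2) ij(3) \<rho>i pq'] im m ..
 also have "... = gen (i ` X Un j ` Y) u (tmlt Q (i ` X) (j ` Y) (smor Q X i p) (smor Q Y j q))"
 proof (rule fgen_nat[OF f(3) m_in[OF f(1,2) ij(3) pq'] \<rho>i _ image_Un[of \<rho> "i ` X" "j ` Y", unfolded im, symmetric]])
  show "merge v w : inl ` X Un inr ` Y \<rightarrow> carr V"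
  proof (rule merge_in)
   show "v : col X" using u(1) u(2)[symmetric] by auto
   show "w : col Y" using u(1) u(3)[symmetric] by auto
  qed
  show "merge v w (\<rho> l) = u l" if "l : i ` X Un j ` Y" for l using that u(2,3) by (auto simp: \<rho> \<rho>')
 qed
 finally show ?thesis .
qed

lemma mform_in: "finite X ==> finite Y ==> p : scar Q X ==> q : scar Q Y ==>
  tmlt Q (inl ` X) (inr ` Y) (smor Q X inl p) (smor Q Y inr q) : scar Q (inl ` X Un inr ` Y)"
 by (intro m_in smor_in Q inj_on_inl inj_on_inr inl_inr_disj finite_imageI)

lemma mform_left:
 assumes Y: "finite Y" "w : col Y" "q : scar Q Y"
 shows "fform V Q F (%X v p. mform X v p Y w q)"
 unfolding fform_def
proof (intro allI impI conjI ballI)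
 fix X :: "lbl set" assume X: "finite X"
 have fin: "finite (inl ` X)" "finite (inr ` Y)" "finite (inl ` X Un inr ` Y)" using X Y by auto
 show "mlin V X F (%v. mform X v p Y w q)" if p: "p : scar Q X" for p
  unfolding mform_def
 proof (rule mlinI)
  let ?g = "gen (inl ` X Un inr ` Y)" and ?t = "tmlt Q (inl ` X) (inr ` Y) (smor Q X inl p) (smor Q Y inr q)"
  fix v assume v: "v : col X"
  note g = mlinD[OF fgen_mlin[OF fin(3) mform_in[OF X Y(1) p Y(3)]]] and mi = merge_in[OF v Y(2)]
  show "?g (merge v w) ?t : carr F"
   by (rule g(1)[OF mi])
  show "?g (merge v w) ?t =
   ?g (merge v' w) ?t"
   if "!!x. x : X ==> v x = v' x" for v'
   by (rule g(2)[OF mi]) (use that in auto)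
  have "merge (v(x := a)) w = (merge v w)(inl x := a)" for a x
   by (auto simp: fun_eq_iff merge_def inj_inl)
  then show "linmap V F (%a. ?g (merge (v(x := a)) w) ?t)"
   if "x : X" for x
   using g(3)[OF mi] that by simp
 qed
 show "linmap (sp Q X) F (%p. mform X v p Y w q)" if v: "v : col X" for v
  unfolding mform_def
  by (rule linmap_comp[OF fgen_linmap[OF fin(3) merge_in[OF v Y(2)]]],
    rule bilin_left_comp[OF m_bilin[OF fin(1,2) inl_inr_disj] smor_linmap[OF Q X inj_on_inl]]) (simp add: smor_in[OF Q Y(1) inj_on_inr Y(3)])
 fix h :: "lbl => lbl" and v p assume p: "p : scar Q X" and h: "inj_on h X" and v: "v : col (h ` X)"
 have "mform X (v o h) p Y w q = gen ((%x. inl (h x)) ` X Un inr ` Y) (merge v w)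
   (tmlt Q ((%x. inl (h x)) ` X) (inr ` Y) (smor Q X (%x. inl (h x)) p) (smor Q Y inr q))"
  by (rule mform_any[OF X Y(1) _ inj_on_inr _ _ _ _ p Y(3)])
   (use h v Y(2) in \<open>auto simp: inj_on_def inj_inl inl_inr\<close>)
 then show "mform (h ` X) v (smor Q X h p) Y w q = mform X (v o h) p Y w q"
  unfolding mform_def smor_smor[OF Q X h inj_on_inl refl p refl] image_image by simp
qed

lemma mform_right:
 assumes X: "finite X" "v : col X" "p : scar Q X"
 shows "fform V Q F (mform X v p)"
 unfolding fform_def
proof (intro allI impI conjI ballI)
 fix Y :: "lbl set" assume Y: "finite Y"
 have fin: "finite (inl ` X)" "finite (inr ` Y)" "finite (inl ` X Un inr ` Y)" using X Y by auto
 show "mlin V Y F (%w. mform X v p Y w q)" if q: "q : scar Q Y" for q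
  unfolding mform_def
 proof (rule mlinI)
  let ?g = "gen (inl ` X Un inr ` Y)" and ?t = "tmlt Q (inl ` X) (inr ` Y) (smor Q X inl p) (smor Q Y inr q)"
  fix w assume w: "w : col Y"
  note g = mlinD[OF fgen_mlin[OF fin(3) mform_in[OF X(1) Y X(3) q]]] and mi = merge_in[OF X(2) w]
  show "?g (merge v w) ?t : carr F"
   by (rule g(1)[OF mi])
  show "?g (merge v w) ?t =
   ?g (merge v w') ?t"
   if "!!x. x : Y ==> w x = w' x" for w'
   by (rule g(2)[OF mi]) (use that in auto)
  have "merge v (w(y := a)) = (merge v w)(inr y := a)" for a y
   by (auto simp: fun_eq_iff merge_def inj_inr inl_inr)
  then show "linmap V F (%a. ?g (merge v (w(y := a))) ?t)"
   if "y : Y" for y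
   using g(3)[OF mi] that by simp
 qed
 show "linmap (sp Q Y) F (mform X v p Y w)" if w: "w : col Y" for w
  unfolding mform_def[abs_def]
  by (rule linmap_comp[OF fgen_linmap[OF fin(3) merge_in[OF X(2) w]]],
    rule bilin_right_comp[OF m_bilin[OF fin(1,2) inl_inr_disj] _ smor_linmap[OF Q Y inj_on_inr]]) (simp add: smor_in[OF Q X(1) inj_on_inl X(3)])
 fix h :: "lbl => lbl" and w q assume q: "q : scar Q Y" and h: "inj_on h Y" and w: "w : col (h ` Y)"
 have "mform X v p Y (w o h) q = gen (inl ` X Un (%x. inr (h x)) ` Y) (merge v w)
   (tmlt Q (inl ` X) ((%x. inr (h x)) ` Y) (smor Q X inl p) (smor Q Y (%x. inr (h x)) q))"
  by (rule mform_any[OF X(1) Y inj_on_inl _ _ _ _ _ X(3) q])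
   (use h w X(2) in \<open>auto simp: inj_on_def inj_inr inl_inr\<close>)
 then show "mform X v p (h ` Y) w (smor Q Y h q) = mform X v p Y (w o h) q"
  unfolding mform_def smor_smor[OF Q Y h inj_on_inr refl q refl] image_image by simp
qed

lemma mform_disj:
 assumes XY: "finite X" "finite Y" "X Int Y = {}" and v: "v : col (X Un Y)" and pq: "p : scar Q X" "q : scar Q Y"
 shows "mform X v p Y v q = gen (X Un Y) v (tmlt Q X Y p q)"
 using mform_any[OF XY(1,2), of id id v v v p q] XY(3) v pq smor_id[OF Q XY(1) pq(1)] smor_id[OF Q XY(2) pq(2)] by simp

text \<open>A generator is unchanged under a bijective relabelling of its label set together with
  its colouring and element, so its labels can avoid any finite set.\<close>

lemma gen_away:
 assumes "finite X" "finite Y" "w : col Y" "q : scar Q Y"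
 obtains Y' w' q' where "finite Y'" "Y' Int X = {}" "w' : col Y'" "q' : scar Q Y'" "gen Y w q = gen Y' w' q'"
proof -
 obtain \<rho> where \<rho>: "inj_on \<rho> Y" "\<rho> ` Y Int X = {}"
  using ex_inj_away[OF assms(1,2)] by blast
 have i: "inv_into Y \<rho> (\<rho> y) = y" if "y : Y" for y using \<rho>(1) that by simp
 have w': "w o inv_into Y \<rho> : col (\<rho> ` Y)"
  using assms(3) by (auto simp: i)
 have "gen Y w q = gen (\<rho> ` Y) (w o inv_into Y \<rho>) (smor Q Y \<rho> q)"
  by (rule fgen_nat[OF assms(2,4) \<rho>(1) w' refl, symmetric]) (simp add: i)
 then show ?thesis
  using that[of "\<rho> ` Y" "w o inv_into Y \<rho>" "smor Q Y \<rho> q"] \<rho> assms w' smor_in[OF Q assms(2) \<rho>(1) assms(4)] by auto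
qed

text \<open>Reduces bilinear identities to pairs of generators with disjoint label sets and one
  common colouring, the situation in which the product is simply \<open>tmlt\<close> on the
  union.\<close>

lemma fock_ext2:
 assumes f: "bilin F F Z f" and g: "bilin F F Z g"
  and eq: "!!X Y v p q. finite X ==> finite Y ==> X Int Y = {} ==> v : col (X Un Y) ==>
   p : scar Q X ==> q : scar Q Y ==> f (gen X v p) (gen Y v q) = g (gen X v p) (gen Y v q)"
  and xy: "x : carr F" "y : carr F"
 shows "f x y = g x y"
proof (rule fock_ext[OF bilin_left[OF f xy(2)] bilin_left[OF g xy(2)] _ xy(1)])
 fix X v p assume X: "finite X" "v : col X" "p : scar Q X"
 note x = fgen_in[OF X]
 show "f (gen X v p) y = g (gen X v p) y"
 proof (rule fock_ext[OF bilin_right[OF f x] bilin_right[OF g x] _ xy(2)])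
  fix Y w q assume "finite Y" "w : col Y" "q : scar Q Y"
  then obtain Y' w' q' where Y: "finite Y'" "Y' Int X = {}" "w' : col Y'" "q' : scar Q Y'" "gen Y w q = gen Y' w' q'"
   using gen_away[OF X(1)] by metis
  \<comment> \<open>Two colourings on disjoint label sets are glued into one.\<close>
  define u where "u l = (if l : X then v l else w' l)" for l
  have u: "u : col (X Un Y')" using X Y by (auto simp: u_def)
  have "gen X v p = gen X u p" by (rule fgen_cong[OF X]) (simp add: u_def)
  moreover have "gen Y' w' q' = gen Y' u q'" by (rule fgen_cong[OF Y(1,3,4)]) (use Y(2) in \<open>auto simp: u_def\<close>)
  ultimately show "f (gen X v p) (gen Y w q) = g (gen X v p) (gen Y w q)"
   using eq[OF X(1) Y(1) _ u X(3) Y(4)] Y(2,5) by (simp add: Int_commute)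
 qed
qed

lemma fock_ext3:
 assumes f: "trilin F F F Z f" and g: "trilin F F F Z g"
  and eq: "!!X Y W v p q r. finite X ==> finite Y ==> finite W ==> X Int Y = {} ==> X Int W = {} ==> Y Int W = {} ==>
   v : X Un Y Un W \<rightarrow> carr V ==>
   p : scar Q X ==> q : scar Q Y ==> r : scar Q W ==>
   f (gen X v p) (gen Y v q) (gen W v r) = g (gen X v p) (gen Y v q) (gen W v r)"
  and xy: "x : carr F" "y : carr F" "z : carr F"
 shows "f x y z = g x y z"
proof (rule fock_ext2[OF trilinD(6)[OF f xy(3)] trilinD(6)[OF g xy(3)] _ xy(1,2)])
 fix X Y v p q assume X: "finite X" "finite Y" "X Int Y = {}" "v : col (X Un Y)" "p : scar Q X" "q : scar Q Y"
 have v: "v : col X" "v : col Y" using X by auto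
 note x = fgen_in[OF X(1) v(1) X(5)] fgen_in[OF X(2) v(2) X(6)]
 show "f (gen X v p) (gen Y v q) z = g (gen X v p) (gen Y v q) z"
 proof (rule fock_ext[OF trilinD(3)[OF f x] trilinD(3)[OF g x] _ xy(3)])
  fix W w r assume "finite W" "w : col W" "r : scar Q W"
  then obtain Y' w' q' where Y: "finite Y'" "Y' Int (X Un Y) = {}" "w' : col Y'" "q' : scar Q Y'" "gen W w r = gen Y' w' q'"
   using gen_away[of "X Un Y"] X by (metis finite_UnI)
  define u where "u l = (if l : Y' then w' l else v l)" for l
  have u: "u : X Un Y Un Y' \<rightarrow> carr V" using X Y by (auto simp: u_def)
  have "gen X v p = gen X u p" by (rule fgen_cong[OF X(1) v(1) X(5)]) (use Y(2) in \<open>auto simp: u_def\<close>)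
  moreover have "gen Y v q = gen Y u q" by (rule fgen_cong[OF X(2) v(2) X(6)]) (use Y(2) in \<open>auto simp: u_def\<close>)
  moreover have "gen Y' w' q' = gen Y' u q'" by (rule fgen_cong[OF Y(1,3,4)]) (auto simp: u_def)
  moreover have "X Int Y' = {}" "Y Int Y' = {}" using Y(2) by auto
  ultimately show "f (gen X v p) (gen Y v q) (gen W w r) = g (gen X v p) (gen Y v q) (gen W w r)"
   using eq[OF X(1,2) Y(1) X(3) _ _ u X(5,6) Y(4)] Y(5) by simp
 qed
qed

text \<open>\<open>fock_mul\<close> is a choice, so a bilinear map with the prescribed values on
  words has to be exhibited. It is the lift of \<open>mform\<close>; on words its label sets [k] and
  k + [l] are disjoint with union [k + l], which gives the required formula.\<close>

lemma mul_exists: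
 "bilin F F F (fock_mul V Q) & (\<forall>vs ws p q. let k = length vs; l = length ws in
    set vs <= carr V --> set ws <= carr V --> p : scar Q (nset k) --> q : scar Q (nset l) \<longrightarrow>
    fock_mul V Q (fock_bar V Q vs p) (fock_bar V Q ws q) =
    fock_bar V Q (vs @ ws)
     (tmlt Q (nset k) (relabel ((+) k) ` nset l) p (smor Q (nset l) (relabel ((+) k)) q)))"
 (is "?P (fock_mul V Q)")
  and mul_agree: "[|finite X; finite Y; X Int Y = {}; v : col (X Un Y); p : scar Q X; q : scar Q Y|] ==>
   fock_mul V Q (gen X v p) (gen Y v q) = gen (X Un Y) v (tmlt Q X Y p q)"
proof -
 obtain \<mu> where \<mu>: "bilin F F F \<mu>" and \<mu>g: "!!X v p Y w q. finite X ==> v : col X ==> p : scar Q X ==>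
   finite Y ==> w : col Y ==> q : scar Q Y ==> \<mu> (gen X v p) (gen Y w q) = mform X v p Y w q"
  by (rule fock_lift2[OF vspace_fock, where \<phi> = mform, OF mform_left mform_right]) auto
 have \<mu>d: "\<mu> (gen X v p) (gen Y v q) = gen (X Un Y) v (tmlt Q X Y p q)"
  if "finite X" "finite Y" "X Int Y = {}" "v : col (X Un Y)" "p : scar Q X" "q : scar Q Y" for X Y v p q
  using that by (simp add: \<mu>g Pi_iff mform_disj)
 have word: "\<mu> (fock_bar V Q vs p) (fock_bar V Q ws q) = fock_bar V Q (vs @ ws)
     (tmlt Q (nset k) (relabel ((+) k) ` nset l) p (smor Q (nset l) (relabel ((+) k)) q))"
  if vs: "set vs <= carr V" "length vs = k" and ws: "set ws <= carr V" "length ws = l"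
   and pq: "p : scar Q (nset k)" "q : scar Q (nset l)" for vs ws p q k l
 proof -
  let ?r = "relabel ((+) k)"
  have r: "inj_on ?r (nset l)" by (auto simp: nset_def inj_on_def)
  have img: "nset k Un ?r ` nset l = nset (k + l)"
  proof -
   have "?r ` nset l = At ` ((+) k ` {1..l})" by (simp only: nset_def image_image relabel.simps)
   moreover have "(+) k ` {1..l} = {k+1..k+l}" by simp
   moreover have "{1..k} Un {k+1..k+l} = {1..k+l}" by auto
   ultimately show ?thesis by (metis nset_def image_Un)
  qed
  have d: "nset k Int ?r ` nset l = {}" by (auto simp: nset_def)
  have fr: "finite (?r ` nset l)" by simp
  have vw: "set (vs @ ws) <= carr V" "length (vs @ ws) = k + l" using vs ws by auto
  have L: "lab (vs @ ws) : nset k Un ?r ` nset l \<rightarrow> carr V"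
   unfolding img by (rule lab_in[OF vw])
  have q': "smor Q (nset l) ?r q : scar Q (?r ` nset l)" by (rule smor_in[OF Q finite_nset r pq(2)])
  have 1: "fock_bar V Q vs p = gen (nset k) (lab (vs @ ws)) p"
   unfolding fgen_nset[OF vs pq(1), symmetric]
   by (rule fgen_cong[OF finite_nset lab_in[OF vs] pq(1)])
    (use vs in \<open>auto simp: nset_def letter_def nth_append\<close>)
  have 2: "fock_bar V Q ws q = gen (?r ` nset l) (lab (vs @ ws)) (smor Q (nset l) ?r q)"
   unfolding fgen_nset[OF ws pq(2), symmetric]
   by (rule fgen_nat[OF finite_nset pq(2) r _ refl, symmetric])
    (use vs L in \<open>auto simp: nset_def letter_def nth_append\<close>)
  have mm: "tmlt Q (nset k) (?r ` nset l) p (smor Q (nset l) ?r q) : scar Q (nset (k + l))"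
   using m_in[OF finite_nset fr d pq(1) q'] by (simp only: img)
  show ?thesis
   unfolding 1 2 \<mu>d[OF finite_nset fr d L pq(1) q'] unfolding img
   by (rule fgen_nset[OF vw mm])
 qed
 have "?P \<mu>" using \<mu> word by (auto simp: Let_def)
 then show P: "?P (fock_mul V Q)"
  unfolding fock_mul_def by (rule someI[where P = ?P])
 have b: "bilin F F F (fock_mul V Q)" using P by blast
 \<comment> \<open>The choice and the lift are both bilinear and agree on words, hence everywhere on
   the carrier.\<close>
 have agree: "fock_mul V Q x y = \<mu> x y" if xy: "x : carr F" "y : carr F" for x y
 proof (rule fock_ext_word[OF bilin_left[OF b xy(2)] bilin_left[OF \<mu> xy(2)] _ xy(1)])
  fix vs p assume vs: "set vs <= carr V" "p : scar Q (nset (length vs))"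
  note x = fock_bar_in[OF vs(1) refl vs(2)]
  show "fock_mul V Q (fock_bar V Q vs p) y = \<mu> (fock_bar V Q vs p) y"
  proof (rule fock_ext_word[OF bilin_right[OF b x] bilin_right[OF \<mu> x] _ xy(2)])
   fix ws q assume ws: "set ws <= carr V" "q : scar Q (nset (length ws))"
   show "fock_mul V Q (fock_bar V Q vs p) (fock_bar V Q ws q) = \<mu> (fock_bar V Q vs p) (fock_bar V Q ws q)"
    using P word[OF vs(1) refl ws(1) refl vs(2) ws(2)] vs ws by (simp add: Let_def)
  qed
 qed
 assume a: "finite X" "finite Y" "X Int Y = {}" "v : col (X Un Y)" "p : scar Q X" "q : scar Q Y"
 have "v : col X" "v : col Y" using a(4) by auto
 then show "fock_mul V Q (gen X v p) (gen Y v q) = gen (X Un Y) v (tmlt Q X Y p q)"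
  using \<mu>d[OF a] agree fgen_in a by simp
qed

abbreviation "mu \<equiv> fock_mul V Q"

lemma mul_bilin: "bilin F F F mu"
 using mul_exists by blast

lemma mul_gen: "[|finite X; finite Y; X Int Y = {}; v : col (X Un Y); p : scar Q X; q : scar Q Y|] ==>
   mu (gen X v p) (gen Y v q) = gen (X Un Y) v (tmlt Q X Y p q)"
 by (rule mul_agree)

text \<open>\<open>v\<close> is free since a colouring of the empty set carries no
  information.\<close>

lemma one_gen: "fock_one V Q = gen {} v (tone Q)"
proof -
 have "gen {} v (tone Q) = gen {} (lab []) (tone Q)"
  by (rule fgen_cong) (auto simp: one_in)
 then show ?thesis
  using fgen_nset[of "[]" 0 "tone Q"] one_in by (simp add: fock_one_def nset_def)
qed

lemma fock_one_in: "fock_one V Q : carr F"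
 unfolding one_gen[of undefined] by (rule fgen_in) (auto simp: one_in)

lemma mul_one:
 assumes "x : carr F"
 shows "mu (fock_one V Q) x = x" "mu x (fock_one V Q) = x"
proof -
 note o = fock_one_in
 show "mu (fock_one V Q) x = x"
  by (rule fock_ext[OF bilin_right[OF mul_bilin o] linmap_id _ assms])
   (subst one_gen, subst mul_gen, auto simp: one_in m_one)
 show "mu x (fock_one V Q) = x"
  by (rule fock_ext[OF bilin_left[OF mul_bilin o] linmap_id _ assms])
   (subst one_gen, subst mul_gen, auto simp: one_in m_one)
qed

lemma mul_assoc:
 assumes "x : carr F" "y : carr F" "z : carr F"
 shows "mu (mu x y) z = mu x (mu y z)"
proof (rule fock_ext3[OF _ _ _ assms])
 note b = bilin_left[OF mul_bilin] bilin_right[OF mul_bilin] bilin_in[OF mul_bilin]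
 show "trilin F F F F (%x y z. mu (mu x y) z)"
  by (intro trilinI b linmap_comp[OF b(1)])
 show "trilin F F F F (%x y z. mu x (mu y z))"
  by (intro trilinI b linmap_comp[OF b(2)])
 fix X Y W v p q r
 assume a: "finite X" "finite Y" "finite W" "X Int Y = {}" "X Int W = {}" "Y Int W = {}"
   "v : X Un Y Un W \<rightarrow> carr V" "p : scar Q X" "q : scar Q Y" "r : scar Q W"
 have v: "v : col (X Un Y)" "v : col (Y Un W)" "v : col (X Un (Y Un W))" using a(7) by auto
 have d: "(X Un Y) Int W = {}" "X Int (Y Un W) = {}" using a by auto
 have f: "finite (X Un Y)" "finite (Y Un W)" using a by auto
 show "mu (mu (gen X v p) (gen Y v q)) (gen W v r) = mu (gen X v p) (mu (gen Y v q) (gen W v r))"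
  unfolding mul_gen[OF a(1,2,4) v(1) a(8,9)] mul_gen[OF a(2,3,6) v(2) a(9,10)]
   mul_gen[OF f(1) a(3) d(1) a(7) m_in[OF a(1,2,4,8,9)] a(10)]
   mul_gen[OF a(1) f(2) d(2) v(3) a(8) m_in[OF a(2,3,6,9,10)]] m_assoc[OF a(1-6) a(8-10)]
  by (simp add: Un_assoc)
qed

section \<open>The first coproduct and its counit on the Fock space\<close>

definition Dform where
 "Dform X v p = (SUM A:Pow X. tL (FF) (%a b. tens F F (gen A v a) (gen (X - A) v b)) (tcop Q A (X - A) p))"

lemma Pow_split:
 assumes "finite X" "A : Pow X"
 shows "finite A" "finite (X - A)" "A Int (X - A) = {}" "A Un (X - A) = X"
 using assms by (auto intro: finite_subset)

lemma fgen_bilin2: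
 assumes "finite X" "finite Y" "v : col X" "w : col Y" "bilin F F Z be"
 shows "bilin (sp Q X) (sp Q Y) Z (%a b. be (gen X v a) (gen Y w b))"
 by (intro bilin_comp[OF assms(5)] fgen_linmap assms)

lemma tens_bilin: "bilin F F (FF) (tens F F)"
 by (intro bilin_tens vspace_fock)

lemma Dform_fform: "fform V Q (FF) Dform"
 unfolding fform_def
proof (intro allI impI conjI ballI)
 fix X :: "lbl set" assume X: "finite X"
 note sp = Pow_split[OF X]
 have vA: "v : col A" "v : col (X - A)" if "v : col X" "A : Pow X" for v A
  using that by auto
 have cop: "tcop Q A (X - A) p : carr (sp Q A >< sp Q (X - A))" if "A : Pow X" "p : scar Q X" for A p
  using D_in[OF sp(1-3)[OF that(1)]] that(2) by (simp only: sp(4)[OF that(1)])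
 have tl: "bilin (sp Q A) (sp Q (X - A)) (FF) (%a b. tens F F (gen A v a) (gen (X - A) v b))"
  if "v : col X" "A : Pow X" for v A
  by (rule fgen_bilin2[OF sp(1,2)[OF that(2)] vA[OF that] tens_bilin])
 show "mlin V X (FF) (%v. Dform X v p)" if p: "p : scar Q X" for p
  unfolding Dform_def
 proof (intro mlin_setsum vspace_tensor)
  fix A assume A: "A : Pow X"
  show "mlin V X (FF) (%v. tL (FF) (%a b. tens F F (gen A v a) (gen (X - A) v b)) (tcop Q A (X - A) p))"
   using mlin_bilin[OF tens_bilin fgen_mlin[OF sp(1)[OF A]] fgen_mlin[OF sp(2)[OF A]] sp(3)[OF A], unfolded sp(4)[OF A]]
   by (intro mlin_tlift[OF Qv[OF sp(1)[OF A]] Qv[OF sp(2)[OF A]] vspace_tensor cop[OF A p]]) simp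
 qed
 show "linmap (sp Q X) (FF) (Dform X v)" if v: "v : col X" for v
  unfolding Dform_def[abs_def]
 proof (intro linmap_setsum vspace_tensor)
  fix A assume A: "A : Pow X"
  show "linmap (sp Q X) (FF) (%p. tL (FF) (%a b. tens F F (gen A v a) (gen (X - A) v b)) (tcop Q A (X - A) p))"
   by (rule linmap_tlift_arg[OF Qv[OF sp(1)[OF A]] Qv[OF sp(2)[OF A]] vspace_tensor tl[OF v A]])
    (use D_lin[OF sp(1-3)[OF A]] in \<open>simp only: sp(4)[OF A]\<close>)
 qed
 fix h :: "lbl => lbl" and v p assume p: "p : scar Q X" and h: "inj_on h X" and v: "v : col (h ` X)"
 have v': "v o h : col X" using v by auto
 have *: "tL (FF) (%a b. tens F F (gen (h ` A) v a) (gen (h ` X - h ` A) v b)) (tcop Q (h ` A) (h ` X - h ` A) (smor Q X h p)) =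
   tL (FF) (%a b. tens F F (gen A (v o h) a) (gen (X - A) (v o h) b)) (tcop Q A (X - A) p)"
  if A: "A : Pow X" for A
 proof -
  have d: "h ` X - h ` A = h ` (X - A)" using h A by (simp add: inj_on_image_set_diff)
  have hA: "inj_on h A" "inj_on h (X - A)" using h A by (auto intro: inj_on_subset)
  note s = sp[OF A]
  have p': "p : scar Q (A Un (X - A))" using p by (simp only: s)
  have "tcop Q (h ` A) (h ` (X - A)) (smor Q X h p) =
    tmap (sp Q (h ` A)) (sp Q (h ` (X - A))) (smor Q A h) (smor Q (X - A) h) (tcop Q A (X - A) p)"
   using D_nat[OF s(1-3) _ p', of h] h by (simp only: s)
  moreover have vs: "v : col (h ` A)" "v : col (h ` (X - A))" using v A by auto
  have b: "bilin (sp Q (h ` A)) (sp Q (h ` (X - A))) (FF) (%a b. tens F F (gen (h ` A) v a) (gen (h ` (X - A)) v b))"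
   by (intro fgen_bilin2 tens_bilin finite_imageI s vs)
  have "tL (FF) (%a b. tens F F (gen (h ` A) v a) (gen (h ` (X - A)) v b))
    (tmap (sp Q (h ` A)) (sp Q (h ` (X - A))) (smor Q A h) (smor Q (X - A) h) (tcop Q A (X - A) p)) =
   tL (FF) (%a b. tens F F (gen (h ` A) v (smor Q A h a)) (gen (h ` (X - A)) v (smor Q (X - A) h b))) (tcop Q A (X - A) p)"
   by (rule tlift_tmap[OF Qv[OF s(1)] Qv[OF s(2)] cop[OF A p] Qv[OF finite_imageI[OF s(1)]] Qv[OF finite_imageI[OF s(2)]] vspace_tensor b])
    (use smor_in[OF Q s(1) hA(1)] smor_in[OF Q s(2) hA(2)] in auto)
  moreover have "... = tL (FF) (%a b. tens F F (gen A (v o h) a) (gen (X - A) (v o h) b)) (tcop Q A (X - A) p)"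
   by (rule tlift_cong[OF Qv[OF s(1)] Qv[OF s(2)] cop[OF A p]])
    (simp add: fgen_nat[OF s(1) _ hA(1) vs(1) refl, of _ "v o h"] fgen_nat[OF s(2) _ hA(2) vs(2) refl, of _ "v o h"])
  ultimately show ?thesis unfolding d by simp
 qed
 have "Dform (h ` X) v (smor Q X h p) = (SUM A:Pow X. tL (FF)
   (%a b. tens F F (gen (h ` A) v a) (gen (h ` X - h ` A) v b)) (tcop Q (h ` A) (h ` X - h ` A) (smor Q X h p)))"
  unfolding Dform_def image_Pow_surj[OF refl, of h X, symmetric]
  by (subst sum.reindex[OF inj_on_image_Pow[OF h]]) simp
 also have "... = Dform X (v o h) p"
  unfolding Dform_def by (rule sum.cong[OF refl *])
 finally show "Dform (h ` X) v (smor Q X h p) = Dform X (v o h) p" .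
qed

lemma fock_Delta_spec: "linmap F (FF) (fock_Delta V Q)"
 and Delta_gen: "finite X ==> v : col X ==> p : scar Q X ==> fock_Delta V Q (gen X v p) = Dform X v p"
proof -
 let ?rhs = "%vs p. (SUM (A, B):{(A, B). A Un B = {1..length vs} & A Int B = {}}.
      tmap F F
       (%p1. fock_bar V Q (subword vs A) (smor Q (At ` A) (relabel (incr_pos A)) p1))
       (%p2. fock_bar V Q (subword vs B) (smor Q (At ` B) (relabel (incr_pos B)) p2))
       (tcop Q (At ` A) (At ` B) p))"
 \<comment> \<open>The standardisation \<open>incr_pos\<close> is a bijection onto an initial
   interval carrying the colouring to the subword, so naturality of generators undoes it.\<close>
 have sub: "fock_bar V Q (subword vs A) (smor Q (At ` A) (relabel (incr_pos A)) a) = gen (At ` A) (lab vs) a"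
  if vs: "set vs <= carr V" "A <= {1..length vs}" and a: "a : scar Q (At ` A)" for vs A a
 proof -
  have fA: "finite A" using vs(2) by (rule finite_subset) simp
  note ip = incr_pos_bij[OF fA]
  have i: "inj_on (relabel (incr_pos A)) (At ` A)"
   using ip(1) by (auto simp: bij_betw_def inj_on_eq_iff intro!: inj_onI)
  have img: "nset (card A) = relabel (incr_pos A) ` At ` A"
  proof -
   have "incr_pos A ` A = {1..card A}" using ip(1) by (simp only: bij_betw_def)
   moreover have "relabel (incr_pos A) ` At ` A = At ` incr_pos A ` A" by (simp only: image_image relabel.simps)
   ultimately show ?thesis by (simp only: nset_def)
  qed
  have sw: "set (subword vs A) <= carr V" "length (subword vs A) = card A"
   using vs fA by (auto simp: subword_def intro!: letter_in)
  have sm: "smor Q (At ` A) (relabel (incr_pos A)) a : scar Q (nset (card A))"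
   unfolding img by (rule smor_in[OF Q _ i a]) (use fA in simp)
  have "gen (nset (card A)) (lab (subword vs A)) (smor Q (At ` A) (relabel (incr_pos A)) a) = gen (At ` A) (lab vs) a"
   by (rule fgen_nat[OF _ a i lab_in[OF sw] img]) (use fA ip(2) in auto)
  then show ?thesis by (simp add: fgen_nset[OF sw sm])
 qed
 have w: "Dform (nset (length vs)) (lab vs) p = ?rhs vs p" if vs: "set vs <= carr V" and p: "p : scar Q (nset (length vs))" for vs p
 proof -
  let ?n = "{1..length vs}" and ?X = "nset (length vs)"
  have "Dform ?X (lab vs) p = (SUM (A, B):{(A, B). A Un B = ?n & A Int B = {}}.
    tL (FF) (%a b. tens F F (gen (At ` A) (lab vs) a) (gen (At ` B) (lab vs) b)) (tcop Q (At ` A) (At ` B) p))"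
   unfolding Dform_def
  proof (rule sum.reindex_bij_witness[of _ "%(A, B). At ` A" "%A. (At -` A, At -` (?X - A))"])
   fix A assume A: "A : Pow ?X"
   then have 1: "At ` (At -` A) = A" "At ` (At -` (?X - A)) = ?X - A" by (auto simp: nset_def)
   show "(case (At -` A, At -` (?X - A)) of (A, B) => At ` A) = A" using 1 by simp
   show "(At -` A, At -` (?X - A)) : {(A, B). A Un B = ?n & A Int B = {}}"
    using A by (auto simp: nset_def)
   show "(case (At -` A, At -` (?X - A)) of (A, B) =>
    tL (FF) (%a b. tens F F (gen (At ` A) (lab vs) a) (gen (At ` B) (lab vs) b)) (tcop Q (At ` A) (At ` B) p)) =
    tL (FF) (%a b. tens F F (gen A (lab vs) a) (gen (?X - A) (lab vs) b)) (tcop Q A (?X - A) p)"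
    by (simp only: prod.case 1)
  next
   fix c assume "c : {(A, B). A Un B = ?n & A Int B = {}}"
   then obtain A B where c: "c = (A, B)" "A Un B = ?n" "A Int B = {}" by auto
   have "At -` (?X - At ` A) = ?n - A" by (auto simp: nset_def)
   also have "... = B" using c(2,3) by blast
   finally show "(At -` (case c of (A, B) => At ` A), At -` (?X - (case c of (A, B) => At ` A))) = c"
    using c(1) by (simp add: inj_vimage_image_eq inj_def)
   show "(case c of (A, B) => At ` A) : Pow ?X" using c by (auto simp: nset_def)
  qed
  also have "... = ?rhs vs p"
  proof (rule sum.cong[OF refl], clarify)
   fix A B assume AB: "A Un B = ?n" "A Int B = {}"
   have f: "finite (At ` A)" "finite (At ` B)"
    using AB(1) by (metis finite_Un finite_atLeastAtMost finite_imageI)+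
   have s: "A <= ?n" "B <= ?n" using AB by auto
   have d: "At ` A Int At ` B = {}" using AB(2) by auto
   have "p : scar Q (At ` A Un At ` B)"
    using p by (simp only: image_Un[symmetric] AB(1) nset_def)
   note t = D_in[OF f d this]
   show "tL (FF) (%a b. tens F F (gen (At ` A) (lab vs) a) (gen (At ` B) (lab vs) b)) (tcop Q (At ` A) (At ` B) p) =
     tmap F F
       (%p1. fock_bar V Q (subword vs A) (smor Q (At ` A) (relabel (incr_pos A)) p1))
       (%p2. fock_bar V Q (subword vs B) (smor Q (At ` B) (relabel (incr_pos B)) p2))
       (tcop Q (At ` A) (At ` B) p)"
    unfolding tmap_def by (rule tlift_cong[OF Qv[OF f(1)] Qv[OF f(2)] t]) (simp add: sub[OF vs s(1)] sub[OF vs s(2)])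
  qed
  finally show ?thesis .
 qed
 note s = fock_some[OF vspace_tensor Dform_fform w fock_Delta_def]
 show "linmap F (FF) (fock_Delta V Q)" by (rule s(1))
 show "finite X ==> v : col X ==> p : scar Q X ==> fock_Delta V Q (gen X v p) = Dform X v p" by (rule s(2))
qed

abbreviation "Dl \<equiv> fock_Delta V Q"

lemma Delta_in: "x : carr F ==> Dl x : carr (FF)"
 by (rule linmap_in[OF fock_Delta_spec])

lemma cop_in:
 assumes "finite X" "A : Pow X" "p : scar Q X"
 shows "tcop Q A (X - A) p : carr (sp Q A >< sp Q (X - A))"
 using D_in[OF Pow_split(1-3)[OF assms(1,2)]] assms(3) by (simp only: Pow_split(4)[OF assms(1,2)])

text \<open>The coproduct of a generator is used only through its contractions, so that nested
  coproducts can be expanded from the outside inwards.\<close>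

lemma Delta_int:
 assumes Z: "vspace Z" and be: "bilin F F Z be" and X: "finite X" "v : col X" "p : scar Q X"
 shows "tL Z be (Dl (gen X v p)) = (SUM A:Pow X. tL Z (%a b. be (gen A v a) (gen (X - A) v b)) (tcop Q A (X - A) p))"
 unfolding Delta_gen[OF X] Dform_def tlift_sum_arg[OF Z]
proof (rule sum.cong[OF refl])
 fix A assume A: "A : Pow X"
 note s = Pow_split[OF X(1) A]
 have v: "v : col A" "v : col (X - A)" using X A by auto
 have "tL Z be (tL (FF) (%a b. tens F F (gen A v a) (gen (X - A) v b)) (tcop Q A (X - A) p)) =
  tL Z (%a b. tL Z be (tens F F (gen A v a) (gen (X - A) v b))) (tcop Q A (X - A) p)"
  by (rule tlift_tlift[OF Qv[OF s(1)] Qv[OF s(2)] cop_in[OF X(1) A X(3)] vspace_fock vspace_fock Z be])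
   (rule bilin_in[OF fgen_bilin2[OF s(1,2) v tens_bilin]])
 then show "tL Z be (tL (FF) (%a b. tens F F (gen A v a) (gen (X - A) v b)) (tcop Q A (X - A) p)) =
  tL Z (%a b. be (gen A v a) (gen (X - A) v b)) (tcop Q A (X - A) p)"
  by (simp add: tlift_tens[OF Z be])
qed

lemma fock_Eps_spec: "linmap F ground (fock_Eps V Q)"
 and Eps_gen: "finite X ==> v : col X ==> p : scar Q X ==> fock_Eps V Q (gen X v p) = (if X = {} then tcou Q p else 0)"
proof -
 let ?\<phi> = "%X v p. if X = {} then tcou Q p else 0"
 have ff: "fform V Q ground ?\<phi>"
  unfolding fform_def
 proof (intro allI impI conjI ballI)
  fix X :: "lbl set" assume X: "finite X"
  show "mlin V X ground (%v. ?\<phi> X v p)" for p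
   by (rule mlinI) (auto intro: linmap_0 vspace_ground)
  show "linmap (sp Q X) ground (?\<phi> X v)" for v
   using cou_lin by (cases "X = {}") (auto intro: linmap_0 vspace_ground)
  show "?\<phi> (h ` X) v (smor Q X h p) = ?\<phi> X (v o h) p" if "p : scar Q X" for h v p
   using smor_ident[OF Q, of "{}" p h] that by auto
 qed
 have n: "nset (length vs) = {} \<longleftrightarrow> vs = []" for vs :: "'v list" by (cases vs) (auto simp: nset_def)
 note s = fock_some[OF vspace_ground ff _ fock_Eps_def]
 show "linmap F ground (fock_Eps V Q)" by (rule s(1)) (simp add: n)
 show "finite X ==> v : col X ==> p : scar Q X ==> fock_Eps V Q (gen X v p) = ?\<phi> X v p" by (rule s(2)) (simp_all add: n)
qed

abbreviation "Ep \<equiv> fock_Eps V Q"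

lemma tlift_kill:
 assumes "vspace Z" "!!a b. be a b = 0"
 shows "tL Z be t = 0"
 using tlift_zero_param[OF assms(1), of t] assms(2) by (simp add: tlift_def)

text \<open>In each counit law a single subset contributes, because \<open>Ep\<close> vanishes on
  nonempty label sets. For coassociativity both sides become sums over ordered decompositions of
  \<open>X\<close> into three blocks, compared block by block.\<close>

lemma fock_coalgebra: "coalgebra_on F Dl Ep"
 unfolding coalgebra_on_def
proof (intro conjI ballI)
 show "vspace F" "linmap F (FF) Dl" "linmap F ground Ep"
  by (rule vspace_fock fock_Delta_spec fock_Eps_spec)+
 interpret f: vector_space "smul F" by (rule vspace_vector_space[OF vspace_fock])
 note vf = vspace_fock
 fix x assume x: "x : carr F"
 have l0: "bilin F F F (%a b. smul F (Ep a) b)" "bilin F F F (%a b. smul F (Ep b) a)"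
  using bilin_ground_scale[OF vf fock_Eps_spec] by auto
 show "tL F (%a b. smul F (Ep a) b) (Dl x) = x"
 proof (rule fock_ext[OF _ linmap_id _ x])
  show "linmap F F (%x. tL F (%a b. smul F (Ep a) b) (Dl x))"
   by (intro linmap_tlift_arg[OF vf vf vf] l0 fock_Delta_spec)
  fix X v p assume X: "finite X" "v : col X" "p : scar Q X"
  note s = Pow_split[OF X(1)]
  have vA: "v : col A" "v : col (X - A)" if "A : Pow X" for A
   using that X by auto
  have "tL F (%a b. smul F (Ep a) b) (Dl (gen X v p)) =
   (SUM A:Pow X. tL F (%a b. smul F (Ep (gen A v a)) (gen (X - A) v b)) (tcop Q A (X - A) p))"
   by (rule Delta_int[OF vf l0(1) X])
  \<comment> \<open>Only the decomposition whose first block is empty survives.\<close>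
  also have "... = (SUM A:Pow X. if A = {} then tL F (%a b. smul F (tcou Q a) (gen X v b)) (tcop Q {} X p) else 0)"
  proof (rule sum.cong[OF refl])
   fix A assume A: "A : Pow X"
   have "tL F (%a b. smul F (Ep (gen A v a)) (gen (X - A) v b)) (tcop Q A (X - A) p) =
     tL F (%a b. smul F (if A = {} then tcou Q a else 0) (gen (X - A) v b)) (tcop Q A (X - A) p)"
    by (rule tlift_cong[OF Qv[OF s(1)[OF A]] Qv[OF s(2)[OF A]] cop_in[OF X(1) A X(3)]])
     (simp only: Eps_gen[OF s(1)[OF A] vA(1)[OF A]] sp_sel)
   then show "tL F (%a b. smul F (Ep (gen A v a)) (gen (X - A) v b)) (tcop Q A (X - A) p) =
    (if A = {} then tL F (%a b. smul F (tcou Q a) (gen X v b)) (tcop Q {} X p) else 0)"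
    by (auto simp: tlift_kill[OF vf])
  qed
  also have "... = tL F (%a b. smul F (tcou Q a) (gen X v b)) (tcop Q {} X p)"
   using X(1) by (simp add: sum.delta)
  also have "... = gen X v (tL (sp Q X) (%a b. sscl Q (tcou Q a) b) (tcop Q {} X p))"
  proof (subst linmap_of_tlift[where Z = F and f = "gen X v" and A = "sp Q {}" and B = "sp Q X"])
   show "tL F (%a b. smul F (tcou Q a) (gen X v b)) (tcop Q {} X p) = tL F (%a b. gen X v (sscl Q (tcou Q a) b)) (tcop Q {} X p)"
    by (rule tlift_cong[OF Qv Qv D_in]) (use X linmap_scale[OF fgen_linmap[OF X(1,2)]] in auto)
  qed (use X D_in[of "{}" X p] vspace_scale[OF Qv[OF X(1)]] in \<open>auto intro: Qv fgen_linmap\<close>)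
  finally show "tL F (%a b. smul F (Ep a) b) (Dl (gen X v p)) = gen X v p"
   by (simp add: D_counit X)
 qed
 show "tL F (%a b. smul F (Ep b) a) (Dl x) = x"
 proof (rule fock_ext[OF _ linmap_id _ x])
  show "linmap F F (%x. tL F (%a b. smul F (Ep b) a) (Dl x))"
   by (intro linmap_tlift_arg[OF vf vf vf] l0 fock_Delta_spec)
  fix X v p assume X: "finite X" "v : col X" "p : scar Q X"
  note s = Pow_split[OF X(1)]
  have vA: "v : col A" "v : col (X - A)" if "A : Pow X" for A
   using that X by auto
  have "tL F (%a b. smul F (Ep b) a) (Dl (gen X v p)) =
   (SUM A:Pow X. tL F (%a b. smul F (Ep (gen (X - A) v b)) (gen A v a)) (tcop Q A (X - A) p))"
   by (rule Delta_int[OF vf l0(2) X])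
  also have "... = (SUM A:Pow X. if A = X then tL F (%a b. smul F (tcou Q b) (gen X v a)) (tcop Q X {} p) else 0)"
  proof (rule sum.cong[OF refl])
   fix A assume A: "A : Pow X"
   have "tL F (%a b. smul F (Ep (gen (X - A) v b)) (gen A v a)) (tcop Q A (X - A) p) =
     tL F (%a b. smul F (if X - A = {} then tcou Q b else 0) (gen A v a)) (tcop Q A (X - A) p)"
    by (rule tlift_cong[OF Qv[OF s(1)[OF A]] Qv[OF s(2)[OF A]] cop_in[OF X(1) A X(3)]])
     (simp only: Eps_gen[OF s(2)[OF A] vA(2)[OF A]] sp_sel)
   moreover have "X - A = {} \<longleftrightarrow> A = X" using A by auto
   ultimately show "tL F (%a b. smul F (Ep (gen (X - A) v b)) (gen A v a)) (tcop Q A (X - A) p) =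
    (if A = X then tL F (%a b. smul F (tcou Q b) (gen X v a)) (tcop Q X {} p) else 0)"
    by (auto simp: tlift_kill[OF vf])
  qed
  also have "... = tL F (%a b. smul F (tcou Q b) (gen X v a)) (tcop Q X {} p)"
   using X(1) by (simp add: sum.delta)
  also have "... = gen X v (tL (sp Q X) (%a b. sscl Q (tcou Q b) a) (tcop Q X {} p))"
  proof (subst linmap_of_tlift[where Z = F and f = "gen X v" and A = "sp Q X" and B = "sp Q {}"])
   show "tL F (%a b. smul F (tcou Q b) (gen X v a)) (tcop Q X {} p) = tL F (%a b. gen X v (sscl Q (tcou Q b) a)) (tcop Q X {} p)"
    by (rule tlift_cong[OF Qv Qv D_in]) (use X linmap_scale[OF fgen_linmap[OF X(1,2)]] in auto)
  qed (use X D_in[of X "{}" p] vspace_scale[OF Qv[OF X(1)]] in \<open>auto intro: Qv fgen_linmap\<close>)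
  finally show "tL F (%a b. smul F (Ep b) a) (Dl (gen X v p)) = gen X v p"
   by (simp add: D_counit X)
 qed
 let ?Z = "F >< FF" and ?T = "%a b c. tens F (FF) a (tens F F b c)"
 have T: "trilin F F F ?Z ?T" by (rule trilin_tens[OF vf vf vf])
 note Z = vspace_tensor[of F "FF"]
 let ?L = "%x. tL ?Z (%a c. tL ?Z (%a b. ?T a b c) (Dl a)) (Dl x)"
 let ?R = "%x. tL ?Z (%a b. tL ?Z (?T a) (Dl b)) (Dl x)"
 have bL: "bilin F F ?Z (%a c. tL ?Z (%a b. ?T a b c) (Dl a))"
  using bilin_comp[OF linmap_tlift_trilin(1)[OF vf vf vf Z T] fock_Delta_spec linmap_id] .
 have bR: "bilin F F ?Z (%a b. tL ?Z (?T a) (Dl b))"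
  using bilin_comp[OF linmap_tlift_trilin(2)[OF vf vf vf Z T] linmap_id fock_Delta_spec] .
 have "?L x = ?R x"
 proof (rule fock_ext[OF _ _ _ x])
  show "linmap F ?Z ?L" "linmap F ?Z ?R"
   by (intro linmap_tlift_arg[OF vf vf Z] bL bR fock_Delta_spec)+
  fix X v p assume X: "finite X" "v : col X" "p : scar Q X"
  note s = Pow_split[OF X(1)]
  have vA: "v : col A" "v : col (X - A)" if "A : Pow X" for A
   using that X by auto
  \<comment> \<open>The common summand for the blocks \<open>B\<close>, \<open>C\<close> and the
    rest of \<open>X\<close>. It is written in the right-hand bracketing;
    \<open>D_coassoc_int\<close> brings the left side into this form.\<close>
  define f where "f B C = tL ?Z (%a x. tL ?Z (%b c. ?T (gen B v a) (gen C v b) (gen (X - (B Un C)) v c)) (tcop Q C (X - (B Un C)) x)) (tcop Q B (X - B) p)" for B C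
  have "?L (gen X v p) = (SUM A:Pow X. tL ?Z (%x c. tL ?Z (%a b. ?T a b (gen (X - A) v c)) (Dl (gen A v x))) (tcop Q A (X - A) p))"
   by (rule Delta_int[OF Z bL X])
  also have "... = (SUM A:Pow X. SUM B:Pow A. tL ?Z (%x c. tL ?Z (%a b. ?T (gen B v a) (gen (A - B) v b) (gen (X - A) v c)) (tcop Q B (A - B) x)) (tcop Q A (X - A) p))"
  proof (rule sum.cong[OF refl])
   fix A assume A: "A : Pow X"
   note c = cop_in[OF X(1) A X(3)] and q = Qv[OF s(1)[OF A]] Qv[OF s(2)[OF A]]
   show "tL ?Z (%x c. tL ?Z (%a b. ?T a b (gen (X - A) v c)) (Dl (gen A v x))) (tcop Q A (X - A) p) =
    (SUM B:Pow A. tL ?Z (%x c. tL ?Z (%a b. ?T (gen B v a) (gen (A - B) v b) (gen (X - A) v c)) (tcop Q B (A - B) x)) (tcop Q A (X - A) p))"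
    unfolding tlift_sum_param[OF Z, symmetric]
    by (rule tlift_cong[OF q c], rule Delta_int[OF Z trilinD(6)[OF T] s(1)[OF A] vA(1)[OF A]])
     (use A fgen_in[OF s(2)[OF A] vA(2)[OF A]] in auto)
  qed
  also have "... = (SUM A:Pow X. SUM B:Pow A. f B (A - B))"
  proof (intro sum.cong refl)
   fix A B assume A: "A : Pow X" and B: "B : Pow A"
   note sB = Pow_split[OF s(1)[OF A] B]
   have vB: "v : col B" "v : col (A - B)" using vA(1)[OF A] B by auto
   have d: "B Int (X - A) = {}" "(A - B) Int (X - A) = {}" and u: "(A - B) Un (X - A) = X - B"
     "B Un (A - B) Un (X - A) = X" "X - (B Un (A - B)) = X - A" using A B by auto
   have TT: "trilin (sp Q B) (sp Q (A - B)) (sp Q (X - A)) ?Z (%a b c. ?T (gen B v a) (gen (A - B) v b) (gen (X - A) v c))"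
    by (intro trilin_comp[OF T] fgen_linmap sB s A vA vB)
   have "p : scar Q (B Un (A - B) Un (X - A))" using X(3) by (simp only: u)
   from D_coassoc_int[OF sB(1,2) s(2)[OF A] sB(3) d this Z TT]
   show "tL ?Z (%x c. tL ?Z (%a b. ?T (gen B v a) (gen (A - B) v b) (gen (X - A) v c)) (tcop Q B (A - B) x)) (tcop Q A (X - A) p) = f B (A - B)"
    unfolding f_def u sB(4) by simp
  qed
  also have "... = (SUM B:Pow X. SUM C:Pow (X - B). f B C)"
   by (rule sum_Pow_Pow[OF X(1)])
  also have "... = (SUM A:Pow X. tL ?Z (%a x. tL ?Z (?T (gen A v a)) (Dl (gen (X - A) v x))) (tcop Q A (X - A) p))"
  proof (rule sum.cong[OF refl])
   fix A assume A: "A : Pow X"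
   note c = cop_in[OF X(1) A X(3)] and q = Qv[OF s(1)[OF A]] Qv[OF s(2)[OF A]]
   have f: "f A C = tL ?Z (%a x. tL ?Z (%b c. ?T (gen A v a) (gen C v b) (gen (X - A - C) v c)) (tcop Q C (X - A - C) x)) (tcop Q A (X - A) p)" for C
    unfolding f_def by (simp add: Diff_Un Diff_Int_distrib2 set_diff_eq Int_def conj_ac)
   show "(SUM C:Pow (X - A). f A C) = tL ?Z (%a x. tL ?Z (?T (gen A v a)) (Dl (gen (X - A) v x))) (tcop Q A (X - A) p)"
    unfolding f tlift_sum_param[OF Z, symmetric]
    by (rule tlift_cong[OF q c], rule Delta_int[OF Z trilinD(4)[OF T] s(2)[OF A] vA(2)[OF A], symmetric])
     (use A fgen_in[OF s(1)[OF A] vA(1)[OF A]] in auto)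
  qed
  also have "... = ?R (gen X v p)"
   by (rule Delta_int[OF Z bR X, symmetric])
  finally show "?L (gen X v p) = ?R (gen X v p)" .
 qed
 then show "tassoc F F F (tmap (FF) F Dl id (Dl x)) = tmap F (FF) id Dl (Dl x)"
  using tassoc_tmap_eq[OF vf vf vf vf Delta_in Delta_in[OF x]] tmap_id_eq[OF vf vf vf vf Delta_in Delta_in[OF x]] by simp
qed

lemma Delta_one: "Dl (fock_one V Q) = tens F F (fock_one V Q) (fock_one V Q)"
proof -
 let ?v = undefined
 have o: "finite {}" "?v : col {}" "tone Q : scar Q {}" using one_in by auto
 have "tL (FF) (tens F F) (Dl (gen {} ?v (tone Q))) = tens F F (gen {} ?v (tone Q)) (gen {} ?v (tone Q))"
  unfolding Delta_int[OF vspace_tensor tens_bilin o]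
  using tlift_tens[OF vspace_tensor fgen_bilin2[OF o(1,1,2,2) tens_bilin]] by (simp add: D_one)
 then show ?thesis
  using tlift_tens_id[OF vspace_fock vspace_fock Delta_in[OF fgen_in[OF o]]] by (simp add: one_gen[of ?v])
qed

text \<open>A subset of the disjoint union of \<open>X\<close> and \<open>Y\<close> is a pair of
  subsets, and for each such pair the claim is the compatibility axiom \<open>D_m\<close> contracted
  with \<open>tens\<close>.\<close>

lemma Delta_mul:
 assumes "x : carr F" "y : carr F"
 shows "Dl (mu x y) = tmul F F mu mu (Dl x) (Dl y)"
proof (rule fock_ext2[OF _ _ _ assms])
 note vf = vspace_fock
 let ?Z = "FF"
 note Z = vspace_tensor[of F F]
 show "bilin F F ?Z (%x y. Dl (mu x y))"
  by (rule linmap_bilin[OF fock_Delta_spec mul_bilin])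
 show "bilin F F ?Z (%x y. tmul F F mu mu (Dl x) (Dl y))"
  by (rule bilin_comp[OF bilin_tmul[OF vf vf vf vf vf vf mul_bilin mul_bilin] fock_Delta_spec fock_Delta_spec])
 fix X Y v p q
 assume a: "finite X" "finite Y" "X Int Y = {}" "v : col (X Un Y)" "p : scar Q X" "q : scar Q Y"
 have f: "finite (X Un Y)" using a by auto
 have v: "v : col X" "v : col Y" using a by auto
 note pq = m_in[OF a(1-3,5,6)]
 note sX = Pow_split[OF a(1)] and sY = Pow_split[OF a(2)]
 \<comment> \<open>The term for the pair of subsets \<open>B\<close>, \<open>C\<close>. It already
   uses the products of \<open>Q\<close>, which are later recognised as products of
   generators.\<close>
 define g where "g B C = tL ?Z (%a b. tL ?Z (%c d. tens F F (gen (B Un C) v (tmlt Q B C a c))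
   (gen ((X - B) Un (Y - C)) v (tmlt Q (X - B) (Y - C) b d))) (tcop Q C (Y - C) q)) (tcop Q B (X - B) p)" for B C
 have "Dl (mu (gen X v p) (gen Y v q)) = tL ?Z (tens F F) (Dl (gen (X Un Y) v (tmlt Q X Y p q)))"
  unfolding mul_gen[OF a] by (rule tlift_tens_id[OF vf vf Delta_in[OF fgen_in[OF f a(4) pq]], symmetric])
 also have "... = (SUM A:Pow (X Un Y). tL ?Z (%a b. tens F F (gen A v a) (gen (X Un Y - A) v b)) (tcop Q A (X Un Y - A) (tmlt Q X Y p q)))"
  by (rule Delta_int[OF Z tens_bilin f a(4) pq])
 also have "... = (SUM A:Pow (X Un Y). g (X Int A) (Y Int A))"
 proof (rule sum.cong[OF refl])
  fix A assume A: "A : Pow (X Un Y)"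
  let ?B = "X Int A" and ?C = "Y Int A"
  note s = Pow_split[OF f A]
  have B: "?B : Pow X" "?C : Pow Y" by auto
  have u: "X Int (X Un Y - A) = X - ?B" "Y Int (X Un Y - A) = Y - ?C" "?B Un ?C = A" "(X - ?B) Un (Y - ?C) = X Un Y - A"
   using A a(3) by auto
  have d: "?B Int ?C = {}" "(X - ?B) Int (Y - ?C) = {}" using a(3) by auto
  have vA: "v : col A" "v : X Un Y - A \<rightarrow> carr V" using a(4) A by auto
  have mb: "bilin (sp Q ?B) (sp Q ?C) (sp Q A) (tmlt Q ?B ?C)"
    "bilin (sp Q (X - ?B)) (sp Q (Y - ?C)) (sp Q (X Un Y - A)) (tmlt Q (X - ?B) (Y - ?C))"
   using m_bilin[OF sX(1)[OF B(1)] sY(1)[OF B(2)] d(1)] m_bilin[OF sX(2)[OF B(1)] sY(2)[OF B(2)] d(2)] by (simp_all only: u)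
  have "tcop Q A (X Un Y - A) (tmlt Q X Y p q) =
    tmul (sp Q A) (sp Q (X Un Y - A)) (tmlt Q ?B ?C) (tmlt Q (X - ?B) (Y - ?C)) (tcop Q ?B (X - ?B) p) (tcop Q ?C (Y - ?C) q)"
   using D_m[of A "X Un Y - A" X Y p q] f s(3,4) a by (simp only: u)
  then show "tL ?Z (%a b. tens F F (gen A v a) (gen (X Un Y - A) v b)) (tcop Q A (X Un Y - A) (tmlt Q X Y p q)) = g ?B ?C"
   unfolding g_def u
   by (simp only:)
    (rule tlift_tmul[OF Qv[OF sX(1)[OF B(1)]] Qv[OF sX(2)[OF B(1)]] Qv[OF sY(1)[OF B(2)]] Qv[OF sY(2)[OF B(2)]]
      Qv[OF s(1)] Qv[OF s(2)] Z mb fgen_bilin2[OF s(1,2) vA tens_bilin] cop_in[OF a(1) B(1) a(5)] cop_in[OF a(2) B(2) a(6)]])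
 qed
 also have "... = (SUM B:Pow X. SUM C:Pow Y. g B C)"
  by (rule sum_Pow_Un[OF a(1-3)])
 also have "... = (SUM B:Pow X. tL ?Z (%a b. tL ?Z (%c d. tens F F (mu (gen B v a) c) (mu (gen (X - B) v b) d)) (Dl (gen Y v q))) (tcop Q B (X - B) p))"
 proof (rule sum.cong[OF refl])
  fix B assume B: "B : Pow X"
  have vB: "v : col B" "v : col (X - B)" using v B by auto
  show "(SUM C:Pow Y. g B C) = tL ?Z (%a b. tL ?Z (%c d. tens F F (mu (gen B v a) c) (mu (gen (X - B) v b) d)) (Dl (gen Y v q))) (tcop Q B (X - B) p)"
   unfolding g_def tlift_sum_param[OF Z, symmetric]
  proof (rule tlift_cong[OF Qv[OF sX(1)[OF B]] Qv[OF sX(2)[OF B]] cop_in[OF a(1) B a(5)]])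
   fix r t assume r: "r : carr (sp Q B)" and t: "t : carr (sp Q (X - B))"
   then have gr: "gen B v r : carr F" "gen (X - B) v t : carr F"
    using fgen_in[OF sX(1)[OF B] vB(1)] fgen_in[OF sX(2)[OF B] vB(2)] by simp_all
   have "tL ?Z (%c d. tens F F (mu (gen B v r) c) (mu (gen (X - B) v t) d)) (Dl (gen Y v q)) =
    (SUM C:Pow Y. tL ?Z (%c d. tens F F (mu (gen B v r) (gen C v c)) (mu (gen (X - B) v t) (gen (Y - C) v d))) (tcop Q C (Y - C) q))"
    by (rule Delta_int[OF Z bilin_comp[OF tens_bilin bilin_right[OF mul_bilin gr(1)] bilin_right[OF mul_bilin gr(2)]] a(2) v(2) a(6)])
   also have "... = (SUM C:Pow Y. tL ?Z (%c d. tens F F (gen (B Un C) v (tmlt Q B C r c)) (gen ((X - B) Un (Y - C)) v (tmlt Q (X - B) (Y - C) t d))) (tcop Q C (Y - C) q))"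
   proof (rule sum.cong[OF refl])
    fix C assume C: "C : Pow Y"
    have vC: "v : col (B Un C)" "v : col ((X - B) Un (Y - C))" using a(4) B C by auto
    have d: "B Int C = {}" "(X - B) Int (Y - C) = {}" using B C a(3) by auto
    show "tL ?Z (%c d. tens F F (mu (gen B v r) (gen C v c)) (mu (gen (X - B) v t) (gen (Y - C) v d))) (tcop Q C (Y - C) q) =
     tL ?Z (%c d. tens F F (gen (B Un C) v (tmlt Q B C r c)) (gen ((X - B) Un (Y - C)) v (tmlt Q (X - B) (Y - C) t d))) (tcop Q C (Y - C) q)"
     by (rule tlift_cong[OF Qv[OF sY(1)[OF C]] Qv[OF sY(2)[OF C]] cop_in[OF a(2) C a(6)]])
      (use r t in \<open>simp add: mul_gen[OF sX(1)[OF B] sY(1)[OF C] d(1) vC(1)] mul_gen[OF sX(2)[OF B] sY(2)[OF C] d(2) vC(2)]\<close>)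
   qed
   finally show "(SUM C:Pow Y. tL ?Z (%c d. tens F F (gen (B Un C) v (tmlt Q B C r c)) (gen ((X - B) Un (Y - C)) v (tmlt Q (X - B) (Y - C) t d))) (tcop Q C (Y - C) q)) =
    tL ?Z (%c d. tens F F (mu (gen B v r) c) (mu (gen (X - B) v t) d)) (Dl (gen Y v q))" ..
  qed
 qed
 also have "... = tL ?Z (%a b. tL ?Z (%c d. tens F F (mu a c) (mu b d)) (Dl (gen Y v q))) (Dl (gen X v p))"
 proof (rule Delta_int[OF Z _ a(1) v(1) a(5), symmetric])
  note dy = Delta_in[OF fgen_in[OF a(2) v(2) a(6)]]
  show "bilin F F ?Z (%a b. tL ?Z (%c d. tens F F (mu a c) (mu b d)) (Dl (gen Y v q)))"
   by (intro bilinI linmap_tlift_param[OF vf vf Z dy] bilin_left_comp[OF tens_bilin] bilin_right_comp[OF tens_bilin]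
     bilin_left[OF mul_bilin] bilin_in[OF mul_bilin])
 qed
 also have "... = tmul F F mu mu (Dl (gen X v p)) (Dl (gen Y v q))"
  by (simp add: tmul_def)
 finally show "Dl (mu (gen X v p) (gen Y v q)) = tmul F F mu mu (Dl (gen X v p)) (Dl (gen Y v q))" .
qed

lemma Eps_one: "Ep (fock_one V Q) = 1"
 unfolding one_gen[of undefined] by (subst Eps_gen) (auto simp: one_in cou_one)

lemma Eps_mul:
 assumes "x : carr F" "y : carr F"
 shows "Ep (mu x y) = Ep x * Ep y"
proof (rule fock_ext2[OF linmap_bilin[OF fock_Eps_spec mul_bilin] _ _ assms])
 show "bilin F F ground (%x y. Ep x * Ep y)"
  by (intro bilinI linmap_mult fock_Eps_spec)
 fix X Y v p q
 assume a: "finite X" "finite Y" "X Int Y = {}" "v : col (X Un Y)" "p : scar Q X" "q : scar Q Y"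
 have v: "v : col X" "v : col Y" "finite (X Un Y)" using a by auto
 show "Ep (mu (gen X v p) (gen Y v q)) = Ep (gen X v p) * Ep (gen Y v q)"
  unfolding mul_gen[OF a] Eps_gen[OF a(1) v(1) a(5)] Eps_gen[OF a(2) v(2) a(6)] Eps_gen[OF v(3) a(4) m_in[OF a(1-3,5,6)]]
  using cou_m[of p q] a by auto
qed

end

section \<open>Quotients of finite sets of labels\<close>

lemma
 assumes "r : eqvs X"
 shows eqvs_sub: "r <= X \<times> X" and eqvs_refl: "x : X ==> (x, x) : r"
  and eqvs_sym: "(x, y) : r ==> (y, x) : r" and eqvs_trans: "(x, y) : r ==> (y, z) : r ==> (x, z) : r"
 using assms unfolding eqvs_def equiv_def refl_on_def sym_def trans_def by blast+

lemma eqvsI: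
 assumes "r <= X \<times> X" "!!x. x : X ==> (x, x) : r" "!!x y. (x, y) : r ==> (y, x) : r"
  "!!x y z. (x, y) : r ==> (y, z) : r ==> (x, z) : r"
 shows "r : eqvs X"
 using assms unfolding eqvs_def equiv_def refl_on_def sym_def trans_def by blast

lemma eqvs_dom: "r : eqvs X ==> (x, y) : r ==> x : X" "r : eqvs X ==> (x, y) : r ==> y : X"
 using eqvs_sub by blast+

lemma finite_eqvs: "finite X ==> finite (eqvs X)"
 by (rule finite_subset[of _ "Pow (X \<times> X)"]) (auto dest: eqvs_sub)

lemma eqvs_empty: "eqvs {} = {{}}"
 by (auto dest: eqvs_sub intro: eqvsI)

lemma quo_cls: "quo X r = cls r ` X"
 by (auto simp: quo_def cls_def quotient_def)

lemma finite_quo [simp]: "finite X ==> finite (quo X r)"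
 by (simp add: quo_cls)

lemma quo_empty [simp]: "quo {} r = {}"
 by (simp add: quo_cls)

lemma finite_class: "finite X ==> r : eqvs X ==> finite (r `` {x})"
 by (rule finite_subset[of _ X]) (auto dest: eqvs_dom)

lemma fset_class: "finite X ==> r : eqvs X ==> fset (Abs_fset (r `` {x})) = r `` {x}"
 using finite_class by (simp add: Abs_fset_inverse)

text \<open>Finiteness enters because \<open>Abs_fset\<close> is injective only on finite
  sets.\<close>

lemma cls_eq:
 assumes "finite X" "r : eqvs X" "x : X" "y : X"
 shows "cls r x = cls r y \<longleftrightarrow> (x, y) : r"
proof -
 have "cls r x = cls r y \<longleftrightarrow> r `` {x} = r `` {y}"
  unfolding cls_def using finite_class[OF assms(1,2)] by (simp add: Abs_fset_inject)
 also have "... \<longleftrightarrow> (x, y) : r"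
  using assms by (auto dest: eqvs_sym eqvs_trans eqvs_refl)
 finally show ?thesis .
qed

lemma eqv_map_iff:
 assumes "r : eqvs X" "inj_on h X" "x : X" "y : X"
 shows "(h x, h y) : eqv_map h r \<longleftrightarrow> (x, y) : r"
proof
 assume "(h x, h y) : eqv_map h r"
 then obtain a b where ab: "(a, b) : r" "h x = h a" "h y = h b"
  unfolding eqv_map_def by auto
 then have "x = a" "y = b"
  using eqvs_dom[OF assms(1) ab(1)] assms(2-4) by (auto dest: inj_onD)
 then show "(x, y) : r" using ab by simp
qed (auto simp: eqv_map_def)

lemma cls_image:
 assumes "finite X" "r : eqvs X" "inj_on h X" "x : X"
 shows "cls_map h (cls r x) = cls (eqv_map h r) (h x)"
proof -
 have "eqv_map h r `` {h x} = h ` (r `` {x})"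
 proof (intro equalityI subsetI)
  fix z assume z: "z : eqv_map h r `` {h x}"
  then obtain b where "z = h b" "b : X"
   using eqvs_dom[OF assms(2)] unfolding eqv_map_def by auto
  then show "z : h ` (r `` {x})" using z eqv_map_iff[OF assms(2-4)] by auto
 qed (auto simp: eqv_map_def)
 then have "h |`| Abs_fset (r `` {x}) = Abs_fset (eqv_map h r `` {h x})"
  using fset_class[OF assms(1,2)] finite_class[OF assms(1,2)]
  by (intro fset_inject[THEN iffD1]) (simp add: Abs_fset_inverse)
 then show ?thesis by (simp add: cls_def)
qed

lemma eqv_map_in:
 assumes "r : eqvs X" "inj_on h X"
 shows "eqv_map h r : eqvs (h ` X)"
proof (rule eqvsI)
 note [dest] = eqvs_dom[OF assms(1)] eqvs_refl[OF assms(1)]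
 show "eqv_map h r <= h ` X \<times> h ` X" unfolding eqv_map_def by auto
 show "(x, x) : eqv_map h r" if "x : h ` X" for x
  using that unfolding eqv_map_def by force
 show "(y, x) : eqv_map h r" if "(x, y) : eqv_map h r" for x y
  using that eqvs_sym[OF assms(1)] unfolding eqv_map_def by force
 show "(x, z) : eqv_map h r" if xy: "(x, y) : eqv_map h r" and yz: "(y, z) : eqv_map h r" for x y z
 proof -
  obtain a b where 1: "x = h a" "y = h b" "(a, b) : r" using xy unfolding eqv_map_def by auto
  obtain c d where 2: "y = h c" "z = h d" "(c, d) : r" using yz unfolding eqv_map_def by auto
  have "b = c" using inj_onD[OF assms(2), of b c] 1 2 by auto
  then have "(a, d) : r" using 1 2 eqvs_trans[OF assms(1)] by blast
  then show ?thesis using 1 2 unfolding eqv_map_def by force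
 qed
qed

lemma eqv_map_inv:
 assumes "r : eqvs X" "!!x. x : X ==> \<tau> (h x) = x"
 shows "eqv_map \<tau> (eqv_map h r) = r"
proof -
 have "map_prod \<tau> \<tau> (map_prod h h z) = z" if "z : r" for z
  using assms(2) eqvs_dom[OF assms(1)] that by (cases z) auto
 then show ?thesis unfolding eqv_map_def by (force simp: image_image)
qed

lemma bij_eqv_map:
 assumes "inj_on h X"
 shows "bij_betw (eqv_map h) (eqvs X) (eqvs (h ` X))"
proof (rule bij_betw_byWitness[where f' = "eqv_map (inv_into X h)"])
 show "ALL r:eqvs X. eqv_map (inv_into X h) (eqv_map h r) = r"
  using assms by (auto intro!: eqv_map_inv)
 show "ALL r:eqvs (h ` X). eqv_map h (eqv_map (inv_into X h) r) = r"
  by (intro ballI eqv_map_inv) (assumption, rule f_inv_into_f)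
 show "eqv_map h ` eqvs X <= eqvs (h ` X)"
  using eqv_map_in[OF _ assms] by blast
 show "eqv_map (inv_into X h) ` eqvs (h ` X) <= eqvs X"
  using eqv_map_in[OF _ inj_on_inv_into[of "h ` X" h X]] assms by (fastforce simp: inv_into_image_cancel)
qed

lemma quo_map:
 assumes "finite X" "r : eqvs X" "inj_on h X"
 shows "cls_map h ` quo X r = quo (h ` X) (eqv_map h r)" "inj_on (cls_map h) (quo X r)"
proof -
 show "cls_map h ` quo X r = quo (h ` X) (eqv_map h r)"
  unfolding quo_cls image_image using cls_image[OF assms] by auto
 show "inj_on (cls_map h) (quo X r)"
 proof (rule inj_onI)
  fix c d assume "c : quo X r" "d : quo X r" "cls_map h c = cls_map h d"
  then obtain x y where *: "c = cls r x" "d = cls r y" "x : X" "y : X" "cls (eqv_map h r) (h x) = cls (eqv_map h r) (h y)"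
   using cls_image[OF assms] by (auto simp: quo_cls)
  then have "(h x, h y) : eqv_map h r"
   using cls_eq[OF finite_imageI[OF assms(1)] eqv_map_in[OF assms(2,3)]] by auto
  then show "c = d" using * cls_eq[OF assms(1,2)] eqv_map_iff[OF assms(2,3)] by auto
 qed
qed

lemma eqv_map_cong: "r : eqvs X ==> (!!x. x : X ==> h x = \<tau> x) ==> eqv_map h r = eqv_map \<tau> r"
 unfolding eqv_map_def by (rule image_cong) (use eqvs_sub[of r X] in auto)

lemma eqv_map_Un: "eqv_map h (r Un s) = eqv_map h r Un eqv_map h s"
 by (simp add: eqv_map_def image_Un)

lemma eqv_map_comp: "eqv_map \<tau> (eqv_map h r) = eqv_map (\<tau> o h) r"
 by (simp add: eqv_map_def image_image prod.map_comp)

lemma eqvs_Un: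
 assumes "r : eqvs X" "s : eqvs Y" "X Int Y = {}"
 shows "r Un s : eqvs (X Un Y)"
proof (rule eqvsI)
 note d = eqvs_dom[OF assms(1)] eqvs_dom[OF assms(2)]
 show "r Un s <= (X Un Y) \<times> (X Un Y)" using d by auto
 show "(x, x) : r Un s" if "x : X Un Y" for x
  using that eqvs_refl assms by blast
 show "(y, x) : r Un s" if "(x, y) : r Un s" for x y
  using that eqvs_sym assms(1,2) by blast
 show "(x, z) : r Un s" if "(x, y) : r Un s" "(y, z) : r Un s" for x y z
  using that d assms(3) eqvs_trans[OF assms(1)] eqvs_trans[OF assms(2)] by blast
qed

lemma eqvs_Int: "t : eqvs Z ==> X <= Z ==> t Int X \<times> X : eqvs X"
 by (rule eqvsI) (auto dest: eqvs_refl eqvs_sym eqvs_trans)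

lemma Un_restrict:
 assumes "r : eqvs X" "s : eqvs Y" "X Int Y = {}"
 shows "(r Un s) Int X \<times> X = r" "(r Un s) Int Y \<times> Y = s"
 using eqvs_sub[OF assms(1)] eqvs_sub[OF assms(2)] assms(3) by blast+

lemma cls_Un:
 assumes "r : eqvs X" "s : eqvs Y" "X Int Y = {}"
 shows "x : X ==> cls (r Un s) x = cls r x" "y : Y ==> cls (r Un s) y = cls s y"
proof -
 note d = eqvs_dom[OF assms(1)] eqvs_dom[OF assms(2)]
 show "cls (r Un s) x = cls r x" if "x : X"
 proof -
  have "(r Un s) `` {x} = r `` {x}" using d assms(3) that by blast
  then show ?thesis by (simp add: cls_def)
 qed
 show "cls (r Un s) y = cls s y" if "y : Y"
 proof -
  have "(r Un s) `` {y} = s `` {y}" using d assms(3) that by blast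
  then show ?thesis by (simp add: cls_def)
 qed
qed

lemma quo_Un:
 assumes "r : eqvs X" "s : eqvs Y" "X Int Y = {}"
 shows "quo (X Un Y) (r Un s) = quo X r Un quo Y s"
 unfolding quo_cls image_Un using cls_Un[OF assms] by auto

lemma quo_disj:
 assumes "finite X" "finite Y" "r : eqvs X" "s : eqvs Y" "X Int Y = {}"
 shows "quo X r Int quo Y s = {}"
proof -
 have "cls r x ~= cls s y" if "x : X" "y : Y" for x y
 proof
  assume "cls r x = cls s y"
  then have "cls (r Un s) x = cls (r Un s) y" using cls_Un[OF assms(3-5)] that by simp
  then have "(x, y) : r Un s"
   using cls_eq[OF _ eqvs_Un[OF assms(3-5)]] that assms(1,2) by auto
  then show False using eqvs_dom[OF assms(3)] eqvs_dom[OF assms(4)] that assms(5) by blast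
 qed
 then show ?thesis by (auto simp: quo_cls)
qed

text \<open>The condition under which the compatibility axioms and the coproduct of P' are nonzero:
  the equivalence is the disjoint union of its restrictions.\<close>

definition splits :: "lbl set => lbl set => (lbl \<times> lbl) set => bool" where
 "splits X Y t \<longleftrightarrow> t = t Int X \<times> X Un t Int Y \<times> Y"

lemma splits_Un: "r : eqvs X ==> s : eqvs Y ==> splits X Y (r Un s)"
 unfolding splits_def by (auto dest: eqvs_dom)

text \<open>By symmetry it suffices to exclude related pairs in one direction. In this form the
  condition passes easily to images, restrictions and coarser equivalences.\<close>

lemma splits_disj:
 assumes "t : eqvs (X Un Y)" "X Int Y = {}"
 shows "splits X Y t \<longleftrightarrow> (ALL x:X. ALL y:Y. (x, y) ~: t)"
proof
 assume "splits X Y t"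
 then show "ALL x:X. ALL y:Y. (x, y) ~: t" unfolding splits_def using assms(2) by blast
next
 assume *: "ALL x:X. ALL y:Y. (x, y) ~: t"
 have "t <= t Int X \<times> X Un t Int Y \<times> Y"
 proof (intro subrelI)
  fix x y assume xy: "(x, y) : t"
  have "(y, x) : t" by (rule eqvs_sym[OF assms(1) xy])
  then show "(x, y) : t Int X \<times> X Un t Int Y \<times> Y" using * xy eqvs_sub[OF assms(1)] by blast
 qed
 then show "splits X Y t" unfolding splits_def by blast
qed

lemma splitsE:
 assumes "splits X Y t" "t : eqvs (X Un Y)"
 obtains r s where "r : eqvs X" "s : eqvs Y" "t = r Un s"
 using that[of "t Int X \<times> X" "t Int Y \<times> Y"] eqvs_Int[OF assms(2)] assms(1) unfolding splits_def by blast

lemma eqv_le_iff: "eqv_le r r' \<longleftrightarrow> r' <= r"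
 by (auto simp: eqv_le_def)

lemma eqv_quo_iff:
 assumes "finite X" "r' : eqvs X" "r : eqvs X" "r' <= r" "x : X" "y : X"
 shows "(cls r' x, cls r' y) : eqv_quo r' r \<longleftrightarrow> (x, y) : r"
proof
 assume "(cls r' x, cls r' y) : eqv_quo r' r"
 then obtain a b where ab: "(a, b) : r" "cls r' x = cls r' a" "cls r' y = cls r' b"
  unfolding eqv_quo_def by auto
 then have "(x, a) : r'" "(y, b) : r'"
  using cls_eq[OF assms(1,2)] eqvs_dom[OF assms(3)] assms(5,6) by blast+
 then show "(x, y) : r"
  using ab(1) assms(4) eqvs_sym[OF assms(3)] eqvs_trans[OF assms(3)] by blast
qed (auto simp: eqv_quo_def)

lemma eqv_quo_in:
 assumes "finite X" "r' : eqvs X" "r : eqvs X" "r' <= r"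
 shows "eqv_quo r' r : eqvs (quo X r')"
proof (rule eqvsI)
 note iff = eqv_quo_iff[OF assms]
 show sub: "eqv_quo r' r <= quo X r' \<times> quo X r'"
  unfolding eqv_quo_def quo_cls using eqvs_dom[OF assms(3)] by auto
 show "(c, c) : eqv_quo r' r" if "c : quo X r'" for c
  using that eqvs_refl[OF assms(3)] iff by (auto simp: quo_cls)
 show "(d, c) : eqv_quo r' r" if cd: "(c, d) : eqv_quo r' r" for c d
 proof -
  obtain x y where "c = cls r' x" "d = cls r' y" "x : X" "y : X" using cd sub by (auto simp: quo_cls)
  then show ?thesis using cd iff eqvs_sym[OF assms(3)] by auto
 qed
 show "(c, e) : eqv_quo r' r" if cd: "(c, d) : eqv_quo r' r" and de: "(d, e) : eqv_quo r' r" for c d e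
 proof -
  obtain x y where 1: "c = cls r' x" "d = cls r' y" "x : X" "y : X" using cd sub by (auto simp: quo_cls)
  obtain z where 2: "e = cls r' z" "z : X" using de sub by (auto simp: quo_cls)
  show ?thesis using cd de 1 2 iff eqvs_trans[OF assms(3)] by auto
 qed
qed

text \<open>The union of the finer classes met by a coarser class is that coarser class, by
  transitivity and because \<open>r'\<close> is contained in \<open>r\<close>.\<close>

lemma cls_flat:
 assumes "finite X" "r' : eqvs X" "r : eqvs X" "r' <= r" "x : X"
 shows "cls_flat (cls (eqv_quo r' r) (cls r' x)) = cls r x"
proof -
 have fs: "fset (cls_members (cls (eqv_quo r' r) (cls r' x))) = eqv_quo r' r `` {cls r' x}"
  using fset_class[OF _ eqv_quo_in[OF assms(1-4)]] assms(1) by (simp add: cls_def[of "eqv_quo r' r"])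
 have im: "eqv_quo r' r `` {cls r' x} = cls r' ` (r `` {x})"
 proof (intro equalityI subsetI)
  fix c assume c: "c : eqv_quo r' r `` {cls r' x}"
  then have "c : quo X r'" using eqvs_dom[OF eqv_quo_in[OF assms(1-4)]] by auto
  then obtain y where "c = cls r' y" "y : X" by (auto simp: quo_cls)
  then show "c : cls r' ` (r `` {x})" using c eqv_quo_iff[OF assms(1-5)] by auto
 next
  fix c assume "c : cls r' ` (r `` {x})"
  then show "c : eqv_quo r' r `` {cls r' x}"
   using eqv_quo_iff[OF assms(1-5)] eqvs_dom[OF assms(3)] by auto
 qed
 have "cls_members (cls r' y) = Abs_fset (r' `` {y})" for y by (simp add: cls_def)
 moreover have "fset (ffUnion (cls_members |`| M)) = (UN c:fset M. fset (cls_members c))" for M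
  by (simp add: ffUnion.rep_eq)
 ultimately have "fset (ffUnion (cls_members |`| cls_members (cls (eqv_quo r' r) (cls r' x)))) = (UN y:r `` {x}. r' `` {y})"
  by (simp only: fs im image_image fset_class[OF assms(1,2)])
 also have "... = r `` {x}"
 proof (intro equalityI subsetI)
  fix z assume "z : (UN y:r `` {x}. r' `` {y})"
  then obtain y where "(x, y) : r" "(y, z) : r" using assms(4) by auto
  from eqvs_trans[OF assms(3) this] show "z : r `` {x}" by simp
 next
  fix z assume z: "z : r `` {x}"
  then have "(z, z) : r'" using eqvs_refl[OF assms(2)] eqvs_dom(2)[OF assms(3)] by auto
  then show "z : (UN y:r `` {x}. r' `` {y})" using z by blast
 qed
 finally have "ffUnion (cls_members |`| cls_members (cls (eqv_quo r' r) (cls r' x))) = Abs_fset (r `` {x})"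
  using fset_inverse by metis
 then show ?thesis by (simp add: cls_flat_def cls_def[of r])
qed

lemma quo_quo: "quo (quo X r') s = (%x. cls s (cls r' x)) ` X"
 by (simp add: quo_cls image_image)

lemma cls_flat_bij:
 assumes "finite X" "r' : eqvs X" "r : eqvs X" "r' <= r"
 shows "cls_flat ` quo (quo X r') (eqv_quo r' r) = quo X r" "inj_on cls_flat (quo (quo X r') (eqv_quo r' r))"
proof -
 show "cls_flat ` quo (quo X r') (eqv_quo r' r) = quo X r"
  unfolding quo_quo image_image quo_cls[of X r] using cls_flat[OF assms] by auto
 show "inj_on cls_flat (quo (quo X r') (eqv_quo r' r))"
 proof (rule inj_onI)
  fix c d assume cd: "c : quo (quo X r') (eqv_quo r' r)" "d : quo (quo X r') (eqv_quo r' r)" "cls_flat c = cls_flat d"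
  then obtain x y where *: "c = cls (eqv_quo r' r) (cls r' x)" "d = cls (eqv_quo r' r) (cls r' y)" "x : X" "y : X"
   by (auto simp: quo_quo)
  then have "(x, y) : r" using cd(3) cls_flat[OF assms] cls_eq[OF assms(1,3)] by auto
  then have "(cls r' x, cls r' y) : eqv_quo r' r" using eqv_quo_iff[OF assms] * by auto
  then show "c = d"
   using cls_eq[OF _ eqv_quo_in[OF assms]] assms(1) * by (auto simp: quo_cls)
 qed
qed

text \<open>Pullback along the projection of \<open>X\<close> onto its quotient, the inverse of
  \<open>eqv_quo\<close>.\<close>

definition eqv_pull :: "lbl set => (lbl \<times> lbl) set => (lbl \<times> lbl) set => (lbl \<times> lbl) set" where
 "eqv_pull X r' s = {(x, y) : X \<times> X. (cls r' x, cls r' y) : s}"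

lemma eqv_pull_in:
 assumes "finite X" "r' : eqvs X" "s : eqvs (quo X r')"
 shows "eqv_pull X r' s : eqvs X" "r' <= eqv_pull X r' s" "eqv_quo r' (eqv_pull X r' s) = s"
proof -
 show "eqv_pull X r' s : eqvs X"
 proof (rule eqvsI)
  show "(x, x) : eqv_pull X r' s" if "x : X" for x
   using that eqvs_refl[OF assms(3)] by (auto simp: eqv_pull_def quo_cls)
 qed (auto simp: eqv_pull_def intro: eqvs_sym[OF assms(3)] eqvs_trans[OF assms(3)])
 show "r' <= eqv_pull X r' s"
 proof clarify
  fix x y assume xy: "(x, y) : r'"
  then have "x : X" "y : X" "cls r' x = cls r' y"
   using eqvs_dom[OF assms(2)] cls_eq[OF assms(1,2)] by blast+
  then show "(x, y) : eqv_pull X r' s"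
   using eqvs_refl[OF assms(3), of "cls r' y"] by (auto simp: eqv_pull_def quo_cls)
 qed
 show "eqv_quo r' (eqv_pull X r' s) = s"
 proof (intro equalityI subsetI)
  fix z assume "z : s"
  then obtain x y where "z = (cls r' x, cls r' y)" "x : X" "y : X"
   using eqvs_sub[OF assms(3)] by (cases z) (auto simp: quo_cls)
  then show "z : eqv_quo r' (eqv_pull X r' s)"
   using \<open>z : s\<close> unfolding eqv_quo_def eqv_pull_def by force
 qed (auto simp: eqv_quo_def eqv_pull_def)
qed

lemma eqv_pull_quo:
 assumes "finite X" "r' : eqvs X" "r : eqvs X" "r' <= r"
 shows "eqv_pull X r' (eqv_quo r' r) = r"
 using eqv_quo_iff[OF assms] eqvs_dom[OF assms(3)] unfolding eqv_pull_def by auto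

text \<open>The identification of the equivalences on X/~' with those on \<open>X\<close> coarser
  than ~'. It converts the sums defining \<delta>' into sums over all equivalences of a
  quotient.\<close>

lemma bij_eqv_quo:
 assumes "finite X" "r' : eqvs X"
 shows "bij_betw (eqv_quo r') {r:eqvs X. eqv_le r r'} (eqvs (quo X r'))"
 by (rule bij_betw_byWitness[where f' = "eqv_pull X r'"])
  (auto simp: eqv_le_iff eqv_pull_quo[OF assms] eqv_pull_in[OF assms] eqv_quo_in[OF assms]
   dest: subsetD[OF eqv_pull_in(2)[OF assms]])

lemma eqv_quo_le:
 assumes "finite X" "r' : eqvs X" "r : eqvs X" "r' <= r" "s : eqvs X" "r' <= s"
 shows "eqv_le (eqv_quo r' r) (eqv_quo r' s) \<longleftrightarrow> eqv_le r s"
proof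
 assume "eqv_le (eqv_quo r' r) (eqv_quo r' s)"
 then have "eqv_pull X r' (eqv_quo r' s) <= eqv_pull X r' (eqv_quo r' r)"
  unfolding eqv_le_iff eqv_pull_def by blast
 then show "eqv_le r s" using eqv_pull_quo[OF assms(1,2)] assms by (simp add: eqv_le_iff)
qed (auto simp: eqv_le_iff eqv_quo_def)

text \<open>Relates the right counit axiom, stated for the equality relation, to the diagonal term
  of \<delta>'.\<close>

lemma eqv_quo_self:
 assumes "finite X" "r : eqvs X"
 shows "eqv_quo r r = Id_on (quo X r)"
proof -
 have "eqv_pull X r (Id_on (quo X r)) = r"
 proof -
  have "eqv_pull X r (Id_on (quo X r)) = {(x, y) : X \<times> X. cls r x = cls r y}"
   by (auto simp: eqv_pull_def quo_cls)
  also have "... = r" using eqvs_sub[OF assms(2)] cls_eq[OF assms] by auto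
  finally show ?thesis .
 qed
 moreover have "Id_on (quo X r) : eqvs (quo X r)" by (rule eqvsI) auto
 ultimately show ?thesis using eqv_pull_in(3)[OF assms] by metis
qed

lemma eqv_quo_map:
 assumes "finite X" "r' : eqvs X" "r : eqvs X" "inj_on h X"
 shows "eqv_quo (eqv_map h r') (eqv_map h r) = eqv_map (cls_map h) (eqv_quo r' r)"
proof -
 have "map_prod (cls (eqv_map h r')) (cls (eqv_map h r')) (map_prod h h z) =
   map_prod (cls_map h) (cls_map h) (map_prod (cls r') (cls r') z)" if "z : r" for z
  using that eqvs_dom[OF assms(3)] cls_image[OF assms(1,2,4)] by (cases z) auto
 then show ?thesis
  unfolding eqv_quo_def eqv_map_def image_image by (rule image_cong[OF refl])
qed

lemma eqv_quo_Un:
 assumes "r' : eqvs X" "s' : eqvs Y" "X Int Y = {}" "r : eqvs X" "s : eqvs Y"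
 shows "eqv_quo (r' Un s') (r Un s) = eqv_quo r' r Un eqv_quo s' s"
proof -
 have "map_prod (cls (r' Un s')) (cls (r' Un s')) ` r = map_prod (cls r') (cls r') ` r"
  by (rule image_cong) (use cls_Un(1)[OF assms(1-3)] eqvs_dom[OF assms(4)] in auto)
 moreover have "map_prod (cls (r' Un s')) (cls (r' Un s')) ` s = map_prod (cls s') (cls s') ` s"
  by (rule image_cong) (use cls_Un(2)[OF assms(1-3)] eqvs_dom[OF assms(5)] in auto)
 ultimately show ?thesis by (simp add: eqv_quo_def image_Un)
qed

text \<open>For three nested equivalences, the one induced on the double quotient corresponds under
  flattening to the one induced on the simple quotient.\<close>

lemma eqv_quo_flat:
 assumes "finite X" "r : eqvs X" "r' : eqvs X" "r'' : eqvs X" "r' <= r" "r'' <= r'"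
 shows "eqv_map cls_flat (eqv_quo (eqv_quo r'' r') (eqv_quo r'' r)) = eqv_quo r' r"
proof -
 have "map_prod cls_flat cls_flat (map_prod (cls (eqv_quo r'' r')) (cls (eqv_quo r'' r')) (map_prod (cls r'') (cls r'') z)) =
   map_prod (cls r') (cls r') z" if "z : r" for z
  using that eqvs_dom[OF assms(2)] cls_flat[OF assms(1,4,3,6)] by (cases z) auto
 then show ?thesis
  unfolding eqv_quo_def[of "eqv_quo r'' r'"] eqv_quo_def[of r'' r] eqv_quo_def[of r'] eqv_map_def image_image by (rule image_cong[OF refl])
qed

text \<open>Flattening a threefold quotient from the inside or from the outside gives the same class
  of \<open>X\<close>. Coassociativity of \<delta>' needs this, because its two sides flatten in
  different orders.\<close>

lemma cls_flat_flat:
 assumes "finite X" "r : eqvs X" "r' : eqvs X" "r'' : eqvs X" "r' <= r" "r'' <= r'"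
  and c: "c : quo (quo (quo X r'') (eqv_quo r'' r')) (eqv_quo (eqv_quo r'' r') (eqv_quo r'' r))"
 shows "cls_flat (cls_map cls_flat c) = cls_flat (cls_flat c)"
proof -
 have r: "r'' <= r" using assms by blast
 obtain x where x: "x : X" "c = cls (eqv_quo (eqv_quo r'' r') (eqv_quo r'' r)) (cls (eqv_quo r'' r') (cls r'' x))"
  using c by (auto simp: quo_cls)
 have f: "finite (quo X r'')" using assms by simp
 have in1: "eqv_quo r'' r' : eqvs (quo X r'')" "eqv_quo r'' r : eqvs (quo X r'')"
  using assms r by (auto intro: eqv_quo_in)
 have sub: "eqv_quo r'' r' <= eqv_quo r'' r" using assms(5) by (auto simp: eqv_quo_def)
 have xq: "cls r'' x : quo X r''" using x by (auto simp: quo_cls)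
 have "cls_flat (cls_flat c) = cls r x"
  using cls_flat[OF f in1 sub xq] cls_flat[OF assms(1,4,2) r x(1)] by (simp add: x)
 moreover have "cls_map cls_flat c = cls (eqv_quo r' r) (cls r' x)"
 proof -
  have "cls_map cls_flat c = cls (eqv_map cls_flat (eqv_quo (eqv_quo r'' r') (eqv_quo r'' r))) (cls_flat (cls (eqv_quo r'' r') (cls r'' x)))"
   unfolding x(2) by (rule cls_image[OF _ eqv_quo_in[OF f in1 sub] cls_flat_bij(2)[OF assms(1,4,3,6)]])
    (use assms(1) xq in \<open>auto simp: quo_cls\<close>)
  then show ?thesis
   by (simp add: eqv_quo_flat[OF assms(1-6)] cls_flat[OF assms(1,4,3,6) x(1)])
 qed
 ultimately show ?thesis using cls_flat[OF assms(1,3,2,5) x(1)] by simp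
qed

text \<open>Flattening undoes the identification of a quotient with its set of singletons that
  occurs in the right counit axiom.\<close>

lemma cls_flat_singleton:
 assumes "c : quo X r"
 shows "cls_flat (Cls {|c|}) = c"
proof -
 obtain C where "c = Cls C" using assms by (auto simp: quo_def)
 then show ?thesis by (simp add: cls_flat_def)
qed

section \<open>The twisted bialgebra of the composition with Com\<close>

lemma smor0: "species P ==> finite X ==> inj_on h X ==> smor P X h 0 = 0"
 using linmap_zero[OF smor_linmap species_vspace] by blast

locale com = twisted_bialg P for P :: "('k::field, 'p::ab_group_add) ctbialg"
begin

abbreviation "Sq X r \<equiv> sp P (quo X r)"
abbreviation "Cq X r \<equiv> scar P (quo X r)"
abbreviation "hq h X r \<equiv> smor P (quo X r) (cls_map h)"
abbreviation "Mq X r Y s \<equiv> tmlt P (quo X r) (quo Y s)"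
abbreviation "Dq X r Y s \<equiv> tcop P (quo X r) (quo Y s)"
abbreviation "C \<equiv> com_species P"
abbreviation "sg \<equiv> sgl :: (lbl \<times> lbl) set => 'p => (lbl \<times> lbl) set \<Rightarrow>\<^sub>0 'p"
abbreviation "S \<equiv> com_sp P"

lemma vs_scl: "vector_space (sscl P)"
 using vspace_vector_space[OF tw_vs[of "{}"]] by simp

lemma sub_scar: "finite X ==> module.subspace (sscl P) (scar P X)"
 using vspace_subspace[OF tw_vs] by simp

lemma sp_C: "sp C X = S X"
 by (simp add: sp_def com_species_def com_sp_def dsum_def)

lemma scar_C: "scar C X = carr (S X)"
 by (simp add: com_species_def)

lemma sp_eta: "\<lparr>carr = scar P X, smul = sscl P\<rparr> = sp P X"
 by (simp add: sp_def)

lemma vS: "finite X ==> vspace (S X)"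
 unfolding com_sp_def by (rule vspace_dsum[OF vs_scl]) (simp add: sub_scar)

lemma sg_lin: "finite X ==> r : eqvs X ==> linmap (Sq X r) (S X) (sg r)"
 using linmap_single[where I = "eqvs X" and C = "%r. Cq X r" and i = r, OF vs_scl, unfolded sp_eta]
 by (simp add: sub_scar com_sp_def)

lemma sg_in: "finite X ==> r : eqvs X ==> p : Cq X r ==> sg r p : carr (S X)"
 using linmap_in[OF sg_lin] by simp

lemma lk_lin: "r : eqvs X ==> linmap (S X) (Sq X r) (%f. lk f r)"
 using linmap_lookup[where I = "eqvs X" and C = "%r. Cq X r" and i = r, OF vs_scl, unfolded sp_eta]
 by (simp add: com_sp_def)

lemma S_ext:
 assumes "finite X" "linmap (S X) Z f" "linmap (S X) Z g"
  "!!r p. r : eqvs X ==> p : Cq X r ==> f (sg r p) = g (sg r p)" "x : carr (S X)"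
 shows "f x = g x"
 by (rule linmap_dsum_ext[where C = "%r. Cq X r", OF vs_scl _ assms(2,3)[unfolded com_sp_def] assms(4)
   assms(5)[unfolded com_sp_def]]) (simp add: sub_scar assms(1))

lemma S_ext2:
 assumes "finite X" "finite Y" and f: "bilin (S X) (S Y) Z f" and g: "bilin (S X) (S Y) Z g"
  and eq: "!!r p s q. r : eqvs X ==> p : Cq X r ==> s : eqvs Y ==> q : Cq Y s ==> f (sg r p) (sg s q) = g (sg r p) (sg s q)"
  and xy: "x : carr (S X)" "y : carr (S Y)"
 shows "f x y = g x y"
 by (rule S_ext[OF assms(1) bilin_left[OF f xy(2)] bilin_left[OF g xy(2)] _ xy(1)],
   rule S_ext[OF assms(2) bilin_right[OF f] bilin_right[OF g] _ xy(2)])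
  (auto intro!: sg_in assms(1) eq)

lemma S_ext3:
 assumes "finite X" "finite Y" "finite W" and f: "trilin (S X) (S Y) (S W) Z f" and g: "trilin (S X) (S Y) (S W) Z g"
  and eq: "!!r p s q u t. r : eqvs X ==> p : Cq X r ==> s : eqvs Y ==> q : Cq Y s ==>
   u : eqvs W ==> t : Cq W u ==> f (sg r p) (sg s q) (sg u t) = g (sg r p) (sg s q) (sg u t)"
  and xy: "x : carr (S X)" "y : carr (S Y)" "w : carr (S W)"
 shows "f x y w = g x y w"
 by (rule S_ext[OF assms(1) trilinD(1)[OF f xy(2,3)] trilinD(1)[OF g xy(2,3)] _ xy(1)],
   rule S_ext2[OF assms(2,3) trilinD(4)[OF f] trilinD(4)[OF g] _ xy(2,3)])
  (auto intro!: sg_in assms(1) eq)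

text \<open>The structure maps of P' are sums over all equivalences; on one summand a single term
  remains, provided every term vanishes at 0.\<close>

lemma sum_lookup_single:
 assumes "finite A" "r : A" "!!s. s : A ==> G s 0 = 0"
 shows "(SUM s:A. G s (lk (sg r p) s)) = G r p"
proof -
 have "(SUM s:A. G s (lk (sg r p) s)) = (SUM s:A. if s = r then G r p else 0)"
  using assms(3) by (intro sum.cong) (auto simp: lookup_single when_def)
 then show ?thesis using assms by simp
qed

lemma smor_C_lin:
 assumes "finite X" "inj_on h X"
 shows "linmap (S X) (S (h ` X)) (smor C X h)"
proof -
 have "linmap (S X) (S (h ` X)) (%f. sg (eqv_map h r) (hq h X r (lk f r)))"
  if r: "r : eqvs X" for r
 proof (rule linmap_comp[OF sg_lin[OF finite_imageI[OF assms(1)] eqv_map_in[OF r assms(2)]]])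
  have "linmap (Sq X r) (Sq (h ` X) (eqv_map h r)) (hq h X r)"
   using smor_linmap[OF tw_species _ quo_map(2)[OF assms(1) r assms(2)]] assms(1) by (simp add: quo_map[OF assms(1) r assms(2)])
  then show "linmap (S X) (Sq (h ` X) (eqv_map h r)) (%f. hq h X r (lk f r))"
   by (rule linmap_comp) (rule lk_lin[OF r])
 qed
 then show ?thesis
  unfolding com_species_def by (simp, intro linmap_setsum vS finite_imageI assms)
qed

lemma smor_C_sg:
 assumes "finite X" "inj_on h X" "r : eqvs X" "p : Cq X r"
 shows "smor C X h (sg r p) = sg (eqv_map h r) (hq h X r p)"
 unfolding com_species_def tbialg.simps
 by (rule sum_lookup_single[OF finite_eqvs[OF assms(1)] assms(3)])
  (simp add: smor0[OF tw_species _ quo_map(2)[OF assms(1) _ assms(2)]] assms(1))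

lemma quo_map_in:
 assumes "finite X" "inj_on h X" "r : eqvs X" "p : Cq X r"
 shows "hq h X r p : Cq (h ` X) (eqv_map h r)"
 using smor_in[OF tw_species _ quo_map(2)[OF assms(1,3,2)] assms(4)] assms(1) by (simp add: quo_map[OF assms(1,3,2)])

lemma cls_map_cong:
 assumes "finite X" "r : eqvs X" "!!x. x : X ==> h x = \<tau> x" "c : quo X r"
 shows "cls_map h c = cls_map \<tau> c"
proof -
 obtain x where x: "c = cls r x" using assms(4) by (auto simp: quo_cls)
 have "h |`| Abs_fset (r `` {x}) = \<tau> |`| Abs_fset (r `` {x})"
 proof (rule fset.map_cong0)
  fix z assume "z : fset (Abs_fset (r `` {x}))"
  then show "h z = \<tau> z" using assms(3) eqvs_dom[OF assms(2)] by (auto simp: fset_class[OF assms(1,2)])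
 qed
 then show ?thesis by (simp add: x cls_def)
qed

lemma cls_map_comp: "cls_map \<tau> (cls_map h c) = cls_map (\<tau> o h) c"
 by (cases c) (auto simp: fset.map_comp)

lemma cls_map_id: "cls_map id c = c"
 by (cases c) (auto simp: fset.map_id)

lemma species_C: "species C"
 unfolding species_def sp_C scar_C
proof (intro conjI allI impI ballI)
 fix X :: "lbl set" assume X: "finite X"
 show "vspace (S X)" by (rule vS[OF X])
 show "linmap (S X) (S (h ` X)) (smor C X h)" if "inj_on h X" for h by (rule smor_C_lin[OF X that])
 show "smor C X id x = x" if x: "x : carr (S X)" for x
 proof (rule S_ext[OF X _ linmap_id _ x])
  show "linmap (S X) (S X) (smor C X id)" using smor_C_lin[OF X inj_on_id] by simp
  fix r p assume r: "r : eqvs X" "p : Cq X r"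
  have "eqv_map id r = r" by (simp add: eqv_map_def map_prod.id)
  moreover have "hq id X r p = p"
   by (rule smor_ident[OF tw_species _ r(2)]) (simp_all add: X cls_map_id)
  ultimately show "smor C X id (sg r p) = sg r p"
   by (simp add: smor_C_sg[OF X inj_on_id r])
 qed
 show "smor C X h x = smor C X \<tau> x" if s: "inj_on h X" and e: "ALL x:X. h x = \<tau> x" and x: "x : carr (S X)" for h \<tau> x
 proof -
  have t: "inj_on \<tau> X" "\<tau> ` X = h ` X" using s e by (auto simp: inj_on_cong[of X h \<tau>])
  show ?thesis
  proof (rule S_ext[OF X smor_C_lin[OF X s] _ _ x])
   show "linmap (S X) (S (h ` X)) (smor C X \<tau>)" using smor_C_lin[OF X t(1)] by (simp add: t)
   fix r p assume r: "r : eqvs X" "p : Cq X r"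
   have "hq h X r p = hq \<tau> X r p"
    using e X by (intro smor_cong[OF tw_species _ quo_map(2)[OF X r(1) s] _ r(2)] cls_map_cong[OF X r(1)]) auto
   then show "smor C X h (sg r p) = smor C X \<tau> (sg r p)"
    using eqv_map_cong[OF r(1), of h \<tau>] e by (simp add: smor_C_sg[OF X s r] smor_C_sg[OF X t(1) r])
  qed
 qed
 show "smor C X (\<tau> o h) x = smor C (h ` X) \<tau> (smor C X h x)"
  if s: "inj_on h X" and t: "inj_on \<tau> (h ` X)" and x: "x : carr (S X)" for h \<tau> x
 proof (rule S_ext[OF X _ _ _ x])
  note X' = finite_imageI[OF X, of h]
  show "linmap (S X) (S (\<tau> ` h ` X)) (smor C X (\<tau> o h))"
   using smor_C_lin[OF X comp_inj_on[OF s t]] by (simp add: image_comp)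
  show "linmap (S X) (S (\<tau> ` h ` X)) (%x. smor C (h ` X) \<tau> (smor C X h x))"
   by (rule linmap_comp[OF smor_C_lin[OF X' t] smor_C_lin[OF X s]])
  fix r p assume r: "r : eqvs X" "p : Cq X r"
  have "hq \<tau> (h ` X) (eqv_map h r) (hq h X r p) = hq (\<tau> o h) X r p"
   by (rule smor_smor[OF tw_species _ quo_map(2)[OF X r(1) s] quo_map(2)[OF X' eqv_map_in[OF r(1) s] t] quo_map(1)[OF X r(1) s, symmetric] r(2)])
    (simp_all add: X cls_map_comp)
  then show "smor C X (\<tau> o h) (sg r p) = smor C (h ` X) \<tau> (smor C X h (sg r p))"
   by (simp add: smor_C_sg[OF X comp_inj_on[OF s t] r] smor_C_sg[OF X s r]
     smor_C_sg[OF X' t eqv_map_in[OF r(1) s] quo_map_in[OF X s r]] eqv_map_comp)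
 qed
qed

section \<open>The product of P'\<close>

lemma m_quo:
 assumes "finite X" "finite Y" "X Int Y = {}" "r : eqvs X" "s : eqvs Y"
 shows "bilin (Sq X r) (Sq Y s) (Sq (X Un Y) (r Un s)) (Mq X r Y s)"
 using m_bilin[OF _ _ quo_disj[OF assms(1,2,4,5,3)]] assms(1,2) by (simp add: quo_Un[OF assms(4,5,3)])

lemma tmlt_C_lin:
 assumes "finite X" "finite Y" "X Int Y = {}"
 shows "bilin (S X) (S Y) (S (X Un Y)) (tmlt C X Y)"
proof -
 have "bilin (S X) (S Y) (S (X Un Y)) (%f g. sg (r Un s) (Mq X r Y s (lk f r) (lk g s)))"
  if "r : eqvs X" "s : eqvs Y" for r s
  using assms that
  by (intro linmap_bilin[OF sg_lin] eqvs_Un bilin_comp[OF m_quo] lk_lin) auto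
 then show ?thesis
  unfolding com_species_def using assms by (simp, intro bilin_sum vS finite_UnI)
qed

lemma tmlt_C_sg:
 assumes "finite X" "finite Y" "X Int Y = {}" "r : eqvs X" "p : Cq X r" "s : eqvs Y" "q : Cq Y s"
 shows "tmlt C X Y (sg r p) (sg s q) = sg (r Un s) (Mq X r Y s p q)"
proof -
 note z = bilin_zero[OF m_quo[OF assms(1-3)]]
 have q: "lk (sg s q) s' : Cq Y s'" if "s' : eqvs Y" for s'
  using linmap_in[OF lk_lin[OF that]] sg_in[OF assms(2,6,7)] by simp
 have fin: "vspace (Sq X r')" "vspace (Sq Y r')" for r' using assms by (auto intro: tw_vs)
 have "tmlt C X Y (sg r p) (sg s q) = (SUM r':eqvs X. SUM s':eqvs Y. sg (r' Un s')
   (Mq X r' Y s' (lk (sg r p) r') (lk (sg s q) s')))"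
  by (simp add: com_species_def)
 also have "... = (SUM s':eqvs Y. sg (r Un s') (Mq X r Y s' p (lk (sg s q) s')))"
  using q by (intro sum_lookup_single[OF finite_eqvs[OF assms(1)] assms(4), where
    G = "%r' x. SUM s':eqvs Y. sg (r' Un s') (Mq X r' Y s' x (lk (sg s q) s'))"])
   (auto intro!: sum.neutral simp: z(1) fin)
 also have "... = sg (r Un s) (Mq X r Y s p q)"
  using assms by (intro sum_lookup_single[OF finite_eqvs[OF assms(2)] assms(6), where
    G = "%s' x. sg (r Un s') (Mq X r Y s' p x)"]) (auto simp: z(2) fin)
 finally show ?thesis .
qed

lemma m_quo_in:
 assumes "finite X" "finite Y" "X Int Y = {}" "r : eqvs X" "p : Cq X r" "s : eqvs Y" "q : Cq Y s"
 shows "Mq X r Y s p q : Cq (X Un Y) (r Un s)"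
 using bilin_in[OF m_quo[OF assms(1-4,6)]] assms by simp

lemma cls_map_Un:
 assumes "finite X" "finite Y" "X Int Y = {}" "r : eqvs X" "s : eqvs Y" "inj_on h (X Un Y)"
 shows "inj_on (cls_map h) (quo X r Un quo Y s)"
 using quo_map(2)[OF _ eqvs_Un[OF assms(4,5,3)] assms(6)] assms(1,2) by (simp add: quo_Un[OF assms(4,5,3)])

lemma twisted_algebra_C: "twisted_algebra C"
 unfolding twisted_algebra_def sp_C scar_C
proof (intro conjI allI impI ballI)
 fix X Y :: "lbl set" assume X: "finite X" and Y: "finite Y" and d: "X Int Y = {}"
 show "bilin (S X) (S Y) (S (X Un Y)) (tmlt C X Y)" by (rule tmlt_C_lin[OF X Y d])
 show "smor C (X Un Y) h (tmlt C X Y x y) = tmlt C (h ` X) (h ` Y) (smor C X h x) (smor C Y h y)"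
  if s: "inj_on h (X Un Y)" and xy: "x : carr (S X)" "y : carr (S Y)" for h x y
 proof (rule S_ext2[OF X Y _ _ _ xy])
  have sX: "inj_on h X" "inj_on h Y" using s by (auto intro: inj_on_subset)
  have f: "finite (X Un Y)" "finite (h ` X)" "finite (h ` Y)" and d': "h ` X Int h ` Y = {}"
   using X Y s d by (auto simp: inj_on_image_Int[symmetric, OF s])
  show "bilin (S X) (S Y) (S (h ` (X Un Y))) (%x y. smor C (X Un Y) h (tmlt C X Y x y))"
   by (rule linmap_bilin[OF smor_C_lin[OF f(1) s] tmlt_C_lin[OF X Y d]])
  show "bilin (S X) (S Y) (S (h ` (X Un Y))) (%x y. tmlt C (h ` X) (h ` Y) (smor C X h x) (smor C Y h y))"
   unfolding image_Un by (rule bilin_comp[OF tmlt_C_lin[OF f(2,3) d'] smor_C_lin[OF X sX(1)] smor_C_lin[OF Y sX(2)]])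
  fix r p t q assume r: "r : eqvs X" "p : Cq X r" and t: "t : eqvs Y" "q : Cq Y t"
  have "hq h (X Un Y) (r Un t) (Mq X r Y t p q) =
   Mq (h ` X) (eqv_map h r) (h ` Y) (eqv_map h t) (hq h X r p) (hq h Y t q)"
   using m_nat[OF _ _ quo_disj[OF X Y r(1) t(1) d] cls_map_Un[OF X Y d r(1) t(1) s] r(2) t(2)] X Y
   by (simp add: quo_Un[OF r(1) t(1) d] quo_map[OF X r(1) sX(1)] quo_map[OF Y t(1) sX(2)])
  then show "smor C (X Un Y) h (tmlt C X Y (sg r p) (sg t q)) = tmlt C (h ` X) (h ` Y) (smor C X h (sg r p)) (smor C Y h (sg t q))"
   by (simp add: tmlt_C_sg[OF X Y d r t] smor_C_sg[OF f(1) s eqvs_Un[OF r(1) t(1) d] m_quo_in[OF X Y d r t]]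
     smor_C_sg[OF X sX(1) r] smor_C_sg[OF Y sX(2) t]
     tmlt_C_sg[OF f(2,3) d' eqv_map_in[OF r(1) sX(1)] quo_map_in[OF X sX(1) r] eqv_map_in[OF t(1) sX(2)] quo_map_in[OF Y sX(2) t]] eqv_map_Un)
 qed
 show "tmlt C (X Un Y) Z (tmlt C X Y x y) z = tmlt C X (Y Un Z) x (tmlt C Y Z y z)"
  if Z: "finite Z" and d2: "X Int Z = {}" "Y Int Z = {}" and xyz: "x : carr (S X)" "y : carr (S Y)" "z : carr (S Z)" for Z x y z
 proof (rule S_ext3[OF X Y Z _ _ _ xyz])
  have f: "finite (X Un Y)" "finite (Y Un Z)" and d3: "(X Un Y) Int Z = {}" "X Int (Y Un Z) = {}" using X Y Z d d2 by auto
  note b = tmlt_C_lin[OF X Y d] tmlt_C_lin[OF Y Z d2(2)] tmlt_C_lin[OF f(1) Z d3(1)] tmlt_C_lin[OF X f(2) d3(2)]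
  show "trilin (S X) (S Y) (S Z) (S (X Un Y Un Z)) (%x y z. tmlt C (X Un Y) Z (tmlt C X Y x y) z)"
   by (intro trilinI bilin_right[OF b(3)] bilin_left_comp[OF b(3)] bilin_left[OF b(1)] bilin_right[OF b(1)] bilin_in[OF b(1)])
  show "trilin (S X) (S Y) (S Z) (S (X Un Y Un Z)) (%x y z. tmlt C X (Y Un Z) x (tmlt C Y Z y z))"
   unfolding Un_assoc
   by (intro trilinI bilin_left[OF b(4)] bilin_right_comp[OF b(4)] bilin_left[OF b(2)] bilin_right[OF b(2)] bilin_in[OF b(2)])
  fix r p s q u t assume r: "r : eqvs X" "p : Cq X r" and s: "s : eqvs Y" "q : Cq Y s"
   and u: "u : eqvs Z" "t : Cq Z u"
  have "Mq (X Un Y) (r Un s) Z u (Mq X r Y s p q) t =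
   Mq X r (Y Un Z) (s Un u) p (Mq Y s Z u q t)"
   unfolding quo_Un[OF r(1) s(1) d] quo_Un[OF s(1) u(1) d2(2)]
   by (rule m_assoc) (use X Y Z r s u quo_disj d d2 in auto)
  then show "tmlt C (X Un Y) Z (tmlt C X Y (sg r p) (sg s q)) (sg u t) = tmlt C X (Y Un Z) (sg r p) (tmlt C Y Z (sg s q) (sg u t))"
   by (simp add: tmlt_C_sg[OF X Y d r s] tmlt_C_sg[OF Y Z d2(2) s u]
     tmlt_C_sg[OF f(1) Z d3(1) eqvs_Un[OF r(1) s(1) d] m_quo_in[OF X Y d r s] u]
     tmlt_C_sg[OF X f(2) d3(2) r eqvs_Un[OF s(1) u(1) d2(2)] m_quo_in[OF Y Z d2(2) s u]] Un_assoc)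
 qed
next
 have e: "{} : eqvs {}" by (simp add: eqvs_empty)
 have o: "tone P : Cq {} {}" by (simp add: one_in)
 have one: "tone C = sg {} (tone P)" by (simp add: com_species_def)
 show o': "tone C : carr (S {})" unfolding one by (rule sg_in[OF _ e o]) simp
 fix X :: "lbl set" and x assume X: "finite X" and x: "x : carr (S X)"
 have b: "bilin (S {}) (S X) (S X) (tmlt C {} X)" "bilin (S X) (S {}) (S X) (tmlt C X {})"
  using tmlt_C_lin[of "{}" X] tmlt_C_lin[of X "{}"] X by auto
 show "tmlt C {} X (tone C) x = x"
 proof (rule S_ext[OF X bilin_right[OF b(1) o'] linmap_id _ x])
  fix r p assume r: "r : eqvs X" "p : Cq X r"
  show "tmlt C {} X (tone C) (sg r p) = sg r p"
   unfolding one using tmlt_C_sg[OF _ X _ e o r] m_one(1)[OF _ r(2)] X by simp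
 qed
 show "tmlt C X {} x (tone C) = x"
 proof (rule S_ext[OF X bilin_left[OF b(2) o'] linmap_id _ x])
  fix r p assume r: "r : eqvs X" "p : Cq X r"
  show "tmlt C X {} (sg r p) (tone C) = sg r p"
   unfolding one using tmlt_C_sg[OF X _ _ r e o] m_one(2)[OF _ r(2)] X by simp
 qed
qed

section \<open>The first coproduct of P'\<close>

lemma D_quo:
 assumes "finite X" "finite Y" "X Int Y = {}" "r : eqvs X" "s : eqvs Y"
 shows "linmap (Sq (X Un Y) (r Un s)) (Sq X r >< Sq Y s) (Dq X r Y s)"
 using D_lin[OF _ _ quo_disj[OF assms(1,2,4,5,3)]] assms(1,2) by (simp add: quo_Un[OF assms(4,5,3)])

lemma D_quo_in:
 assumes "finite X" "finite Y" "X Int Y = {}" "r : eqvs X" "s : eqvs Y" "p : Cq (X Un Y) (r Un s)"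
 shows "Dq X r Y s p : carr (Sq X r >< Sq Y s)"
 using linmap_in[OF D_quo[OF assms(1-5)]] assms(6) by simp

lemma tcop_C_lin:
 assumes "finite X" "finite Y" "X Int Y = {}"
 shows "linmap (S (X Un Y)) (S X >< S Y) (tcop C X Y)"
proof -
 have "linmap (S (X Un Y)) (S X >< S Y) (%f. tmap (S X) (S Y) (sg r) (sg s) (Dq X r Y s (lk f (r Un s))))"
  if rs: "r : eqvs X" "s : eqvs Y" for r s
 proof (rule linmap_comp[OF linmap_tmap])
  show "linmap (S (X Un Y)) (Sq X r >< Sq Y s) (%f. Dq X r Y s (lk f (r Un s)))"
   by (rule linmap_comp[OF D_quo[OF assms rs] lk_lin[OF eqvs_Un[OF rs assms(3)]]])
 qed (use assms rs in \<open>auto intro: tw_vs vS sg_lin\<close>)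
 then show ?thesis
  unfolding com_species_def by (simp, intro linmap_setsum vspace_tensor)
qed

lemma tcop_C_sg:
 assumes "finite X" "finite Y" "X Int Y = {}" "r : eqvs X" "s : eqvs Y" "p : Cq (X Un Y) (r Un s)"
 shows "tcop C X Y (sg (r Un s) p) = tmap (S X) (S Y) (sg r) (sg s) (Dq X r Y s p)"
proof -
 let ?G = "%(r', s') x. tmap (S X) (S Y) (sg r') (sg s') (Dq X r' Y s' x)"
 have z: "?G z 0 = 0" if "z : eqvs X \<times> eqvs Y" for z
  using that linmap_zero[OF D_quo[OF assms(1-3)] tw_vs] assms(1,2) by (auto simp: tmap_def)
 \<comment> \<open>The two parts of a split equivalence are its restrictions, hence unique, so only
   one pair of indices reads off the given summand.\<close>
 have u: "r' = r & s' = s" if "r' : eqvs X" "s' : eqvs Y" "r' Un s' = r Un s" for r' s'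
  using Un_restrict[OF that(1,2) assms(3)] Un_restrict[OF assms(4,5,3)] that(3) by metis
 have "tcop C X Y (sg (r Un s) p) = (SUM z:eqvs X \<times> eqvs Y. ?G z (lk (sg (r Un s) p) (fst z Un snd z)))"
  by (simp add: com_species_def sum.cartesian_product case_prod_beta)
 also have "... = (SUM z:eqvs X \<times> eqvs Y. if z = (r, s) then ?G (r, s) p else 0)"
 proof (rule sum.cong[OF refl])
  fix z assume z': "z : eqvs X \<times> eqvs Y"
  then have "fst z Un snd z = r Un s \<longleftrightarrow> z = (r, s)" using u[of "fst z" "snd z"] by (cases z) auto
  then show "?G z (lk (sg (r Un s) p) (fst z Un snd z)) = (if z = (r, s) then ?G (r, s) p else 0)"
   using z[OF z'] by (auto simp: lookup_single when_def)
 qed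
 also have "... = ?G (r, s) p"
  using assms finite_eqvs by (simp add: sum.delta)
 finally show ?thesis by simp
qed

text \<open>No index pair has union \<open>t\<close>, so every coefficient that is read off is
  0.\<close>

lemma tcop_C_0:
 assumes "finite X" "finite Y" "X Int Y = {}" "\<not> splits X Y t" "t : eqvs (X Un Y)"
 shows "tcop C X Y (sg t p) = 0"
proof -
 have "lk (sg t p) (r Un s) = 0" if "r : eqvs X" "s : eqvs Y" for r s
  using splits_Un[OF that] assms(4) by (auto simp: lookup_single when_def)
 moreover have "Dq X r Y s 0 = 0" if "r : eqvs X" "s : eqvs Y" for r s
  using linmap_zero[OF D_quo[OF assms(1-3) that] tw_vs] assms(1,2) by simp
 ultimately show ?thesis
  by (simp add: com_species_def tmap_def)
qed

lemma tlift_tcop_C: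
 assumes "finite X" "finite Y" "X Int Y = {}" "r : eqvs X" "s : eqvs Y" "p : Cq (X Un Y) (r Un s)"
  and "vspace Z" "bilin (S X) (S Y) Z be"
 shows "tL Z be (tcop C X Y (sg (r Un s) p)) = tL Z (%a b. be (sg r a) (sg s b)) (Dq X r Y s p)"
 unfolding tcop_C_sg[OF assms(1-6)]
 by (rule tlift_tmap[OF tw_vs tw_vs D_quo_in[OF assms(1-6)] vS vS assms(7,8)]) (use assms in \<open>auto intro: sg_in\<close>)

lemma tcop_C_in: "finite X ==> finite Y ==> X Int Y = {} ==> x : carr (S (X Un Y)) ==> tcop C X Y x : carr (S X >< S Y)"
 by (rule linmap_in[OF tcop_C_lin])

end

context com
begin

lemma tlift_tcop_C_0:
 assumes "finite X" "finite Y" "X Int Y = {}" "\<not> splits X Y t" "t : eqvs (X Un Y)"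
 shows "tL Z be (tcop C X Y (sg t p)) = 0"
 by (simp add: tcop_C_0[OF assms])

lemma twisted_coalgebra_C: "twisted_coalgebra C"
 unfolding twisted_coalgebra_def sp_C scar_C
proof (intro conjI allI impI ballI)
 fix X Y :: "lbl set" assume X: "finite X" and Y: "finite Y" and d: "X Int Y = {}"
 show "linmap (S (X Un Y)) (S X >< S Y) (tcop C X Y)" by (rule tcop_C_lin[OF X Y d])
 have XY: "finite (X Un Y)" using X Y by simp
 show "tcop C (h ` X) (h ` Y) (smor C (X Un Y) h x) = tmap (S (h ` X)) (S (h ` Y)) (smor C X h) (smor C Y h) (tcop C X Y x)"
  if s: "inj_on h (X Un Y)" and x: "x : carr (S (X Un Y))" for h x
 proof (rule S_ext[OF XY _ _ _ x])
  have sX: "inj_on h X" "inj_on h Y" using s by (auto intro: inj_on_subset)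
  have f: "finite (h ` X)" "finite (h ` Y)" and d': "h ` X Int h ` Y = {}"
   using X Y s d by (auto simp: inj_on_image_Int[symmetric, OF s])
  show "linmap (S (X Un Y)) (S (h ` X) >< S (h ` Y)) (%x. tcop C (h ` X) (h ` Y) (smor C (X Un Y) h x))"
   by (rule linmap_comp[OF tcop_C_lin[OF f d', folded image_Un] smor_C_lin[OF XY s]])
  show "linmap (S (X Un Y)) (S (h ` X) >< S (h ` Y)) (%x. tmap (S (h ` X)) (S (h ` Y)) (smor C X h) (smor C Y h) (tcop C X Y x))"
   by (rule linmap_comp[OF linmap_tmap tcop_C_lin[OF X Y d]]) (intro vS X Y f smor_C_lin sX)+
  fix t p assume t: "t : eqvs (X Un Y)" "p : Cq (X Un Y) t"
  have L: "smor C (X Un Y) h (sg t p) = sg (eqv_map h t) (hq h (X Un Y) t p)"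
   by (rule smor_C_sg[OF XY s t])
  show "tcop C (h ` X) (h ` Y) (smor C (X Un Y) h (sg t p)) = tmap (S (h ` X)) (S (h ` Y)) (smor C X h) (smor C Y h) (tcop C X Y (sg t p))"
  proof (cases "splits X Y t")
   case False
   \<comment> \<open>A bijection preserves related pairs across the two parts, so both sides
     vanish.\<close>
   then have "\<not> splits (h ` X) (h ` Y) (eqv_map h t)"
    using splits_disj[OF t(1) d] splits_disj[OF eqv_map_in[OF t(1) s, unfolded image_Un] d'] eqv_map_iff[OF t(1) s] by auto
   from tcop_C_0[OF f d' this eqv_map_in[OF t(1) s, unfolded image_Un]] tcop_C_0[OF X Y d False t(1)]
   show ?thesis unfolding L by (simp add: tmap_def)
  next
   case True
   then obtain r u where r: "r : eqvs X" and u: "u : eqvs Y" and tt: "t = r Un u" using splitsE t(1) by metis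
   note p = t(2)[unfolded tt]
   note r' = eqv_map_in[OF r sX(1)] and u' = eqv_map_in[OF u sX(2)]
   have q: "finite (quo X r)" "finite (quo Y u)" "finite (quo (h ` X) (eqv_map h r))" "finite (quo (h ` Y) (eqv_map h u))" using X Y by auto
   have p': "hq h (X Un Y) (r Un u) p : Cq (h ` X Un h ` Y) (eqv_map h r Un eqv_map h u)"
    using quo_map_in[OF XY s t] by (simp add: tt image_Un eqv_map_Un)
   have Dn: "Dq (h ` X) (eqv_map h r) (h ` Y) (eqv_map h u) (hq h (X Un Y) (r Un u) p) =
    tmap (Sq (h ` X) (eqv_map h r)) (Sq (h ` Y) (eqv_map h u)) (hq h X r) (hq h Y u)
     (Dq X r Y u p)"
    using D_nat[OF q(1,2) quo_disj[OF X Y r u d] cls_map_Un[OF X Y d r u s]] p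
    by (simp add: quo_Un[OF r u d] quo_map[OF X r sX(1)] quo_map[OF Y u sX(2)])
   have sl: "linmap (Sq X r) (Sq (h ` X) (eqv_map h r)) (hq h X r)"
    "linmap (Sq Y u) (Sq (h ` Y) (eqv_map h u)) (hq h Y u)"
    using smor_linmap[OF tw_species q(1) quo_map(2)[OF X r sX(1)]] smor_linmap[OF tw_species q(2) quo_map(2)[OF Y u sX(2)]]
    by (simp_all add: quo_map[OF X r sX(1)] quo_map[OF Y u sX(2)])
   note c = D_quo_in[OF X Y d r u p]
   have "tcop C (h ` X) (h ` Y) (smor C (X Un Y) h (sg t p)) =
    tmap (S (h ` X)) (S (h ` Y)) (%x. sg (eqv_map h r) (hq h X r x)) (%x. sg (eqv_map h u) (hq h Y u x))
     (Dq X r Y u p)"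
    unfolding L unfolding tt eqv_map_Un tcop_C_sg[OF f d' r' u' p'] Dn
    by (rule tmap_tmap[OF tw_vs[OF q(1)] tw_vs[OF q(2)] c tw_vs[OF q(3)] tw_vs[OF q(4)] vS[OF f(1)] vS[OF f(2)] sg_lin[OF f(1) r'] sg_lin[OF f(2) u']])
     (use linmap_in[OF sl(1)] linmap_in[OF sl(2)] in auto)
   also have "... = tmap (S (h ` X)) (S (h ` Y)) (%x. smor C X h (sg r x)) (%x. smor C Y h (sg u x)) (Dq X r Y u p)"
    by (rule tmap_cong[OF tw_vs[OF q(1)] tw_vs[OF q(2)] c]) (simp_all add: smor_C_sg[OF X sX(1) r] smor_C_sg[OF Y sX(2) u])
   also have "... = tmap (S (h ` X)) (S (h ` Y)) (smor C X h) (smor C Y h) (tcop C X Y (sg t p))"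
    unfolding tt tcop_C_sg[OF X Y d r u p]
    by (rule tmap_tmap[OF tw_vs[OF q(1)] tw_vs[OF q(2)] c vS[OF X] vS[OF Y] vS[OF f(1)] vS[OF f(2)] smor_C_lin[OF X sX(1)] smor_C_lin[OF Y sX(2)], symmetric])
     (auto intro: sg_in X Y r u)
   finally show ?thesis .
  qed
 qed
 show "tassoc (S X) (S Y) (S Z) (tmap (S X >< S Y) (S Z) (tcop C X Y) id (tcop C (X Un Y) Z x)) =
   tmap (S X) (S Y >< S Z) id (tcop C Y Z) (tcop C X (Y Un Z) x)"
  if Z: "finite Z" and d2: "X Int Z = {}" "Y Int Z = {}" and x: "x : carr (S (X Un Y Un Z))" for Z x
 proof -
  have f: "finite (X Un Y)" "finite (Y Un Z)" "finite (X Un Y Un Z)" and d3: "(X Un Y) Int Z = {}" "X Int (Y Un Z) = {}" using X Y Z d d2 by auto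
  let ?W = "S X >< S Y >< S Z" and ?T = "%a b c. tens (S X) (S Y >< S Z) a (tens (S Y) (S Z) b c)"
  note vs = vS[OF X] vS[OF Y] vS[OF Z] and W = vspace_tensor[of "S X" "S Y >< S Z"]
  have T: "trilin (S X) (S Y) (S Z) ?W ?T" by (rule trilin_tens[OF vs])
  have x': "x : carr (S (X Un (Y Un Z)))" using x by (simp add: Un_assoc)
  have bL: "bilin (S (X Un Y)) (S Z) ?W (%a c. tL ?W (%a b. ?T a b c) (tcop C X Y a))"
   using bilin_comp[OF linmap_tlift_trilin(1)[OF vs W T] tcop_C_lin[OF X Y d] linmap_id] .
  have bR: "bilin (S X) (S (Y Un Z)) ?W (%a b. tL ?W (?T a) (tcop C Y Z b))"
   using bilin_comp[OF linmap_tlift_trilin(2)[OF vs W T] linmap_id tcop_C_lin[OF Y Z d2(2)]] .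
  have "tL ?W (%a c. tL ?W (%a b. ?T a b c) (tcop C X Y a)) (tcop C (X Un Y) Z x) =
   tL ?W (%a b. tL ?W (?T a) (tcop C Y Z b)) (tcop C X (Y Un Z) x)"
  proof (rule S_ext[OF f(3) _ _ _ x])
   show "linmap (S (X Un Y Un Z)) ?W (%x. tL ?W (%a c. tL ?W (%a b. ?T a b c) (tcop C X Y a)) (tcop C (X Un Y) Z x))"
    by (rule linmap_tlift_arg[OF vS[OF f(1)] vs(3) W bL tcop_C_lin[OF f(1) Z d3(1)]])
   show "linmap (S (X Un Y Un Z)) ?W (%x. tL ?W (%a b. tL ?W (?T a) (tcop C Y Z b)) (tcop C X (Y Un Z) x))"
    unfolding Un_assoc by (rule linmap_tlift_arg[OF vs(1) vS[OF f(2)] W bR tcop_C_lin[OF X f(2) d3(2)]])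
   fix t p assume t: "t : eqvs (X Un Y Un Z)" "p : Cq (X Un Y Un Z) t"
   note t' = t[unfolded Un_assoc]
   show "tL ?W (%a c. tL ?W (%a b. ?T a b c) (tcop C X Y a)) (tcop C (X Un Y) Z (sg t p)) =
    tL ?W (%a b. tL ?W (?T a) (tcop C Y Z b)) (tcop C X (Y Un Z) (sg t p))"
   \<comment> \<open>Either the equivalence splits into three parts and the law is that of
     \<open>P\<close> on the three quotients, or it does not and each side vanishes
     separately.\<close>
   proof (cases "\<exists>r s u. r : eqvs X & s : eqvs Y & u : eqvs Z & t = r Un s Un u")
    case True
    then obtain r s u where r: "r : eqvs X" and s: "s : eqvs Y" and u: "u : eqvs Z" and tt: "t = r Un s Un u" by blast
    have rs: "r Un s : eqvs (X Un Y)" and su: "s Un u : eqvs (Y Un Z)" by (rule eqvs_Un[OF r s d], rule eqvs_Un[OF s u d2(2)])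
    note p = t(2)[unfolded tt] and p' = t'(2)[unfolded tt Un_assoc]
    have q: "finite (quo X r)" "finite (quo Y s)" "finite (quo Z u)" using X Y Z by auto
    have qd: "quo X r Int quo Y s = {}" "quo X r Int quo Z u = {}" "quo Y s Int quo Z u = {}"
     by (rule quo_disj[OF X Y r s d] quo_disj[OF X Z r u d2(1)] quo_disj[OF Y Z s u d2(2)])+
    have qu: "quo (X Un Y) (r Un s) = quo X r Un quo Y s" "quo (Y Un Z) (s Un u) = quo Y s Un quo Z u"
     by (rule quo_Un[OF r s d] quo_Un[OF s u d2(2)])+
    have pq: "p : scar P (quo X r Un quo Y s Un quo Z u)"
     using p by (simp add: quo_Un[OF rs u d3(1)] qu)
    have "tL ?W (%a c. tL ?W (%a b. ?T a b c) (tcop C X Y a)) (tcop C (X Un Y) Z (sg t p)) =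
     tL ?W (%a c. tL ?W (%a b. ?T a b (sg u c)) (tcop C X Y (sg (r Un s) a))) (Dq (X Un Y) (r Un s) Z u p)"
     unfolding tt by (rule tlift_tcop_C[OF f(1) Z d3(1) rs u p W bL])
    also have "... = tL ?W (%a c. tL ?W (%a b. ?T (sg r a) (sg s b) (sg u c)) (Dq X r Y s a)) (Dq (X Un Y) (r Un s) Z u p)"
     by (intro tlift_cong[OF tw_vs tw_vs D_quo_in[OF f(1) Z d3(1) rs u p]] tlift_tcop_C[OF X Y d r s _ W trilinD(6)[OF T]])
      (use f Z u in \<open>auto intro: sg_in\<close>)
    also have "... = tL ?W (%a b. tL ?W (%b c. ?T (sg r a) (sg s b) (sg u c)) (Dq Y s Z u b)) (Dq X r (Y Un Z) (s Un u) p)"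
     unfolding qu by (rule D_coassoc_int[OF q qd pq W trilin_comp[OF T sg_lin[OF X r] sg_lin[OF Y s] sg_lin[OF Z u]]])
    also have "... = tL ?W (%a b. tL ?W (?T (sg r a)) (tcop C Y Z (sg (s Un u) b))) (Dq X r (Y Un Z) (s Un u) p)"
     by (intro tlift_cong[OF tw_vs tw_vs D_quo_in[OF X f(2) d3(2) r su p']] tlift_tcop_C[OF Y Z d2(2) s u _ W trilinD(4)[OF T], symmetric])
      (use f X r in \<open>auto intro: sg_in\<close>)
    also have "... = tL ?W (%a b. tL ?W (?T a) (tcop C Y Z b)) (tcop C X (Y Un Z) (sg t p))"
     unfolding tt Un_assoc by (rule tlift_tcop_C[OF X f(2) d3(2) r su p' W bR, symmetric])
    finally show ?thesis .
   next
    case False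
    \<comment> \<open>If the outer coproduct does not already vanish, its first part cannot split
      further, and the inner coproduct vanishes.\<close>
    have L: "tL ?W (%a c. tL ?W (%a b. ?T a b c) (tcop C X Y a)) (tcop C (X Un Y) Z (sg t p)) = 0"
    proof (cases "splits (X Un Y) Z t")
     case True
     then obtain rs u where rs: "rs : eqvs (X Un Y)" and u: "u : eqvs Z" and tt: "t = rs Un u" using splitsE t(1) by metis
     have n: "\<not> splits X Y rs" using False rs u tt splitsE by metis
     have "tL ?W (%a c. tL ?W (%a b. ?T a b c) (tcop C X Y a)) (tcop C (X Un Y) Z (sg t p)) =
      tL ?W (%a c. tL ?W (%a b. ?T a b (sg u c)) (tcop C X Y (sg rs a))) (Dq (X Un Y) rs Z u p)"
      unfolding tt by (rule tlift_tcop_C[OF f(1) Z d3(1) rs u t(2)[unfolded tt] W bL])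
     then show ?thesis by (simp add: tlift_tcop_C_0[OF X Y d n rs] tlift_zero_param[OF W])
    qed (rule tlift_tcop_C_0[OF f(1) Z d3(1) _ t(1)])
    have R: "tL ?W (%a b. tL ?W (?T a) (tcop C Y Z b)) (tcop C X (Y Un Z) (sg t p)) = 0"
    proof (cases "splits X (Y Un Z) t")
     case True
     then obtain r su where r: "r : eqvs X" and su: "su : eqvs (Y Un Z)" and tt: "t = r Un su" using splitsE t'(1) by metis
     have n: "\<not> splits Y Z su" using False r su tt splitsE[of Y Z su] by (metis Un_assoc)
     have "tL ?W (%a b. tL ?W (?T a) (tcop C Y Z b)) (tcop C X (Y Un Z) (sg t p)) =
      tL ?W (%a b. tL ?W (?T (sg r a)) (tcop C Y Z (sg su b))) (Dq X r (Y Un Z) su p)"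
      unfolding tt by (rule tlift_tcop_C[OF X f(2) d3(2) r su t'(2)[unfolded tt] W bR])
     then show ?thesis by (simp add: tlift_tcop_C_0[OF Y Z d2(2) n su] tlift_zero_param[OF W])
    qed (rule tlift_tcop_C_0[OF X f(2) d3(2) _ t'(1)])
    show ?thesis unfolding L R ..
   qed
  qed
  then show ?thesis
   using tassoc_tmap_eq[OF vs vS[OF f(1)] tcop_C_in[OF X Y d] tcop_C_in[OF f(1) Z d3(1) x]]
    tmap_id_eq[OF vs vS[OF f(2)] tcop_C_in[OF Y Z d2(2)] tcop_C_in[OF X f(2) d3(2) x']] by simp
 qed
next
 have e: "{} : eqvs {}" by (simp add: eqvs_empty)
 have tc: "tcou C = (%f. tcou P (lk f {}))" by (simp add: com_species_def)
 show c: "linmap (S {}) ground (tcou C)"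
  unfolding tc using linmap_comp[OF cou_lin lk_lin[OF e, unfolded quo_empty]] by simp
 have v0: "vspace (S {})" by (rule vS) simp
 have sscl: "sscl C = smul (S X)" for X by (simp add: com_species_def com_sp_def dsum_def)
 fix X :: "lbl set" and x assume X: "finite X" and x: "x : carr (S X)"
 note b = bilin_ground_scale[OF vS[OF X] c]
 have lin: "linmap (S X) (S {} >< S X) (tcop C {} X)" "linmap (S X) (S X >< S {}) (tcop C X {})"
  using tcop_C_lin[of "{}" X] tcop_C_lin[of X "{}"] X by auto
 have ts: "tcou C (sg {} a) = tcou P a" for a by (simp add: tc)
 note sl = linmap_scale[OF sg_lin[OF X]]
 show "tL (S X) (%a b. sscl C (tcou C a) b) (tcop C {} X x) = x"
  unfolding sscl[of X]
 proof (rule S_ext[OF X _ linmap_id _ x])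
  show "linmap (S X) (S X) (%x. tL (S X) (%a. smul (S X) (tcou C a)) (tcop C {} X x))"
   by (rule linmap_tlift_arg[OF v0 vS[OF X] vS[OF X] b(1) lin(1)])
  fix r p assume r: "r : eqvs X" and p: "p : Cq X r"
  have qf: "finite (quo X r)" using X by simp
  note ci = D_in[of "{}" "quo X r" p, simplified, OF qf p]
  have "tL (S X) (%a. smul (S X) (tcou C a)) (tcop C {} X (sg ({} Un r) p)) =
   tL (S X) (%a b. smul (S X) (tcou C (sg {} a)) (sg r b)) (Dq {} {} X r p)"
   by (rule tlift_tcop_C[OF _ X _ e r _ vS[OF X] b(1)]) (use p in auto)
  also have "... = tL (S X) (%a b. sg r (sscl P (tcou P a) b)) (tcop P {} (quo X r) p)"
   using ci by (simp, intro tlift_cong[OF tw_vs tw_vs]) (use X sl[OF r] in \<open>auto simp: ts\<close>)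
  also have "... = sg r (tL (Sq X r) (%a b. sscl P (tcou P a) b) (tcop P {} (quo X r) p))"
   by (rule linmap_of_tlift[OF tw_vs tw_vs ci sg_lin[OF X r] tw_vs, symmetric])
    (use X vspace_scale[OF tw_vs[OF qf]] in auto)
  finally show "tL (S X) (%a. smul (S X) (tcou C a)) (tcop C {} X (sg r p)) = sg r p"
   by (simp add: D_counit qf p)
 qed
 show "tL (S X) (%a b. sscl C (tcou C b) a) (tcop C X {} x) = x"
  unfolding sscl[of X]
 proof (rule S_ext[OF X _ linmap_id _ x])
  show "linmap (S X) (S X) (%x. tL (S X) (%a b. smul (S X) (tcou C b) a) (tcop C X {} x))"
   by (rule linmap_tlift_arg[OF vS[OF X] v0 vS[OF X] b(2) lin(2)])
  fix r p assume r: "r : eqvs X" and p: "p : Cq X r"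
  have qf: "finite (quo X r)" using X by simp
  note ci = D_in[of "quo X r" "{}" p, simplified, OF qf p]
  have "tL (S X) (%a b. smul (S X) (tcou C b) a) (tcop C X {} (sg (r Un {}) p)) =
   tL (S X) (%a b. smul (S X) (tcou C (sg {} b)) (sg r a)) (Dq X r {} {} p)"
   by (rule tlift_tcop_C[OF X _ _ r e _ vS[OF X] b(2)]) (use p in auto)
  also have "... = tL (S X) (%a b. sg r (sscl P (tcou P b) a)) (tcop P (quo X r) {} p)"
   using ci by (simp, intro tlift_cong[OF tw_vs tw_vs]) (use X sl[OF r] in \<open>auto simp: ts\<close>)
  also have "... = sg r (tL (Sq X r) (%a b. sscl P (tcou P b) a) (tcop P (quo X r) {} p))"
   by (rule linmap_of_tlift[OF tw_vs tw_vs ci sg_lin[OF X r] tw_vs, symmetric])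
    (use X vspace_scale[OF tw_vs[OF qf]] in auto)
  finally show "tL (S X) (%a b. smul (S X) (tcou C b) a) (tcop C X {} (sg r p)) = sg r p"
   by (simp add: D_counit qf p)
 qed
qed

lemma tcop_tmlt_C:
 assumes fin: "finite (I Un J)" and U: "I Un J = I' Un J'" and d: "I Int J = {}" "I' Int J' = {}"
  and xy: "x : carr (S I')" "y : carr (S J')"
 shows "tcop C I J (tmlt C I' J' x y) =
  tmul (S I) (S J) (tmlt C (I' Int I) (J' Int I)) (tmlt C (I' Int J) (J' Int J)) (tcop C (I' Int I) (I' Int J) x) (tcop C (J' Int I) (J' Int J) y)"
proof -
 \<comment> \<open>The four blocks cut out by the two decompositions; naming them removes the
   intersections from the product and coproduct indices.\<close>
 define A B D E where "A = I' Int I" and "B = I' Int J" and "D = J' Int I" and "E = J' Int J"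
 have un: "A Un B = I'" "D Un E = J'" "A Un D = I" "B Un E = J"
  and dis: "A Int B = {}" "D Int E = {}" "A Int D = {}" "B Int E = {}"
  using U d by (auto simp: A_def B_def D_def E_def)
 have fI: "finite I" "finite J" "finite I'" "finite J'" using fin U by (metis finite_Un)+
 have fA: "finite A" "finite B" "finite D" "finite E" using fI by (auto simp: A_def B_def D_def E_def)
 note vA = vS[OF fA(1)] vS[OF fA(2)] vS[OF fA(3)] vS[OF fA(4)] and vI = vS[OF fI(1)] vS[OF fI(2)]
 have mb: "bilin (S A) (S D) (S I) (tmlt C A D)" "bilin (S B) (S E) (S J) (tmlt C B E)"
  using tmlt_C_lin[OF fA(1,3) dis(3)] tmlt_C_lin[OF fA(2,4) dis(4)] by (simp_all add: un)
 have cl: "linmap (S I') (S A >< S B) (tcop C A B)" "linmap (S J') (S D >< S E) (tcop C D E)"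
  using tcop_C_lin[OF fA(1,2) dis(1)] tcop_C_lin[OF fA(3,4) dis(2)] by (simp_all add: un)
 have "tcop C I J (tmlt C I' J' x y) = tmul (S I) (S J) (tmlt C A D) (tmlt C B E) (tcop C A B x) (tcop C D E y)"
 proof (rule S_ext2[OF fI(3,4) _ _ _ xy])
  have "bilin (S I') (S J') (S (I Un J)) (tmlt C I' J')" unfolding U by (rule tmlt_C_lin[OF fI(3,4) d(2)])
  then show "bilin (S I') (S J') (S I >< S J) (%x y. tcop C I J (tmlt C I' J' x y))"
   by (rule linmap_bilin[OF tcop_C_lin[OF fI(1,2) d(1)]])
  show "bilin (S I') (S J') (S I >< S J) (%x y. tmul (S I) (S J) (tmlt C A D) (tmlt C B E) (tcop C A B x) (tcop C D E y))"
   by (rule bilin_comp[OF bilin_tmul[OF vA vI mb] cl])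
  fix r p s q assume r: "r : eqvs I'" "p : Cq I' r" and s: "s : eqvs J'" "q : Cq J' s"
  have rs: "r Un s : eqvs (I Un J)" unfolding U by (rule eqvs_Un[OF r(1) s(1) d(2)])
  have m: "tmlt C I' J' (sg r p) (sg s q) = sg (r Un s) (Mq I' r J' s p q)"
   by (rule tmlt_C_sg[OF fI(3,4) d(2) r s])
  show "tcop C I J (tmlt C I' J' (sg r p) (sg s q)) =
   tmul (S I) (S J) (tmlt C A D) (tmlt C B E) (tcop C A B (sg r p)) (tcop C D E (sg s q))"
  proof (cases "splits A B r & splits D E s")
   case False
   \<comment> \<open>A pair related across \<open>I\<close> and \<open>J\<close> inside one factor
     remains related in the union, so a failure to split in one factor makes both sides 0.\<close>
   have ns: "\<not> splits I J (r Un s)"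
    using False splits_disj[OF _ dis(1), of r] splits_disj[OF _ dis(2), of s] r(1) s(1) un splits_disj[OF rs d(1)]
    unfolding A_def B_def D_def E_def by auto
   have "tcop C A B (sg r p) = 0 \<or> tcop C D E (sg s q) = 0"
    using False tcop_C_0[OF fA(1,2) dis(1), of r p] tcop_C_0[OF fA(3,4) dis(2), of s q] r(1) s(1) un by auto
   then show ?thesis
    unfolding m tcop_C_0[OF fI(1,2) d(1) ns rs] by (auto simp: tmul_def tlift_zero_param[OF vspace_tensor])
  next
   case True
   obtain rA rB where rA: "rA : eqvs A" and rB: "rB : eqvs B" and r': "r = rA Un rB"
    using True splitsE[of A B r] r(1) un by metis
   obtain sD sE where sD: "sD : eqvs D" and sE: "sE : eqvs E" and s': "s = sD Un sE"
    using True splitsE[of D E s] s(1) un by metis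
   have rs': "r Un s = (rA Un sD) Un (rB Un sE)" using r' s' by auto
   note IJ = eqvs_Un[OF rA sD dis(3), unfolded un] eqvs_Un[OF rB sE dis(4), unfolded un]
   have qI: "quo I (rA Un sD) = quo A rA Un quo D sD" "quo J (rB Un sE) = quo B rB Un quo E sE"
    "quo I' r = quo A rA Un quo B rB" "quo J' s = quo D sD Un quo E sE"
    using quo_Un[OF rA sD dis(3)] quo_Un[OF rB sE dis(4)] quo_Un[OF rA rB dis(1)] quo_Un[OF sD sE dis(2)]
    unfolding un r' s' .
   have dd: "A Int E = {}" "B Int D = {}" using d by (auto simp: A_def B_def D_def E_def)
   have qd: "quo A rA Int quo B rB = {}" "quo A rA Int quo D sD = {}" "quo A rA Int quo E sE = {}"
     "quo B rB Int quo D sD = {}" "quo B rB Int quo E sE = {}" "quo D sD Int quo E sE = {}"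
    by (rule quo_disj[OF fA(1,2) rA rB dis(1)] quo_disj[OF fA(1,3) rA sD dis(3)] quo_disj[OF fA(1,4) rA sE dd(1)]
     quo_disj[OF fA(2,3) rB sD dd(2)] quo_disj[OF fA(2,4) rB sE dis(4)] quo_disj[OF fA(3,4) sD sE dis(2)])+
   have qi: "quo I' r Int quo I (rA Un sD) = quo A rA" "quo I' r Int quo J (rB Un sE) = quo B rB"
    "quo J' s Int quo I (rA Un sD) = quo D sD" "quo J' s Int quo J (rB Un sE) = quo E sE"
    unfolding qI using qd by blast+
   have qf: "finite (quo A rA)" "finite (quo B rB)" "finite (quo D sD)" "finite (quo E sE)"
    "finite (quo I (rA Un sD))" "finite (quo J (rB Un sE))" using fA fI by auto
   note qv = tw_vs[OF qf(1)] tw_vs[OF qf(2)] tw_vs[OF qf(3)] tw_vs[OF qf(4)] tw_vs[OF qf(5)] tw_vs[OF qf(6)]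
   have DP: "Dq I (rA Un sD) J (rB Un sE) (Mq I' r J' s p q) =
    tmul (Sq I (rA Un sD)) (Sq J (rB Un sE)) (Mq A rA D sD) (Mq B rB E sE)
     (Dq A rA B rB p) (Dq D sD E sE q)"
    using D_m[of "quo I (rA Un sD)" "quo J (rB Un sE)" "quo I' r" "quo J' s" p q] qf r(2) s(2)
    unfolding qi using qI quo_disj[OF fI(1,2) IJ d(1)] quo_disj[OF fI(3,4) r(1) s(1) d(2)] by (simp add: Un_ac)
   have mp: "Mq I' r J' s p q : Cq (I Un J) ((rA Un sD) Un (rB Un sE))"
    using m_quo_in[OF fI(3,4) d(2) r s] unfolding U rs' .
   have p': "p : Cq (A Un B) (rA Un rB)" "q : Cq (D Un E) (sD Un sE)"
    using r(2) s(2) unfolding un r' s' .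
   have ci: "Dq A rA B rB p : carr (Sq A rA >< Sq B rB)"
    "Dq D sD E sE q : carr (Sq D sD >< Sq E sE)"
    by (rule D_quo_in[OF fA(1,2) dis(1) rA rB p'(1)], rule D_quo_in[OF fA(3,4) dis(2) sD sE p'(2)])
   have mq: "bilin (Sq A rA) (Sq D sD) (Sq I (rA Un sD)) (Mq A rA D sD)"
    "bilin (Sq B rB) (Sq E sE) (Sq J (rB Un sE)) (Mq B rB E sE)"
    using m_quo[OF fA(1,3) dis(3) rA sD] m_quo[OF fA(2,4) dis(4) rB sE] unfolding un .
   let ?W = "S I >< S J"
   have tb: "bilin (S I) (S J) ?W (tens (S I) (S J))" by (rule bilin_tens[OF vI])
   have "tcop C I J (tmlt C I' J' (sg r p) (sg s q)) =
    tL ?W (%a b. tens (S I) (S J) (sg (rA Un sD) a) (sg (rB Un sE) b)) (Dq I (rA Un sD) J (rB Un sE) (Mq I' r J' s p q))"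
    unfolding m unfolding rs' tcop_C_sg[OF fI(1,2) d(1) IJ mp] tmap_def ..
   also have "... = tL ?W (%a b. tL ?W (%c e. tens (S I) (S J) (sg (rA Un sD) (Mq A rA D sD a c)) (sg (rB Un sE) (Mq B rB E sE b e)))
     (Dq D sD E sE q)) (Dq A rA B rB p)"
    unfolding DP by (rule tlift_tmul[OF qv vspace_tensor mq bilin_comp[OF tb sg_lin[OF fI(1) IJ(1)] sg_lin[OF fI(2) IJ(2)]] ci])
   also have "... = tL ?W (%a b. tL ?W (%c e. tens (S I) (S J) (tmlt C A D (sg rA a) (sg sD c)) (tmlt C B E (sg rB b) (sg sE e)))
     (Dq D sD E sE q)) (Dq A rA B rB p)"
    by (intro tlift_cong[OF qv(1,2) ci(1)] tlift_cong[OF qv(3,4) ci(2)])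
     (simp add: tmlt_C_sg[OF fA(1,3) dis(3) rA _ sD] tmlt_C_sg[OF fA(2,4) dis(4) rB _ sE])
   also have "... = tL ?W (%a b. tL ?W (%c e. tens (S I) (S J) (tmlt C A D (sg rA a) c) (tmlt C B E (sg rB b) e))
     (tcop C D E (sg s q))) (Dq A rA B rB p)"
    unfolding s'
    by (intro tlift_cong[OF qv(1,2) ci(1)] tlift_tcop_C[OF fA(3,4) dis(2) sD sE p'(2) vspace_tensor, symmetric] bilin_pair(1)[OF tb mb])
     (auto intro: sg_in fA rA rB)
   also have "... = tL ?W (%a b. tL ?W (%c e. tens (S I) (S J) (tmlt C A D a c) (tmlt C B E b e))
     (tcop C D E (sg s q))) (tcop C A B (sg r p))"
   proof -
    have sq: "tcop C D E (sg s q) : carr (S D >< S E)"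
     by (rule linmap_in[OF cl(2) sg_in[OF fI(4) s]])
    have "bilin (S A) (S B) ?W (%a b. tL ?W (%c e. tens (S I) (S J) (tmlt C A D a c) (tmlt C B E b e)) (tcop C D E (sg s q)))"
     by (intro bilinI linmap_tlift_param[OF vA(3,4) vspace_tensor sq])
      (auto intro: bilin_left_comp[OF tb] bilin_right_comp[OF tb] bilin_left[OF mb(1)] bilin_left[OF mb(2)] bilin_in[OF mb(1)] bilin_in[OF mb(2)])
    from tlift_tcop_C[OF fA(1,2) dis(1) rA rB p'(1) vspace_tensor this] show ?thesis unfolding r' by simp
   qed
   finally show ?thesis by (simp add: tmul_def)
  qed
 qed
 then show ?thesis unfolding A_def B_def D_def E_def .
qed

lemma twisted_bialgebra_C: "twisted_bialgebra C"
 unfolding twisted_bialgebra_def sp_C scar_C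
proof (intro conjI allI impI ballI)
 show "species C" "twisted_algebra C" "twisted_coalgebra C"
  by (rule species_C twisted_algebra_C twisted_coalgebra_C)+
 have e: "{} : eqvs {}" by (simp add: eqvs_empty)
 have o: "tone P : Cq {} {}" by (simp add: one_in)
 have one: "tone C = sg {} (tone P)" by (simp add: com_species_def)
 have tc: "tcou C = (%f. tcou P (lk f {}))" by (simp add: com_species_def)
 have f0: "finite ({} :: lbl set)" "{} Int {} = ({} :: lbl set)" by auto
 note v0 = vS[OF f0(1)] and t0 = tw_vs[OF f0(1)]
 show "tcop C {} {} (tone C) = tens (S {}) (S {}) (tone C) (tone C)"
  using tcop_C_sg[OF f0(1,1,2) e e, of "tone P"] one_in
   tmap_tens[OF t0 t0 v0 v0] sg_lin[OF f0(1) e] by (simp add: one D_one)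
 show "tcou C (tone C) = 1" by (simp add: one tc cou_one)
 show "tcou C (tmlt C {} {} x y) = tcou C x * tcou C y" if xy: "x : carr (S {})" "y : carr (S {})" for x y
 proof (rule S_ext2[OF f0(1,1) _ _ _ xy])
  have l: "linmap (S {}) ground (tcou C)"
   unfolding tc using linmap_comp[OF cou_lin lk_lin[OF e, unfolded quo_empty]] by simp
  show "bilin (S {}) (S {}) ground (%x y. tcou C (tmlt C {} {} x y))"
   by (rule linmap_bilin[OF l]) (use tmlt_C_lin[OF f0(1,1,2)] in simp)
  show "bilin (S {}) (S {}) ground (%x y. tcou C x * tcou C y)"
   by (intro bilinI linmap_mult l)
  fix r p s q assume "r : eqvs {}" "p : Cq {} r" "s : eqvs {}" "q : Cq {} s"
  then show "tcou C (tmlt C {} {} (sg r p) (sg s q)) = tcou C (sg r p) * tcou C (sg s q)"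
   using tmlt_C_sg[OF f0(1,1,2) e _ e] by (simp add: eqvs_empty tc cou_m)
 qed
qed (rule tcop_tmlt_C)

end

lemma tlift_tmap_tens_id:
 assumes vs: "vspace A" "vspace C" "vspace F" "vspace Z" "vspace X" and T: "trilin A C F Z T"
  and f: "!!x. x : carr X ==> f x : carr (A >< C)" and t: "t : carr (X >< F)"
 shows "tL Z (%s z. tL Z (%a c. T a c z) s) (tmap (A >< C) F f id t) =
  tL Z (%x z. tL Z (%a c. T a c z) (f x)) t"
 by (subst tlift_tmap[OF vs(5,3) t vspace_tensor vs(3,4) linmap_tlift_trilin(1)[OF vs(1-4) T]]) (auto intro: f)

section \<open>Contraction-extraction coproducts on quotients\<close>

locale ce = com P for P :: "('k::field, 'p::ab_group_add) ctbialg" +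
 assumes CE: "contraction_extraction P" and CC: "ce_compatible P"
begin

lemma cd_lin: "finite X ==> r : eqvs X ==> linmap (sp P X) (Sq X r >< sp P X) (cdel P X r)"
 and cd_nat: "finite X ==> inj_on h X ==> r : eqvs X ==> p : scar P X ==>
    cdel P (h ` X) (eqv_map h r) (smor P X h p) =
    tmap (Sq (h ` X) (eqv_map h r)) (sp P (h ` X))
     (hq h X r) (smor P X h) (cdel P X r p)"
 and cd_coassoc: "finite X ==> r : eqvs X ==> r' : eqvs X ==> p : scar P X ==> eqv_le r r' ==>
      tassoc (Sq X r) (Sq X r') (sp P X)
       (tmap (Sq X r >< Sq X r') (sp P X) (cdel_quo P X r' r) id (cdel P X r' p)) =
      tmap (Sq X r) (Sq X r' >< sp P X) id (cdel P X r') (cdel P X r p)"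
 and cd_coassoc0: "finite X ==> r : eqvs X ==> r' : eqvs X ==> p : scar P X ==> \<not> eqv_le r r' ==>
      tmap (Sq X r) (Sq X r' >< sp P X) id (cdel P X r') (cdel P X r p) = 0"
 and ce_lin: "finite X ==> linmap (sp P X) ground (ceps P X)"
 and ce_nat: "finite X ==> inj_on h X ==> p : scar P X ==> ceps P (h ` X) (smor P X h p) = ceps P X p"
 and cd_counitR: "finite X ==> r : eqvs X ==> p : scar P X ==>
    tL (Sq X r) (%a b. sscl P (ceps P X b) a) (cdel P X r p) =
    (if r = Id_on X then smor P X (%x. Cls {|x|}) p else 0)"
 and cd_counitL: "finite X ==> p : scar P X ==>
    (SUM r:eqvs X. tL (sp P X) (%a b. sscl P (ceps P (quo X r) a) b) (cdel P X r p)) = p"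
 using CE unfolding contraction_extraction_def by simp_all

lemma cd_m: "finite X ==> finite Y ==> X Int Y = {} ==> r : eqvs X ==> s : eqvs Y ==> p : scar P X ==> q : scar P Y ==>
   cdel P (X Un Y) (r Un s) (tmlt P X Y p q) =
    tmul (Sq (X Un Y) (r Un s)) (sp P (X Un Y)) (Mq X r Y s) (tmlt P X Y) (cdel P X r p) (cdel P Y s q)"
 and cd_m0: "finite X ==> finite Y ==> X Int Y = {} ==> t : eqvs (X Un Y) ==> \<not> splits X Y t ==> p : scar P X ==> q : scar P Y ==>
   cdel P (X Un Y) t (tmlt P X Y p q) = 0"
 and cd_D: "finite X ==> finite Y ==> X Int Y = {} ==> r : eqvs X ==> s : eqvs Y ==> z : scar P (X Un Y) ==>
   tmap (Sq X r >< Sq Y s) (sp P (X Un Y)) (Dq X r Y s) id (cdel P (X Un Y) (r Un s) z) =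
   m1324 (Sq X r) (Sq Y s) (sp P (X Un Y)) (tmlt P X Y)
    (tmap (Sq X r >< sp P X) (Sq Y s >< sp P Y) (cdel P X r) (cdel P Y s) (tcop P X Y z))"
proof -
 assume a: "finite X" "finite Y" "X Int Y = {}"
 note c = CC[unfolded ce_compatible_def Let_def, THEN conjunct1, rule_format, OF a]
 show "cdel P (X Un Y) t (tmlt P X Y p q) = 0" if "t : eqvs (X Un Y)" "\<not> splits X Y t" "p : scar P X" "q : scar P Y"
  using c[OF that(1), THEN conjunct1, rule_format, OF that(3,4)] that(2) by (simp add: splits_def)
 assume r: "r : eqvs X" and s: "s : eqvs Y"
 note u = eqvs_Un[OF r s a(3)] and R = Un_restrict[OF r s a(3)]
 show "cdel P (X Un Y) (r Un s) (tmlt P X Y p q) =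
    tmul (Sq (X Un Y) (r Un s)) (sp P (X Un Y)) (Mq X r Y s) (tmlt P X Y) (cdel P X r p) (cdel P Y s q)"
  if "p : scar P X" "q : scar P Y"
  using c[OF u, THEN conjunct1, rule_format, OF that] unfolding R by simp
 show "tmap (Sq X r >< Sq Y s) (sp P (X Un Y)) (Dq X r Y s) id (cdel P (X Un Y) (r Un s) z) =
   m1324 (Sq X r) (Sq Y s) (sp P (X Un Y)) (tmlt P X Y)
    (tmap (Sq X r >< sp P X) (Sq Y s >< sp P Y) (cdel P X r) (cdel P Y s) (tcop P X Y z))"
  if "z : scar P (X Un Y)"
  using c[OF u, THEN conjunct2] that unfolding R by simp
qed

lemma cd_one: "cdel P {} {} (tone P) = tens (sp P {}) (sp P {}) (tone P) (tone P)"
 and cd_cou: "p : scar P {} ==> tL (sp P {}) (%a b. sscl P (tcou P a) b) (cdel P {} {} p) = sscl P (tcou P p) (tone P)"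
 using CC unfolding ce_compatible_def by blast+

lemma cd_in: "finite X ==> r : eqvs X ==> p : scar P X ==> cdel P X r p : carr (Sq X r >< sp P X)"
 using linmap_in[OF cd_lin] by simp

text \<open>The index set of \<delta>' on the summand \<open>r'\<close>.\<close>

definition E :: "lbl set => (lbl \<times> lbl) set => (lbl \<times> lbl) set set" where
 "E X r' = {r:eqvs X. eqv_le r r'}"

lemma ED: "r : E X r' ==> r : eqvs X" "r : E X r' ==> r' <= r"
 by (auto simp: E_def eqv_le_iff)

lemma EI: "r : eqvs X ==> r' <= r ==> r : E X r'"
 by (auto simp: E_def eqv_le_iff)

section \<open>The axioms of \<delta> carried to quotients of one label set\<close>

abbreviation "qqo X r' r \<equiv> quo (quo X r') (eqv_quo r' r)"
abbreviation "cdq X r' r \<equiv> cdel P (quo X r') (eqv_quo r' r)"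
abbreviation "dq \<equiv> cdel_quo P"
abbreviation "flt X r' r \<equiv> smor P (qqo X r' r) cls_flat"

lemma flt_lin:
 assumes "finite X" "r' : eqvs X" "r : E X r'"
 shows "linmap (sp P (qqo X r' r)) (Sq X r) (flt X r' r)"
 using smor_linmap[OF tw_species _ cls_flat_bij(2)[OF assms(1,2) ED[OF assms(3)]]] assms(1)
 by (simp add: cls_flat_bij(1)[OF assms(1,2) ED[OF assms(3)]])

lemma flt_in:
 assumes "finite X" "r' : eqvs X" "r : E X r'" "a : scar P (qqo X r' r)"
 shows "flt X r' r a : Cq X r"
 using linmap_in[OF flt_lin[OF assms(1-3)]] assms(4) by simp

lemma uq_in: "finite X ==> r' : eqvs X ==> r : E X r' ==> eqv_quo r' r : eqvs (quo X r')"
 by (rule eqv_quo_in[OF _ _ ED])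

lemma qvs: "finite X ==> vspace (Sq X r)"
 by (simp add: tw_vs)

lemma qqvs: "finite X ==> vspace (Sq (quo X r) s)"
 by (simp add: tw_vs)

lemma cdq_in:
 assumes "finite X" "r' : eqvs X" "r : E X r'" "p : Cq X r'"
 shows "cdq X r' r p : carr (sp P (qqo X r' r) >< Sq X r')"
 by (rule cd_in[OF finite_quo[OF assms(1)] uq_in[OF assms(1-3)] assms(4)])

lemma dq_lin:
 assumes "finite X" "r' : eqvs X" "r : E X r'"
 shows "linmap (Sq X r') (Sq X r >< Sq X r') (dq X r' r)"
 unfolding cdel_quo_def[abs_def]
 by (rule linmap_comp[OF linmap_tmap[OF qqvs[OF assms(1)] qvs[OF assms(1)] qvs[OF assms(1)] qvs[OF assms(1)] flt_lin[OF assms]]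
   cd_lin[OF finite_quo[OF assms(1)] uq_in[OF assms]]]) (simp add: linmap_id id_def)

lemma dq_in:
 assumes "finite X" "r' : eqvs X" "r : E X r'" "p : Cq X r'"
 shows "dq X r' r p : carr (Sq X r >< Sq X r')"
 using linmap_in[OF dq_lin[OF assms(1-3)]] assms(4) by simp

lemma dq_int:
 assumes X: "finite X" "r' : eqvs X" "r : E X r'" "p : Cq X r'"
  and Z: "vspace Z" and be: "bilin (Sq X r) (Sq X r') Z be"
 shows "tL Z be (dq X r' r p) = tL Z (%a b. be (flt X r' r a) b) (cdq X r' r p)"
 unfolding cdel_quo_def
 by (subst tlift_tmap[OF qqvs[OF X(1)] qvs[OF X(1)] cdq_in[OF X] qvs[OF X(1)] qvs[OF X(1)] Z be])
  (use flt_in[OF X(1-3)] in auto)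

text \<open>Naturality of \<delta> on the quotient along \<open>cls_map h\<close>, combined with the
  fact that flattening commutes with relabelling.\<close>

lemma dq_nat:
 assumes X: "finite X" "r' : eqvs X" "r : E X r'" "p : Cq X r'" and h: "inj_on h X"
 shows "dq (h ` X) (eqv_map h r') (eqv_map h r) (hq h X r' p) =
  tmap (Sq (h ` X) (eqv_map h r)) (Sq (h ` X) (eqv_map h r'))
   (hq h X r) (hq h X r') (dq X r' r p)"
proof -
 let ?u = "eqv_quo r' r" and ?Q = "quo X r'"
 note r = ED[OF X(3)]
 note u = uq_in[OF X(1-3)]
 have f: "finite ?Q" "finite (quo ?Q ?u)" "finite (h ` X)" "finite (quo X r)" using X(1) by auto
 note qm = quo_map[OF X(1,2) h] and qmr = quo_map[OF X(1) r(1) h]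
 note r's = eqv_map_in[OF X(2) h] and rs = eqv_map_in[OF r(1) h]
 have rE: "eqv_map h r : E (h ` X) (eqv_map h r')" using rs r(2) by (auto intro!: EI simp: eqv_map_def)
 note qmu = quo_map[OF f(1) u qm(2), unfolded qm(1)]
 note eqm = eqv_quo_map[OF X(1,2) r(1) h]
 have cd: "cdq (h ` X) (eqv_map h r') (eqv_map h r) (smor P ?Q (cls_map h) p) =
   tmap (sp P (qqo (h ` X) (eqv_map h r') (eqv_map h r))) (Sq (h ` X) (eqv_map h r'))
    (hq (cls_map h) ?Q ?u) (smor P ?Q (cls_map h)) (cdel P ?Q ?u p)"
  using cd_nat[OF f(1) qm(2) u X(4)] unfolding qm(1) eqm .
 have s1: "linmap (sp P ?Q) (Sq (h ` X) (eqv_map h r')) (smor P ?Q (cls_map h))"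
  using smor_linmap[OF tw_species f(1) qm(2)] unfolding qm(1) .
 have s2: "linmap (Sq ?Q ?u) (sp P (qqo (h ` X) (eqv_map h r') (eqv_map h r))) (hq (cls_map h) ?Q ?u)"
  using smor_linmap[OF tw_species f(2) qmu(2)] unfolding qmu(1) eqm .
 have s3: "linmap (Sq X r) (Sq (h ` X) (eqv_map h r)) (hq h X r)"
  using smor_linmap[OF tw_species f(4) qmr(2)] unfolding qmr(1) .
 have comp: "flt (h ` X) (eqv_map h r') (eqv_map h r) (hq (cls_map h) ?Q ?u a) =
   hq h X r (flt X r' r a)" if a: "a : Cq ?Q ?u" for a
 proof -
  \<comment> \<open>Both sides are computed on the class of a point \<open>x\<close> of
    \<open>X\<close>, where each of them is the class of \<open>h x\<close>.\<close>
  have pt: "cls_flat (cls_map (cls_map h) c) = cls_map h (cls_flat c)" if c: "c : quo ?Q ?u" for c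
  proof -
   obtain x where x: "x : X" "c = cls ?u (cls r' x)" using c by (auto simp: quo_quo)
   have xq: "cls r' x : ?Q" using x by (simp add: quo_cls)
   have "cls_map (cls_map h) c = cls (eqv_quo (eqv_map h r') (eqv_map h r)) (cls (eqv_map h r') (h x))"
    unfolding x(2) cls_image[OF f(1) u qm(2) xq] cls_image[OF X(1,2) h x(1)] eqm ..
   then show ?thesis
    using cls_flat[OF f(3) r's rs ED(2)[OF rE], of "h x"] x cls_flat[OF X(1,2) r x(1)] cls_image[OF X(1) r(1) h x(1)]
    by simp
  qed
  have "flt (h ` X) (eqv_map h r') (eqv_map h r) (hq (cls_map h) ?Q ?u a) =
    smor P (quo ?Q ?u) (%c. cls_flat (cls_map (cls_map h) c)) a"
   by (rule smor_smor[OF tw_species f(2) qmu(2) cls_flat_bij(2)[OF f(3) r's rs ED(2)[OF rE]] _ a refl])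
    (simp only: qmu(1) eqm)
  also have "... = hq h X r (flt X r' r a)"
   by (rule smor_smor[OF tw_species f(2) cls_flat_bij(2)[OF X(1,2) r] qmr(2) cls_flat_bij(1)[OF X(1,2) r, symmetric] a, symmetric])
    (simp add: pt)
  finally show ?thesis .
 qed
 have "dq (h ` X) (eqv_map h r') (eqv_map h r) (smor P ?Q (cls_map h) p) =
   tmap (Sq (h ` X) (eqv_map h r)) (Sq (h ` X) (eqv_map h r'))
    (%a. flt (h ` X) (eqv_map h r') (eqv_map h r) (hq (cls_map h) ?Q ?u a)) (%b. id (smor P ?Q (cls_map h) b)) (cdel P ?Q ?u p)"
  unfolding cdel_quo_def cd
  by (rule tmap_tmap[OF qqvs[OF X(1)] qvs[OF X(1)] cdq_in[OF X(1-4)] qqvs[OF f(3)] qvs[OF f(3)] qvs[OF f(3)] qvs[OF f(3)] flt_lin[OF f(3) r's rE]])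
   (use linmap_in[OF s1] linmap_in[OF s2] in \<open>auto simp: linmap_id id_def\<close>)
 also have "... = tmap (Sq (h ` X) (eqv_map h r)) (Sq (h ` X) (eqv_map h r'))
   (%a. hq h X r (flt X r' r a)) (%b. smor P ?Q (cls_map h) (id b)) (cdel P ?Q ?u p)"
  by (rule tmap_cong[OF qqvs[OF X(1)] qvs[OF X(1)] cdq_in[OF X(1-4)]]) (simp_all add: comp)
 also have "... = tmap (Sq (h ` X) (eqv_map h r)) (Sq (h ` X) (eqv_map h r'))
   (hq h X r) (hq h X r') (dq X r' r p)"
  unfolding cdel_quo_def
  by (rule tmap_tmap[OF qqvs[OF X(1)] qvs[OF X(1)] cdq_in[OF X(1-4)] qvs[OF X(1)] qvs[OF X(1)] qvs[OF f(3)] qvs[OF f(3)] s3 s1, symmetric])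
   (use flt_in[OF X(1-3)] in auto)
 finally show ?thesis .
qed

text \<open>This is the coassociativity axiom on the label set X/~3. The obstacle is that the inner
  \<delta> acts on X/~2 on one side and on a quotient of X/~3 on the other; naturality along the
  flattening bijection between them bridges the gap.\<close>

lemma dq_coassoc:
 assumes X: "finite X" "r3 : eqvs X" "r2 : E X r3" "r1 : E X r2" "p : Cq X r3"
  and Z: "vspace Z" and T: "trilin (Sq X r1) (Sq X r2) (Sq X r3) Z T"
 shows "tL Z (%a c. tL Z (%a1 a2. T a1 a2 c) (dq X r2 r1 a)) (dq X r3 r2 p) =
  tL Z (%a b. tL Z (T a) (dq X r3 r2 b)) (dq X r3 r1 p)"
proof -
 note r2 = ED[OF X(3)] and r1 = ED[OF X(4)]
 have r13: "r3 <= r1" using r1(2) r2(2) by blast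
 have r1E: "r1 : E X r3" by (rule EI[OF r1(1) r13])
 let ?Q = "quo X r3" and ?u1 = "eqv_quo r3 r1" and ?u2 = "eqv_quo r3 r2"
 note u1 = uq_in[OF X(1,2) r1E] and u2 = uq_in[OF X(1,2,3)]
 have le: "eqv_le ?u1 ?u2"
  using eqv_quo_le[OF X(1,2) r1(1) r13 r2] r1(2) by (simp add: eqv_le_iff)
 then have u12: "?u1 : E ?Q ?u2" using u1 by (auto intro!: EI simp: eqv_le_iff)
 have f: "finite ?Q" "finite (quo ?Q ?u1)" "finite (quo ?Q ?u2)" "finite (qqo ?Q ?u2 ?u1)" using X(1) by auto
 note l1 = flt_lin[OF X(1,2) r1E] and l2 = flt_lin[OF X(1,2,3)]
 \<comment> \<open>The flattenings are absorbed into the test map, so the axiom on \<open>?Q\<close>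
   can be applied to unflattened quotients.\<close>
 define T' where "T' a b c = T (flt X r3 r1 a) (flt X r3 r2 b) c" for a b c
 have T': "trilin (Sq ?Q ?u1) (Sq ?Q ?u2) (sp P ?Q) Z T'"
  unfolding T'_def by (rule trilin_comp[OF T l1 l2 linmap_id])
 note v = tw_vs[OF f(2)] tw_vs[OF f(3)] tw_vs[OF f(1)]
 have main: "tL Z (%x c. tL Z (%a b. T' a b c) (dq ?Q ?u2 ?u1 x)) (cdel P ?Q ?u2 p) =
   tL Z (%a x. tL Z (T' a) (cdel P ?Q ?u2 x)) (cdel P ?Q ?u1 p)"
  using tlift_tassoc[OF v Z v(2) T' _ cd_in[OF f(1) u2 X(5)], of "dq ?Q ?u2 ?u1"] dq_in[OF f(1) u2 u12]
   tlift_tmap_id[OF v Z v(3) T' _ cd_in[OF f(1) u1 X(5)], of "cdel P ?Q ?u2"] cd_in[OF f(1) u2]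
   cd_coassoc[OF f(1) u1 u2 X(5) le] by simp
 have bL: "bilin (Sq X r2) (sp P ?Q) Z (%a c. tL Z (%a1 a2. T a1 a2 c) (dq X r2 r1 a))"
  using bilin_comp[OF linmap_tlift_trilin(1)[OF qvs[OF X(1)] qvs[OF X(1)] qvs[OF X(1)] Z T] dq_lin[OF X(1) r2(1) X(4)] linmap_id] .
 have bR: "bilin (Sq X r1) (sp P ?Q) Z (%a b. tL Z (T a) (dq X r3 r2 b))"
  using bilin_comp[OF linmap_tlift_trilin(2)[OF qvs[OF X(1)] qvs[OF X(1)] qvs[OF X(1)] Z T] linmap_id dq_lin[OF X(1-3)]] .
 have "tL Z (%a c. tL Z (%a1 a2. T a1 a2 c) (dq X r2 r1 a)) (dq X r3 r2 p) =
   tL Z (%a c. tL Z (%a1 a2. T a1 a2 c) (dq X r2 r1 (flt X r3 r2 a))) (cdel P ?Q ?u2 p)"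
  by (rule dq_int[OF X(1-3,5) Z bL])
 also have "... = tL Z (%x c. tL Z (%a b. T' a b c) (dq ?Q ?u2 ?u1 x)) (cdel P ?Q ?u2 p)"
 proof (rule tlift_cong[OF v(2,3) cd_in[OF f(1) u2 X(5)]])
  fix a c assume "a : carr (Sq ?Q ?u2)" and "c : carr (sp P ?Q)"
  then have a: "a : Cq ?Q ?u2" and c: "c : scar P ?Q" by auto
  let ?w = "eqv_quo ?u2 ?u1"
  note w = uq_in[OF f(1) u2 u12]
  note fb = cls_flat_bij[OF X(1,2) r2]
  have qr: "quo X r2 = cls_flat ` quo ?Q ?u2" using fb(1) by simp
  have er: "eqv_quo r2 r1 = eqv_map cls_flat ?w"
   by (rule eqv_quo_flat[OF X(1) r1(1) r2(1) X(2) r1(2) r2(2), symmetric])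
  have qw: "cls_map cls_flat ` quo (quo ?Q ?u2) ?w = qqo X r2 r1" "inj_on (cls_map cls_flat) (quo (quo ?Q ?u2) ?w)"
   using quo_map[OF f(3) w fb(2)] unfolding fb(1) er by auto
  \<comment> \<open>The quotient \<open>X/r2\<close> is the flattened image of the quotient of
    \<open>?Q\<close>, and its equivalence is the transported one, so naturality of \<delta>
    applies.\<close>
  have cd: "cdq X r2 r1 (flt X r3 r2 a) =
   tmap (sp P (qqo X r2 r1)) (Sq X r2) (hq cls_flat (quo ?Q ?u2) ?w) (flt X r3 r2) (cdel P (quo ?Q ?u2) ?w a)"
   using cd_nat[OF f(3) fb(2) w a] unfolding fb(1) er .
  have T2: "bilin (Sq X r1) (Sq X r2) Z (%a b. T a b c)" using trilinD(6)[OF T] c by simp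
  have T2': "bilin (Sq ?Q ?u1) (Sq ?Q ?u2) Z (%a b. T' a b c)" using trilinD(6)[OF T'] c by simp
  have sl: "linmap (Sq (quo ?Q ?u2) ?w) (sp P (qqo X r2 r1)) (hq cls_flat (quo ?Q ?u2) ?w)"
   using smor_linmap[OF tw_species f(4) qw(2)] unfolding qw(1) .
  have "tL Z (%a1 a2. T a1 a2 c) (dq X r2 r1 (flt X r3 r2 a)) =
   tL Z (%a b. T (flt X r2 r1 a) b c) (cdq X r2 r1 (flt X r3 r2 a))"
   by (rule dq_int[OF X(1) r2(1) X(4) flt_in[OF X(1-3) a] Z T2])
  also have "... = tL Z (%a b. T (flt X r2 r1 (hq cls_flat (quo ?Q ?u2) ?w a)) (flt X r3 r2 b) c) (cdel P (quo ?Q ?u2) ?w a)"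
   unfolding cd
   by (rule tlift_tmap[OF tw_vs[OF f(4)] tw_vs[OF f(3)] cd_in[OF f(3) w a] qqvs[OF X(1)] qvs[OF X(1)] Z
     bilin_comp[OF T2 flt_lin[OF X(1) r2(1) X(4)] linmap_id]])
    (use linmap_in[OF sl] flt_in[OF X(1-3)] in auto)
  also have "... = tL Z (%a b. T' (flt ?Q ?u2 ?u1 a) b c) (cdel P (quo ?Q ?u2) ?w a)"
  proof (rule tlift_cong[OF tw_vs[OF f(4)] tw_vs[OF f(3)] cd_in[OF f(3) w a]])
   fix x y assume "x : carr (Sq (quo ?Q ?u2) ?w)"
   then have x: "x : Cq (quo ?Q ?u2) ?w" by simp
   \<comment> \<open>The two orders of flattening a threefold quotient are compared here, through
     \<open>cls_flat_flat\<close>.\<close>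
   have "flt X r2 r1 (hq cls_flat (quo ?Q ?u2) ?w x) = smor P (quo (quo ?Q ?u2) ?w) (%c. cls_flat (cls_map cls_flat c)) x"
    by (rule smor_smor[OF tw_species f(4) qw(2) cls_flat_bij(2)[OF X(1) r2(1) r1] qw(1)[symmetric] x refl])
   also have "... = flt X r3 r1 (flt ?Q ?u2 ?u1 x)"
    by (rule smor_smor[OF tw_species f(4) cls_flat_bij(2)[OF f(1) u2 ED[OF u12]] cls_flat_bij(2)[OF X(1,2) ED[OF r1E]]
      cls_flat_bij(1)[OF f(1) u2 ED[OF u12], symmetric] x, symmetric])
     (rule cls_flat_flat[OF X(1) r1(1) r2(1) X(2) r1(2) r2(2), symmetric])
   finally show "T (flt X r2 r1 (hq cls_flat (quo ?Q ?u2) ?w x)) (flt X r3 r2 y) c = T' (flt ?Q ?u2 ?u1 x) y c"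
    by (simp add: T'_def)
  qed
  also have "... = tL Z (%a b. T' a b c) (dq ?Q ?u2 ?u1 a)"
   by (rule dq_int[OF f(1) u2 u12 a Z T2', symmetric])
  finally show "tL Z (%a1 a2. T a1 a2 c) (dq X r2 r1 (flt X r3 r2 a)) = tL Z (%a b. T' a b c) (dq ?Q ?u2 ?u1 a)" .
 qed
 also have "... = tL Z (%a x. tL Z (T' a) (cdel P ?Q ?u2 x)) (cdel P ?Q ?u1 p)" by (rule main)
 also have "... = tL Z (%a b. tL Z (T (flt X r3 r1 a)) (dq X r3 r2 b)) (cdel P ?Q ?u1 p)"
  unfolding T'_def
  by (intro tlift_cong[OF v(1,3) cd_in[OF f(1) u1 X(5)]] dq_int[OF X(1-3) _ Z, symmetric] trilinD(4)[OF T])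
   (use flt_in[OF X(1,2) r1E] in auto)
 also have "... = tL Z (%a b. tL Z (T a) (dq X r3 r2 b)) (dq X r3 r1 p)"
  by (rule dq_int[OF X(1,2) r1E X(5) Z bR, symmetric])
 finally show ?thesis .
qed

text \<open>The vanishing half of the coassociativity axiom: passing to the quotient by
  \<open>r3\<close> neither creates nor destroys comparability, by
  \<open>eqv_quo_le\<close>.\<close>

lemma dq_coassoc0:
 assumes X: "finite X" "r3 : eqvs X" "r2 : E X r3" "r1 : E X r3" "\<not> eqv_le r1 r2" "p : Cq X r3"
  and Z: "vspace Z" and T: "trilin (Sq X r1) (Sq X r2) (Sq X r3) Z T"
 shows "tL Z (%a b. tL Z (T a) (dq X r3 r2 b)) (dq X r3 r1 p) = 0"
proof -
 let ?Q = "quo X r3" and ?u1 = "eqv_quo r3 r1" and ?u2 = "eqv_quo r3 r2"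
 note u1 = uq_in[OF X(1,2,4)] and u2 = uq_in[OF X(1,2,3)]
 have le: "\<not> eqv_le ?u1 ?u2"
  using eqv_quo_le[OF X(1,2) ED[OF X(4)] ED[OF X(3)]] X(5) by simp
 have f: "finite ?Q" "finite (quo ?Q ?u1)" "finite (quo ?Q ?u2)" using X(1) by auto
 note l1 = flt_lin[OF X(1,2,4)] and l2 = flt_lin[OF X(1,2,3)]
 have T': "trilin (Sq ?Q ?u1) (Sq ?Q ?u2) (sp P ?Q) Z (%a b c. T (flt X r3 r1 a) (flt X r3 r2 b) c)"
  by (rule trilin_comp[OF T l1 l2 linmap_id])
 note v = tw_vs[OF f(2)] tw_vs[OF f(3)] tw_vs[OF f(1)]
 have bR: "bilin (Sq X r1) (sp P ?Q) Z (%a b. tL Z (T a) (dq X r3 r2 b))"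
  using bilin_comp[OF linmap_tlift_trilin(2)[OF qvs[OF X(1)] qvs[OF X(1)] qvs[OF X(1)] Z T] linmap_id dq_lin[OF X(1-3)]] .
 have "tL Z (%a b. tL Z (T a) (dq X r3 r2 b)) (dq X r3 r1 p) =
  tL Z (%a b. tL Z (T (flt X r3 r1 a)) (dq X r3 r2 b)) (cdel P ?Q ?u1 p)"
  by (rule dq_int[OF X(1,2,4,6) Z bR])
 also have "... = tL Z (%a b. tL Z (%b c. T (flt X r3 r1 a) (flt X r3 r2 b) c) (cdel P ?Q ?u2 b)) (cdel P ?Q ?u1 p)"
  by (intro tlift_cong[OF v(1,3) cd_in[OF f(1) u1 X(6)]] dq_int[OF X(1-3) _ Z] trilinD(4)[OF T])
   (use flt_in[OF X(1,2,4)] in auto)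
 also have "... = 0"
  using tlift_tmap_id[OF v Z v(3) T' _ cd_in[OF f(1) u1 X(6)], of "cdel P ?Q ?u2"] cd_in[OF f(1) u2]
   cd_coassoc0[OF f(1) u1 u2 X(6) le] by simp
 finally show ?thesis .
qed

text \<open>The induced equivalence on the quotient is equality exactly when \<open>r\<close> and
  \<open>r'\<close> coincide, which turns the case distinction of the axiom into this one.\<close>

lemma dq_counitR:
 assumes X: "finite X" "r' : eqvs X" "r : E X r'" "p : Cq X r'"
 shows "tL (Sq X r) (%a b. sscl P (ceps P (quo X r') b) a) (dq X r' r p) = (if r = r' then p else 0)"
proof -
 let ?u = "eqv_quo r' r" and ?Q = "quo X r'"
 note u = uq_in[OF X(1-3)]
 have f: "finite ?Q" "finite (quo ?Q ?u)" "finite (quo X r)" using X(1) by auto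
 have b: "bilin (Sq X r) (sp P ?Q) (Sq X r) (%a b. sscl P (ceps P ?Q b) a)"
  using bilin_ground_scale(2)[OF qvs[OF X(1)] ce_lin[OF f(1)]] by simp
 have "tL (Sq X r) (%a b. sscl P (ceps P ?Q b) a) (dq X r' r p) =
  tL (Sq X r) (%a b. sscl P (ceps P ?Q b) (flt X r' r a)) (cdel P ?Q ?u p)"
  by (rule dq_int[OF X qvs[OF X(1)] b])
 also have "... = tL (Sq X r) (%a b. flt X r' r (sscl P (ceps P ?Q b) a)) (cdel P ?Q ?u p)"
  by (rule tlift_cong[OF qqvs[OF X(1)] qvs[OF X(1)] cdq_in[OF X]]) (use linmap_scale[OF flt_lin[OF X(1-3)]] in simp)
 also have "... = flt X r' r (tL (Sq ?Q ?u) (%a b. sscl P (ceps P ?Q b) a) (cdel P ?Q ?u p))"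
  by (rule linmap_of_tlift[OF qqvs[OF X(1)] qvs[OF X(1)] cdq_in[OF X] flt_lin[OF X(1-3)] qqvs[OF X(1)], symmetric])
   (use vspace_scale[OF tw_vs[OF f(2)]] in simp)
 also have "... = flt X r' r (if ?u = Id_on ?Q then smor P ?Q (%x. Cls {|x|}) p else 0)"
  by (simp add: cd_counitR[OF f(1) u X(4)])
 also have "... = (if r = r' then p else 0)"
 proof (cases "r = r'")
  case True
  have id: "?u = Id_on ?Q" unfolding True by (rule eqv_quo_self[OF X(1,2)])
  have "cls (Id_on ?Q) c = Cls {|c|}" if "c : ?Q" for c
  proof -
   have "Id_on ?Q `` {c} = {c}" using that by auto
   moreover have "Abs_fset {c} = {|c|}" by (metis bot_fset.rep_eq finsert.rep_eq fset_inverse)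
   ultimately show ?thesis by (simp add: cls_def)
  qed
  then have im: "quo ?Q ?u = (%x. Cls {|x|}) ` ?Q" unfolding id by (simp add: quo_cls[of ?Q])
  \<comment> \<open>The axiom returns the element relabelled by singletons; flattening relabels it
    back.\<close>
  have "flt X r' r (smor P ?Q (%x. Cls {|x|}) p) = smor P ?Q id p"
   by (rule smor_smor[OF tw_species f(1) _ cls_flat_bij(2)[OF X(1,2) ED[OF X(3)]] im X(4)])
    (auto simp: inj_on_def cls_flat_singleton)
  then show ?thesis using smor_id[OF tw_species f(1) X(4)] by (simp add: True eqv_quo_self[OF X(1,2)])
 next
  case False
  have "?u ~= Id_on ?Q"
  proof
   assume "?u = Id_on ?Q"
   then have "eqv_pull X r' ?u = eqv_pull X r' (eqv_quo r' r')" using eqv_quo_self[OF X(1,2)] by simp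
   then show False using eqv_pull_quo[OF X(1,2) ED[OF X(3)]] eqv_pull_quo[OF X(1,2,2)] False by simp
  qed
  then show ?thesis using False linmap_zero[OF flt_lin[OF X(1-3)] qqvs[OF X(1)]] by simp
 qed
 finally show ?thesis .
qed

text \<open>By invariance of the counit under bijections the flattenings drop out, and
  \<open>bij_eqv_quo\<close> turns the sum into the one of the axiom on X/~'.\<close>

lemma dq_counitL:
 assumes X: "finite X" "r' : eqvs X" "p : Cq X r'"
 shows "(SUM r:E X r'. tL (Sq X r') (%a b. sscl P (ceps P (quo X r) a) b) (dq X r' r p)) = p"
proof -
 let ?Q = "quo X r'"
 have f: "finite ?Q" using X(1) by auto
 have "(SUM r:E X r'. tL (sp P ?Q) (%a b. sscl P (ceps P (quo X r) a) b) (dq X r' r p)) =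
  (SUM r:E X r'. tL (sp P ?Q) (%a b. sscl P (ceps P (quo ?Q (eqv_quo r' r)) a) b) (cdel P ?Q (eqv_quo r' r) p))"
 proof (rule sum.cong[OF refl])
  fix r assume r: "r : E X r'"
  have b: "bilin (Sq X r) (sp P ?Q) (sp P ?Q) (%a b. sscl P (ceps P (quo X r) a) b)"
   using bilin_ground_scale(1)[OF qvs[OF X(1)] ce_lin[OF finite_quo[OF X(1)]]] by simp
  have e: "ceps P (quo X r) (flt X r' r a) = ceps P (quo ?Q (eqv_quo r' r)) a" if "a : Cq ?Q (eqv_quo r' r)" for a
   using ce_nat[OF _ cls_flat_bij(2)[OF X(1,2) ED[OF r]] that] f by (simp add: cls_flat_bij(1)[OF X(1,2) ED[OF r]])
  show "tL (sp P ?Q) (%a b. sscl P (ceps P (quo X r) a) b) (dq X r' r p) =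
   tL (sp P ?Q) (%a b. sscl P (ceps P (quo ?Q (eqv_quo r' r)) a) b) (cdel P ?Q (eqv_quo r' r) p)"
   unfolding dq_int[OF X(1,2) r X(3) qvs[OF X(1)] b]
   by (rule tlift_cong[OF qqvs[OF X(1)] qvs[OF X(1)] cdq_in[OF X(1,2) r X(3)]]) (simp add: e)
 qed
 also have "... = (SUM u:eqvs ?Q. tL (sp P ?Q) (%a b. sscl P (ceps P (quo ?Q u) a) b) (cdel P ?Q u p))"
  by (rule sum.reindex_bij_betw[OF bij_eqv_quo[OF X(1,2), folded E_def]])
 also have "... = p" by (rule cd_counitL[OF f X(3)])
 finally show ?thesis .
qed

text \<open>Quotients, induced equivalences and flattenings of a disjoint union all decompose into
  parts, so the multiplicativity axiom on the two quotients gives the claim once naturality of the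
  product moves the flattening inside.\<close>

lemma dq_m:
 assumes X: "finite X" "finite Y" "X Int Y = {}" "r' : eqvs X" "s' : eqvs Y" "r : E X r'" "s : E Y s'"
  and p: "p : Cq X r'" and q: "q : Cq Y s'"
  and Z: "vspace Z" and be: "bilin (Sq (X Un Y) (r Un s)) (Sq (X Un Y) (r' Un s')) Z be"
 shows "tL Z be (dq (X Un Y) (r' Un s') (r Un s) (Mq X r' Y s' p q)) =
  tL Z (%a b. tL Z (%c d. be (Mq X r Y s a c) (Mq X r' Y s' b d)) (dq Y s' s q)) (dq X r' r p)"
proof -
 let ?Q = "quo X r'" and ?R = "quo Y s'" and ?u = "eqv_quo r' r" and ?w = "eqv_quo s' s"
 note r = ED[OF X(6)] and s = ED[OF X(7)]
 note u = uq_in[OF X(1,4,6)] and w = uq_in[OF X(2,5,7)]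
 have f: "finite ?Q" "finite ?R" "finite (X Un Y)" "finite (quo ?Q ?u)" "finite (quo ?R ?w)" using X by auto
 note rs' = eqvs_Un[OF X(4,5,3)] and rs = eqvs_Un[OF r(1) s(1) X(3)]
 have rsE: "r Un s : E (X Un Y) (r' Un s')" using r(2) s(2) by (intro EI[OF rs]) auto
 have eq: "eqv_quo (r' Un s') (r Un s) = ?u Un ?w" by (rule eqv_quo_Un[OF X(4,5,3) r(1) s(1)])
 have qQ: "quo (X Un Y) (r' Un s') = ?Q Un ?R" by (rule quo_Un[OF X(4,5,3)])
 have qr: "quo (X Un Y) (r Un s) = quo X r Un quo Y s" by (rule quo_Un[OF r(1) s(1) X(3)])
 have dQ: "?Q Int ?R = {}" by (rule quo_disj[OF X(1,2,4,5,3)])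
 have qq: "quo (?Q Un ?R) (?u Un ?w) = quo ?Q ?u Un quo ?R ?w" by (rule quo_Un[OF u w dQ])
 have dq: "quo ?Q ?u Int quo ?R ?w = {}" by (rule quo_disj[OF f(1,2) u w dQ])
 have m: "tmlt P ?Q ?R p q : Cq (X Un Y) (r' Un s')" by (rule m_quo_in[OF X(1-4) p X(5) q])
 have mb: "bilin (Sq ?Q ?u) (Sq ?R ?w) (Sq (?Q Un ?R) (?u Un ?w)) (Mq ?Q ?u ?R ?w)"
  using m_bilin[OF f(4,5) dq] by (simp add: qq)
 have mb': "bilin (sp P ?Q) (sp P ?R) (sp P (?Q Un ?R)) (tmlt P ?Q ?R)" by (rule m_bilin[OF f(1,2) dQ])
 have fl: "flt (X Un Y) (r' Un s') (r Un s) (Mq ?Q ?u ?R ?w a c) = Mq X r Y s (flt X r' r a) (flt Y s' s c)"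
  if "a : Cq ?Q ?u" "c : Cq ?R ?w" for a c
  using m_nat[OF f(4,5) dq _ that, of cls_flat] cls_flat_bij(2)[OF f(3) rs' ED[OF rsE]]
  by (simp add: qQ eq qq cls_flat_bij(1)[OF X(1,4) r] cls_flat_bij(1)[OF X(2,5) s])
 have b1: "bilin (Sq (?Q Un ?R) (?u Un ?w)) (sp P (?Q Un ?R)) Z (%a b. be (flt (X Un Y) (r' Un s') (r Un s) a) b)"
  using bilin_comp[OF be flt_lin[OF f(3) rs' rsE] linmap_id] by (simp add: qQ eq)
 note ci = cdq_in[OF X(1,4,6) p] cdq_in[OF X(2,5,7) q]
 have "tL Z be (dq (X Un Y) (r' Un s') (r Un s) (tmlt P ?Q ?R p q)) =
  tL Z (%a b. be (flt (X Un Y) (r' Un s') (r Un s) a) b) (cdel P (?Q Un ?R) (?u Un ?w) (tmlt P ?Q ?R p q))"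
  using dq_int[OF f(3) rs' rsE m Z be] by (simp add: qQ eq)
 also have "... = tL Z (%a b. tL Z (%c d. be (flt (X Un Y) (r' Un s') (r Un s) (Mq ?Q ?u ?R ?w a c)) (tmlt P ?Q ?R b d))
   (cdel P ?R ?w q)) (cdel P ?Q ?u p)"
  unfolding cd_m[OF f(1,2) dQ u w p q]
  by (rule tlift_tmul[OF tw_vs[OF f(4)] tw_vs[OF f(1)] tw_vs[OF f(5)] tw_vs[OF f(2)] tw_vs tw_vs Z mb mb' b1 ci]) (use f in auto)
 also have "... = tL Z (%a b. tL Z (%c d. be (Mq X r Y s (flt X r' r a) (flt Y s' s c)) (tmlt P ?Q ?R b d))
   (cdel P ?R ?w q)) (cdel P ?Q ?u p)"
  by (intro tlift_cong[OF tw_vs[OF f(4)] tw_vs[OF f(1)] ci(1)] tlift_cong[OF tw_vs[OF f(5)] tw_vs[OF f(2)] ci(2)]) (simp add: fl)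
 also have "... = tL Z (%a b. tL Z (%c d. be (Mq X r Y s (flt X r' r a) c) (tmlt P ?Q ?R b d)) (dq Y s' s q)) (cdel P ?Q ?u p)"
  by (intro tlift_cong[OF tw_vs[OF f(4)] tw_vs[OF f(1)] ci(1)] dq_int[OF X(2,5,7) q Z, symmetric]
   bilin_pair(1)[OF be m_quo[OF X(1-3) r(1) s(1)] m_quo[OF X(1-5)]]) (use flt_in[OF X(1,4,6)] in auto)
 also have "... = tL Z (%a b. tL Z (%c d. be (Mq X r Y s a c) (tmlt P ?Q ?R b d)) (dq Y s' s q)) (dq X r' r p)"
 proof (rule dq_int[OF X(1,4,6) p Z, symmetric])
  show "bilin (Sq X r) (sp P ?Q) Z (%a b. tL Z (%c d. be (Mq X r Y s a c) (tmlt P ?Q ?R b d)) (dq Y s' s q))"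
   by (intro bilinI linmap_tlift_param[OF qvs[OF X(2)] qvs[OF X(2)] Z dq_in[OF X(2,5,7) q]])
    (auto intro: bilin_left[OF bilin_pair(2)[OF be m_quo[OF X(1-3) r(1) s(1)] m_quo[OF X(1-5)]]]
     bilin_right[OF bilin_pair(2)[OF be m_quo[OF X(1-3) r(1) s(1)] m_quo[OF X(1-5)]]])
 qed
 finally show ?thesis .
qed

lemma dq_m0:
 assumes X: "finite X" "finite Y" "X Int Y = {}" "r' : eqvs X" "s' : eqvs Y" "t : E (X Un Y) (r' Un s')" "\<not> splits X Y t"
  and p: "p : Cq X r'" and q: "q : Cq Y s'"
 shows "dq (X Un Y) (r' Un s') t (Mq X r' Y s' p q) = 0"
proof -
 have f: "finite (quo X r')" "finite (quo Y s')" "finite (X Un Y)" using X by auto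
 have qQ: "quo (X Un Y) (r' Un s') = quo X r' Un quo Y s'" by (rule quo_Un[OF X(4,5,3)])
 have dQ: "quo X r' Int quo Y s' = {}" by (rule quo_disj[OF X(1,2,4,5,3)])
 note rs' = eqvs_Un[OF X(4,5,3)] and t = ED[OF X(6)]
 have u: "eqv_quo (r' Un s') t : eqvs (quo X r' Un quo Y s')" using uq_in[OF f(3) rs' X(6)] by (simp add: qQ)
 \<comment> \<open>A related pair across \<open>X\<close> and \<open>Y\<close> gives related classes
   across the two quotients, so the zero case of the axiom applies there.\<close>
 obtain x y where xy: "x : X" "y : Y" "(x, y) : t" using X(7) splits_disj[OF t(1) X(3)] by blast
 then have "(cls (r' Un s') x, cls (r' Un s') y) : eqv_quo (r' Un s') t" by (auto simp: eqv_quo_def)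
 then have "(cls r' x, cls s' y) : eqv_quo (r' Un s') t" using cls_Un[OF X(4,5,3)] xy by simp
 then have "\<not> splits (quo X r') (quo Y s') (eqv_quo (r' Un s') t)"
  using splits_disj[OF u dQ] xy by (auto simp: quo_cls)
 from cd_m0[OF f(1,2) dQ u this p q] show ?thesis by (simp add: cdel_quo_def qQ tmap_def)
qed

text \<open>The same transfer for the comodule law. Here naturality of the first coproduct along
  \<open>cls_flat\<close> splits the flattening of the union into the two partial ones.\<close>

lemma dq_D:
 assumes X: "finite X" "finite Y" "X Int Y = {}" "r' : eqvs X" "s' : eqvs Y" "r : E X r'" "s : E Y s'"
  and p: "p : Cq (X Un Y) (r' Un s')"
  and Z: "vspace Z" and T: "trilin (Sq X r) (Sq Y s) (Sq (X Un Y) (r' Un s')) Z T"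
 shows "tL Z (%a b. tL Z (%a1 a2. T a1 a2 b) (Dq X r Y s a)) (dq (X Un Y) (r' Un s') (r Un s) p) =
  tL Z (%x y. tL Z (%a b. tL Z (%c d. T a c (Mq X r' Y s' b d)) (dq Y s' s y)) (dq X r' r x)) (Dq X r' Y s' p)"
proof -
 let ?Q = "quo X r'" and ?R = "quo Y s'" and ?u = "eqv_quo r' r" and ?w = "eqv_quo s' s"
 note r = ED[OF X(6)] and s = ED[OF X(7)]
 note u = uq_in[OF X(1,4,6)] and w = uq_in[OF X(2,5,7)]
 have f: "finite ?Q" "finite ?R" "finite (X Un Y)" "finite (quo ?Q ?u)" "finite (quo ?R ?w)" "finite (?Q Un ?R)"
  "finite (quo (?Q Un ?R) (?u Un ?w))" "finite (quo X r)" "finite (quo Y s)" using X by auto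
 note rs' = eqvs_Un[OF X(4,5,3)] and rs = eqvs_Un[OF r(1) s(1) X(3)]
 have rsE: "r Un s : E (X Un Y) (r' Un s')" using r(2) s(2) by (intro EI[OF rs]) auto
 have eq: "eqv_quo (r' Un s') (r Un s) = ?u Un ?w" by (rule eqv_quo_Un[OF X(4,5,3) r(1) s(1)])
 have qQ: "quo (X Un Y) (r' Un s') = ?Q Un ?R" by (rule quo_Un[OF X(4,5,3)])
 have qr: "quo (X Un Y) (r Un s) = quo X r Un quo Y s" by (rule quo_Un[OF r(1) s(1) X(3)])
 have dQ: "?Q Int ?R = {}" by (rule quo_disj[OF X(1,2,4,5,3)])
 have qq: "quo (?Q Un ?R) (?u Un ?w) = quo ?Q ?u Un quo ?R ?w" by (rule quo_Un[OF u w dQ])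
 have dq: "quo ?Q ?u Int quo ?R ?w = {}" by (rule quo_disj[OF f(1,2) u w dQ])
 note uw = eqvs_Un[OF u w dQ]
 have p': "p : scar P (?Q Un ?R)" using p by (simp add: qQ)
 note T0 = T[unfolded qQ]
 define T' where "T' a c z = T (flt X r' r a) (flt Y s' s c) z" for a c z
 have T': "trilin (Sq ?Q ?u) (Sq ?R ?w) (sp P (?Q Un ?R)) Z T'"
  unfolding T'_def by (rule trilin_comp[OF T0 flt_lin[OF X(1,4,6)] flt_lin[OF X(2,5,7)] linmap_id])
 note v = tw_vs[OF f(4)] tw_vs[OF f(5)] tw_vs[OF f(6)]
 have bL: "bilin (Sq (X Un Y) (r Un s)) (Sq (X Un Y) (r' Un s')) Z (%a b. tL Z (%a1 a2. T a1 a2 b) (Dq X r Y s a))"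
  using bilin_comp[OF linmap_tlift_trilin(1)[OF qvs[OF X(1)] qvs[OF X(2)] qvs[OF f(3)] Z T] D_quo[OF X(1-3) r(1) s(1)] linmap_id] .
 note ci = cd_in[OF f(6) uw p']
 have tc: "Dq ?Q ?u ?R ?w a : carr (Sq ?Q ?u >< Sq ?R ?w)" if "a : Cq (?Q Un ?R) (?u Un ?w)" for a
  using D_in[OF f(4,5) dq] that by (simp add: qq)
 have "tL Z (%a b. tL Z (%a1 a2. T a1 a2 b) (Dq X r Y s a)) (dq (X Un Y) (r' Un s') (r Un s) p) =
  tL Z (%a b. tL Z (%a1 a2. T a1 a2 b) (Dq X r Y s (flt (X Un Y) (r' Un s') (r Un s) a))) (cdel P (?Q Un ?R) (?u Un ?w) p)"
  using dq_int[OF f(3) rs' rsE p Z bL] by (simp add: qQ eq)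
 also have "... = tL Z (%a b. tL Z (%a1 a2. T' a1 a2 b) (Dq ?Q ?u ?R ?w a)) (cdel P (?Q Un ?R) (?u Un ?w) p)"
 proof (rule tlift_cong[OF tw_vs[OF f(7)] v(3) ci])
  fix a b assume "a : carr (Sq (?Q Un ?R) (?u Un ?w))" and "b : carr (sp P (?Q Un ?R))"
  then have a: "a : scar P (quo ?Q ?u Un quo ?R ?w)" and b: "b : scar P (?Q Un ?R)" by (auto simp: qq)
  have i: "inj_on cls_flat (quo ?Q ?u Un quo ?R ?w)"
   using cls_flat_bij(2)[OF f(3) rs' ED[OF rsE]] by (simp add: qQ eq qq)
  have "Dq X r Y s (flt (X Un Y) (r' Un s') (r Un s) a) =
   tmap (Sq X r) (Sq Y s) (flt X r' r) (flt Y s' s) (Dq ?Q ?u ?R ?w a)"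
   using D_nat[OF f(4,5) dq i a] by (simp add: qQ eq qq cls_flat_bij(1)[OF X(1,4) r] cls_flat_bij(1)[OF X(2,5) s])
  then show "tL Z (%a1 a2. T a1 a2 b) (Dq X r Y s (flt (X Un Y) (r' Un s') (r Un s) a)) =
   tL Z (%a1 a2. T' a1 a2 b) (Dq ?Q ?u ?R ?w a)"
   unfolding T'_def
   by (simp only:) (rule tlift_tmap[OF v(1,2) D_in[OF f(4,5) dq a] tw_vs[OF f(8)] tw_vs[OF f(9)] Z],
    use trilinD(6)[OF T0] b flt_in[OF X(1,4,6)] flt_in[OF X(2,5,7)] in auto)
 qed
 also have "... = tL Z (%s z. tL Z (%a c. T' a c z) s) (tmap (Sq ?Q ?u >< Sq ?R ?w) (sp P (?Q Un ?R)) (Dq ?Q ?u ?R ?w) id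
   (cdel P (?Q Un ?R) (?u Un ?w) p))"
  by (rule tlift_tmap_tens_id[OF v Z tw_vs[OF f(7)] T' _ ci, symmetric]) (use tc in auto)
 also have "... = tL Z (%x y. tL Z (%a b. tL Z (%c d. T' a c (tmlt P ?Q ?R b d)) (cdel P ?R ?w y)) (cdel P ?Q ?u x)) (tcop P ?Q ?R p)"
  unfolding cd_D[OF f(1,2) dQ u w p']
  by (rule tlift_m1324[OF v(1) tw_vs[OF f(1)] v(2) tw_vs[OF f(2)] v(3) tw_vs[OF f(1)] tw_vs[OF f(2)] Z _ _ m_bilin[OF f(1,2) dQ] D_in[OF f(1,2) dQ p'] T'])
   (use cd_in[OF f(1) u] cd_in[OF f(2) w] in auto)
 also have "... = tL Z (%x y. tL Z (%a b. tL Z (%c d. T a c (tmlt P ?Q ?R b d)) (dq Y s' s y)) (dq X r' r x)) (tcop P ?Q ?R p)"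
 proof (rule tlift_cong[OF tw_vs[OF f(1)] tw_vs[OF f(2)] D_in[OF f(1,2) dQ p']])
  fix x y assume "x : carr (sp P ?Q)" "y : carr (sp P ?R)"
  then have x: "x : scar P ?Q" and y: "y : scar P ?R" by auto
  note mb = m_bilin[OF f(1,2) dQ]
  have "tL Z (%a b. tL Z (%c d. T' a c (tmlt P ?Q ?R b d)) (cdel P ?R ?w y)) (cdel P ?Q ?u x) =
    tL Z (%a b. tL Z (%c d. T (flt X r' r a) c (tmlt P ?Q ?R b d)) (dq Y s' s y)) (cdel P ?Q ?u x)"
   unfolding T'_def
   by (intro tlift_cong[OF v(1) tw_vs[OF f(1)] cdq_in[OF X(1,4,6) x]] dq_int[OF X(2,5,7) y Z, symmetric]
     bilin_comp[OF trilinD(4)[OF T0] linmap_id bilin_right[OF mb]]) (use flt_in[OF X(1,4,6)] in auto)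
  also have "... = tL Z (%a b. tL Z (%c d. T a c (tmlt P ?Q ?R b d)) (dq Y s' s y)) (dq X r' r x)"
  proof (rule dq_int[OF X(1,4,6) x Z, symmetric])
   show "bilin (Sq X r) (sp P ?Q) Z (%a b. tL Z (%c d. T a c (tmlt P ?Q ?R b d)) (dq Y s' s y))"
    by (intro bilinI linmap_tlift_param[OF qvs[OF X(2)] qvs[OF X(2)] Z dq_in[OF X(2,5,7) y]])
     (auto intro!: trilinD(1)[OF T0] linmap_comp[OF trilinD(3)[OF T0] bilin_left[OF mb]] bilin_in[OF mb, simplified])
  qed
  finally show "tL Z (%a b. tL Z (%c d. T' a c (tmlt P ?Q ?R b d)) (cdel P ?R ?w y)) (cdel P ?Q ?u x) = ..." .
 qed
 finally show ?thesis .
qed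

lemma dq_empty: "dq {} {} {} p = cdel P {} {} p" if "p : scar P {}"
proof -
 have e: "{} : eqvs {}" by (simp add: eqvs_empty)
 have c: "cdel P {} {} p : carr (sp P {} >< sp P {})" using cd_in[OF _ e that] by simp
 have "eqv_quo {} {} = {}" by (simp add: eqv_quo_def)
 then show ?thesis
  using c by (simp add: cdel_quo_def)
   (rule tmap_ident[OF tw_vs tw_vs], auto intro: smor_ident[OF tw_species])
qed

end

section \<open>Double twisted bialgebras\<close>

text \<open>The axioms of a double twisted bialgebra. In contrast to a contraction-extraction
  coproduct, the second coproduct stays on the label set \<open>X\<close>; this is why the Fock
  construction for it needs no multiplication of colours.\<close>

locale dtwist = twisted_bialg Q for Q :: "('k::field, 'q::ab_group_add, 'z) dtbialg_scheme" +
 assumes td_lin: "finite X ==> linmap (sp Q X) (sp Q X >< sp Q X) (tdel Q X)"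
  and td_nat: "finite X ==> inj_on h X ==> p : scar Q X ==>
   tdel Q (h ` X) (smor Q X h p) = tmap (sp Q (h ` X)) (sp Q (h ` X)) (smor Q X h) (smor Q X h) (tdel Q X p)"
  and td_coassoc: "finite X ==> p : scar Q X ==>
   tassoc (sp Q X) (sp Q X) (sp Q X) (tmap (sp Q X >< sp Q X) (sp Q X) (tdel Q X) id (tdel Q X p)) =
   tmap (sp Q X) (sp Q X >< sp Q X) id (tdel Q X) (tdel Q X p)"
  and te_lin: "finite X ==> linmap (sp Q X) ground (teps Q X)"
  and te_nat: "finite X ==> inj_on h X ==> p : scar Q X ==> teps Q (h ` X) (smor Q X h p) = teps Q X p"
  and td_counitL: "finite X ==> p : scar Q X ==> tL (sp Q X) (%a b. smul (sp Q X) (teps Q X a) b) (tdel Q X p) = p"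
  and td_counitR: "finite X ==> p : scar Q X ==> tL (sp Q X) (%a b. smul (sp Q X) (teps Q X b) a) (tdel Q X p) = p"
  and td_m: "finite X ==> finite Y ==> X Int Y = {} ==> p : scar Q X ==> q : scar Q Y ==>
   tdel Q (X Un Y) (tmlt Q X Y p q) =
   tmul (sp Q (X Un Y)) (sp Q (X Un Y)) (tmlt Q X Y) (tmlt Q X Y) (tdel Q X p) (tdel Q Y q)"
  and td_one: "tdel Q {} (tone Q) = tens (sp Q {}) (sp Q {}) (tone Q) (tone Q)"
  and td_D: "finite X ==> finite Y ==> X Int Y = {} ==> z : scar Q (X Un Y) ==>
   tmap (sp Q X >< sp Q Y) (sp Q (X Un Y)) (tcop Q X Y) id (tdel Q (X Un Y) z) =
   m1324 (sp Q X) (sp Q Y) (sp Q (X Un Y)) (tmlt Q X Y)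
    (tmap (sp Q X >< sp Q X) (sp Q Y >< sp Q Y) (tdel Q X) (tdel Q Y) (tcop Q X Y z))"
  and td_cou: "p : scar Q {} ==>
   tL (sp Q {}) (%a b. smul (sp Q {}) (tcou Q a) b) (tdel Q {} p) = smul (sp Q {}) (tcou Q p) (tone Q)"

context ce
begin

section \<open>The second coproduct of P'\<close>

lemma finite_E: "finite X ==> finite (E X r')"
 using finite_eqvs by (simp add: E_def)

lemma tdel_C_lin:
 assumes "finite X"
 shows "linmap (S X) (S X >< S X) (tdel C X)"
proof -
 have "linmap (S X) (S X >< S X) (%f. tmap (S X) (S X) (sg r) (sg r') (dq X r' r (lk f r')))"
  if r: "r' : eqvs X" "r : E X r'" for r r'
  by (rule linmap_comp[OF linmap_tmap[OF qvs[OF assms] qvs[OF assms] vS[OF assms] vS[OF assms] sg_lin[OF assms ED(1)[OF r(2)]] sg_lin[OF assms r(1)]]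
    linmap_comp[OF dq_lin[OF assms r] lk_lin[OF r(1)]]])
 then show ?thesis
  unfolding com_species_def by (simp add: E_def[symmetric], intro linmap_setsum vspace_tensor)
qed

lemma tdel_C_in: "finite X ==> x : carr (S X) ==> tdel C X x : carr (S X >< S X)"
 by (rule linmap_in[OF tdel_C_lin])

lemma tdel_C_sg:
 assumes "finite X" "r' : eqvs X" "p : Cq X r'"
 shows "tdel C X (sg r' p) = (SUM r:E X r'. tmap (S X) (S X) (sg r) (sg r') (dq X r' r p))"
proof -
 have z: "dq X s r 0 = 0" if "s : eqvs X" "r : E X s" for s r
  by (rule linmap_zero[OF dq_lin[OF assms(1) that] qvs[OF assms(1)]])
 have "tdel C X (sg r' p) = (SUM s:eqvs X. (%s x. SUM r:E X s. tmap (S X) (S X) (sg r) (sg s) (dq X s r x)) s (lk (sg r' p) s))"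
  by (simp add: com_species_def E_def)
 also have "... = (SUM r:E X r'. tmap (S X) (S X) (sg r) (sg r') (dq X r' r p))"
  by (rule sum_lookup_single[OF finite_eqvs[OF assms(1)] assms(2)]) (auto intro!: sum.neutral simp: z tmap_def)
 finally show ?thesis .
qed

lemma tlift_tdel_C:
 assumes "finite X" "r' : eqvs X" "p : Cq X r'" "vspace Z" "bilin (S X) (S X) Z be"
 shows "tL Z be (tdel C X (sg r' p)) = (SUM r:E X r'. tL Z (%a b. be (sg r a) (sg r' b)) (dq X r' r p))"
 unfolding tdel_C_sg[OF assms(1-3)] tlift_sum_arg[OF assms(4)]
proof (rule sum.cong[OF refl])
 fix r assume r: "r : E X r'"
 show "tL Z be (tmap (S X) (S X) (sg r) (sg r') (dq X r' r p)) = tL Z (%a b. be (sg r a) (sg r' b)) (dq X r' r p)"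
  by (rule tlift_tmap[OF qvs[OF assms(1)] qvs[OF assms(1)] dq_in[OF assms(1,2) r assms(3)] vS[OF assms(1)] vS[OF assms(1)] assms(4,5)])
   (use sg_in[OF assms(1) ED(1)[OF r]] sg_in[OF assms(1,2)] in auto)
qed

lemma teps_C_lin: "finite X ==> linmap (S X) ground (teps C X)"
proof -
 assume X: "finite X"
 have "linmap (S X) ground (%f. ceps P (quo X r) (lk f r))" if "r : eqvs X" for r
  by (rule linmap_comp[OF ce_lin[OF finite_quo[OF X]] lk_lin[OF that]])
 then show ?thesis unfolding com_species_def by (simp, intro linmap_setsum vspace_ground)
qed

lemma teps_C_sg: "finite X ==> r : eqvs X ==> teps C X (sg r p) = ceps P (quo X r) p"
 unfolding com_species_def dtbialg.simps tbialg.simps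
 by (rule sum_lookup_single[OF finite_eqvs]) (simp_all add: linmap_zero[OF ce_lin qvs])

text \<open>A coarser equivalence may join the two parts, but such terms are assumed to vanish;
  those that remain are pairs of coarser equivalences.\<close>

lemma sum_E_Un:
 assumes "finite X" "finite Y" "X Int Y = {}" "r' : eqvs X" "s' : eqvs Y"
  and f: "!!t. t : E (X Un Y) (r' Un s') ==> \<not> splits X Y t ==> f t = 0"
 shows "(SUM t:E (X Un Y) (r' Un s'). f t) = (SUM r:E X r'. SUM s:E Y s'. f (r Un s))"
proof -
 have "(SUM t:E (X Un Y) (r' Un s'). f t) = (SUM t:{t:E (X Un Y) (r' Un s'). splits X Y t}. f t)"
  using assms finite_E by (intro sum.mono_neutral_right) auto
 also have "... = (SUM (r, s):E X r' \<times> E Y s'. f (r Un s))"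
 proof (rule sum.reindex_bij_witness[of _ "%(r, s). r Un s" "%t. (t Int X \<times> X, t Int Y \<times> Y)"])
  fix t assume t: "t : {t:E (X Un Y) (r' Un s'). splits X Y t}"
  then have tE: "t : eqvs (X Un Y)" "r' Un s' <= t" using ED[of t "X Un Y" "r' Un s'"] by blast+
  show e: "(case (t Int X \<times> X, t Int Y \<times> Y) of (r, s) => r Un s) = t" using t by (simp add: splits_def)
  show "(t Int X \<times> X, t Int Y \<times> Y) : E X r' \<times> E Y s'"
   using tE eqvs_sub[OF assms(4)] eqvs_sub[OF assms(5)] by (auto intro!: EI eqvs_Int[OF tE(1)])
  show "(case (t Int X \<times> X, t Int Y \<times> Y) of (r, s) => f (r Un s)) = f t" using e by simp
 next
  fix z assume "z : E X r' \<times> E Y s'"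
  then obtain r s where z: "z = (r, s)" "r : E X r'" "s : E Y s'" by auto
  note rs = ED[OF z(2)] ED[OF z(3)]
  show "((case z of (r, s) => r Un s) Int X \<times> X, (case z of (r, s) => r Un s) Int Y \<times> Y) = z"
   using Un_restrict[OF rs(1,3) assms(3)] z by simp
  show "(case z of (r, s) => r Un s) : {t:E (X Un Y) (r' Un s'). splits X Y t}"
   using z rs eqvs_Un[OF rs(1,3) assms(3)] splits_Un[OF rs(1,3)] by (auto intro!: EI)
 qed
 also have "... = (SUM r:E X r'. SUM s:E Y s'. f (r Un s))"
  by (simp add: sum.cartesian_product)
 finally show ?thesis .
qed

lemma E_map:
 assumes "finite X" "inj_on h X" "r' : eqvs X"
 shows "bij_betw (eqv_map h) (E X r') (E (h ` X) (eqv_map h r'))"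
proof -
 note b = bij_eqv_map[OF assms(2)]
 have iff: "eqv_map h r' <= eqv_map h r \<longleftrightarrow> r' <= r" if r: "r : eqvs X" for r
 proof
  assume *: "eqv_map h r' <= eqv_map h r"
  show "r' <= r"
  proof (intro subrelI)
   fix x y assume xy: "(x, y) : r'"
   note d = eqvs_dom[OF assms(3) xy]
   have "(h x, h y) : eqv_map h r'" using eqv_map_iff[OF assms(3,2) d] xy by simp
   then show "(x, y) : r" using * eqv_map_iff[OF r assms(2) d] by blast
  qed
 qed (auto simp: eqv_map_def)
 have "eqv_map h ` E X r' = E (h ` X) (eqv_map h r')"
 proof (intro equalityI subsetI)
  fix s assume "s : E (h ` X) (eqv_map h r')"
  then have s: "s : eqvs (h ` X)" "eqv_map h r' <= s" using ED by auto
  then obtain r where "r : eqvs X" "s = eqv_map h r" using b unfolding bij_betw_def by blast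
  then show "s : eqv_map h ` E X r'" using s iff by (auto intro!: EI imageI)
 next
  fix s assume "s : eqv_map h ` E X r'"
  then obtain r where r: "r : E X r'" "s = eqv_map h r" by auto
  show "s : E (h ` X) (eqv_map h r')"
   unfolding r(2) using iff[OF ED(1)[OF r(1)]] ED[OF r(1)] by (intro EI eqv_map_in[OF _ assms(2)]) auto
 qed
 moreover have "inj_on (eqv_map h) (E X r')"
  using b by (auto simp: bij_betw_def E_def intro: inj_on_subset)
 ultimately show ?thesis by (simp add: bij_betw_def)
qed

lemma tdel_C_nat:
 assumes X: "finite X" and s: "inj_on h X" and x: "x : carr (S X)"
 shows "tdel C (h ` X) (smor C X h x) = tmap (S (h ` X)) (S (h ` X)) (smor C X h) (smor C X h) (tdel C X x)"
proof (rule S_ext[OF X _ _ _ x])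
 have X': "finite (h ` X)" using X by simp
 note v = vS[OF X] and v' = vS[OF X'] and sl = smor_C_lin[OF X s]
 let ?W = "S (h ` X) >< S (h ` X)"
 note W = vspace_tensor[of "S (h ` X)" "S (h ` X)"]
 note tb = bilin_tens[OF v' v']
 show "linmap (S X) ?W (%x. tdel C (h ` X) (smor C X h x))"
  by (rule linmap_comp[OF tdel_C_lin[OF X'] sl])
 show "linmap (S X) ?W (%x. tmap (S (h ` X)) (S (h ` X)) (smor C X h) (smor C X h) (tdel C X x))"
  by (rule linmap_comp[OF linmap_tmap[OF v v v' v' sl sl] tdel_C_lin[OF X]])
 fix r' p assume r': "r' : eqvs X" and p: "p : Cq X r'"
 note sr = eqv_map_in[OF r' s] and sp' = quo_map_in[OF X s r' p]
 have "tdel C (h ` X) (smor C X h (sg r' p)) = tL ?W (tens (S (h ` X)) (S (h ` X))) (tdel C (h ` X) (sg (eqv_map h r') (hq h X r' p)))"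
  unfolding smor_C_sg[OF X s r' p]
  by (rule tlift_tens_id[OF v' v' tdel_C_in[OF X' sg_in[OF X' sr sp']], symmetric])
 also have "... = (SUM t:E (h ` X) (eqv_map h r'). tL ?W (%a b. tens (S (h ` X)) (S (h ` X)) (sg t a) (sg (eqv_map h r') b))
   (dq (h ` X) (eqv_map h r') t (hq h X r' p)))"
  by (rule tlift_tdel_C[OF X' sr sp' W tb])
 also have "... = (SUM r:E X r'. tL ?W (%a b. tens (S (h ` X)) (S (h ` X)) (sg (eqv_map h r) a) (sg (eqv_map h r') b))
   (dq (h ` X) (eqv_map h r') (eqv_map h r) (hq h X r' p)))"
  by (rule sum.reindex_bij_betw[OF E_map[OF X s r'], symmetric])
 also have "... = (SUM r:E X r'. tL ?W (%a b. tens (S (h ` X)) (S (h ` X)) (smor C X h (sg r a)) (smor C X h (sg r' b))) (dq X r' r p))"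
 proof (rule sum.cong[OF refl])
  fix r assume r: "r : E X r'"
  note rr = ED(1)[OF r] and srr = eqv_map_in[OF ED(1)[OF r] s]
  have "tL ?W (%a b. tens (S (h ` X)) (S (h ` X)) (sg (eqv_map h r) a) (sg (eqv_map h r') b))
   (dq (h ` X) (eqv_map h r') (eqv_map h r) (hq h X r' p)) =
   tL ?W (%a b. tens (S (h ` X)) (S (h ` X)) (sg (eqv_map h r) (hq h X r a)) (sg (eqv_map h r') (hq h X r' b))) (dq X r' r p)"
   unfolding dq_nat[OF X r' r p s]
   by (rule tlift_tmap[OF qvs[OF X] qvs[OF X] dq_in[OF X r' r p] qvs[OF X'] qvs[OF X'] W bilin_comp[OF tb sg_lin[OF X' srr] sg_lin[OF X' sr]]])
    (use quo_map_in[OF X s rr] quo_map_in[OF X s r'] in auto)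
  also have "... = tL ?W (%a b. tens (S (h ` X)) (S (h ` X)) (smor C X h (sg r a)) (smor C X h (sg r' b))) (dq X r' r p)"
   by (rule tlift_cong[OF qvs[OF X] qvs[OF X] dq_in[OF X r' r p]]) (simp add: smor_C_sg[OF X s rr] smor_C_sg[OF X s r'])
  finally show "tL ?W (%a b. tens (S (h ` X)) (S (h ` X)) (sg (eqv_map h r) a) (sg (eqv_map h r') b))
   (dq (h ` X) (eqv_map h r') (eqv_map h r) (hq h X r' p)) = ..." .
 qed
 also have "... = tmap (S (h ` X)) (S (h ` X)) (smor C X h) (smor C X h) (tdel C X (sg r' p))"
  unfolding tmap_def by (rule tlift_tdel_C[OF X r' p W bilin_comp[OF tb sl sl], symmetric])
 finally show "tdel C (h ` X) (smor C X h (sg r' p)) = tmap (S (h ` X)) (S (h ` X)) (smor C X h) (smor C X h) (tdel C X (sg r' p))" .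
qed

text \<open>On the left the sum runs over chains, each equivalence coarser than the one before; on
  the right over all pairs coarser than \<open>r3\<close>. Along chains the terms agree by
  \<open>dq_coassoc\<close>, and the remaining terms of the right side vanish by
  \<open>dq_coassoc0\<close>.\<close>

lemma tdel_C_coassoc:
 assumes X: "finite X" and x: "x : carr (S X)"
 shows "tassoc (S X) (S X) (S X) (tmap (S X >< S X) (S X) (tdel C X) id (tdel C X x)) =
   tmap (S X) (S X >< S X) id (tdel C X) (tdel C X x)"
proof -
 note v = vS[OF X]
 let ?W = "S X >< S X >< S X" and ?T = "%a b c. tens (S X) (S X >< S X) a (tens (S X) (S X) b c)"
 note W = vspace_tensor[of "S X" "S X >< S X"]
 have T: "trilin (S X) (S X) (S X) ?W ?T" by (rule trilin_tens[OF v v v])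
 note dl = tdel_C_lin[OF X]
 have bL: "bilin (S X) (S X) ?W (%a c. tL ?W (%a b. ?T a b c) (tdel C X a))"
  using bilin_comp[OF linmap_tlift_trilin(1)[OF v v v W T] dl linmap_id] .
 have bR: "bilin (S X) (S X) ?W (%a b. tL ?W (?T a) (tdel C X b))"
  using bilin_comp[OF linmap_tlift_trilin(2)[OF v v v W T] linmap_id dl] .
 have "tL ?W (%a c. tL ?W (%a b. ?T a b c) (tdel C X a)) (tdel C X x) = tL ?W (%a b. tL ?W (?T a) (tdel C X b)) (tdel C X x)"
 proof (rule S_ext[OF X linmap_tlift_arg[OF v v W bL dl] linmap_tlift_arg[OF v v W bR dl] _ x])
  fix r3 p assume r3: "r3 : eqvs X" and p: "p : Cq X r3"
  \<comment> \<open>The summand of the right side, defined for every pair and not only for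
    comparable ones.\<close>
  define G where "G r1 r2 = tL ?W (%a b. tL ?W (%b c. ?T (sg r1 a) (sg r2 b) (sg r3 c)) (dq X r3 r2 b)) (dq X r3 r1 p)" for r1 r2
  have TT: "trilin (Sq X r1) (Sq X r2) (Sq X r3) ?W (%a b c. ?T (sg r1 a) (sg r2 b) (sg r3 c))"
   if "r1 : eqvs X" "r2 : eqvs X" for r1 r2
   by (rule trilin_comp[OF T sg_lin[OF X that(1)] sg_lin[OF X that(2)] sg_lin[OF X r3]])
  have "tL ?W (%a c. tL ?W (%a b. ?T a b c) (tdel C X a)) (tdel C X (sg r3 p)) =
   (SUM r2:E X r3. tL ?W (%a c. tL ?W (%a b. ?T a b (sg r3 c)) (tdel C X (sg r2 a))) (dq X r3 r2 p))"
   by (rule tlift_tdel_C[OF X r3 p W bL])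
  also have "... = (SUM r2:E X r3. SUM r1:E X r2. tL ?W (%a c. tL ?W (%a b. ?T (sg r1 a) (sg r2 b) (sg r3 c)) (dq X r2 r1 a)) (dq X r3 r2 p))"
  proof (rule sum.cong[OF refl])
   fix r2 assume r2: "r2 : E X r3"
   show "tL ?W (%a c. tL ?W (%a b. ?T a b (sg r3 c)) (tdel C X (sg r2 a))) (dq X r3 r2 p) =
    (SUM r1:E X r2. tL ?W (%a c. tL ?W (%a b. ?T (sg r1 a) (sg r2 b) (sg r3 c)) (dq X r2 r1 a)) (dq X r3 r2 p))"
    unfolding tlift_sum_param[OF W, symmetric]
    by (intro tlift_cong[OF qvs[OF X] qvs[OF X] dq_in[OF X r3 r2 p]] tlift_tdel_C[OF X ED(1)[OF r2] _ W trilinD(6)[OF T]])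
     (use sg_in[OF X r3] in auto)
  qed
  also have "... = (SUM r2:E X r3. SUM r1:E X r2. G r1 r2)"
   unfolding G_def
   by (intro sum.cong refl dq_coassoc[OF X r3 _ _ p W TT]) (auto dest: ED)
  \<comment> \<open>Pairs that are not comparable contribute 0, so the inner range can be enlarged
    and the two sums interchanged.\<close>
  also have "... = (SUM r2:E X r3. SUM r1:E X r3. G r1 r2)"
  proof (rule sum.cong[OF refl])
   fix r2 assume r2: "r2 : E X r3"
   show "(SUM r1:E X r2. G r1 r2) = (SUM r1:E X r3. G r1 r2)"
   proof (rule sum.mono_neutral_left[OF finite_E[OF X]])
    show "E X r2 <= E X r3" using ED[OF r2] by (auto simp: E_def eqv_le_iff)
    show "ALL r1:E X r3 - E X r2. G r1 r2 = 0"
    proof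
     fix r1 assume r1: "r1 : E X r3 - E X r2"
     then have "\<not> eqv_le r1 r2" "r1 : E X r3" by (auto simp: E_def)
     then show "G r1 r2 = 0" unfolding G_def
      using dq_coassoc0[OF X r3 r2 _ _ p W TT[OF _ ED(1)[OF r2]]] ED(1) by blast
    qed
   qed
  qed
  also have "... = (SUM r1:E X r3. SUM r2:E X r3. G r1 r2)"
   by (rule sum.swap)
  also have "... = (SUM r1:E X r3. tL ?W (%a b. tL ?W (?T (sg r1 a)) (tdel C X (sg r3 b))) (dq X r3 r1 p))"
  proof (rule sum.cong[OF refl])
   fix r1 assume r1: "r1 : E X r3"
   show "(SUM r2:E X r3. G r1 r2) = tL ?W (%a b. tL ?W (?T (sg r1 a)) (tdel C X (sg r3 b))) (dq X r3 r1 p)"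
    unfolding G_def tlift_sum_param[OF W, symmetric]
    by (intro tlift_cong[OF qvs[OF X] qvs[OF X] dq_in[OF X r3 r1 p]] tlift_tdel_C[OF X r3 _ W trilinD(4)[OF T], symmetric])
     (use sg_in[OF X ED(1)[OF r1]] in auto)
  qed
  also have "... = tL ?W (%a b. tL ?W (?T a) (tdel C X b)) (tdel C X (sg r3 p))"
   by (rule tlift_tdel_C[OF X r3 p W bR, symmetric])
  finally show "tL ?W (%a c. tL ?W (%a b. ?T a b c) (tdel C X a)) (tdel C X (sg r3 p)) =
   tL ?W (%a b. tL ?W (?T a) (tdel C X b)) (tdel C X (sg r3 p))" .
 qed
 then show ?thesis
  using tassoc_tmap_eq[OF v v v v tdel_C_in[OF X] tdel_C_in[OF X x]] tmap_id_eq[OF v v v v tdel_C_in[OF X] tdel_C_in[OF X x]] by simp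
qed

text \<open>The left counit keeps all coarser equivalences and needs their sum, while the right
  counit kills every term except the diagonal one.\<close>

lemma tdel_C_counit:
 assumes X: "finite X" and x: "x : carr (S X)"
 shows "tL (S X) (%a b. smul (S X) (teps C X a) b) (tdel C X x) = x"
  and "tL (S X) (%a b. smul (S X) (teps C X b) a) (tdel C X x) = x"
proof -
 note v = vS[OF X] and b = bilin_ground_scale[OF vS[OF X] teps_C_lin[OF X]] and dl = tdel_C_lin[OF X]
 note sl = linmap_scale[OF sg_lin[OF X]]
 show "tL (S X) (%a b. smul (S X) (teps C X a) b) (tdel C X x) = x"
 proof (rule S_ext[OF X linmap_tlift_arg[OF v v v b(1) dl] linmap_id _ x])
  fix r' p assume r': "r' : eqvs X" and p: "p : Cq X r'"
  have "tL (S X) (%a b. smul (S X) (teps C X a) b) (tdel C X (sg r' p)) =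
   (SUM r:E X r'. tL (S X) (%a b. smul (S X) (teps C X (sg r a)) (sg r' b)) (dq X r' r p))"
   by (rule tlift_tdel_C[OF X r' p v b(1)])
  also have "... = (SUM r:E X r'. sg r' (tL (Sq X r') (%a b. sscl P (ceps P (quo X r) a) b) (dq X r' r p)))"
  proof (rule sum.cong[OF refl])
   fix r assume r: "r : E X r'"
   have "tL (S X) (%a b. smul (S X) (teps C X (sg r a)) (sg r' b)) (dq X r' r p) =
    tL (S X) (%a b. sg r' (sscl P (ceps P (quo X r) a) b)) (dq X r' r p)"
    by (rule tlift_cong[OF qvs[OF X] qvs[OF X] dq_in[OF X r' r p]]) (use sl[OF r'] in \<open>simp add: teps_C_sg[OF X ED(1)[OF r]]\<close>)
   also have "... = sg r' (tL (Sq X r') (%a b. sscl P (ceps P (quo X r) a) b) (dq X r' r p))"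
    by (rule linmap_of_tlift[OF qvs[OF X] qvs[OF X] dq_in[OF X r' r p] sg_lin[OF X r'] qvs[OF X], symmetric])
     (use vspace_scale[OF qvs[OF X]] in auto)
   finally show "tL (S X) (%a b. smul (S X) (teps C X (sg r a)) (sg r' b)) (dq X r' r p) = ..." .
  qed
  also have "... = sg r' (SUM r:E X r'. tL (Sq X r') (%a b. sscl P (ceps P (quo X r) a) b) (dq X r' r p))"
  proof -
   have "(SUM r:A. sg r' (f r)) = sg r' (SUM r:A. f r)" for A and f :: "_ => 'p"
    by (induction A rule: infinite_finite_induct) (auto simp: single_add)
   then show ?thesis .
  qed
  finally show "tL (S X) (%a b. smul (S X) (teps C X a) b) (tdel C X (sg r' p)) = sg r' p"
   by (simp add: dq_counitL[OF X r' p])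
 qed
 show "tL (S X) (%a b. smul (S X) (teps C X b) a) (tdel C X x) = x"
 proof (rule S_ext[OF X linmap_tlift_arg[OF v v v b(2) dl] linmap_id _ x])
  fix r' p assume r': "r' : eqvs X" and p: "p : Cq X r'"
  have "tL (S X) (%a b. smul (S X) (teps C X b) a) (tdel C X (sg r' p)) =
   (SUM r:E X r'. tL (S X) (%a b. smul (S X) (teps C X (sg r' b)) (sg r a)) (dq X r' r p))"
   by (rule tlift_tdel_C[OF X r' p v b(2)])
  also have "... = (SUM r:E X r'. if r = r' then sg r' p else 0)"
  proof (rule sum.cong[OF refl])
   fix r assume r: "r : E X r'"
   have "tL (S X) (%a b. smul (S X) (teps C X (sg r' b)) (sg r a)) (dq X r' r p) =
    tL (S X) (%a b. sg r (sscl P (ceps P (quo X r') b) a)) (dq X r' r p)"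
    by (rule tlift_cong[OF qvs[OF X] qvs[OF X] dq_in[OF X r' r p]]) (use sl[OF ED(1)[OF r]] in \<open>simp add: teps_C_sg[OF X r']\<close>)
   also have "... = sg r (tL (Sq X r) (%a b. sscl P (ceps P (quo X r') b) a) (dq X r' r p))"
    by (rule linmap_of_tlift[OF qvs[OF X] qvs[OF X] dq_in[OF X r' r p] sg_lin[OF X ED(1)[OF r]] qvs[OF X], symmetric])
     (use vspace_scale[OF qvs[OF X]] in auto)
   finally show "tL (S X) (%a b. smul (S X) (teps C X (sg r' b)) (sg r a)) (dq X r' r p) = (if r = r' then sg r' p else 0)"
    by (simp add: dq_counitR[OF X r' r p])
  qed
  also have "... = sg r' p"
   using finite_E[OF X] EI[OF r' subset_refl] by (simp add: sum.delta)
  finally show "tL (S X) (%a b. smul (S X) (teps C X b) a) (tdel C X (sg r' p)) = sg r' p" .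
 qed
qed

lemma tdel_C_m:
 assumes X: "finite X" "finite Y" "X Int Y = {}" and xy: "x : carr (S X)" "y : carr (S Y)"
 shows "tdel C (X Un Y) (tmlt C X Y x y) =
   tmul (S (X Un Y)) (S (X Un Y)) (tmlt C X Y) (tmlt C X Y) (tdel C X x) (tdel C Y y)"
proof (rule S_ext2[OF X(1,2) _ _ _ xy])
 have f: "finite (X Un Y)" using X by simp
 note vX = vS[OF X(1)] and vY = vS[OF X(2)] and vU = vS[OF f] and mb = tmlt_C_lin[OF X]
 let ?U = "S (X Un Y)"
 let ?W = "?U >< ?U"
 note W = vspace_tensor[of ?U ?U] and tb = bilin_tens[OF vU vU]
 show "bilin (S X) (S Y) ?W (%x y. tdel C (X Un Y) (tmlt C X Y x y))"
  by (rule linmap_bilin[OF tdel_C_lin[OF f] mb])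
 show "bilin (S X) (S Y) ?W (%x y. tmul ?U ?U (tmlt C X Y) (tmlt C X Y) (tdel C X x) (tdel C Y y))"
  by (rule bilin_comp[OF bilin_tmul[OF vX vX vY vY vU vU mb mb] tdel_C_lin[OF X(1)] tdel_C_lin[OF X(2)]])
 fix r' p s' q assume r': "r' : eqvs X" and p: "p : Cq X r'" and s': "s' : eqvs Y" and q: "q : Cq Y s'"
 let ?m = "Mq X r' Y s'"
 let ?h = "%r s a b. tens ?U ?U (sg (r Un s) a) (sg (r' Un s') b)"
 note u = eqvs_Un[OF r' s' X(3)] and mi = m_quo_in[OF X r' p s' q]
 have "tdel C (X Un Y) (tmlt C X Y (sg r' p) (sg s' q)) = tL ?W (tens ?U ?U) (tdel C (X Un Y) (sg (r' Un s') (?m p q)))"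
  unfolding tmlt_C_sg[OF X r' p s' q] by (rule tlift_tens_id[OF vU vU tdel_C_in[OF f sg_in[OF f u mi]], symmetric])
 also have "... = (SUM t:E (X Un Y) (r' Un s'). tL ?W (%a b. tens ?U ?U (sg t a) (sg (r' Un s') b)) (dq (X Un Y) (r' Un s') t (?m p q)))"
  by (rule tlift_tdel_C[OF f u mi W tb])
 also have "... = (SUM r:E X r'. SUM s:E Y s'. tL ?W (?h r s) (dq (X Un Y) (r' Un s') (r Un s) (?m p q)))"
  by (rule sum_E_Un[OF X r' s']) (simp add: dq_m0[OF X r' s' _ _ p q])
 also have "... = (SUM r:E X r'. tL ?W (%a b. tL ?W (%c d. tens ?U ?U (tmlt C X Y (sg r a) c) (tmlt C X Y (sg r' b) d)) (tdel C Y (sg s' q))) (dq X r' r p))"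
 proof (rule sum.cong[OF refl])
  fix r assume r: "r : E X r'"
  note rr = ED(1)[OF r]
  have "(SUM s:E Y s'. tL ?W (?h r s) (dq (X Un Y) (r' Un s') (r Un s) (?m p q))) =
   (SUM s:E Y s'. tL ?W (%a b. tL ?W (%c d. tens ?U ?U (tmlt C X Y (sg r a) (sg s c)) (tmlt C X Y (sg r' b) (sg s' d))) (dq Y s' s q)) (dq X r' r p))"
  proof (rule sum.cong[OF refl])
   fix s assume s: "s : E Y s'"
   note ss = ED(1)[OF s]
   have "tL ?W (?h r s) (dq (X Un Y) (r' Un s') (r Un s) (?m p q)) =
    tL ?W (%a b. tL ?W (%c d. tens ?U ?U (sg (r Un s) (Mq X r Y s a c)) (sg (r' Un s') (?m b d))) (dq Y s' s q)) (dq X r' r p)"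
    by (rule dq_m[OF X r' s' r s p q W bilin_comp[OF tb sg_lin[OF f eqvs_Un[OF rr ss X(3)]] sg_lin[OF f u]]])
   also have "... = tL ?W (%a b. tL ?W (%c d. tens ?U ?U (tmlt C X Y (sg r a) (sg s c)) (tmlt C X Y (sg r' b) (sg s' d))) (dq Y s' s q)) (dq X r' r p)"
    by (intro tlift_cong[OF qvs[OF X(1)] qvs[OF X(1)] dq_in[OF X(1) r' r p]] tlift_cong[OF qvs[OF X(2)] qvs[OF X(2)] dq_in[OF X(2) s' s q]])
     (simp add: tmlt_C_sg[OF X rr _ ss] tmlt_C_sg[OF X r' _ s'])
   finally show "tL ?W (?h r s) (dq (X Un Y) (r' Un s') (r Un s) (?m p q)) = ..." .
  qed
  also have "... = tL ?W (%a b. tL ?W (%c d. tens ?U ?U (tmlt C X Y (sg r a) c) (tmlt C X Y (sg r' b) d)) (tdel C Y (sg s' q))) (dq X r' r p)"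
   unfolding tlift_sum_param[OF W, symmetric]
   by (intro tlift_cong[OF qvs[OF X(1)] qvs[OF X(1)] dq_in[OF X(1) r' r p]] tlift_tdel_C[OF X(2) s' q W, symmetric] bilin_pair(1)[OF tb mb mb])
    (use sg_in[OF X(1) rr] sg_in[OF X(1) r'] in auto)
  finally show "(SUM s:E Y s'. tL ?W (?h r s) (dq (X Un Y) (r' Un s') (r Un s) (?m p q))) = ..." .
 qed
 also have "... = tmul ?U ?U (tmlt C X Y) (tmlt C X Y) (tdel C X (sg r' p)) (tdel C Y (sg s' q))"
  unfolding tmul_def
 proof (rule tlift_tdel_C[OF X(1) r' p W, symmetric])
  show "bilin (S X) (S X) ?W (%a b. tL ?W (%c d. tens ?U ?U (tmlt C X Y a c) (tmlt C X Y b d)) (tdel C Y (sg s' q)))"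
   by (intro bilinI linmap_tlift_param[OF vY vY W tdel_C_in[OF X(2) sg_in[OF X(2) s' q]]])
    (auto intro: bilin_left[OF bilin_pair(2)[OF tb mb mb]] bilin_right[OF bilin_pair(2)[OF tb mb mb]])
 qed
 finally show "tdel C (X Un Y) (tmlt C X Y (sg r' p) (sg s' q)) = tmul ?U ?U (tmlt C X Y) (tmlt C X Y) (tdel C X (sg r' p)) (tdel C Y (sg s' q))" .
qed

lemma tdel_C_D:
 assumes X: "finite X" "finite Y" "X Int Y = {}" and z: "z : carr (S (X Un Y))"
 shows "tmap (S X >< S Y) (S (X Un Y)) (tcop C X Y) id (tdel C (X Un Y) z) =
   m1324 (S X) (S Y) (S (X Un Y)) (tmlt C X Y)
    (tmap (S X >< S X) (S Y >< S Y) (tdel C X) (tdel C Y) (tcop C X Y z))"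
proof -
 have f: "finite (X Un Y)" using X by simp
 note vX = vS[OF X(1)] and vY = vS[OF X(2)] and vU = vS[OF f] and mb = tmlt_C_lin[OF X]
 note dX = tdel_C_lin[OF X(1)] and dY = tdel_C_lin[OF X(2)] and dU = tdel_C_lin[OF f] and cl = tcop_C_lin[OF X]
 let ?U = "S (X Un Y)"
 let ?W = "(S X >< S Y) >< ?U" and ?T = "%a c z. tens (S X >< S Y) ?U (tens (S X) (S Y) a c) z"
 note W = vspace_tensor[of "S X >< S Y" ?U]
 note T = trilin_tens'[OF vX vY vU]
 have bL: "bilin ?U ?U ?W (%x z. tL ?W (%a c. ?T a c z) (tcop C X Y x))"
  using bilin_comp[OF linmap_tlift_trilin(1)[OF vX vY vU W T] cl linmap_id] .
 let ?M = "%s t. tL ?W (%a b. tL ?W (%c d. ?T a c (tmlt C X Y b d)) t) s"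
 note q1 = bilin_m1324(1)[OF vX vX vY vY W T mb] and bM = bilin_m1324(2)[OF vX vX vY vY W T mb]
 note bR = bilin_m1324(3)[OF vX vX vY vY W T mb dX dY]
 have "tL ?W (%x z. tL ?W (%a c. ?T a c z) (tcop C X Y x)) (tdel C (X Un Y) z) =
  tL ?W (%x y. ?M (tdel C X x) (tdel C Y y)) (tcop C X Y z)"
 proof (rule S_ext[OF f linmap_tlift_arg[OF vU vU W bL dU] linmap_tlift_arg[OF vX vY W bR cl] _ z])
  fix t p assume t: "t : eqvs (X Un Y)" and p: "p : Cq (X Un Y) t"
  have L: "tL ?W (%x z. tL ?W (%a c. ?T a c z) (tcop C X Y x)) (tdel C (X Un Y) (sg t p)) =
   (SUM u:E (X Un Y) t. tL ?W (%x z. tL ?W (%a c. ?T a c (sg t z)) (tcop C X Y (sg u x))) (dq (X Un Y) t u p))"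
   by (rule tlift_tdel_C[OF f t p W bL])
  have n0: "tL ?W (%x z. tL ?W (%a c. ?T a c (sg t z)) (tcop C X Y (sg u x))) (dq (X Un Y) t u p) = 0"
   if "u : E (X Un Y) t" "\<not> splits X Y u" for u
   by (simp add: tlift_tcop_C_0[OF X that(2) ED(1)[OF that(1)]] tlift_zero_param[OF W])
  show "tL ?W (%x z. tL ?W (%a c. ?T a c z) (tcop C X Y x)) (tdel C (X Un Y) (sg t p)) =
   tL ?W (%x y. ?M (tdel C X x) (tdel C Y y)) (tcop C X Y (sg t p))"
  proof (cases "splits X Y t")
   case False
   \<comment> \<open>A coarser equivalence keeps the related pair that prevents splitting, so every
     term of the left side vanishes along with the right side.\<close>
   have "\<not> splits X Y u" if "u : E (X Un Y) t" for u
    using False splits_disj[OF t X(3)] splits_disj[OF ED(1)[OF that] X(3)] ED(2)[OF that] by blast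
   then show ?thesis unfolding L tlift_tcop_C_0[OF X False t] by (intro sum.neutral) (auto intro: n0)
  next
   case True
   then obtain r' s' where r': "r' : eqvs X" and s': "s' : eqvs Y" and tt: "t = r' Un s'" using splitsE t by metis
   note p' = p[unfolded tt] and u = eqvs_Un[OF r' s' X(3)]
   let ?m = "Mq X r' Y s'"
   let ?k = "%r s a b c d. ?T (sg r a) (sg s c) (tmlt C X Y (sg r' b) (sg s' d))"
   have TT: "trilin (Sq X r) (Sq Y s) (Sq (X Un Y) (r' Un s')) ?W (%a c z. ?T (sg r a) (sg s c) (sg (r' Un s') z))"
    if "r : eqvs X" "s : eqvs Y" for r s
    by (rule trilin_comp[OF T sg_lin[OF X(1) that(1)] sg_lin[OF X(2) that(2)] sg_lin[OF f u]])
   note ci = D_quo_in[OF X r' s' p']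
   have "tL ?W (%x z. tL ?W (%a c. ?T a c z) (tcop C X Y x)) (tdel C (X Un Y) (sg t p)) =
    (SUM r:E X r'. SUM s:E Y s'. tL ?W (%x z. tL ?W (%a c. ?T a c (sg (r' Un s') z)) (tcop C X Y (sg (r Un s) x))) (dq (X Un Y) (r' Un s') (r Un s) p))"
    unfolding L unfolding tt by (rule sum_E_Un[OF X r' s']) (rule n0[unfolded tt])
   also have "... = (SUM r:E X r'. SUM s:E Y s'. tL ?W (%x y. tL ?W (%a b. tL ?W (?k r s a b)
     (dq Y s' s y)) (dq X r' r x)) (Dq X r' Y s' p))"
   proof (intro sum.cong refl)
    fix r s assume r: "r : E X r'" and s: "s : E Y s'"
    note rr = ED(1)[OF r] and ss = ED(1)[OF s]
    have rsE: "r Un s : E (X Un Y) (r' Un s')" using ED(2)[OF r] ED(2)[OF s] by (intro EI eqvs_Un[OF rr ss X(3)]) auto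
    have "tL ?W (%x z. tL ?W (%a c. ?T a c (sg (r' Un s') z)) (tcop C X Y (sg (r Un s) x))) (dq (X Un Y) (r' Un s') (r Un s) p) =
     tL ?W (%x z. tL ?W (%a c. ?T (sg r a) (sg s c) (sg (r' Un s') z)) (Dq X r Y s x)) (dq (X Un Y) (r' Un s') (r Un s) p)"
     by (intro tlift_cong[OF qvs[OF f] qvs[OF f] dq_in[OF f u rsE p']] tlift_tcop_C[OF X rr ss _ W trilinD(6)[OF T]])
      (use sg_in[OF f u] in auto)
    also have "... = tL ?W (%x y. tL ?W (%a b. tL ?W (%c d. ?T (sg r a) (sg s c) (sg (r' Un s') (?m b d)))
     (dq Y s' s y)) (dq X r' r x)) (Dq X r' Y s' p)"
     by (rule dq_D[OF X r' s' r s p' W TT[OF rr ss]])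
    also have "... = tL ?W (%x y. tL ?W (%a b. tL ?W (?k r s a b)
     (dq Y s' s y)) (dq X r' r x)) (Dq X r' Y s' p)"
     by (intro tlift_cong[OF qvs[OF X(1)] qvs[OF X(2)] ci] tlift_cong[OF qvs[OF X(1)] qvs[OF X(1)] dq_in[OF X(1) r' r]]
       tlift_cong[OF qvs[OF X(2)] qvs[OF X(2)] dq_in[OF X(2) s' s]]) (simp_all add: tmlt_C_sg[OF X r' _ s'])
    finally show "tL ?W (%x z. tL ?W (%a c. ?T a c (sg (r' Un s') z)) (tcop C X Y (sg (r Un s) x))) (dq (X Un Y) (r' Un s') (r Un s) p) = ..." .
   qed
   also have "... = tL ?W (%x y. SUM r:E X r'. tL ?W (%a b. SUM s:E Y s'. tL ?W (?k r s a b)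
     (dq Y s' s y)) (dq X r' r x)) (Dq X r' Y s' p)"
    by (simp only: tlift_sum_param[OF W])
   also have "... = tL ?W (%x y. ?M (tdel C X (sg r' x)) (tdel C Y (sg s' y))) (Dq X r' Y s' p)"
   proof (rule tlift_cong[OF qvs[OF X(1)] qvs[OF X(2)] ci])
    fix x y assume "x : carr (Sq X r')" "y : carr (Sq Y s')"
    then have x: "x : Cq X r'" and y: "y : Cq Y s'" by auto
    have sy: "tdel C Y (sg s' y) : carr (S Y >< S Y)" by (rule tdel_C_in[OF X(2) sg_in[OF X(2) s' y]])
    have "?M (tdel C X (sg r' x)) (tdel C Y (sg s' y)) =
     (SUM r:E X r'. tL ?W (%a b. tL ?W (%c d. ?T (sg r a) c (tmlt C X Y (sg r' b) d)) (tdel C Y (sg s' y))) (dq X r' r x))"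
     by (rule tlift_tdel_C[OF X(1) r' x W bM[OF sy]])
    also have "... = (SUM r:E X r'. tL ?W (%a b. SUM s:E Y s'. tL ?W (?k r s a b)
     (dq Y s' s y)) (dq X r' r x))"
    proof (rule sum.cong[OF refl])
     fix r assume r: "r : E X r'"
     show "tL ?W (%a b. tL ?W (%c d. ?T (sg r a) c (tmlt C X Y (sg r' b) d)) (tdel C Y (sg s' y))) (dq X r' r x) =
      tL ?W (%a b. SUM s:E Y s'. tL ?W (?k r s a b) (dq Y s' s y)) (dq X r' r x)"
      by (intro tlift_cong[OF qvs[OF X(1)] qvs[OF X(1)] dq_in[OF X(1) r' r x]] tlift_tdel_C[OF X(2) s' y W] q1)
       (use sg_in[OF X(1) ED(1)[OF r]] sg_in[OF X(1) r'] in auto)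
    qed
    finally show "(SUM r:E X r'. tL ?W (%a b. SUM s:E Y s'. tL ?W (?k r s a b)
     (dq Y s' s y)) (dq X r' r x)) = ?M (tdel C X (sg r' x)) (tdel C Y (sg s' y))" ..
   qed
   also have "... = tL ?W (%x y. ?M (tdel C X x) (tdel C Y y)) (tcop C X Y (sg t p))"
    unfolding tt by (rule tlift_tcop_C[OF X r' s' p' W bR, symmetric])
   finally show ?thesis .
  qed
 qed
 then show ?thesis
  using tmap_tens_id_eq[OF vX vY vU vU tcop_C_in[OF X] tdel_C_in[OF f z]]
   m1324_tmap_eq[OF vX vX vY vY vU vX vY tdel_C_in[OF X(1)] tdel_C_in[OF X(2)] mb tcop_C_in[OF X z]] by simp
qed

lemma dtwist_C: "dtwist C"
proof (intro dtwist.intro dtwist_axioms.intro twisted_bialg.intro, unfold sp_C scar_C)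
 have e: "{} : eqvs {}" by (simp add: eqvs_empty)
 have f0: "finite ({} :: lbl set)" by auto
 note v0 = vS[OF f0] and t0 = tw_vs[OF f0]
 have E0: "E {} {} = {{}}" by (auto simp: E_def eqvs_empty eqv_le_iff)
 have one: "tone C = sg {} (tone P)" by (simp add: com_species_def)
 have tc: "tcou C (sg {} a) = tcou P a" for a by (simp add: com_species_def)
 have c: "linmap (S {}) ground (tcou C)"
  using linmap_comp[OF cou_lin lk_lin[OF e, unfolded quo_empty]] by (simp add: com_species_def)
 have sl: "linmap (sp P {}) (S {}) (sg {})" using sg_lin[OF f0 e] by simp
 have d0: "tdel C {} (sg {} p) = tmap (S {}) (S {}) (sg {}) (sg {}) (cdel P {} {} p)" if "p : scar P {}" for p
  using tdel_C_sg[OF f0 e, of p] that by (simp add: E0 dq_empty)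
 show "tdel C {} (tone C) = tens (S {}) (S {}) (tone C) (tone C)"
  unfolding one d0[OF one_in] cd_one by (rule tmap_tens[OF t0 t0 v0 v0 sl sl])
 fix p assume p: "p : carr (S {})"
 show "tL (S {}) (%a b. smul (S {}) (tcou C a) b) (tdel C {} p) = smul (S {}) (tcou C p) (tone C)"
 proof (rule S_ext[OF f0 linmap_tlift_arg[OF v0 v0 v0 bilin_ground_scale(1)[OF v0 c] tdel_C_lin[OF f0]] _ _ p])
  have o: "tone C : carr (S {})" unfolding one using linmap_in[OF sl] one_in by simp
  show "linmap (S {}) (S {}) (%p. smul (S {}) (tcou C p) (tone C))" by (rule linmap_scale_left[OF v0 c o])
  fix r q assume "r : eqvs {}" "q : Cq {} r"
  then have r: "r = {}" and q: "q : scar P {}" by (auto simp: eqvs_empty)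
  have ci: "cdel P {} {} q : carr (sp P {} >< sp P {})" using cd_in[OF f0 e q] by simp
  have "tL (S {}) (%a b. smul (S {}) (tcou C a) b) (tdel C {} (sg {} q)) =
   tL (S {}) (%a b. smul (S {}) (tcou C (sg {} a)) (sg {} b)) (cdel P {} {} q)"
   unfolding d0[OF q]
   by (rule tlift_tmap[OF t0 t0 ci v0 v0 v0 bilin_ground_scale(1)[OF v0 c]]) (use linmap_in[OF sl] in auto)
  also have "... = tL (S {}) (%a b. sg {} (sscl P (tcou P a) b)) (cdel P {} {} q)"
   by (rule tlift_cong[OF t0 t0 ci]) (use linmap_scale[OF sl] in \<open>simp add: tc\<close>)
  also have "... = sg {} (tL (sp P {}) (%a b. sscl P (tcou P a) b) (cdel P {} {} q))"
   by (rule linmap_of_tlift[OF t0 t0 ci sl t0, symmetric]) (use vspace_scale[OF t0] in auto)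
  also have "... = smul (S {}) (tcou C (sg {} q)) (tone C)"
   unfolding cd_cou[OF q] using linmap_scale[OF sl] one_in by (simp add: tc one)
  finally show "tL (S {}) (%a b. smul (S {}) (tcou C a) b) (tdel C {} (sg r q)) = smul (S {}) (tcou C (sg r q)) (tone C)"
   unfolding r .
 qed
next
 show "teps C (h ` X) (smor C X h p) = teps C X p" if X: "finite X" and s: "inj_on h X" and p: "p : carr (S X)" for X h p
 proof (rule S_ext[OF X linmap_comp[OF teps_C_lin smor_C_lin[OF X s]] teps_C_lin[OF X] _ p])
  show "finite (h ` X)" using X by simp
  fix r q assume r: "r : eqvs X" and q: "q : Cq X r"
  show "teps C (h ` X) (smor C X h (sg r q)) = teps C X (sg r q)"
   using X ce_nat[OF _ quo_map(2)[OF X r s] q]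
   by (simp add: smor_C_sg[OF X s r q] teps_C_sg[OF X r] teps_C_sg[OF _ eqv_map_in[OF r s]] quo_map(1)[OF X r s])
 qed
qed (rule twisted_bialgebra_C tdel_C_lin tdel_C_nat tdel_C_coassoc teps_C_lin tdel_C_counit tdel_C_m tdel_C_D; assumption?)+

end

section \<open>Coproducts of all letters of a colouring\<close>

text \<open>\<open>swl Z D X v \<Phi>\<close> is the sum of \<open>\<Phi> v' v''\<close> over the Sweedler components \<open>v' x, v'' x\<close> of all \<open>D (v x)\<close>, with \<open>\<Phi>\<close> multilinear.\<close>

definition swl :: "('k::field, 'z::ab_group_add) vsp => ('v => ('v \<times> 'v \<Rightarrow>\<^sub>0 'k)) => lbl set => (lbl => 'v)
  => ((lbl => 'v) => (lbl => 'v) => 'z) => 'z" where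
 "swl Z D X v \<Phi> = (SUM f:(\<Pi>\<^sub>E x\<in>X. pk (D (v x))).
   smul Z (PROD x:X. lk (D (v x)) (f x)) (\<Phi> (%x. fst (f x)) (%x. snd (f x))))"

text \<open>The extensional product over the empty set contains only the undefined function, whence
  the constant arguments. They are harmless because the forms used depend only on colours of labels
  in the set.\<close>

lemma swl_empty:
 fixes D :: "'v => ('v \<times> 'v \<Rightarrow>\<^sub>0 'k::field)"
 assumes "vspace Z"
 shows "swl Z D {} v \<Phi> = \<Phi> (%x. fst (undefined :: 'v \<times> 'v)) (%x. snd (undefined :: 'v \<times> 'v))"
proof -
 interpret vector_space "smul Z" using assms by (rule vspace_vector_space)
 show ?thesis by (simp add: swl_def)
qed

text \<open>Splits off the components of one letter; the inductions below on sums over Sweedler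
  components rest on this recursion.\<close>

lemma swl_insert:
 assumes Z: "vspace Z" and X: "finite X" "x ~: X"
 shows "swl Z D (insert x X) v \<Phi> = tL Z (%a b. swl Z D X v (%v' v''. \<Phi> (v'(x := a)) (v''(x := b)))) (D (v x))"
proof -
 interpret vector_space "smul Z" using Z by (rule vspace_vector_space)
 let ?T = "%x. pk (D (v x))"
 let ?G = "%f. smul Z (PROD x:insert x X. lk (D (v x)) (f x)) (\<Phi> (%x. fst (f x)) (%x. snd (f x)))"
 have "swl Z D (insert x X) v \<Phi> = (SUM (y, g):?T x \<times> Pi\<^sub>E X ?T. ?G (g(x := y)))"
  unfolding swl_def PiE_insert_eq
  by (subst sum.reindex[OF inj_combinator[OF X(2)]]) (simp add: case_prod_beta)
 also have "... = (SUM y:?T x. SUM g:Pi\<^sub>E X ?T. ?G (g(x := y)))"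
  by (simp add: sum.cartesian_product)
 also have "... = (SUM y:?T x. smul Z (lk (D (v x)) y)
   (swl Z D X v (%v' v''. \<Phi> (v'(x := fst y)) (v''(x := snd y)))))"
 proof (rule sum.cong[OF refl])
  fix y assume "y : ?T x"
  have "?G (g(x := y)) = smul Z (lk (D (v x)) y)
   (smul Z (PROD z:X. lk (D (v z)) (g z)) (\<Phi> ((%z. fst (g z))(x := fst y)) ((%z. snd (g z))(x := snd y))))" for g
  proof -
   have 1: "(PROD z:insert x X. lk (D (v z)) ((g(x := y)) z)) =
    lk (D (v x)) y * (PROD z:X. lk (D (v z)) (g z))"
    using X by (simp add: prod.insert) (rule disjI2, rule prod.cong, auto)
   have 2: "(%z. fst ((g(x := y)) z)) = (%z. fst (g z))(x := fst y)" "(%z. snd ((g(x := y)) z)) = (%z. snd (g z))(x := snd y)"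
    by auto
   show ?thesis unfolding 1 2 by simp
  qed
  then show "(SUM g:Pi\<^sub>E X ?T. ?G (g(x := y))) = smul Z (lk (D (v x)) y)
   (swl Z D X v (%v' v''. \<Phi> (v'(x := fst y)) (v''(x := snd y))))"
   unfolding swl_def scale_sum_right by (simp only:)
 qed
 finally show ?thesis by (simp add: tlift_def case_prod_beta)
qed

lemma swl_cong_v:
 assumes "!!x. x : X ==> v x = w x"
 shows "swl Z D X v \<Phi> = swl Z D X w \<Phi>"
proof -
 have "(\<Pi>\<^sub>E x\<in>X. pk (D (v x))) = (\<Pi>\<^sub>E x\<in>X. pk (D (w x)))"
  by (rule PiE_cong) (simp add: assms)
 moreover have "(PROD x:X. lk (D (v x)) (f x)) = (PROD x:X. lk (D (w x)) (f x))" for f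
  by (rule prod.cong) (simp_all add: assms)
 ultimately show ?thesis unfolding swl_def by simp
qed

lemma swl_tlift_swap:
 assumes "vspace Z"
 shows "swl Z D X v (%v' v''. tL Z (be v' v'') t) = tL Z (%a b. swl Z D X v (%v' v''. be v' v'' a b)) t"
proof -
 interpret vector_space "smul Z" using assms by (rule vspace_vector_space)
 show ?thesis
  unfolding swl_def tlift_def case_prod_beta scale_sum_right scale_scale
  by (subst sum.swap) (simp only: mult.commute)
qed

lemma swl_sum:
 assumes "vspace Z"
 shows "swl Z D X v (%v' v''. SUM i:I. \<Phi> i v' v'') = (SUM i:I. swl Z D X v (\<Phi> i))"
proof -
 interpret vector_space "smul Z" using assms by (rule vspace_vector_space)
 show ?thesis unfolding swl_def scale_sum_right by (rule sum.swap)
qed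

text \<open>Replaces the recursion along a word by a sum indexed by an unordered set of labels,
  which can be relabelled and decomposed freely.\<close>

lemma sweedler_swl:
 assumes "vspace Z" "distinct xs"
 shows "sweedler Z D (map v xs) \<Phi> = swl Z D (set xs) v (%v' v''. \<Phi> (map v' xs) (map v'' xs))"
 using assms(2)
proof (induction xs arbitrary: \<Phi>)
 case Nil
 then show ?case by (simp add: swl_empty[OF assms(1)])
next
 case (Cons x xs)
 have "map (w(x := a)) xs = map w xs" for w :: "lbl => 'c" and a
  using Cons.prems by (intro map_cong) auto
 then show ?case
  using Cons by (simp add: swl_insert[OF assms(1)])
qed

lemma mlin_upd:
 assumes "mlin V (insert x X) Z \<Psi>" "x ~: X" "a : carr V"
 shows "mlin V X Z (%v. \<Psi> (v(x := a)))"
proof (rule mlinI)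
 have up: "v(x := a) : insert x X \<rightarrow> carr V" if "v : X \<rightarrow> carr V" for v
  using that assms(3) by auto
 fix v assume v: "v : X \<rightarrow> carr V"
 show "\<Psi> (v(x := a)) : carr Z" by (rule mlinD(1)[OF assms(1) up[OF v]])
 show "\<Psi> (v(x := a)) = \<Psi> (w(x := a))" if "!!y. y : X ==> v y = w y" for w
  by (rule mlinD(2)[OF assms(1) up[OF v]]) (use that in auto)
 fix y assume y: "y : X"
 have "(v(y := b))(x := a) = (v(x := a))(y := b)" for b
  using y assms(2) by (auto simp: fun_eq_iff)
 then show "linmap V Z (%b. \<Psi> ((v(y := b))(x := a)))"
  using mlinD(3)[OF assms(1) up[OF v], of y] y by simp
qed

section \<open>Coassociativity and counits for all letters at once\<close>

locale nb =
 fixes V :: "('k::field, 'v::ab_group_add) nbialg"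
 assumes NB: "comm_nbialgebra V"
begin

abbreviation "A \<equiv> nsp V"
abbreviation "cl X \<equiv> X \<rightarrow> carr A"
abbreviation "cop \<equiv> ncop V"
abbreviation "cou \<equiv> ncou V"

lemma vA: "vspace A"
 and cop_lin: "linmap A (A >< A) cop"
 and coun_lin: "linmap A ground cou"
 and cop_coassoc: "x : carr A ==> tassoc A A A (tmap (A >< A) A cop id (cop x)) = tmap A (A >< A) id cop (cop x)"
 and cop_counit: "x : carr A ==> tL A (%a b. smul A (cou a) b) (cop x) = x"
  "x : carr A ==> tL A (%a b. smul A (cou b) a) (cop x) = x"
 and nmul_bilin: "bilin A A A (nmul V)"
 and nmul_assoc: "x : carr A ==> y : carr A ==> z : carr A ==> nmul V (nmul V x y) z = nmul V x (nmul V y z)"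
 and nmul_comm: "x : carr A ==> y : carr A ==> nmul V x y = nmul V y x"
 and cop_nmul: "x : carr A ==> y : carr A ==> cop (nmul V x y) = tmul A A (nmul V) (nmul V) (cop x) (cop y)"
 and cou_nmul: "x : carr A ==> y : carr A ==> cou (nmul V x y) = cou x * cou y"
 using NB unfolding comm_nbialgebra_def coalgebra_on_def by (simp_all add: Let_def)

lemma cop_in: "x : carr A ==> cop x : carr (A >< A)"
 by (rule linmap_in[OF cop_lin])

lemma cop_coassoc_int:
 assumes "x : carr A" "vspace Z" "trilin A A A Z T"
 shows "tL Z (%s c. tL Z (%a b. T a b c) (cop s)) (cop x) = tL Z (%a s. tL Z (T a) (cop s)) (cop x)"
 using tlift_tassoc[where f = cop, OF vA vA vA assms(2) vA assms(3) cop_in cop_in[OF assms(1)]]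
  tlift_tmap_id[where f = cop, OF vA vA vA assms(2) vA assms(3) cop_in cop_in[OF assms(1)]] cop_coassoc[OF assms(1)] by simp

abbreviation sw :: "('k, 'z::ab_group_add) vsp => lbl set => (lbl => 'v) => ((lbl => 'v) => (lbl => 'v) => 'z) => 'z"
 where "sw Z X v \<Phi> \<equiv> swl Z cop X v \<Phi>"

lemma PiE_keys:
 assumes "v : cl X" "f : (\<Pi>\<^sub>E x\<in>X. pk (cop (v x)))"
 shows "(%x. fst (f x)) : cl X" "(%x. snd (f x)) : cl X"
proof -
 have "fst (f x) : carr A & snd (f x) : carr A" if x: "x : X" for x
  using tensor_keys[OF vA vA cop_in, of "v x" "fst (f x)" "snd (f x)"] assms x by (auto simp: PiE_iff Pi_iff)
 then show "(%x. fst (f x)) : cl X" "(%x. snd (f x)) : cl X" by auto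
qed

lemma sw_cong:
 assumes "v : cl X" "!!v' v''. v' : cl X ==> v'' : cl X ==> \<Phi> v' v'' = \<Psi> v' v''"
 shows "sw Z X v \<Phi> = sw Z X v \<Psi>"
 unfolding swl_def by (rule sum.cong[OF refl]) (simp add: assms(2)[OF PiE_keys[OF assms(1)]])

lemma sw_in:
 assumes "vspace Z" "v : cl X" "!!v' v''. v' : cl X ==> v'' : cl X ==> \<Phi> v' v'' : carr Z"
 shows "sw Z X v \<Phi> : carr Z"
 unfolding swl_def by (intro vspace_sum vspace_scale assms PiE_keys[OF assms(2)])

lemma sw_lin:
 assumes "vspace Z" "v : cl X"
  "!!v' v''. v' : cl X ==> v'' : cl X ==> linmap B Z (%c. \<Phi> c v' v'')"
 shows "linmap B Z (%c. sw Z X v (\<Phi> c))"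
 unfolding swl_def by (intro linmap_setsum linmap_scaled assms PiE_keys[OF assms(2)])

lemma sw_of_linmap:
 assumes "vspace Z" "v : cl X" "linmap Z Y g"
  "!!v' v''. v' : cl X ==> v'' : cl X ==> \<Phi> v' v'' : carr Z"
 shows "g (sw Z X v \<Phi>) = sw Y X v (%v' v''. g (\<Phi> v' v''))"
 unfolding swl_def
 by (subst linmap_sum[OF assms(3,1)])
  (auto intro!: vspace_scale sum.cong assms(1) assms(4) PiE_keys[OF assms(2)] linmap_scale[OF assms(3)])

text \<open>The two forms are compared only through values on \<open>X\<close> and its image,
  because component colourings are unrelated elsewhere.\<close>

lemma sw_reindex:
 assumes "vspace Z" "finite X" "inj_on h X" "v : cl (h ` X)"
  "!!v' v'' w' w''. w' : cl X ==> w'' : cl X ==> (!!x. x : X ==> v' (h x) = w' x) ==>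
   (!!x. x : X ==> v'' (h x) = w'' x) ==> \<Phi> v' v'' = \<Psi> w' w''"
 shows "sw Z (h ` X) v \<Phi> = sw Z X (v o h) \<Psi>"
 using assms(2-5)
proof (induction X arbitrary: \<Phi> \<Psi> rule: finite_induct)
 case empty
 then show ?case by (simp add: swl_empty[OF assms(1)])
next
 case (insert x X)
 have i: "inj_on h X" "h x ~: h ` X" using insert.prems(1) insert.hyps by auto
 have v: "v : cl (h ` X)" "v (h x) : carr A" using insert.prems(2) by auto
 have "sw Z (h ` insert x X) v \<Phi> = tL Z (%a b. sw Z (h ` X) v (%v' v''. \<Phi> (v'(h x := a)) (v''(h x := b)))) (cop (v (h x)))"
  unfolding image_insert by (rule swl_insert[OF assms(1) finite_imageI[OF insert.hyps(1)] i(2)])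
 also have "... = tL Z (%a b. sw Z X (v o h) (%w' w''. \<Psi> (w'(x := a)) (w''(x := b)))) (cop (v (h x)))"
 proof (rule tlift_cong[OF vA vA cop_in[OF v(2)]])
  fix a b assume ab: "a : carr A" "b : carr A"
  show "sw Z (h ` X) v (%v' v''. \<Phi> (v'(h x := a)) (v''(h x := b))) = sw Z X (v o h) (%w' w''. \<Psi> (w'(x := a)) (w''(x := b)))"
  proof (rule insert.IH[OF i(1) v(1)])
   fix v' v'' w' w'' :: "lbl => 'v"
   assume w: "w' : cl X" "w'' : cl X" and e: "!!x. x : X ==> v' (h x) = w' x" "!!x. x : X ==> v'' (h x) = w'' x"
   have ne: "h y ~= h x" "y ~= x" if "y : X" for y using i(2) insert.hyps(2) that by (metis imageI)+
   show "\<Phi> (v'(h x := a)) (v''(h x := b)) = \<Psi> (w'(x := a)) (w''(x := b))"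
    by (rule insert.prems(3)) (use w ab e ne in auto)
  qed
 qed
 also have "... = sw Z (insert x X) (v o h) \<Psi>"
  by (simp add: swl_insert[OF assms(1) insert.hyps])
 finally show ?case .
qed

text \<open>Fubini for Sweedler components: choices for a disjoint union are pairs of choices,
  nested here so that each part can be handled alone.\<close>

lemma sw_union:
 assumes "vspace Z" "finite X" "finite Y" "X Int Y = {}" "v : cl (X Un Y)"
  "!!c c' a a' b b'. a : cl X ==> a' : cl X ==> b : cl Y ==> b' : cl Y ==>
   (!!x. x : X ==> c x = a x & c' x = a' x) ==> (!!y. y : Y ==> c y = b y & c' y = b' y) ==> \<Phi> c c' = \<Psi> a a' b b'"
 shows "sw Z (X Un Y) v \<Phi> = sw Z X v (%a a'. sw Z Y v (\<Psi> a a'))"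
 using assms(2,4-6)
proof (induction X arbitrary: \<Phi> \<Psi> rule: finite_induct)
 case empty
 have v: "v : cl Y" using empty by simp
 show ?case
  unfolding swl_empty[OF assms(1)] by simp (rule sw_cong[OF v], rule empty.prems(3), auto)
next
 case (insert x X)
 have d: "X Int Y = {}" "x ~: X Un Y" using insert by auto
 have v: "v : cl (X Un Y)" "v x : carr A" using insert.prems(2) by auto
 have "sw Z (insert x X Un Y) v \<Phi> = tL Z (%p q. sw Z (X Un Y) v (%v' v''. \<Phi> (v'(x := p)) (v''(x := q)))) (cop (v x))"
  unfolding Un_insert_left by (rule swl_insert[OF assms(1) _ d(2)]) (use insert.hyps assms(3) in simp)
 also have "... = tL Z (%p q. sw Z X v (%a a'. sw Z Y v (\<Psi> (a(x := p)) (a'(x := q))))) (cop (v x))"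
 proof (rule tlift_cong[OF vA vA cop_in[OF v(2)]])
  fix p q assume pq: "p : carr A" "q : carr A"
  show "sw Z (X Un Y) v (%v' v''. \<Phi> (v'(x := p)) (v''(x := q))) = sw Z X v (%a a'. sw Z Y v (\<Psi> (a(x := p)) (a'(x := q))))"
  proof (rule insert.IH[OF d(1) v(1)])
   fix c c' a a' b b' :: "lbl => 'v"
   assume *: "a : cl X" "a' : cl X" "b : cl Y" "b' : cl Y"
    "!!x. x : X ==> c x = a x & c' x = a' x" "!!y. y : Y ==> c y = b y & c' y = b' y"
   show "\<Phi> (c(x := p)) (c'(x := q)) = \<Psi> (a(x := p)) (a'(x := q)) b b'"
    by (rule insert.prems(3)) (use * pq d(2) in auto)
  qed
 qed
 also have "... = sw Z (insert x X) v (%a a'. sw Z Y v (\<Psi> a a'))"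
  by (simp add: swl_insert[OF assms(1) insert.hyps])
 finally show ?case .
qed

definition bml where
 "bml X Z \<Phi> \<longleftrightarrow> (\<forall>w. w : cl X --> mlin A X Z (%v. \<Phi> v w) & mlin A X Z (\<Phi> w))"

lemma bmlD: "bml X Z \<Phi> ==> w : cl X ==> mlin A X Z (%v. \<Phi> v w)"
 "bml X Z \<Phi> ==> w : cl X ==> mlin A X Z (\<Phi> w)"
 by (simp_all add: bml_def)

lemma bml_upd:
 assumes "bml (insert x X) Z \<Phi>" "x ~: X" "a : carr A" "b : carr A"
 shows "bml X Z (%v w. \<Phi> (v(x := a)) (w(x := b)))"
 unfolding bml_def
proof (intro allI impI conjI)
 fix w assume w: "w : cl X"
 have up: "w(x := c) : cl (insert x X)" if "c : carr A" for c using w that by auto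
 show "mlin A X Z (%v. \<Phi> (v(x := a)) (w(x := b)))" by (rule mlin_upd[OF bmlD(1)[OF assms(1) up[OF assms(4)]] assms(2,3)])
 show "mlin A X Z (%v. \<Phi> (w(x := a)) (v(x := b)))" by (rule mlin_upd[OF bmlD(2)[OF assms(1) up[OF assms(3)]] assms(2,4)])
qed

lemma bml_in: "bml X Z \<Phi> ==> v : cl X ==> w : cl X ==> \<Phi> v w : carr Z"
 by (rule mlinD(1)[OF bmlD(1)])

lemma bml_pair:
 assumes "bml (insert x X) Z \<Phi>" "v : cl X" "w : cl X"
 shows "bilin A A Z (%a b. \<Phi> (v(x := a)) (w(x := b)))"
proof -
 have up: "u(x := c) : cl (insert x X)" if "u : cl X" "c : carr A" for c u using that by auto
 note z = vspace_zero[OF vA]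
 show ?thesis
 proof (rule bilinI)
  fix a assume a: "a : carr A"
  show "linmap A Z (%b. \<Phi> (v(x := a)) (w(x := b)))"
   using mlinD(3)[OF bmlD(2)[OF assms(1) up[OF assms(2) a]] up[OF assms(3) z], of x] by simp
 next
  fix b assume b: "b : carr A"
  show "linmap A Z (%a. \<Phi> (v(x := a)) (w(x := b)))"
   using mlinD(3)[OF bmlD(1)[OF assms(1) up[OF assms(3) b]] up[OF assms(2) z], of x] by simp
 qed
qed

lemma sw_bilin:
 assumes "vspace Z" "v : cl X"
  "!!v' v''. v' : cl X ==> v'' : cl X ==> bilin B C Z (%b c. \<Phi> b c v' v'')"
 shows "bilin B C Z (%b c. sw Z X v (\<Phi> b c))"
 by (intro bilinI sw_lin[OF assms(1,2)]) (auto intro: bilin_right[OF assms(3)] bilin_left[OF assms(3)])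

lemma sw_mlin:
 assumes Z: "vspace Z" and X: "finite X" and \<Phi>: "bml X Z \<Phi>"
 shows "mlin A X Z (%v. sw Z X v \<Phi>)"
proof (rule mlinI)
 show "sw Z X v \<Phi> : carr Z" if "v : cl X" for v
  by (rule sw_in[OF Z that bml_in[OF \<Phi>]])
 show "sw Z X v \<Phi> = sw Z X w \<Phi>" if "!!x. x : X ==> v x = w x" for v w
  by (rule swl_cong_v[OF that])
 fix v x assume v: "v : cl X" and x: "x : X"
 define Y where "Y = X - {x}"
 have Y: "X = insert x Y" "x ~: Y" "finite Y" using x X by (auto simp: Y_def)
 have vY: "v : cl Y" using v Y by auto
 \<comment> \<open>Once the letter \<open>x\<close> is split off, the remaining sum does not see its
   new colour, so the dependence on that colour is only through its coproduct.\<close>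
 have e: "sw Z X (v(x := y)) \<Phi> = tL Z (%a b. sw Z Y v (%v' v''. \<Phi> (v'(x := a)) (v''(x := b)))) (cop y)" for y
 proof -
  have "sw Z Y (v(x := y)) \<Psi> = sw Z Y v \<Psi>" for \<Psi>
   by (rule swl_cong_v) (use Y(2) in auto)
  then show ?thesis unfolding Y(1) swl_insert[OF Z Y(3,2)] by simp
 qed
 show "linmap A Z (%y. sw Z X (v(x := y)) \<Phi>)"
  unfolding e by (rule linmap_tlift_arg[OF vA vA Z sw_bilin[OF Z vY bml_pair[OF \<Phi>[unfolded Y(1)]]] cop_lin])
qed

definition tml where
 "tml X Z T \<longleftrightarrow> (\<forall>a b. a : cl X --> b : cl X \<longrightarrow>
   mlin A X Z (%v. T v a b) & mlin A X Z (%v. T a v b) & mlin A X Z (T a b))"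

lemma tmlD:
 assumes "tml X Z T" "a : cl X" "b : cl X"
 shows "mlin A X Z (%v. T v a b)" "mlin A X Z (%v. T a v b)" "mlin A X Z (T a b)"
 using assms by (simp_all add: tml_def)

text \<open>Coassociativity of \<open>cop\<close> is applied one letter at a time. After the letter
  \<open>x\<close> is split off, the sums over the remaining letters form a trilinear map in the
  three components of \<open>x\<close>.\<close>

lemma sw_coassoc:
 assumes Z: "vspace Z" and X: "finite X" and T: "tml X Z T" and v: "v : cl X"
 shows "sw Z X v (%v' v''. sw Z X v' (%a b. T a b v'')) = sw Z X v (%v' v''. sw Z X v'' (T v'))"
 using X T v
proof (induction X arbitrary: T rule: finite_induct)
 case empty
 have "mlin A {} Z (%v. T u v w)" for u w
  by (rule tmlD(2)[OF empty.prems(1)]) auto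
 \<comment> \<open>Without letters the two sides differ only in the irrelevant middle argument: the
   second components on the left, the first components on the right.\<close>
 then have "T u a w = T u b w" for u w a b
  using mlinD(2)[of A "{}" Z "%v. T u v w" a b] by auto
 from this[of _ "%x. snd undefined" _ "%x. fst undefined"] show ?case by (simp add: swl_empty[OF Z])
next
 case (insert x X)
 note T = insert.prems(1) and x = insert.hyps(2) and fX = insert.hyps(1)
 have v: "v : cl X" "v x : carr A" using insert.prems(2) by auto
 have up: "u(x := c) : cl (insert x X)" if "u : cl X" "c : carr A" for c u using that by auto
 note z0 = vspace_zero[OF vA]
 have drop: "sw Z X (w(x := y)) \<Psi> = sw Z X w \<Psi>" for w y \<Psi>
  by (rule swl_cong_v) (use x in auto)
 let ?T = "%s1 s2 t a b c. T (a(x := s1)) (b(x := s2)) (c(x := t))"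
 \<comment> \<open>The contribution of the remaining letters for fixed components of
   \<open>x\<close>, in the right-hand bracketing that the induction hypothesis produces.\<close>
 let ?K = "%s1 s2 t. sw Z X v (%v' v''. sw Z X v'' (?T s1 s2 t v'))"
 have Ts: "tml X Z (?T s1 s2 t)" if "s1 : carr A" "s2 : carr A" "t : carr A" for s1 s2 t
  unfolding tml_def
  by (intro allI impI conjI mlin_upd[OF tmlD(1)[OF T up up] x] mlin_upd[OF tmlD(2)[OF T up up] x] mlin_upd[OF tmlD(3)[OF T up up] x] that)
 have K: "trilin A A A Z ?K"
 proof (intro trilinI sw_lin[OF Z])
  fix b c and v' v'' w' w'' :: "lbl => 'v" assume bc: "b : carr A" "c : carr A"
  assume w: "v' : cl X" "v'' : cl X" "w' : cl X" "w'' : cl X"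
  have "linmap A Z (%a. T ((v'(x := 0))(x := a)) (w'(x := b)) (w''(x := c)))"
   by (rule mlinD(3)[OF tmlD(1)[OF T up[OF w(3) bc(1)] up[OF w(4) bc(2)]] up[OF w(1) z0]]) simp
  then show "linmap A Z (%a. ?T a b c v' w' w'')" by simp
  have "linmap A Z (%a. T (v'(x := b)) ((w'(x := 0))(x := a)) (w''(x := c)))"
   by (rule mlinD(3)[OF tmlD(2)[OF T up[OF w(1) bc(1)] up[OF w(4) bc(2)]] up[OF w(3) z0]]) simp
  then show "linmap A Z (%a. ?T b a c v' w' w'')" by simp
  have "linmap A Z (%a. T (v'(x := b)) (w'(x := c)) ((w''(x := 0))(x := a)))"
   by (rule mlinD(3)[OF tmlD(3)[OF T up[OF w(1) bc(1)] up[OF w(3) bc(2)]] up[OF w(4) z0]]) simp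
  then show "linmap A Z (%a. ?T b c a v' w' w'')" by simp
 qed (use v(1) in simp_all)
 have "sw Z (insert x X) v (%v' v''. sw Z (insert x X) v' (%a b. T a b v'')) =
  tL Z (%s t. sw Z X v (%v' v''. tL Z (%s1 s2. sw Z X v' (%a b. ?T s1 s2 t a b v'')) (cop s))) (cop (v x))"
  by (simp add: swl_insert[OF Z fX x] drop)
 also have "... = tL Z (%s t. tL Z (%s1 s2. sw Z X v (%v' v''. sw Z X v' (%a b. ?T s1 s2 t a b v''))) (cop s)) (cop (v x))"
  by (simp add: swl_tlift_swap[OF Z])
 also have "... = tL Z (%s t. tL Z (%s1 s2. ?K s1 s2 t) (cop s)) (cop (v x))"
  by (intro tlift_cong[OF vA vA cop_in[OF v(2)]] tlift_cong[OF vA vA cop_in] insert.IH[OF Ts v(1)])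
 also have "... = tL Z (%s1 r. tL Z (%s2 t. ?K s1 s2 t) (cop r)) (cop (v x))"
  by (rule cop_coassoc_int[OF v(2) Z K])
 also have "... = tL Z (%s1 r. sw Z X v (%v' v''. tL Z (%s2 t. sw Z X v'' (?T s1 s2 t v')) (cop r))) (cop (v x))"
  by (simp add: swl_tlift_swap[OF Z])
 also have "... = sw Z (insert x X) v (%v' v''. sw Z (insert x X) v'' (T v'))"
  by (simp add: swl_insert[OF Z fX x] drop)
 finally show ?case .
qed

text \<open>Letter by letter: linearity of \<Psi> in the split slot moves the scalar onto the other
  component, and the counit law restores the letter.\<close>

lemma sw_counit:
 assumes Z: "vspace Z" and X: "finite X" and \<Psi>: "mlin A X Z \<Psi>" and v: "v : cl X"
 shows "sw Z X v (%v' v''. smul Z (PROD x:X. cou (v' x)) (\<Psi> v'')) = \<Psi> v"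
  and "sw Z X v (%v' v''. smul Z (PROD x:X. cou (v'' x)) (\<Psi> v')) = \<Psi> v"
proof -
 interpret vector_space "smul Z" using Z by (rule vspace_vector_space)
 show "sw Z X v (%v' v''. smul Z (PROD x:X. cou (v' x)) (\<Psi> v'')) = \<Psi> v"
  using X \<Psi> v
 proof (induction X arbitrary: \<Psi> rule: finite_induct)
  case empty
  show ?case unfolding swl_empty[OF Z] by simp (rule mlinD(2)[OF empty.prems(1)], auto)
 next
  case (insert x X)
  have v: "v : cl X" "v x : carr A" using insert.prems(2) by auto
  have l: "linmap A Z (%a. \<Psi> (v(x := a)))" by (rule mlinD(3)[OF insert.prems(1,2)]) simp
  have p: "(PROD y:insert x X. cou ((w(x := a)) y)) = cou a * (PROD y:X. cou (w y))" for w a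
   using insert.hyps by (simp add: prod.insert) (rule disjI2, rule prod.cong, auto)
  have "sw Z (insert x X) v (%v' v''. smul Z (PROD x:insert x X. cou (v' x)) (\<Psi> v'')) =
   tL Z (%a b. smul Z (cou a) (sw Z X v (%v' v''. smul Z (PROD x:X. cou (v' x)) (\<Psi> (v''(x := b)))))) (cop (v x))"
   unfolding swl_insert[OF Z insert.hyps] p scale_scale[symmetric] by (simp add: swl_def scale_sum_right mult_ac)
  also have "... = tL Z (%a b. \<Psi> (v(x := smul A (cou a) b))) (cop (v x))"
  proof (rule tlift_cong[OF vA vA cop_in[OF v(2)]])
   fix a b assume ab: "a : carr A" "b : carr A"
   have "sw Z X v (%v' v''. smul Z (PROD x:X. cou (v' x)) (\<Psi> (v''(x := b)))) = \<Psi> (v(x := b))"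
    by (rule insert.IH[OF mlin_upd[OF insert.prems(1) insert.hyps(2) ab(2)] v(1)])
   then show "smul Z (cou a) (sw Z X v (%v' v''. smul Z (PROD x:X. cou (v' x)) (\<Psi> (v''(x := b))))) = \<Psi> (v(x := smul A (cou a) b))"
    using linmap_scale[OF l ab(2)] by simp
  qed
  also have "... = \<Psi> (v(x := tL A (%a b. smul A (cou a) b) (cop (v x))))"
   by (rule linmap_of_tlift[OF vA vA cop_in[OF v(2)] l vA vspace_scale[OF vA], symmetric])
  finally show ?case by (simp add: cop_counit v)
 qed
 show "sw Z X v (%v' v''. smul Z (PROD x:X. cou (v'' x)) (\<Psi> v')) = \<Psi> v"
  using X \<Psi> v
 proof (induction X arbitrary: \<Psi> rule: finite_induct)
  case empty
  show ?case unfolding swl_empty[OF Z] by simp (rule mlinD(2)[OF empty.prems(1)], auto)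
 next
  case (insert x X)
  have v: "v : cl X" "v x : carr A" using insert.prems(2) by auto
  have l: "linmap A Z (%a. \<Psi> (v(x := a)))" by (rule mlinD(3)[OF insert.prems(1,2)]) simp
  have p: "(PROD y:insert x X. cou ((w(x := a)) y)) = cou a * (PROD y:X. cou (w y))" for w a
   using insert.hyps by (simp add: prod.insert) (rule disjI2, rule prod.cong, auto)
  have "sw Z (insert x X) v (%v' v''. smul Z (PROD x:insert x X. cou (v'' x)) (\<Psi> v')) =
   tL Z (%a b. smul Z (cou b) (sw Z X v (%v' v''. smul Z (PROD x:X. cou (v'' x)) (\<Psi> (v'(x := a)))))) (cop (v x))"
   unfolding swl_insert[OF Z insert.hyps] p scale_scale[symmetric] by (simp add: swl_def scale_sum_right mult_ac)
  also have "... = tL Z (%a b. \<Psi> (v(x := smul A (cou b) a))) (cop (v x))"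
  proof (rule tlift_cong[OF vA vA cop_in[OF v(2)]])
   fix a b assume ab: "a : carr A" "b : carr A"
   have "sw Z X v (%v' v''. smul Z (PROD x:X. cou (v'' x)) (\<Psi> (v'(x := a)))) = \<Psi> (v(x := a))"
    by (rule insert.IH[OF mlin_upd[OF insert.prems(1) insert.hyps(2) ab(1)] v(1)])
   then show "smul Z (cou b) (sw Z X v (%v' v''. smul Z (PROD x:X. cou (v'' x)) (\<Psi> (v'(x := a))))) = \<Psi> (v(x := smul A (cou b) a))"
    using linmap_scale[OF l ab(1)] by simp
  qed
  also have "... = \<Psi> (v(x := tL A (%a b. smul A (cou b) a) (cop (v x))))"
   by (rule linmap_of_tlift[OF vA vA cop_in[OF v(2)] l vA vspace_scale[OF vA], symmetric])
  finally show ?case by (simp add: cop_counit v)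
 qed
qed

text \<open>Gives the counit both on the Fock space of a double twisted bialgebra and on that of
  \<open>P\<close>, where the second factor is \<open>ceps\<close>.\<close>

lemma cou_fform:
 assumes l: "!!X. finite X ==> linmap (sp Q X) ground (e X)"
  and n: "!!X h p. finite X ==> inj_on h X ==> p : scar Q X ==> e (h ` X) (smor Q X h p) = e X p"
 shows "fform A Q ground (%X v p. (PROD x:X. cou (v x)) * e X p)"
 unfolding fform_def
proof (intro allI impI conjI ballI)
 fix X :: "lbl set" assume X: "finite X"
 show "mlin A X ground (%v. (PROD x:X. cou (v x)) * e X p)" for p
 proof (rule mlinI)
  show "(PROD x:X. cou (v x)) * e X p : carr ground" for v by simp
  show "(PROD x:X. cou (v x)) * e X p = (PROD x:X. cou (w x)) * e X p" if "!!x. x : X ==> v x = w x" for v w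
   using prod.cong[OF refl, of X "%x. cou (v x)" "%x. cou (w x)"] that by simp
  fix v x assume x: "x : X"
  have "(PROD y:X. cou ((v(x := a)) y)) = cou a * (PROD y:X - {x}. cou (v y))" for a
   using prod.cong[OF refl, of "X - {x}" "%y. cou ((v(x := a)) y)" "%y. cou (v y)"]
   by (subst prod.remove[OF X x]) auto
  then show "linmap A ground (%a. (PROD y:X. cou ((v(x := a)) y)) * e X p)"
   by (simp add: linmap_mult(1)[OF linmap_mult(1)[OF coun_lin]])
 qed
 show "linmap (sp Q X) ground (%p. (PROD x:X. cou (v x)) * e X p)" for v
  by (rule linmap_mult(2)[OF l[OF X]])
 show "(PROD x:h ` X. cou (v x)) * e (h ` X) (smor Q X h p) = (PROD x:X. cou ((v o h) x)) * e X p"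
  if "p : scar Q X" "inj_on h X" for h v p
  using that by (simp add: n[OF X] prod.reindex)
qed

end

section \<open>The double bialgebra structure of a Fock space\<close>

locale fock_dtwist = nb V + dtwist Q + fock_twisted "nsp V" Q
 for V :: "('k::field, 'v::ab_group_add) nbialg" and Q :: "('k, 'q::ab_group_add, 'z) dtbialg_scheme"
begin

lemma td_in: "finite X ==> p : scar Q X ==> tdel Q X p : carr (sp Q X >< sp Q X)"
 using linmap_in[OF td_lin] by simp

lemma vF: "vspace F"
 by (rule vspace_fock)

definition dform where
 "dform X v p = sw (FF) X v (%v' v''. tL (FF) (%a b. tens F F (gen X v' a) (gen X v'' b)) (tdel Q X p))"

lemma td_int_in:
 assumes "finite X" "v' : cl X" "v'' : cl X" "p : scar Q X" "vspace Z" "bilin F F Z be"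
 shows "tL Z (%a b. be (gen X v' a) (gen X v'' b)) (tdel Q X p) : carr Z"
 by (rule tlift_in[OF Qv[OF assms(1)] Qv[OF assms(1)] assms(5) td_in[OF assms(1,4)]])
  (rule bilin_in[OF fgen_bilin2[OF assms(1,1,2,3,6)]])

lemma td_bml:
 assumes X: "finite X" and p: "p : scar Q X" and Z: "vspace Z" and be: "bilin F F Z be"
 shows "bml X Z (%v' v''. tL Z (%a b. be (gen X v' a) (gen X v'' b)) (tdel Q X p))"
 unfolding bml_def
proof (intro allI impI conjI mlin_tlift[OF Qv[OF X] Qv[OF X] Z td_in[OF X p]])
 fix w a b assume w: "w : cl X" and ab: "a : carr (sp Q X)" "b : carr (sp Q X)"
 show "mlin A X Z (%v. be (gen X v a) (gen X w b))"
  by (rule linmap_mlin[OF bilin_left[OF be] fgen_mlin[OF X]]) (use ab fgen_in[OF X w] in auto)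
 show "mlin A X Z (%v. be (gen X w a) (gen X v b))"
  by (rule linmap_mlin[OF bilin_right[OF be] fgen_mlin[OF X]]) (use ab fgen_in[OF X w] in auto)
qed

lemma dform_fform: "fform A Q (FF) dform"
 unfolding fform_def
proof (intro allI impI conjI ballI)
 fix X :: "lbl set" assume X: "finite X"
 let ?W = "FF"
 note W = vspace_tensor[of F F] and q = Qv[OF X]
 show "mlin A X ?W (%v. dform X v p)" if p: "p : scar Q X" for p
  unfolding dform_def by (rule sw_mlin[OF W X td_bml[OF X p W tens_bilin]])
 show "linmap (sp Q X) ?W (dform X v)" if v: "v : cl X" for v
  unfolding dform_def[abs_def]
  by (rule sw_lin[OF W v], rule linmap_tlift_arg[OF q q W _ td_lin[OF X]], rule fgen_bilin2[OF X X _ _ tens_bilin])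
 fix h :: "lbl => lbl" and v p assume p: "p : scar Q X" and h: "inj_on h X" and v: "v : cl (h ` X)"
 note fX = finite_imageI[OF X, of h]
 show "dform (h ` X) v (smor Q X h p) = dform X (v o h) p"
  unfolding dform_def
 proof (rule sw_reindex[OF W X h v])
  fix v' v'' w' w'' :: "lbl => 'v"
  assume w: "w' : cl X" "w'' : cl X" and e: "!!x. x : X ==> v' (h x) = w' x" "!!x. x : X ==> v'' (h x) = w'' x"
  have v: "v' : cl (h ` X)" "v'' : cl (h ` X)" using w e by auto
  have "tL ?W (%a b. tens F F (gen (h ` X) v' a) (gen (h ` X) v'' b)) (tdel Q (h ` X) (smor Q X h p)) =
   tL ?W (%a b. tens F F (gen (h ` X) v' (smor Q X h a)) (gen (h ` X) v'' (smor Q X h b))) (tdel Q X p)"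
   unfolding td_nat[OF X h p]
   by (rule tlift_tmap[OF q q td_in[OF X p] Qv[OF fX] Qv[OF fX] W fgen_bilin2[OF fX fX v tens_bilin]])
    (use smor_in[OF Q X h] in auto)
  also have "... = tL ?W (%a b. tens F F (gen X w' a) (gen X w'' b)) (tdel Q X p)"
   by (rule tlift_cong[OF q q td_in[OF X p]])
    (simp add: fgen_nat[OF X _ h v(1) refl e(1)] fgen_nat[OF X _ h v(2) refl e(2)])
  finally show "tL ?W (%a b. tens F F (gen (h ` X) v' a) (gen (h ` X) v'' b)) (tdel Q (h ` X) (smor Q X h p)) = ..." .
 qed
qed

text \<open>The word formula with \<open>sweedler\<close> is rewritten as a sum over colourings of
  [n]; then \<open>fock_some\<close> applies as for the first coproduct.\<close>

lemma delta_spec: "linmap F (FF) (fock_delta V Q)"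
 and delta_gen: "finite X ==> v : cl X ==> p : scar Q X ==> fock_delta V Q (gen X v p) = dform X v p"
proof -
 let ?W = "FF"
 note W = vspace_tensor[of F F]
 let ?rhs = "%vs p. sweedler ?W cop vs (%as bs. tmap F F (fock_bar A Q as) (fock_bar A Q bs) (tdel Q (nset (length vs)) p))"
 have w: "dform (nset (length vs)) (lab vs) p = ?rhs vs p" if vs: "set vs <= carr A" and p: "p : scar Q (nset (length vs))" for vs p
 proof -
  let ?n = "length vs"
  \<comment> \<open>The labels of [n] in order; reading the colouring of a word along this list
    gives the word back.\<close>
  define xs where "xs = map At [1..<Suc ?n]"
  have xs: "distinct xs" "set xs = nset ?n" "length xs = ?n"
   by (auto simp: xs_def distinct_map inj_on_def nset_def simp del: upt_Suc)
  have mv: "map (lab vs) xs = vs"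
   by (rule nth_equalityI) (auto simp: xs_def letter_def simp del: upt_Suc)
  have "?rhs vs p = sw ?W (nset ?n) (lab vs) (%v' v''. tmap F F (fock_bar A Q (map v' xs)) (fock_bar A Q (map v'' xs)) (tdel Q (nset ?n) p))"
   using sweedler_swl[OF W xs(1), of cop "lab vs"] unfolding mv xs(2) by simp
  also have "... = dform (nset ?n) (lab vs) p"
   unfolding dform_def
  proof (rule sw_cong[OF lab_in[OF vs refl]])
   fix v' v'' assume v: "v' : nset ?n \<rightarrow> carr A" "v'' : nset ?n \<rightarrow> carr A"
   have b: "fock_bar A Q (map w xs) a = gen (nset ?n) w a" if w: "w : nset ?n \<rightarrow> carr A" and a: "a : scar Q (nset ?n)" for w a
   proof -
    have ws: "set (map w xs) <= carr A" "length (map w xs) = ?n" using w xs by auto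
    have "gen (nset ?n) (lab (map w xs)) a = gen (nset ?n) w a"
     by (rule fgen_cong[OF finite_nset lab_in[OF ws] a])
      (auto simp: nset_def letter_def xs_def simp del: upt_Suc)
    then show ?thesis by (simp add: fgen_nset[OF ws a])
   qed
   show "tmap F F (fock_bar A Q (map v' xs)) (fock_bar A Q (map v'' xs)) (tdel Q (nset ?n) p) =
    tL ?W (%a b. tens F F (gen (nset ?n) v' a) (gen (nset ?n) v'' b)) (tdel Q (nset ?n) p)"
    unfolding tmap_def
    by (rule tlift_cong[OF Qv[OF finite_nset] Qv[OF finite_nset] td_in[OF finite_nset p]]) (simp add: b v)
  qed
  finally show ?thesis ..
 qed
 note s = fock_some[OF W dform_fform w fock_delta_def[unfolded Let_def]]
 show "linmap F ?W (fock_delta V Q)" by (rule s(1))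
 show "finite X ==> v : cl X ==> p : scar Q X ==> fock_delta V Q (gen X v p) = dform X v p" by (rule s(2))
qed

abbreviation "dl \<equiv> fock_delta V Q"

lemma delta_in: "x : carr F ==> dl x : carr (FF)"
 by (rule linmap_in[OF delta_spec])

lemma delta_int:
 assumes Z: "vspace Z" and be: "bilin F F Z be" and X: "finite X" "v : cl X" "p : scar Q X"
 shows "tL Z be (dl (gen X v p)) = sw Z X v (%v' v''. tL Z (%a b. be (gen X v' a) (gen X v'' b)) (tdel Q X p))"
proof -
 have "tL Z be (dl (gen X v p)) =
  sw Z X v (%v' v''. tL Z be (tL (FF) (%a b. tens F F (gen X v' a) (gen X v'' b)) (tdel Q X p)))"
  unfolding delta_gen[OF X] dform_def
  by (rule sw_of_linmap[OF vspace_tensor X(2) linmap_tlift[OF vF vF Z be]])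
   (rule td_int_in[OF X(1) _ _ X(3) vspace_tensor tens_bilin])
 also have "... = sw Z X v (%v' v''. tL Z (%a b. be (gen X v' a) (gen X v'' b)) (tdel Q X p))"
 proof (rule sw_cong[OF X(2)])
  fix v' v'' assume v: "v' : cl X" "v'' : cl X"
  have "tL Z be (tL (FF) (%a b. tens F F (gen X v' a) (gen X v'' b)) (tdel Q X p)) =
   tL Z (%a b. tL Z be (tens F F (gen X v' a) (gen X v'' b))) (tdel Q X p)"
   by (rule tlift_tlift[OF Qv[OF X(1)] Qv[OF X(1)] td_in[OF X(1,3)] vF vF Z be])
    (rule bilin_in[OF fgen_bilin2[OF X(1,1) v tens_bilin]])
  then show "tL Z be (tL (FF) (%a b. tens F F (gen X v' a) (gen X v'' b)) (tdel Q X p)) =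
   tL Z (%a b. be (gen X v' a) (gen X v'' b)) (tdel Q X p)"
   by (simp add: tlift_tens[OF Z be])
 qed
 finally show ?thesis .
qed

definition eform where "eform X v p = (PROD x:X. cou (v x)) * teps Q X p"

lemma eform_fform: "fform A Q ground eform"
 unfolding eform_def[abs_def] by (rule cou_fform) (use te_lin te_nat in auto)

lemma eps_spec: "linmap F ground (fock_eps V Q)"
 and eps_gen: "finite X ==> v : cl X ==> p : scar Q X ==> fock_eps V Q (gen X v p) = eform X v p"
proof -
 have w: "eform (nset (length vs)) (lab vs) p = (\<Prod>v\<leftarrow>vs. cou v) * teps Q (nset (length vs)) p" for vs p
 proof -
  have "(PROD x:nset n. cou (lab vs x)) = prod_list (map cou (map (letter vs) [1..<Suc n]))" for n
   using prod.distinct_set_conv_list[OF distinct_upt, of "%i. cou (letter vs i)" 1 "Suc n"]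
   by (simp add: nset_def prod.reindex inj_on_def atLeastLessThanSuc_atLeastAtMost comp_def del: upt_Suc One_nat_def)
  moreover have "map (letter vs) [1..<Suc (length vs)] = vs"
   by (rule nth_equalityI) (auto simp: letter_def simp del: upt_Suc)
  ultimately show ?thesis by (simp only: eform_def)
 qed
 note s = fock_some[OF vspace_ground eform_fform w fock_eps_def]
 show "linmap F ground (fock_eps V Q)" by (rule s(1))
 show "finite X ==> v : cl X ==> p : scar Q X ==> fock_eps V Q (gen X v p) = eform X v p" by (rule s(2))
qed

abbreviation "ep \<equiv> fock_eps V Q"

lemma td_coassoc_int:
 assumes X: "finite X" "p : scar Q X" and Z: "vspace Z" and T: "trilin (sp Q X) (sp Q X) (sp Q X) Z T"
 shows "tL Z (%s c. tL Z (%a b. T a b c) (tdel Q X s)) (tdel Q X p) = tL Z (%a s. tL Z (T a) (tdel Q X s)) (tdel Q X p)"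
proof -
 note q = Qv[OF X(1)]
 have t: "tdel Q X s : carr (sp Q X >< sp Q X)" if "s : carr (sp Q X)" for s using td_in[OF X(1)] that by simp
 show ?thesis
  using tlift_tassoc[where f = "tdel Q X", OF q q q Z q T t td_in[OF X]]
   tlift_tmap_id[where f = "tdel Q X", OF q q q Z q T t td_in[OF X]] td_coassoc[OF X] by simp
qed

text \<open>Colours and elements are independent: each law is the combination of the law of
  \<open>cop\<close> over all letters, from \<open>sw_coassoc\<close> or \<open>sw_counit\<close>,
  with the law of \<open>tdel\<close> on \<open>X\<close>.\<close>

lemma delta_coalgebra: "coalgebra_on F dl ep"
 unfolding coalgebra_on_def
proof (intro conjI ballI)
 show "vspace F" "linmap F (FF) dl" "linmap F ground ep"
  by (rule vF delta_spec eps_spec)+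
 fix x assume x: "x : carr F"
 interpret f: vector_space "smul F" by (rule vspace_vector_space[OF vF])
 have l0: "bilin F F F (%a b. smul F (ep a) b)" "bilin F F F (%a b. smul F (ep b) a)"
  using bilin_ground_scale[OF vF eps_spec] by auto
 show "tL F (%a b. smul F (ep a) b) (dl x) = x"
 proof (rule fock_ext[OF linmap_tlift_arg[OF vF vF vF l0(1) delta_spec] linmap_id _ x])
  fix X v p assume X: "finite X" "v : cl X" "p : scar Q X"
  note q = Qv[OF X(1)] and t = td_in[OF X(1,3)]
  have "tL F (%a b. smul F (ep a) b) (dl (gen X v p)) =
   sw F X v (%v' v''. tL F (%a b. smul F (ep (gen X v' a)) (gen X v'' b)) (tdel Q X p))"
   by (rule delta_int[OF vF l0(1) X])
  also have "... = sw F X v (%v' v''. smul F (PROD x:X. cou (v' x)) (gen X v'' p))"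
  proof (rule sw_cong[OF X(2)])
   fix v' v'' assume v: "v' : cl X" "v'' : cl X"
   note gl = fgen_linmap[OF X(1) v(2)]
   have "tL F (%a b. smul F (ep (gen X v' a)) (gen X v'' b)) (tdel Q X p) =
    tL F (%a b. smul F (PROD x:X. cou (v' x)) (gen X v'' (smul (sp Q X) (teps Q X a) b))) (tdel Q X p)"
    by (rule tlift_cong[OF q q t]) (use linmap_scale[OF gl] in \<open>simp add: eps_gen[OF X(1) v(1)] eform_def\<close>)
   also have "... = smul F (PROD x:X. cou (v' x)) (tL F (%a b. gen X v'' (smul (sp Q X) (teps Q X a) b)) (tdel Q X p))"
    by (rule tlift_scale_param[OF vF])
   also have "tL F (%a b. gen X v'' (smul (sp Q X) (teps Q X a) b)) (tdel Q X p) = gen X v'' (tL (sp Q X) (%a b. smul (sp Q X) (teps Q X a) b) (tdel Q X p))"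
    by (rule linmap_of_tlift[OF q q t gl q vspace_scale[OF q], symmetric])
   finally show "tL F (%a b. smul F (ep (gen X v' a)) (gen X v'' b)) (tdel Q X p) = smul F (PROD x:X. cou (v' x)) (gen X v'' p)"
    by (simp only: td_counitL[OF X(1,3)])
  qed
  also have "... = gen X v p" by (rule sw_counit(1)[OF vF X(1) fgen_mlin[OF X(1,3)] X(2)])
  finally show "tL F (%a b. smul F (ep a) b) (dl (gen X v p)) = gen X v p" .
 qed
 show "tL F (%a b. smul F (ep b) a) (dl x) = x"
 proof (rule fock_ext[OF linmap_tlift_arg[OF vF vF vF l0(2) delta_spec] linmap_id _ x])
  fix X v p assume X: "finite X" "v : cl X" "p : scar Q X"
  note q = Qv[OF X(1)] and t = td_in[OF X(1,3)]
  have "tL F (%a b. smul F (ep b) a) (dl (gen X v p)) =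
   sw F X v (%v' v''. tL F (%a b. smul F (ep (gen X v'' b)) (gen X v' a)) (tdel Q X p))"
   by (rule delta_int[OF vF l0(2) X])
  also have "... = sw F X v (%v' v''. smul F (PROD x:X. cou (v'' x)) (gen X v' p))"
  proof (rule sw_cong[OF X(2)])
   fix v' v'' assume v: "v' : cl X" "v'' : cl X"
   note gl = fgen_linmap[OF X(1) v(1)]
   have "tL F (%a b. smul F (ep (gen X v'' b)) (gen X v' a)) (tdel Q X p) =
    tL F (%a b. smul F (PROD x:X. cou (v'' x)) (gen X v' (smul (sp Q X) (teps Q X b) a))) (tdel Q X p)"
    by (rule tlift_cong[OF q q t]) (use linmap_scale[OF gl] in \<open>simp add: eps_gen[OF X(1) v(2)] eform_def\<close>)
   also have "... = smul F (PROD x:X. cou (v'' x)) (tL F (%a b. gen X v' (smul (sp Q X) (teps Q X b) a)) (tdel Q X p))"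
    by (rule tlift_scale_param[OF vF])
   also have "tL F (%a b. gen X v' (smul (sp Q X) (teps Q X b) a)) (tdel Q X p) = gen X v' (tL (sp Q X) (%a b. smul (sp Q X) (teps Q X b) a) (tdel Q X p))"
    by (rule linmap_of_tlift[OF q q t gl q vspace_scale[OF q], symmetric])
   finally show "tL F (%a b. smul F (ep (gen X v'' b)) (gen X v' a)) (tdel Q X p) = smul F (PROD x:X. cou (v'' x)) (gen X v' p)"
    by (simp only: td_counitR[OF X(1,3)])
  qed
  also have "... = gen X v p" by (rule sw_counit(2)[OF vF X(1) fgen_mlin[OF X(1,3)] X(2)])
  finally show "tL F (%a b. smul F (ep b) a) (dl (gen X v p)) = gen X v p" .
 qed
 let ?Z = "F >< FF" and ?T = "%a b c. tens F (FF) a (tens F F b c)"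
 have T: "trilin F F F ?Z ?T" by (rule trilin_tens[OF vF vF vF])
 note Z = vspace_tensor[of F "FF"]
 have bL: "bilin F F ?Z (%a c. tL ?Z (%a b. ?T a b c) (dl a))"
  using bilin_comp[OF linmap_tlift_trilin(1)[OF vF vF vF Z T] delta_spec linmap_id] .
 have bR: "bilin F F ?Z (%a b. tL ?Z (?T a) (dl b))"
  using bilin_comp[OF linmap_tlift_trilin(2)[OF vF vF vF Z T] linmap_id delta_spec] .
 have "tL ?Z (%a c. tL ?Z (%a b. ?T a b c) (dl a)) (dl x) = tL ?Z (%a b. tL ?Z (?T a) (dl b)) (dl x)"
 proof (rule fock_ext[OF linmap_tlift_arg[OF vF vF Z bL delta_spec] linmap_tlift_arg[OF vF vF Z bR delta_spec] _ x])
  fix X v p assume X: "finite X" "v : cl X" "p : scar Q X"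
  note q = Qv[OF X(1)] and t = td_in[OF X(1,3)]
  have t': "tdel Q X s : carr (sp Q X >< sp Q X)" if "s : carr (sp Q X)" for s using td_in[OF X(1)] that by simp
  have g: "gen X w a : carr F" if "w : cl X" "a : carr (sp Q X)" for w a using fgen_in[OF X(1)] that by simp
  \<comment> \<open>The contraction with the iterated coproduct of \<open>p\<close>, as a form in
    three colourings; \<open>sw_coassoc\<close> then rearranges the components of the
    letters.\<close>
  define K where "K w w' w'' = tL ?Z (%a s. tL ?Z (%b c. ?T (gen X w a) (gen X w' b) (gen X w'' c)) (tdel Q X s)) (tdel Q X p)" for w w' w''
  have TT: "trilin (sp Q X) (sp Q X) (sp Q X) ?Z (%a b c. ?T (gen X w a) (gen X w' b) (gen X w'' c))"
   if "w : cl X" "w' : cl X" "w'' : cl X" for w w' w''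
   by (rule trilin_comp[OF T fgen_linmap[OF X(1) that(1)] fgen_linmap[OF X(1) that(2)] fgen_linmap[OF X(1) that(3)]])
  have K: "tml X ?Z K"
   unfolding tml_def K_def
  proof (intro allI impI conjI mlin_tlift[OF q q Z t] mlin_tlift[OF q q Z t'])
   fix w w' a b c assume w: "w : cl X" "w' : cl X" and abc: "a : carr (sp Q X)" "b : carr (sp Q X)" "c : carr (sp Q X)"
   note m = linmap_mlin[OF _ fgen_mlin[OF X(1)]]
   show "mlin A X ?Z (%v. ?T (gen X v a) (gen X w b) (gen X w' c))"
    by (rule m[OF trilinD(1)[OF T]]) (use abc w g in auto)
   show "mlin A X ?Z (%v. ?T (gen X w a) (gen X v b) (gen X w' c))"
    by (rule m[OF trilinD(2)[OF T]]) (use abc w g in auto)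
   show "mlin A X ?Z (%v. ?T (gen X w a) (gen X w' b) (gen X v c))"
    by (rule m[OF trilinD(3)[OF T]]) (use abc w g in auto)
  qed
  have "tL ?Z (%a c. tL ?Z (%a b. ?T a b c) (dl a)) (dl (gen X v p)) =
   sw ?Z X v (%v' v''. tL ?Z (%s c. tL ?Z (%a b. ?T a b (gen X v'' c)) (dl (gen X v' s))) (tdel Q X p))"
   by (rule delta_int[OF Z bL X])
  also have "... = sw ?Z X v (%v' v''. sw ?Z X v' (%w w'. K w w' v''))"
  proof (rule sw_cong[OF X(2)])
   fix v' v'' assume v: "v' : cl X" "v'' : cl X"
   have "tL ?Z (%s c. tL ?Z (%a b. ?T a b (gen X v'' c)) (dl (gen X v' s))) (tdel Q X p) =
    tL ?Z (%s c. sw ?Z X v' (%w w'. tL ?Z (%a b. ?T (gen X w a) (gen X w' b) (gen X v'' c)) (tdel Q X s))) (tdel Q X p)"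
    by (rule tlift_cong[OF q q t], rule delta_int[OF Z trilinD(6)[OF T] X(1) v(1)]) (use g v in auto)
   also have "... = sw ?Z X v' (%w w'. tL ?Z (%s c. tL ?Z (%a b. ?T (gen X w a) (gen X w' b) (gen X v'' c)) (tdel Q X s)) (tdel Q X p))"
    by (rule swl_tlift_swap[OF Z, symmetric])
   also have "... = sw ?Z X v' (%w w'. K w w' v'')"
    by (rule sw_cong[OF v(1)]) (simp add: K_def td_coassoc_int[OF X(1,3) Z TT] v)
   finally show "tL ?Z (%s c. tL ?Z (%a b. ?T a b (gen X v'' c)) (dl (gen X v' s))) (tdel Q X p) = ..." .
  qed
  also have "... = sw ?Z X v (%v' v''. sw ?Z X v'' (K v'))"
   by (rule sw_coassoc[OF Z X(1) K X(2)])
  also have "... = sw ?Z X v (%v' v''. tL ?Z (%a s. tL ?Z (?T (gen X v' a)) (dl (gen X v'' s))) (tdel Q X p))"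
  proof (rule sw_cong[OF X(2)])
   fix v' v'' assume v: "v' : cl X" "v'' : cl X"
   have "tL ?Z (%a s. tL ?Z (?T (gen X v' a)) (dl (gen X v'' s))) (tdel Q X p) =
    tL ?Z (%a s. sw ?Z X v'' (%w w'. tL ?Z (%b c. ?T (gen X v' a) (gen X w b) (gen X w' c)) (tdel Q X s))) (tdel Q X p)"
    by (rule tlift_cong[OF q q t], rule delta_int[OF Z trilinD(4)[OF T] X(1) v(2)]) (use g v in auto)
   also have "... = sw ?Z X v'' (K v')"
    unfolding K_def by (rule swl_tlift_swap[OF Z, symmetric])
   finally show "sw ?Z X v'' (K v') = tL ?Z (%a s. tL ?Z (?T (gen X v' a)) (dl (gen X v'' s))) (tdel Q X p)" ..
  qed
  also have "... = tL ?Z (%a b. tL ?Z (?T a) (dl b)) (dl (gen X v p))"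
   by (rule delta_int[OF Z bR X, symmetric])
  finally show "tL ?Z (%a c. tL ?Z (%a b. ?T a b c) (dl a)) (dl (gen X v p)) =
   tL ?Z (%a b. tL ?Z (?T a) (dl b)) (dl (gen X v p))" .
 qed
 then show "tassoc F F F (tmap (FF) F dl id (dl x)) = tmap F (FF) id dl (dl x)"
  using tassoc_tmap_eq[OF vF vF vF vF delta_in delta_in[OF x]] tmap_id_eq[OF vF vF vF vF delta_in delta_in[OF x]] by simp
qed

lemma delta_one: "dl (fock_one A Q) = tens F F (fock_one A Q) (fock_one A Q)"
proof -
 have o: "finite ({} :: lbl set)" "v : cl {}" "tone Q : scar Q {}" for v using one_in by auto
 note W = vspace_tensor[of F F]
 have "tL (FF) (tens F F) (dl (gen {} v (tone Q))) = tens F F (gen {} v (tone Q)) (gen {} v (tone Q))" for v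
  unfolding delta_int[OF W tens_bilin o] swl_empty[OF W] td_one
   tlift_tens[OF W fgen_bilin2[OF o(1,1,2,2) tens_bilin]] by (simp add: one_gen[symmetric])
 then show ?thesis
  using tlift_tens_id[OF vF vF delta_in[OF fock_one_in]] one_gen by metis
qed

text \<open>\<open>sw_union\<close> separates the components of the letters of \<open>X\<close> from
  those of \<open>Y\<close>, and \<open>td_m\<close> separates the elements; the outcome is the
  product of the two coproducts.\<close>

lemma delta_mul:
 assumes "x : carr F" "y : carr F"
 shows "dl (mu x y) = tmul F F mu mu (dl x) (dl y)"
proof (rule fock_ext2[OF _ _ _ assms])
 let ?Z = "FF"
 note Z = vspace_tensor[of F F]
 show "bilin F F ?Z (%x y. dl (mu x y))"
  by (rule linmap_bilin[OF delta_spec mul_bilin])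
 show "bilin F F ?Z (%x y. tmul F F mu mu (dl x) (dl y))"
  by (rule bilin_comp[OF bilin_tmul[OF vF vF vF vF vF vF mul_bilin mul_bilin] delta_spec delta_spec])
 fix X Y v p q
 assume a: "finite X" "finite Y" "X Int Y = {}" "v : cl (X Un Y)" "p : scar Q X" "q : scar Q Y"
 have f: "finite (X Un Y)" using a by auto
 have v: "v : cl X" "v : cl Y" using a by auto
 note pq = m_in[OF a(1-3,5,6)] and mb = m_bilin[OF a(1-3)]
 note q = Qv[OF a(1)] Qv[OF a(2)] Qv[OF f]
 note tp = td_in[OF a(1,5)] and tq = td_in[OF a(2,6)]
 have M: "bilin F F ?Z (%c d. tens F F (mu a c) (mu b d))" if "a : carr F" "b : carr F" for a b
  by (rule bilin_pair(1)[OF tens_bilin mul_bilin mul_bilin that])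
 have "dl (mu (gen X v p) (gen Y v q)) = tL ?Z (tens F F) (dl (gen (X Un Y) v (tmlt Q X Y p q)))"
  unfolding mul_gen[OF a] by (rule tlift_tens_id[OF vF vF delta_in[OF fgen_in[OF f a(4) pq]], symmetric])
 also have "... = sw ?Z (X Un Y) v (%v' v''. tL ?Z (%a b. tens F F (gen (X Un Y) v' a) (gen (X Un Y) v'' b)) (tdel Q (X Un Y) (tmlt Q X Y p q)))"
  by (rule delta_int[OF Z tens_bilin f a(4) pq])
 also have "... = sw ?Z X v (%v' v''. sw ?Z Y v (%w' w''. tL ?Z (%a b. tL ?Z (%c d. tens F F (mu (gen X v' a) (gen Y w' c)) (mu (gen X v'' b) (gen Y w'' d)))
   (tdel Q Y q)) (tdel Q X p)))"
 proof (rule sw_union[OF Z a(1-4)])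
  fix c c' v' v'' w' w'' :: "lbl => 'v"
  assume w: "v' : cl X" "v'' : cl X" "w' : cl Y" "w'' : cl Y"
   and e: "!!x. x : X ==> c x = v' x & c' x = v'' x" "!!y. y : Y ==> c y = w' y & c' y = w'' y"
  have c: "c : cl (X Un Y)" "c' : cl (X Un Y)" using w e by auto
  have g: "gen X v' a = gen X c a" "gen X v'' a = gen X c' a" if "a : scar Q X" for a
   using fgen_cong[OF a(1) w(1) that, of c] fgen_cong[OF a(1) w(2) that, of c'] e by auto
  have h: "gen Y w' a = gen Y c a" "gen Y w'' a = gen Y c' a" if "a : scar Q Y" for a
   using fgen_cong[OF a(2) w(3) that, of c] fgen_cong[OF a(2) w(4) that, of c'] e by auto
  have "tL ?Z (%a b. tens F F (gen (X Un Y) c a) (gen (X Un Y) c' b)) (tdel Q (X Un Y) (tmlt Q X Y p q)) =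
   tL ?Z (%a b. tL ?Z (%s t. tens F F (gen (X Un Y) c (tmlt Q X Y a s)) (gen (X Un Y) c' (tmlt Q X Y b t))) (tdel Q Y q)) (tdel Q X p)"
   unfolding td_m[OF a(1-3,5,6)]
   by (rule tlift_tmul[OF q(1,1,2,2,3,3) Z mb mb fgen_bilin2[OF f f c tens_bilin] tp tq])
  also have "... = tL ?Z (%a b. tL ?Z (%s t. tens F F (mu (gen X v' a) (gen Y w' s)) (mu (gen X v'' b) (gen Y w'' t))) (tdel Q Y q)) (tdel Q X p)"
   by (intro tlift_cong[OF q(1,1) tp] tlift_cong[OF q(2,2) tq]) (simp add: g h mul_gen[OF a(1-3) c(1)] mul_gen[OF a(1-3) c(2)])
  finally show "tL ?Z (%a b. tens F F (gen (X Un Y) c a) (gen (X Un Y) c' b)) (tdel Q (X Un Y) (tmlt Q X Y p q)) = ..." .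
 qed
 also have "... = sw ?Z X v (%v' v''. tL ?Z (%a b. tL ?Z (%c d. tens F F (mu (gen X v' a) c) (mu (gen X v'' b) d)) (dl (gen Y v q))) (tdel Q X p))"
 proof (rule sw_cong[OF v(1)])
  fix v' v'' assume w: "v' : cl X" "v'' : cl X"
  show "sw ?Z Y v (%w' w''. tL ?Z (%a b. tL ?Z (%c d. tens F F (mu (gen X v' a) (gen Y w' c)) (mu (gen X v'' b) (gen Y w'' d)))
   (tdel Q Y q)) (tdel Q X p)) = tL ?Z (%a b. tL ?Z (%c d. tens F F (mu (gen X v' a) c) (mu (gen X v'' b) d)) (dl (gen Y v q))) (tdel Q X p)"
   unfolding swl_tlift_swap[OF Z]
   by (rule tlift_cong[OF q(1,1) tp], subst delta_int[OF Z M a(2) v(2) a(6)])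
    (use fgen_in[OF a(1) w(1)] fgen_in[OF a(1) w(2)] in \<open>auto simp: swl_tlift_swap[OF Z]\<close>)
 qed
 also have "... = tL ?Z (%a b. tL ?Z (%c d. tens F F (mu a c) (mu b d)) (dl (gen Y v q))) (dl (gen X v p))"
 proof (rule delta_int[OF Z _ a(1) v(1) a(5), symmetric])
  note dy = delta_in[OF fgen_in[OF a(2) v(2) a(6)]]
  show "bilin F F ?Z (%a b. tL ?Z (%c d. tens F F (mu a c) (mu b d)) (dl (gen Y v q)))"
   by (intro bilinI linmap_tlift_param[OF vF vF Z dy] bilin_left_comp[OF tens_bilin] bilin_right_comp[OF tens_bilin]
     bilin_left[OF mul_bilin] bilin_in[OF mul_bilin])
 qed
 also have "... = tmul F F mu mu (dl (gen X v p)) (dl (gen Y v q))"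
  by (simp add: tmul_def)
 finally show "dl (mu (gen X v p) (gen Y v q)) = tmul F F mu mu (dl (gen X v p)) (dl (gen Y v q))" .
qed

lemma td_D_int:
 assumes X: "finite X" "finite Y" "X Int Y = {}" "z : scar Q (X Un Y)" and Z: "vspace Z"
  and T: "trilin (sp Q X) (sp Q Y) (sp Q (X Un Y)) Z T"
 shows "tL Z (%s z. tL Z (%a c. T a c z) (tcop Q X Y s)) (tdel Q (X Un Y) z) =
  tL Z (%x y. tL Z (%a b. tL Z (%c d. T a c (tmlt Q X Y b d)) (tdel Q Y y)) (tdel Q X x)) (tcop Q X Y z)"
proof -
 have f: "finite (X Un Y)" using X by simp
 note q = Qv[OF X(1)] Qv[OF X(2)] Qv[OF f]
 have i: "tcop Q X Y s : carr (sp Q X >< sp Q Y)" if "s : carr (sp Q (X Un Y))" for s using D_in[OF X(1-3)] that by simp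
 have tX: "tdel Q X s : carr (sp Q X >< sp Q X)" if "s : carr (sp Q X)" for s using td_in[OF X(1)] that by simp
 have tY: "tdel Q Y s : carr (sp Q Y >< sp Q Y)" if "s : carr (sp Q Y)" for s using td_in[OF X(2)] that by simp
 show ?thesis
  using tlift_tmap_tens_id[where f = "tcop Q X Y", OF q Z q(3) T i td_in[OF f X(4)]]
   tlift_m1324[where f = "tdel Q X" and g = "tdel Q Y", OF q(1,1,2,2,3,1,2) Z tX tY m_bilin[OF X(1-3)] D_in[OF X] T]
   td_D[OF X] by simp
qed

text \<open>For each subset \<open>B\<close> of \<open>X\<close> the element part is the comodule
  law of \<open>Q\<close>, and the colours are split between \<open>B\<close> and its complement by
  \<open>sw_union\<close>. The second components of both parts are then joined by the
  product.\<close>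

lemma delta_Delta:
 assumes x: "x : carr F"
 shows "tmap (FF) F Dl id (dl x) = m1324 F F F mu (tmap (FF) (FF) dl dl (Dl x))"
proof -
 let ?Z = "(FF) >< F" and ?T = "%a c z. tens (FF) F (tens F F a c) z"
 note Z = vspace_tensor[of "FF" F]
 note T = trilin_tens'[OF vF vF vF]
 have bL: "bilin F F ?Z (%s z. tL ?Z (%a c. ?T a c z) (Dl s))"
  using bilin_comp[OF linmap_tlift_trilin(1)[OF vF vF vF Z T] fock_Delta_spec linmap_id] .
 let ?M = "%s t. tL ?Z (%a b. tL ?Z (%c d. ?T a c (mu b d)) t) s"
 note q1 = bilin_m1324(1)[OF vF vF vF vF Z T mul_bilin] and bM = bilin_m1324(2)[OF vF vF vF vF Z T mul_bilin]
 note bR = bilin_m1324(3)[OF vF vF vF vF Z T mul_bilin delta_spec delta_spec]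
 have "tL ?Z (%s z. tL ?Z (%a c. ?T a c z) (Dl s)) (dl x) = tL ?Z (%x y. ?M (dl x) (dl y)) (Dl x)"
 proof (rule fock_ext[OF linmap_tlift_arg[OF vF vF Z bL delta_spec] linmap_tlift_arg[OF vF vF Z bR fock_Delta_spec] _ x])
  fix X v p assume X: "finite X" "v : cl X" "p : scar Q X"
  note sp = Pow_split[OF X(1)]
  \<comment> \<open>The term of the subset \<open>B\<close> after the comodule law of
    \<open>Q\<close>: first components stay separated, second components lie on all of
    \<open>X\<close>.\<close>
  let ?G = "%B v' v''. tL ?Z (%x y. tL ?Z (%a b. tL ?Z (%c d. ?T (gen B v' a) (gen (X - B) v' c) (gen X v'' (tmlt Q B (X - B) b d))) (tdel Q (X - B) y)) (tdel Q B x)) (tcop Q B (X - B) p)"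
  have vB: "w : cl B" "w : cl (X - B)" if "w : cl X" "B : Pow X" for w :: "lbl => 'v" and B
   using that by auto
  have "tL ?Z (%s z. tL ?Z (%a c. ?T a c z) (Dl s)) (dl (gen X v p)) =
   sw ?Z X v (%v' v''. tL ?Z (%s z. tL ?Z (%a c. ?T a c (gen X v'' z)) (Dl (gen X v' s))) (tdel Q X p))"
   by (rule delta_int[OF Z bL X])
  also have "... = sw ?Z X v (%v' v''. SUM B:Pow X. ?G B v' v'')"
  proof (rule sw_cong[OF X(2)])
   fix v' v'' assume v: "v' : cl X" "v'' : cl X"
   have "tL ?Z (%s z. tL ?Z (%a c. ?T a c (gen X v'' z)) (Dl (gen X v' s))) (tdel Q X p) =
    tL ?Z (%s z. SUM B:Pow X. tL ?Z (%a c. ?T (gen B v' a) (gen (X - B) v' c) (gen X v'' z)) (tcop Q B (X - B) s)) (tdel Q X p)"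
    by (rule tlift_cong[OF Qv[OF X(1)] Qv[OF X(1)] td_in[OF X(1,3)]], rule Delta_int[OF Z trilinD(6)[OF T] X(1) v(1)])
     (use fgen_in[OF X(1) v(2)] in auto)
   also have "... = (SUM B:Pow X. tL ?Z (%s z. tL ?Z (%a c. ?T (gen B v' a) (gen (X - B) v' c) (gen X v'' z)) (tcop Q B (X - B) s)) (tdel Q X p))"
    by (rule tlift_sum_param[OF Z])
   also have "... = (SUM B:Pow X. ?G B v' v'')"
   proof (rule sum.cong[OF refl])
    fix B assume B: "B : Pow X"
    have "trilin (sp Q B) (sp Q (X - B)) (sp Q (B Un (X - B))) ?Z (%a c z. ?T (gen B v' a) (gen (X - B) v' c) (gen X v'' z))"
     unfolding sp(4)[OF B]
     by (rule trilin_comp[OF T fgen_linmap[OF sp(1)[OF B] vB(1)[OF v(1) B]] fgen_linmap[OF sp(2)[OF B] vB(2)[OF v(1) B]] fgen_linmap[OF X(1) v(2)]])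
    from td_D_int[OF sp(1-3)[OF B] _ Z this, of p] X(3)
    show "tL ?Z (%s z. tL ?Z (%a c. ?T (gen B v' a) (gen (X - B) v' c) (gen X v'' z)) (tcop Q B (X - B) s)) (tdel Q X p) =
     ?G B v' v''"
     unfolding sp(4)[OF B] by blast
   qed
   finally show "tL ?Z (%s z. tL ?Z (%a c. ?T a c (gen X v'' z)) (Dl (gen X v' s))) (tdel Q X p) = ..." .
  qed
  also have "... = (SUM B:Pow X. sw ?Z X v (%v' v''. ?G B v' v''))"
   by (rule swl_sum[OF Z])
  also have "... = (SUM B:Pow X. tL ?Z (%x y. ?M (dl (gen B v x)) (dl (gen (X - B) v y))) (tcop Q B (X - B) p))"
  proof (rule sum.cong[OF refl])
   fix B assume B: "B : Pow X"
   note s = sp[OF B] and vv = vB[OF X(2) B] and ci = cop_in[OF X(1) B X(3)]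
   note q = Qv[OF s(1)] Qv[OF s(2)]
   let ?R = "%v' v'' w' w''. tL ?Z (%x y. tL ?Z (%a b. tL ?Z (%c d.
    ?T (gen B v' a) (gen (X - B) w' c) (mu (gen B v'' b) (gen (X - B) w'' d))) (tdel Q (X - B) y)) (tdel Q B x)) (tcop Q B (X - B) p)"
   have vu: "v : cl (B Un (X - B))" using X(2) by (simp only: s)
   have "sw ?Z (B Un (X - B)) v (%v' v''. ?G B v' v'') =
    sw ?Z B v (%v' v''. sw ?Z (X - B) v (%w' w''. ?R v' v'' w' w''))"
   proof (rule sw_union[OF Z s(1-3) vu])
    fix c c' v' v'' w' w'' :: "lbl => 'v"
    assume w: "v' : cl B" "v'' : cl B" "w' : cl (X - B)" "w'' : cl (X - B)"
     and e: "!!x. x : B ==> c x = v' x & c' x = v'' x" "!!y. y : X - B ==> c y = w' y & c' y = w'' y"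
    have c: "c' : cl (B Un (X - B))"
    proof
     fix x assume "x : B Un (X - B)"
     then show "c' x : carr A" using w(2,4) e by (cases "x : B") auto
    qed
    have g: "gen B v' a = gen B c a" "gen B v'' a = gen B c' a" if "a : scar Q B" for a
     using fgen_cong[OF s(1) w(1) that, of c] fgen_cong[OF s(1) w(2) that, of c'] e by auto
    have h: "gen (X - B) w' a = gen (X - B) c a" "gen (X - B) w'' a = gen (X - B) c' a" if "a : scar Q (X - B)" for a
     using fgen_cong[OF s(2) w(3) that, of c] fgen_cong[OF s(2) w(4) that, of c'] e by auto
    show "?G B c c' = ?R v' v'' w' w''"
     by (rule tlift_cong[OF q ci], rule tlift_cong[OF q(1,1) td_in[OF s(1)]], simp, rule tlift_cong[OF q(2,2) td_in[OF s(2)]], simp)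
      (use mul_gen[OF s(1-3) c, unfolded s(4)] in \<open>simp add: g h\<close>)
   qed
   then have "sw ?Z X v (%v' v''. ?G B v' v'') =
    sw ?Z B v (%v' v''. sw ?Z (X - B) v (%w' w''. ?R v' v'' w' w''))"
    by (simp only: s(4))
   also have "... = tL ?Z (%x y. sw ?Z B v (%v' v''. tL ?Z (%a b. sw ?Z (X - B) v (%w' w''. tL ?Z (%c d.
     ?T (gen B v' a) (gen (X - B) w' c) (mu (gen B v'' b) (gen (X - B) w'' d))) (tdel Q (X - B) y))) (tdel Q B x))) (tcop Q B (X - B) p)"
    unfolding swl_tlift_swap[OF Z] ..
   also have "... = tL ?Z (%x y. ?M (dl (gen B v x)) (dl (gen (X - B) v y))) (tcop Q B (X - B) p)"
   proof (rule tlift_cong[OF q ci])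
    fix x y assume "x : carr (sp Q B)" "y : carr (sp Q (X - B))"
    then have x: "x : scar Q B" and y: "y : scar Q (X - B)" by auto
    note dy = delta_in[OF fgen_in[OF s(2) vv(2) y]]
    from delta_int[OF Z bM[OF dy] s(1) vv(1) x]
    have "?M (dl (gen B v x)) (dl (gen (X - B) v y)) =
     sw ?Z B v (%v' v''. tL ?Z (%a b. tL ?Z (%c d. ?T (gen B v' a) c (mu (gen B v'' b) d)) (dl (gen (X - B) v y))) (tdel Q B x))" .
    also have "... = sw ?Z B v (%v' v''. tL ?Z (%a b. sw ?Z (X - B) v (%w' w''. tL ?Z (%c d.
     ?T (gen B v' a) (gen (X - B) w' c) (mu (gen B v'' b) (gen (X - B) w'' d))) (tdel Q (X - B) y))) (tdel Q B x))"
     by (rule sw_cong[OF vv(1)], rule tlift_cong[OF q(1,1) td_in[OF s(1) x]], rule delta_int[OF Z q1 s(2) vv(2) y])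
      (auto intro: fgen_in s)
    finally show "sw ?Z B v (%v' v''. tL ?Z (%a b. sw ?Z (X - B) v (%w' w''. tL ?Z (%c d.
     ?T (gen B v' a) (gen (X - B) w' c) (mu (gen B v'' b) (gen (X - B) w'' d))) (tdel Q (X - B) y))) (tdel Q B x)) =
     ?M (dl (gen B v x)) (dl (gen (X - B) v y))" ..
   qed
   finally show "sw ?Z X v (%v' v''. ?G B v' v'') = ..." .
  qed
  also have "... = tL ?Z (%x y. ?M (dl x) (dl y)) (Dl (gen X v p))"
   by (rule Delta_int[OF Z bR X, symmetric])
  finally show "tL ?Z (%s z. tL ?Z (%a c. ?T a c z) (Dl s)) (dl (gen X v p)) = tL ?Z (%x y. ?M (dl x) (dl y)) (Dl (gen X v p))" .
 qed
 then show ?thesis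
  using tmap_tens_id_eq[OF vF vF vF vF Delta_in delta_in[OF x]]
   m1324_tmap_eq[OF vF vF vF vF vF vF vF delta_in delta_in mul_bilin Delta_in[OF x]] by simp
qed

text \<open>\<open>Ep\<close> kills generators on nonempty label sets, so the law is trivial except
  on the empty set, where it is the axiom for Q[{}].\<close>

lemma delta_Eps:
 assumes x: "x : carr F"
 shows "tL F (%a b. smul F (Ep a) b) (dl x) = smul F (Ep x) (fock_one A Q)"
proof (rule fock_ext[OF _ _ _ x])
 interpret f: vector_space "smul F" by (rule vspace_vector_space[OF vF])
 have b: "bilin F F F (%a b. smul F (Ep a) b)" by (rule bilin_ground_scale(1)[OF vF fock_Eps_spec])
 show "linmap F F (%x. tL F (%a b. smul F (Ep a) b) (dl x))" by (rule linmap_tlift_arg[OF vF vF vF b delta_spec])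
 show "linmap F F (%x. smul F (Ep x) (fock_one A Q))" by (rule linmap_scale_left[OF vF fock_Eps_spec fock_one_in])
 fix X v p assume X: "finite X" "v : cl X" "p : scar Q X"
 note q = Qv[OF X(1)] and t = td_in[OF X(1,3)]
 have e: "tL F (%a b. smul F (Ep a) b) (dl (gen X v p)) =
  sw F X v (%v' v''. tL F (%a b. smul F (if X = {} then tcou Q a else 0) (gen X v'' b)) (tdel Q X p))"
  unfolding delta_int[OF vF b X]
  by (rule sw_cong[OF X(2)], rule tlift_cong[OF q q t]) (simp only: Eps_gen[OF X(1)] sp_sel)
 show "tL F (%a b. smul F (Ep a) b) (dl (gen X v p)) = smul F (Ep (gen X v p)) (fock_one A Q)"
 proof (cases "X = {}")
  case False
  have "tL F (%a b. smul F (Ep a) b) (dl (gen X v p)) = 0"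
   unfolding e using False by (simp add: tlift_zero_param[OF vF]) (simp add: swl_def)
  then show ?thesis using False by (simp add: Eps_gen[OF X])
 next
  case True
  let ?w = "%x. snd (undefined :: 'v \<times> 'v)"
  have w: "?w : cl {}" by simp
  note p = X(3)[unfolded True] and q0 = q[unfolded True] and t0 = t[unfolded True] and gl = fgen_linmap[OF finite.emptyI w]
  have "tL F (%a b. smul F (Ep a) b) (dl (gen X v p)) = tL F (%a b. smul F (tcou Q a) (gen {} ?w b)) (tdel Q {} p)"
   unfolding e unfolding True swl_empty[OF vF] by simp
  also have "... = tL F (%a b. gen {} ?w (smul (sp Q {}) (tcou Q a) b)) (tdel Q {} p)"
   by (rule tlift_cong[OF q0 q0 t0]) (use linmap_scale[OF gl] in simp)
  also have "... = gen {} ?w (tL (sp Q {}) (%a b. smul (sp Q {}) (tcou Q a) b) (tdel Q {} p))"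
   by (rule linmap_of_tlift[OF q0 q0 t0 gl q0 vspace_scale[OF q0], symmetric])
  also have "... = smul F (tcou Q p) (gen {} ?w (tone Q))"
   unfolding td_cou[OF p] by (rule linmap_scale[OF gl]) (simp add: one_in)
  finally show ?thesis using True X by (simp add: Eps_gen one_gen[symmetric])
 qed
qed

lemma double_bialgebra_fock: "double_bialgebra (fock_dbialg V Q dl ep)"
 unfolding double_bialgebra_def fock_dbialg_def Let_def dbialg.simps
 by (intro conjI ballI mul_bilin fock_one_in mul_assoc mul_one fock_coalgebra Delta_one Delta_mul Eps_one Eps_mul
   delta_coalgebra delta_one delta_mul delta_Delta delta_Eps)

end

section \<open>Products of letters over classes\<close>

fun opt_mul :: "('v => 'v => 'v) => 'v option => 'v option => 'v option" where
 "opt_mul f None y = y"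
| "opt_mul f (Some x) None = Some x"
| "opt_mul f (Some x) (Some y) = Some (f x y)"

lemma opt_mul_None [simp]: "opt_mul f x None = x"
 by (cases x) simp_all

context nb
begin

text \<open>The algebra \<open>V\<close> has no unit; \<open>None\<close> is adjoined as one, so that \<open>finprod\<close> applies.\<close>

definition "M = \<lparr>carrier = insert None (Some ` carr A), monoid.mult = opt_mul (nmul V), one = None\<rparr>"

lemma M_sel: "carrier M = insert None (Some ` carr A)" "monoid.mult M = opt_mul (nmul V)" "one M = None"
 by (simp_all add: M_def)

lemma comm_monoid_M: "comm_monoid M"
 by (rule comm_monoidI) (auto simp: M_sel nmul_assoc bilin_in[OF nmul_bilin] intro: nmul_comm)

interpretation M: comm_monoid M
 by (rule comm_monoid_M)

text \<open>Meaningful on nonempty sets only; every class of an equivalence is one. Taking it from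
  \<open>finprod\<close> makes it independent of any order of the factors.\<close>

definition pr :: "(lbl => 'v) => lbl set => 'v" where
 "pr v X = the (finprod M (%x. Some (v x)) X)"

lemma Some_in: "v : cl X ==> (%x. Some (v x)) : X \<rightarrow> carrier M"
 by (auto simp: M_sel)

lemma finprod_pr:
 assumes "finite X" "X ~= {}" "v : cl X"
 shows "finprod M (%x. Some (v x)) X = Some (pr v X)" "pr v X : carr A"
proof -
 have "EX a:carr A. finprod M (%x. Some (v x)) X = Some a"
  using assms
 proof (induction X rule: finite_ne_induct)
  case (singleton x)
  then show ?case using M.finprod_insert[of "{}" x "%x. Some (v x)"] by (simp add: M_sel)
 next
  case (insert x X)
  have "v : cl X" "v x : carr A" using insert.prems by auto
  with insert.IH insert.hyps Some_in[of v X] show ?case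
   using M.finprod_insert[of X x "%x. Some (v x)"] by (auto simp: M_sel bilin_in[OF nmul_bilin])
 qed
 then show "finprod M (%x. Some (v x)) X = Some (pr v X)" "pr v X : carr A"
  by (auto simp: pr_def)
qed

lemma pr_single: "v x : carr A ==> pr v {x} = v x"
 using M.finprod_insert[of "{}" x "%x. Some (v x)"] by (simp add: M_sel pr_def)

lemma pr_Un:
 assumes "finite X" "finite Y" "X Int Y = {}" "X ~= {}" "Y ~= {}" "v : cl (X Un Y)"
 shows "pr v (X Un Y) = nmul V (pr v X) (pr v Y)"
proof -
 have v: "v : cl X" "v : cl Y" using assms(6) by auto
 show ?thesis
  using M.finprod_Un_disjoint[OF assms(1-3) Some_in[OF v(1)] Some_in[OF v(2)]]
  by (simp add: finprod_pr(1)[OF assms(1,4) v(1)] finprod_pr(1)[OF assms(2,5) v(2)] M_sel pr_def[of v "X Un Y"])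
qed

lemma pr_insert:
 assumes "finite X" "x ~: X" "X ~= {}" "v : cl (insert x X)"
 shows "pr v (insert x X) = nmul V (v x) (pr v X)"
 using pr_Un[of "{x}" X v] assms pr_single[of v x] by auto

lemma pr_cong: "v : cl X ==> (!!x. x : X ==> v x = w x) ==> pr v X = pr w X"
 unfolding pr_def using M.finprod_cong'[OF refl Some_in, of v X "%x. Some (w x)"] by simp

lemma pr_reindex: "v : cl (h ` X) ==> inj_on h X ==> pr v (h ` X) = pr (v o h) X"
 unfolding pr_def using M.finprod_reindex[OF Some_in, of v h X] by (simp add: comp_def)

text \<open>Generalised commutativity and associativity: a product over a partitioned set may first
  be formed inside the blocks.\<close>

lemma pr_UN:
 assumes "finite Y" "Y ~= {}" "!!y. y : Y ==> finite (B y) & B y ~= {}"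
  "!!y z. y : Y ==> z : Y ==> y ~= z ==> B y Int B z = {}" "v : cl (UN y:Y. B y)"
 shows "pr (%y. pr v (B y)) Y = pr v (UN y:Y. B y)"
 using assms
proof (induction Y rule: finite_ne_induct)
 case (singleton y)
 then show ?case using pr_single[of "%y. pr v (B y)" y] finprod_pr(2)[of "B y" v] by simp
next
 case (insert y Y)
 have v: "v : cl (UN y:Y. B y)" and vz: "!!z. z : insert y Y ==> v : B z \<rightarrow> carr A"
  using insert.prems(3) by auto
 have d: "B y Int (UN y:Y. B y) = {}" using insert.prems(2) insert.hyps(3) by blast
 have ne: "(UN y:Y. B y) ~= {}" using insert.prems(1) insert.hyps(2) by blast
 have fU: "finite (UN y:Y. B y)" using insert.prems(1) insert.hyps(1) by blast
 have By: "finite (B y)" "B y ~= {}" using insert.prems(1)[of y] by auto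
 have "pr (%y. pr v (B y)) (insert y Y) = nmul V (pr v (B y)) (pr (%y. pr v (B y)) Y)"
  by (intro pr_insert insert.hyps Pi_I finprod_pr(2) vz) (use insert.prems(1) in simp_all)
 also have "pr (%y. pr v (B y)) Y = pr v (UN y:Y. B y)"
  by (rule insert.IH[OF _ _ v]) (use insert.prems in simp_all)
 also have "nmul V (pr v (B y)) (pr v (UN y:Y. B y)) = pr v (B y Un (UN y:Y. B y))"
  by (rule pr_Un[OF By(1) fU d By(2) ne, symmetric]) (use insert.prems(3) in simp)
 finally show ?case by simp
qed

lemma wprod_pr:
 assumes "xs ~= []" "distinct xs" "v : set xs \<rightarrow> carr A"
 shows "wprod (nmul V) (map v xs) = pr v (set xs)"
 using assms
proof (induction xs rule: induct_list012)
 case (2 x)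
 then show ?case by (simp add: pr_single)
next
 case (3 x y xs)
 then have "v : set (y # xs) \<rightarrow> carr A" by auto
 with 3 show ?case using pr_insert[of "set (y # xs)" x v] by simp
qed simp

lemma pr_upd_lin:
 assumes X: "finite X" "x : X" "v : cl X"
 shows "linmap A A (%a. pr (v(x := a)) X)"
proof -
 define Y where "Y = X - {x}"
 have Y: "X = insert x Y" "x ~: Y" "finite Y" using X by (auto simp: Y_def)
 have v: "v : cl Y" using X(3) Y by auto
 show ?thesis
 proof (cases "Y = {}")
  case True
  show ?thesis
   by (rule linmap_cong[OF linmap_id vA]) (use Y True pr_single in simp)
 next
  case False
  have "pr (v(x := a)) X = nmul V a (pr v Y)" if a: "a : carr A" for a
  proof -
   have "v(x := a) : cl (insert x Y)" using v a by auto
   moreover have "pr (v(x := a)) Y = pr v Y"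
    by (rule pr_cong[symmetric, OF v]) (use Y(2) in auto)
   ultimately show ?thesis using pr_insert[OF Y(3,2) False] Y(1) by simp
  qed
  then show ?thesis
   by (intro linmap_cong[OF bilin_left[OF nmul_bilin finprod_pr(2)[OF Y(3) False v]] vA])
 qed
qed

lemma cou_pr:
 assumes "finite X" "X ~= {}" "v : cl X"
 shows "cou (pr v X) = (PROD x:X. cou (v x))"
 using assms
proof (induction X rule: finite_ne_induct)
 case (singleton x)
 then show ?case by (simp add: pr_single)
next
 case (insert x X)
 have "v : cl X" "v x : carr A" using insert.prems by auto
 with insert show ?case by (simp add: pr_insert cou_nmul finprod_pr)
qed

text \<open>The coproduct of a product is the product of the coproducts of its letters.
  Multiplicativity of \<open>cop\<close> is used once for each further letter of the class.\<close>

lemma sw_pr: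
 assumes Z: "vspace Z" and be: "bilin A A Z be" and X: "finite X" "X ~= {}" "v : cl X"
 shows "sw Z X v (%v' v''. be (pr v' X) (pr v'' X)) = tL Z be (cop (pr v X))"
 using X be
proof (induction X arbitrary: be rule: finite_ne_induct)
 case (singleton x)
 then have v: "v x : carr A" by auto
 have "sw Z {x} v (%v' v''. be (pr v' {x}) (pr v'' {x})) = tL Z (%a b. be (pr ((%y. fst (undefined :: 'v \<times> 'v))(x := a)) {x}) (pr ((%y. snd (undefined :: 'v \<times> 'v))(x := b)) {x})) (cop (v x))"
  using swl_insert[OF Z finite.emptyI, of x cop v "%v' v''. be (pr v' {x}) (pr v'' {x})"] by (simp add: swl_empty[OF Z])
 also have "... = tL Z be (cop (v x))"
  by (rule tlift_cong[OF vA vA cop_in[OF v]]) (simp add: pr_single)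
 finally show ?case using v by (simp add: pr_single)
next
 case (insert x X)
 have v: "v : cl X" "v x : carr A" using insert.prems(1) by auto
 note X = insert.hyps(1,3,2) and p = finprod_pr(2)[OF insert.hyps(1,2)]
 have \<beta>': "bilin A A Z (%c d. be (nmul V a c) (nmul V b d))" if "a : carr A" "b : carr A" for a b
  by (rule bilin_pair(1)[OF insert.prems(2) nmul_bilin nmul_bilin that])
 have "sw Z (insert x X) v (%v' v''. be (pr v' (insert x X)) (pr v'' (insert x X))) =
  tL Z (%a b. sw Z X v (%v' v''. be (pr (v'(x := a)) (insert x X)) (pr (v''(x := b)) (insert x X)))) (cop (v x))"
  by (rule swl_insert[OF Z X(1,2)])
 also have "... = tL Z (%a b. tL Z (%c d. be (nmul V a c) (nmul V b d)) (cop (pr v X))) (cop (v x))"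
 proof (rule tlift_cong[OF vA vA cop_in[OF v(2)]])
  fix a b assume ab: "a : carr A" "b : carr A"
  have up: "pr (w(x := c)) (insert x X) = nmul V c (pr w X)" if w: "w : cl X" and c: "c : carr A" for w c
  proof -
   have "w(x := c) : cl (insert x X)" using w c by auto
   moreover have "pr (w(x := c)) X = pr w X"
    by (rule pr_cong[symmetric, OF w]) (use X(2) in auto)
   ultimately show ?thesis using pr_insert[OF X] by simp
  qed
  have "sw Z X v (%v' v''. be (pr (v'(x := a)) (insert x X)) (pr (v''(x := b)) (insert x X))) =
   sw Z X v (%v' v''. be (nmul V a (pr v' X)) (nmul V b (pr v'' X)))"
   by (rule sw_cong[OF v(1)]) (simp add: up ab)
  also have "... = tL Z (%c d. be (nmul V a c) (nmul V b d)) (cop (pr v X))"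
   by (rule insert.IH[OF v(1) \<beta>'[OF ab]])
  finally show "sw Z X v (%v' v''. be (pr (v'(x := a)) (insert x X)) (pr (v''(x := b)) (insert x X))) = ..." .
 qed
 also have "... = tL Z be (cop (nmul V (v x) (pr v X)))"
  using tlift_tmul[OF vA vA vA vA vA vA Z nmul_bilin nmul_bilin insert.prems(2) cop_in[OF v(2)] cop_in[OF p[OF v(1)]]]
  by (simp add: cop_nmul[OF v(2) p[OF v(1)]])
 finally show ?case using pr_insert[OF X insert.prems(1)] by simp
qed

text \<open>The push-forward of a colouring along \<open>q\<close>: colours are multiplied over the
  fibres.\<close>

definition pf :: "lbl set => (lbl => lbl) => (lbl => 'v) => lbl => 'v" where
 "pf X q v y = pr v {x:X. q x = y}"

lemma pf_in: "finite X ==> v : cl X ==> pf X q v : cl (q ` X)"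
 unfolding pf_def by (auto intro!: finprod_pr(2))

lemma pf_cong: "v : cl X ==> (!!x. x : X ==> v x = w x) ==> pf X q v y = pf X q w y"
 unfolding pf_def by (rule pr_cong) auto

lemma pf_inj:
 assumes "v : cl X" "inj_on q X" "x : X"
 shows "pf X q v (q x) = v x"
proof -
 have "{x':X. q x' = q x} = {x}" using assms(2,3) by (auto simp: inj_on_eq_iff)
 then show ?thesis using pr_single[of v x] assms(1,3) by (auto simp: pf_def)
qed

text \<open>Functoriality of the push-forward. The value at \<open>z\<close> is claimed only where
  the fibre is nonempty.\<close>

lemma pf_pf:
 assumes X: "finite X" "v : cl X" and x: "x : X" "z = q' (q x)"
 shows "pf (q ` X) q' (pf X q v) z = pf X (%x. q' (q x)) v z"
proof -
 have "pf (q ` X) q' (pf X q v) z = pr v (UN y:{y:q ` X. q' y = z}. {x:X. q x = y})"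
  unfolding pf_def by (rule pr_UN) (use X x in auto)
 also have "(UN y:{y:q ` X. q' y = z}. {x:X. q x = y}) = {x:X. q' (q x) = z}" by auto
 finally show ?thesis by (simp add: pf_def[abs_def])
qed

lemma pf_image:
 assumes "inj_on h X" "v : cl (h ` X)"
 shows "pf (h ` X) q v y = pf X (%x. q (h x)) (v o h) y"
proof -
 have "{x:h ` X. q x = y} = h ` {x:X. q (h x) = y}" by auto
 moreover have "pr v (h ` {x:X. q (h x) = y}) = pr (v o h) {x:X. q (h x) = y}"
  by (rule pr_reindex) (use assms in \<open>auto intro: inj_on_subset\<close>)
 ultimately show ?thesis by (simp add: pf_def)
qed

lemma pf_upd:
 assumes "x : X" "y ~= q x" "v : cl X" "a : carr A"
 shows "pf X q (v(x := a)) y = pf X q v y"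
 unfolding pf_def by (rule pr_cong) (use assms in auto)

lemma mlin_pf:
 assumes X: "finite X" and \<Psi>: "mlin A (q ` X) Z \<Psi>"
 shows "mlin A X Z (%v. \<Psi> (pf X q v))"
proof (rule mlinI)
 fix v assume v: "v : cl X"
 show "\<Psi> (pf X q v) : carr Z" by (rule mlinD(1)[OF \<Psi> pf_in[OF X v]])
 show "\<Psi> (pf X q v) = \<Psi> (pf X q w)" if "!!x. x : X ==> v x = w x" for w
  by (rule mlinD(2)[OF \<Psi> pf_in[OF X v]], rule pf_cong[OF v that])
 fix x assume x: "x : X"
 \<comment> \<open>A change at \<open>x\<close> affects only the product over the fibre through
   \<open>x\<close>, and that product is linear in the colour of \<open>x\<close>.\<close>
 have e: "\<Psi> (pf X q (v(x := a))) = \<Psi> ((pf X q v)(q x := pr (v(x := a)) {x':X. q x' = q x}))" if a: "a : carr A" for a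
 proof -
  have "v(x := a) : cl X" using v a by auto
  from pf_in[OF X this] show ?thesis
   by (rule mlinD(2)[OF \<Psi>]) (use pf_upd[OF x _ v a] in \<open>auto simp: pf_def\<close>)
 qed
 have "linmap A Z (%a. \<Psi> ((pf X q v)(q x := pr (v(x := a)) {x':X. q x' = q x})))"
  by (rule linmap_comp[OF mlinD(3)[OF \<Psi> pf_in[OF X v]] pr_upd_lin]) (use X v x in auto)
 then show "linmap A Z (%a. \<Psi> (pf X q (v(x := a))))"
  by (rule linmap_cong[OF _ vA]) (rule e)
qed

lemma cou_pf:
 assumes X: "finite X" "v : cl X"
 shows "(PROD y:q ` X. cou (pf X q v y)) = (PROD x:X. cou (v x))"
proof -
 have "(PROD y:q ` X. cou (pf X q v y)) = (PROD y:q ` X. PROD x:{x:X. q x = y}. cou (v x))"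
  by (rule prod.cong[OF refl], unfold pf_def, rule cou_pr) (use X in auto)
 also have "... = (PROD x:X. cou (v x))"
  using prod.group[OF X(1) finite_imageI[OF X(1)] subset_refl, where h = "%x. cou (v x)"] by simp
 finally show ?thesis .
qed

text \<open>Applies \<open>sw_pr\<close> to all blocks simultaneously: components of the letters,
  multiplied over the blocks, may be replaced by components of the block products.\<close>

lemma sw_UN:
 assumes Z: "vspace Z" and Y: "finite Y" "!!y. y : Y ==> finite (B y) & B y ~= {}"
  "!!y z. y : Y ==> z : Y ==> y ~= z ==> B y Int B z = {}" "v : cl (UN y:Y. B y)" and \<Psi>: "bml Y Z \<Psi>"
 shows "sw Z (UN y:Y. B y) v (%v' v''. \<Psi> (%y. pr v' (B y)) (%y. pr v'' (B y))) = sw Z Y (%y. pr v (B y)) \<Psi>"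
 using Y \<Psi>
proof (induction Y arbitrary: \<Psi> rule: finite_induct)
 case empty
 have "\<Psi> u u' = \<Psi> w w'" for u u' w w'
  using mlinD(2)[OF bmlD(1)[OF empty.prems(4)], of u' u w] mlinD(2)[OF bmlD(2)[OF empty.prems(4)], of w u' w'] by simp
 then show ?case by (simp add: swl_empty[OF Z])
next
 case (insert y Y)
 let ?U = "UN y:Y. B y"
 have v: "v : cl ?U" "v : B y \<rightarrow> carr A" and vU: "v : B y Un ?U \<rightarrow> carr A"
  using insert.prems(3) by auto
 have d: "B y Int ?U = {}" using insert.prems(2) insert.hyps(2) by blast
 have f: "finite ?U" "finite (B y)" "B y ~= {}" using insert.prems(1) insert.hyps(1) by auto
 have py: "pr w (B y) : carr A" if "w : B y \<rightarrow> carr A" for w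
  by (rule finprod_pr(2)[OF f(2,3) that])
 \<comment> \<open>The form with the slot \<open>y\<close> filled. The induction hypothesis treats
   the blocks in \<open>Y\<close> and \<open>sw_pr\<close> the block of \<open>y\<close>;
   \<open>swl_insert\<close> then recombines them.\<close>
 let ?\<Theta> = "%a b w w'. \<Psi> (w(y := a)) (w'(y := b))"
 have "sw Z (B y Un ?U) v (%v' v''. \<Psi> (%y. pr v' (B y)) (%y. pr v'' (B y))) =
  sw Z (B y) v (%a a'. sw Z ?U v (%b b'. ?\<Theta> (pr a (B y)) (pr a' (B y)) (%y. pr b (B y)) (%y. pr b' (B y))))"
 proof (rule sw_union[OF Z f(2,1) d vU])
  fix c c' a a' b b' :: "lbl => 'v"
  assume w: "a : B y \<rightarrow> carr A" "a' : B y \<rightarrow> carr A" "b : cl ?U" "b' : cl ?U"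
   and e: "!!x. x : B y ==> c x = a x & c' x = a' x" "!!x. x : ?U ==> c x = b x & c' x = b' x"
  have bz: "b : B z \<rightarrow> carr A" "b' : B z \<rightarrow> carr A" if "z : Y" for z using w(3,4) that by auto
  have 1: "pr c (B z) = ((%y. pr b (B y))(y := pr a (B y))) z" "pr c' (B z) = ((%y. pr b' (B y))(y := pr a' (B y))) z"
   if "z : insert y Y" for z
  proof -
   have "pr a (B y) = pr c (B y)" "pr a' (B y) = pr c' (B y)"
    using pr_cong[OF w(1), of c] pr_cong[OF w(2), of c'] e(1) by simp_all
   moreover have "pr b (B z) = pr c (B z)" if z: "z : Y"
    by (rule pr_cong[OF bz(1)[OF z]]) (simp add: e(2)[OF UN_I[OF z]])
   moreover have "pr b' (B z) = pr c' (B z)" if z: "z : Y"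
    by (rule pr_cong[OF bz(2)[OF z]]) (simp add: e(2)[OF UN_I[OF z]])
   ultimately show "pr c (B z) = ((%y. pr b (B y))(y := pr a (B y))) z" "pr c' (B z) = ((%y. pr b' (B y))(y := pr a' (B y))) z"
    using that by auto
  qed
  have in1: "(%y. pr c (B y)) : cl (insert y Y)" "(%y. pr c' (B y)) : cl (insert y Y)"
   "(%y. pr b (B y))(y := pr a (B y)) : cl (insert y Y)"
   using 1 py[OF w(1)] py[OF w(2)] finprod_pr(2) bz insert.prems(1) by auto
  show "\<Psi> (%y. pr c (B y)) (%y. pr c' (B y)) = ?\<Theta> (pr a (B y)) (pr a' (B y)) (%y. pr b (B y)) (%y. pr b' (B y))"
   by (rule trans[OF mlinD(2)[OF bmlD(1)[OF insert.prems(4) in1(2)] in1(1) 1(1)] mlinD(2)[OF bmlD(2)[OF insert.prems(4) in1(3)] in1(2) 1(2)]])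
 qed
 also have "... = sw Z (B y) v (%a a'. sw Z Y (%y. pr v (B y)) (?\<Theta> (pr a (B y)) (pr a' (B y))))"
  by (rule sw_cong[OF v(2)], rule insert.IH[OF _ _ v(1)])
   (use insert.prems(1,2) bml_upd[OF insert.prems(4) insert.hyps(2)] py in simp_all)
 also have "... = tL Z (%a b. sw Z Y (%y. pr v (B y)) (?\<Theta> a b)) (cop (pr v (B y)))"
 proof (rule sw_pr[OF Z _ f(2,3) v(2)], rule sw_bilin[OF Z])
  show "(%y. pr v (B y)) : cl Y"
  proof
   fix z assume z: "z : Y"
   show "pr v (B z) : carr A" by (rule finprod_pr(2)) (use z insert.prems(1) v(1) in auto)
  qed
 qed (rule bml_pair[OF insert.prems(4)])
 also have "... = sw Z (insert y Y) (%y. pr v (B y)) \<Psi>"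
  by (rule swl_insert[OF Z insert.hyps, symmetric])
 finally show ?case by simp
qed

text \<open>The blocks are the fibres of \<open>q\<close>. This is the step that makes \<pi>
  compatible with the second coproducts.\<close>

lemma sw_pf:
 assumes Z: "vspace Z" and X: "finite X" "v : cl X" and \<Psi>: "bml (q ` X) Z \<Psi>"
 shows "sw Z X v (%v' v''. \<Psi> (pf X q v') (pf X q v'')) = sw Z (q ` X) (pf X q v) \<Psi>"
proof -
 have U: "(UN y:q ` X. {x:X. q x = y}) = X" by auto
 have "sw Z (UN y:q ` X. {x:X. q x = y}) v (%v' v''. \<Psi> (%y. pr v' {x:X. q x = y}) (%y. pr v'' {x:X. q x = y})) =
  sw Z (q ` X) (%y. pr v {x:X. q x = y}) \<Psi>"
  by (rule sw_UN[OF Z finite_imageI[OF X(1)] _ _ _ \<Psi>]) (use X in auto)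
 then show ?thesis unfolding U pf_def[abs_def] .
qed

end

section \<open>Transport of bialgebra structures along surjections\<close>

lemma tmap_tmul:
 assumes vs: "vspace A" "vspace B" and f: "linmap A B f" and m: "bilin A A A m" and m': "bilin B B B m'"
  and fm: "!!x y. x : carr A ==> y : carr A ==> f (m x y) = m' (f x) (f y)"
  and st: "s : carr (A >< A)" "t : carr (A >< A)"
 shows "tmap B B f f (tmul A A m m s t) = tmul B B m' m' (tmap B B f f s) (tmap B B f f t)"
proof -
 let ?W = "B >< B"
 note W = vspace_tensor[of B B] and fi = linmap_in[OF f]
 have T: "bilin B B ?W (%c d. tens B B (m' a c) (m' b d))" "bilin B B ?W (%a b. tens B B (m' a c) (m' b d))"
  if "a : carr B" "b : carr B" "c : carr B" "d : carr B" for a b c d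
  using bilin_pair[OF bilin_tens[OF vs(2,2)] m' m'] that by auto
 have t': "tmap B B f f t : carr ?W" by (rule tmap_in[OF vs(1,1) st(2) vs(2,2) fi fi])
 have "tmap B B f f (tmul A A m m s t) = tL ?W (%a b. tL ?W (%c d. tens B B (f (m a c)) (f (m b d))) t) s"
  unfolding tmap_def
  by (rule tlift_tmul[OF vs(1,1,1,1,1,1) W m m _ st]) (rule bilin_comp[OF bilin_tens[OF vs(2,2)] f f])
 also have "... = tL ?W (%a b. tL ?W (%c d. tens B B (m' (f a) c) (m' (f b) d)) (tmap B B f f t)) s"
 proof (rule tlift_cong[OF vs(1,1) st(1)])
  fix a b assume ab: "a : carr A" "b : carr A"
  have "tL ?W (%c d. tens B B (m' (f a) c) (m' (f b) d)) (tmap B B f f t) =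
   tL ?W (%c d. tens B B (m' (f a) (f c)) (m' (f b) (f d))) t"
   by (rule tlift_tmap[OF vs(1,1) st(2) vs(2,2) W T(1)[OF fi[OF ab(1)] fi[OF ab(2)] vspace_zero[OF vs(2)] vspace_zero[OF vs(2)]] fi fi])
  also have "... = tL ?W (%c d. tens B B (f (m a c)) (f (m b d))) t"
   by (rule tlift_cong[OF vs(1,1) st(2)]) (simp add: fm ab)
  finally show "tL ?W (%c d. tens B B (f (m a c)) (f (m b d))) t = tL ?W (%c d. tens B B (m' (f a) c) (m' (f b) d)) (tmap B B f f t)" ..
 qed
 also have "... = tmul B B m' m' (tmap B B f f s) (tmap B B f f t)"
  unfolding tmul_def
 proof (rule tlift_tmap[OF vs(1,1) st(1) vs(2,2) W _ fi fi, symmetric])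
  show "bilin B B ?W (%a b. tL ?W (%c d. tens B B (m' a c) (m' b d)) (tmap B B f f t))"
   by (intro bilinI linmap_tlift_param[OF vs(2,2) W t']) (auto intro: bilin_left[OF T(2)] bilin_right[OF T(2)])
 qed
 finally show ?thesis .
qed

locale surj_lin =
 fixes A :: "('k::field, 'a::ab_group_add) vsp" and B :: "('k, 'b::ab_group_add) vsp" and f :: "'a => 'b"
 assumes A: "vspace A" and B: "vspace B" and f: "linmap A B f" and surj: "f ` carr A = carr B"
begin

lemma fi: "x : carr A ==> f x : carr B"
 by (rule linmap_in[OF f])

definition comm_cop where
 "comm_cop \<Delta> \<Delta>' \<longleftrightarrow> linmap A (A >< A) \<Delta> & linmap B (B >< B) \<Delta>' & (ALL x:carr A. \<Delta>' (f x) = tmap B B f f (\<Delta> x))"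

text \<open>Contractions of a coproduct at an image point are computed upstairs. As each axiom is an
  equation of contractions and each point is an image, axioms descend by pushing in, applying the
  axiom upstairs, and pushing out.\<close>

lemma cop_push:
 assumes c: "comm_cop \<Delta> \<Delta>'" and Z: "vspace Z" and be: "bilin B B Z be" and x: "x : carr A"
  and e: "!!a b. a : carr A ==> b : carr A ==> be (f a) (f b) = \<gamma> a b"
 shows "tL Z be (\<Delta>' (f x)) = tL Z \<gamma> (\<Delta> x)"
proof -
 have d: "\<Delta> x : carr (A >< A)" and e': "\<Delta>' (f x) = tmap B B f f (\<Delta> x)"
  using c x by (auto simp: comm_cop_def intro: linmap_in)
 have "tL Z be (\<Delta>' (f x)) = tL Z (%a b. be (f a) (f b)) (\<Delta> x)"
  unfolding e' by (rule tlift_tmap[OF A A d B B Z be fi fi])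
 also have "... = tL Z \<gamma> (\<Delta> x)" by (rule tlift_cong[OF A A d e])
 finally show ?thesis .
qed

lemma unit_push:
 assumes c: "comm_cop \<Delta> \<Delta>'" and e: "linmap B ground e'" "!!x. x : carr A ==> e' (f x) = e x" and x: "x : carr A"
 shows "tL B (%a b. smul B (e' a) b) (\<Delta>' (f x)) = f (tL A (%a b. smul A (e a) b) (\<Delta> x))"
  and "tL B (%a b. smul B (e' b) a) (\<Delta>' (f x)) = f (tL A (%a b. smul A (e b) a) (\<Delta> x))"
proof -
 have d: "\<Delta> x : carr (A >< A)" using c x by (auto simp: comm_cop_def intro: linmap_in)
 show "tL B (%a b. smul B (e' a) b) (\<Delta>' (f x)) = f (tL A (%a b. smul A (e a) b) (\<Delta> x))"
  by (rule trans[OF cop_push[where \<gamma> = "%a b. f (smul A (e a) b)", OF c B bilin_ground_scale(1)[OF B e(1)] x]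
     linmap_of_tlift[OF A A d f A vspace_scale[OF A], symmetric]]) (simp_all add: e(2) linmap_scale[OF f])
 show "tL B (%a b. smul B (e' b) a) (\<Delta>' (f x)) = f (tL A (%a b. smul A (e b) a) (\<Delta> x))"
  by (rule trans[OF cop_push[where \<gamma> = "%a b. f (smul A (e b) a)", OF c B bilin_ground_scale(2)[OF B e(1)] x]
     linmap_of_tlift[OF A A d f A vspace_scale[OF A], symmetric]]) (simp_all add: e(2) linmap_scale[OF f])
qed

lemma coalgebra_transport:
 assumes C: "coalgebra_on A \<Delta> e" and c: "linmap B (B >< B) \<Delta>'" "!!x. x : carr A ==> \<Delta>' (f x) = tmap B B f f (\<Delta> x)"
  and e: "linmap B ground e'" "!!x. x : carr A ==> e' (f x) = e x"
 shows "coalgebra_on B \<Delta>' e'"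
 unfolding coalgebra_on_def
proof (intro conjI ballI B c(1) e(1))
 fix y assume "y : carr B"
 then obtain x where x: "x : carr A" "y = f x" using surj by auto
 have l: "linmap A (A >< A) \<Delta>" using C by (simp add: coalgebra_on_def)
 then have cc: "comm_cop \<Delta> \<Delta>'" using c by (simp add: comm_cop_def)
 show "tL B (%a b. smul B (e' a) b) (\<Delta>' y) = y" "tL B (%a b. smul B (e' b) a) (\<Delta>' y) = y"
  using unit_push[OF cc e x(1)] C x by (simp_all add: coalgebra_on_def)
 let ?Z = "B >< B >< B" and ?T = "%a b c. tens B (B >< B) a (tens B B b c)"
 note Z = vspace_tensor[of B "B >< B"] and T = trilin_tens[OF B B B]
 have T': "trilin A A A ?Z (%a b c. ?T (f a) (f b) (f c))" by (rule trilin_comp[OF T f f f])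
 have di: "!!x. x : carr A ==> \<Delta> x : carr (A >< A)" "!!x. x : carr B ==> \<Delta>' x : carr (B >< B)"
  using l c(1) by (auto intro: linmap_in)
 have bL: "bilin B B ?Z (%a c. tL ?Z (%a b. ?T a b c) (\<Delta>' a))"
  using bilin_comp[OF linmap_tlift_trilin(1)[OF B B B Z T] c(1) linmap_id] .
 have bR: "bilin B B ?Z (%a b. tL ?Z (?T a) (\<Delta>' b))"
  using bilin_comp[OF linmap_tlift_trilin(2)[OF B B B Z T] linmap_id c(1)] .
 have "tassoc B B B (tmap (B >< B) B \<Delta>' id (\<Delta>' y)) = tL ?Z (%s c. tL ?Z (%a b. ?T a b c) (\<Delta>' s)) (\<Delta>' (f x))"
  unfolding x(2) by (rule tassoc_tmap_eq[OF B B B B di(2) di(2)[OF fi[OF x(1)]]])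
 also have "... = tL ?Z (%s c. tL ?Z (%a b. ?T (f a) (f b) (f c)) (\<Delta> s)) (\<Delta> x)"
  by (rule cop_push[OF cc Z bL x(1)], rule cop_push[OF cc Z trilinD(6)[OF T fi]]) auto
 also have "... = tL ?Z (%a s. tL ?Z (%b c. ?T (f a) (f b) (f c)) (\<Delta> s)) (\<Delta> x)"
  using tlift_tassoc[where f = \<Delta>, OF A A A Z A T' di(1) di(1)[OF x(1)]]
   tlift_tmap_id[where f = \<Delta>, OF A A A Z A T' di(1) di(1)[OF x(1)]] C x(1) by (simp add: coalgebra_on_def)
 also have "... = tL ?Z (%a s. tL ?Z (?T a) (\<Delta>' s)) (\<Delta>' (f x))"
  by (rule cop_push[OF cc Z bR x(1), symmetric], rule cop_push[OF cc Z trilinD(4)[OF T fi]]) auto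
 also have "... = tmap B (B >< B) id \<Delta>' (\<Delta>' y)"
  unfolding x(2) by (rule tmap_id_eq[OF B B B B di(2) di(2)[OF fi[OF x(1)]], symmetric])
 finally show "tassoc B B B (tmap (B >< B) B \<Delta>' id (\<Delta>' y)) = tmap B (B >< B) id \<Delta>' (\<Delta>' y)" .
qed

text \<open>Since \<open>double_morphism\<close> includes that both sides are double bialgebras,
  this yields the structure on the target together with the morphism; only linearity of the
  structure maps and their compatibility with \<open>f\<close> has to be supplied.\<close>

lemma double_transport:
 assumes D: "double_bialgebra D" "dsp D = A" "dsp E = B"
  and m: "bilin B B B (dmul E)" "!!x y. x : carr A ==> y : carr A ==> f (dmul D x y) = dmul E (f x) (f y)"
  and u: "f (dunit D) = dunit E"
  and De: "linmap B (B >< B) (dDel E)" "!!x. x : carr A ==> dDel E (f x) = tmap B B f f (dDel D x)"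
  and Ep: "linmap B ground (dEps E)" "!!x. x : carr A ==> dEps E (f x) = dEps D x"
  and de: "linmap B (B >< B) (ddel E)" "!!x. x : carr A ==> ddel E (f x) = tmap B B f f (ddel D x)"
  and ep: "linmap B ground (deps E)" "!!x. x : carr A ==> deps E (f x) = deps D x"
 shows "double_morphism D E f"
proof -
 note D' = D(1)[unfolded double_bialgebra_def Let_def D(2)]
 have uA: "dunit D : carr A" and mA: "bilin A A A (dmul D)" and cA: "coalgebra_on A (dDel D) (dEps D)" "coalgebra_on A (ddel D) (deps D)"
  and dA: "ALL x:carr A. ALL y:carr A. ALL z:carr A. dmul D (dmul D x y) z = dmul D x (dmul D y z)"
  and d1: "ALL x:carr A. dmul D (dunit D) x = x & dmul D x (dunit D) = x"
  and du: "dDel D (dunit D) = tens A A (dunit D) (dunit D)" "dEps D (dunit D) = 1" "ddel D (dunit D) = tens A A (dunit D) (dunit D)"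
  and dm: "ALL x:carr A. ALL y:carr A. dDel D (dmul D x y) = tmul A A (dmul D) (dmul D) (dDel D x) (dDel D y)"
   "ALL x:carr A. ALL y:carr A. ddel D (dmul D x y) = tmul A A (dmul D) (dmul D) (ddel D x) (ddel D y)"
   "ALL x:carr A. ALL y:carr A. dEps D (dmul D x y) = dEps D x * dEps D y"
  and dD: "ALL x:carr A. tmap (A >< A) A (dDel D) id (ddel D x) =
    m1324 A A A (dmul D) (tmap (A >< A) (A >< A) (ddel D) (ddel D) (dDel D x))"
  and dE: "ALL x:carr A. tL A (%a b. smul A (dEps D a) b) (ddel D x) = smul A (dEps D x) (dunit D)"
  by ((insert D')[1], elim conjE, assumption)+
 have l: "linmap A (A >< A) (dDel D)" "linmap A (A >< A) (ddel D)" using cA unfolding coalgebra_on_def by blast+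
 have cc: "comm_cop (dDel D) (dDel E)" "comm_cop (ddel D) (ddel E)" unfolding comm_cop_def by (intro conjI ballI l De de, assumption)+
 note tt = tmap_tens[OF A A B B f f, of "dunit D" "dunit D"] and mi = bilin_in[OF mA]
 note tm = tmap_tmul[where f = f and m = "dmul D" and m' = "dmul E", OF A B f mA m]
 have E: "double_bialgebra E"
  unfolding double_bialgebra_def Let_def D(3)
 proof (intro conjI ballI m(1))
  show "dunit E : carr B" using fi[OF uA] u by simp
  show "dDel E (dunit E) = tens B B (dunit E) (dunit E)" "ddel E (dunit E) = tens B B (dunit E) (dunit E)" "dEps E (dunit E) = 1"
   using De(2)[OF uA] de(2)[OF uA] Ep(2)[OF uA] du u tt by simp_all
  show "coalgebra_on B (dDel E) (dEps E)" by (rule coalgebra_transport[OF cA(1) De Ep])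
  show "coalgebra_on B (ddel E) (deps E)" by (rule coalgebra_transport[OF cA(2) de ep])
  fix y assume "y : carr B"
  then obtain x where x: "x : carr A" "y = f x" using surj by auto
  show "dmul E (dunit E) y = y" "dmul E y (dunit E) = y"
   using m(2)[OF uA x(1)] m(2)[OF x(1) uA] d1 x u by simp_all
  have "tL B (%a b. smul B (dEps E a) b) (ddel E (f x)) = f (smul A (dEps D x) (dunit D))"
   using unit_push(1)[OF cc(2) Ep x(1)] dE x(1) by simp
  then show "tL B (%a b. smul B (dEps E a) b) (ddel E y) = smul B (dEps E y) (dunit E)"
   using Ep(2)[OF x(1)] linmap_scale[OF f uA] u x(2) by simp
  show "tmap (B >< B) B (dDel E) id (ddel E y) =
   m1324 B B B (dmul E) (tmap (B >< B) (B >< B) (ddel E) (ddel E) (dDel E y))"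
  proof -
   let ?Z = "(B >< B) >< B" and ?T = "%a c z. tens (B >< B) B (tens B B a c) z"
   note Z = vspace_tensor[of "B >< B" B]
   note T = trilin_tens'[OF B B B]
   have T': "trilin A A A ?Z (%a b c. ?T (f a) (f b) (f c))" by (rule trilin_comp[OF T f f f])
   have di: "!!x. x : carr A ==> dDel D x : carr (A >< A)" "!!x. x : carr A ==> ddel D x : carr (A >< A)"
    "!!x. x : carr B ==> dDel E x : carr (B >< B)" "!!x. x : carr B ==> ddel E x : carr (B >< B)"
    using l De(1) de(1) by (auto intro: linmap_in)
   have bL: "bilin B B ?Z (%s z. tL ?Z (%a c. ?T a c z) (dDel E s))"
    using bilin_comp[OF linmap_tlift_trilin(1)[OF B B B Z T] De(1) linmap_id] .
   let ?M = "%s t. tL ?Z (%a b. tL ?Z (%c d. ?T a c (dmul E b d)) t) s"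
   note q1 = bilin_m1324(1)[OF B B B B Z T m(1)] and bM = bilin_m1324(2)[OF B B B B Z T m(1) di(4)]
    and bR = bilin_m1324(3)[OF B B B B Z T m(1) de(1) de(1)]
   have "tmap (B >< B) B (dDel E) id (ddel E y) = tL ?Z (%s z. tL ?Z (%a c. ?T a c z) (dDel E s)) (ddel E (f x))"
    unfolding x(2) by (rule tmap_tens_id_eq[OF B B B B di(3) di(4)[OF fi[OF x(1)]]])
   also have "... = tL ?Z (%s z. tL ?Z (%a c. ?T (f a) (f c) (f z)) (dDel D s)) (ddel D x)"
    by (rule cop_push[OF cc(2) Z bL x(1)], rule cop_push[OF cc(1) Z trilinD(6)[OF T fi]]) auto
   also have "... = tL ?Z (%x y. tL ?Z (%a b. tL ?Z (%c d. ?T (f a) (f c) (f (dmul D b d))) (ddel D y)) (ddel D x)) (dDel D x)"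
    using tlift_tmap_tens_id[where f = "dDel D", OF A A A Z A T' di(1) di(2)[OF x(1)]]
     tlift_m1324[where f = "ddel D" and g = "ddel D", OF A A A A A A A Z di(2,2) mA di(1)[OF x(1)] T'] dD x(1) by simp
   also have "... = tL ?Z (%x y. ?M (ddel E x) (ddel E y)) (dDel E (f x))"
    by (rule cop_push[OF cc(1) Z bR x(1), symmetric], rule cop_push[OF cc(2) Z bM[OF fi]], assumption+, rule cop_push[OF cc(2) Z q1[OF fi fi]])
     (auto simp: m(2))
   also have "... = m1324 B B B (dmul E) (tmap (B >< B) (B >< B) (ddel E) (ddel E) (dDel E y))"
    unfolding x(2) by (rule m1324_tmap_eq[OF B B B B B B B di(4,4) m(1) di(3)[OF fi[OF x(1)]], symmetric])
   finally show ?thesis .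
  qed
  fix y' assume "y' : carr B"
  then obtain x' where x': "x' : carr A" "y' = f x'" using surj by auto
  note mm = m(2)[OF x(1) x'(1), symmetric] and xm = mi[OF x(1) x'(1)]
  show "dEps E (dmul E y y') = dEps E y * dEps E y'"
   unfolding x(2) x'(2) mm Ep(2)[OF xm] Ep(2)[OF x(1)] Ep(2)[OF x'(1)] using dm(3) x x' by blast
  have d: "dDel D (dmul D x x') = tmul A A (dmul D) (dmul D) (dDel D x) (dDel D x')"
   "ddel D (dmul D x x') = tmul A A (dmul D) (dmul D) (ddel D x) (ddel D x')"
   using dm(1,2) x(1) x'(1) by blast+
  show "dDel E (dmul E y y') = tmul B B (dmul E) (dmul E) (dDel E y) (dDel E y')"
   unfolding x(2) x'(2) mm De(2)[OF xm] d De(2)[OF x(1)] De(2)[OF x'(1)]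
   by (rule tm[OF _ _ linmap_in[OF l(1) x(1)] linmap_in[OF l(1) x'(1)]])
  show "ddel E (dmul E y y') = tmul B B (dmul E) (dmul E) (ddel E y) (ddel E y')"
   unfolding x(2) x'(2) mm de(2)[OF xm] d de(2)[OF x(1)] de(2)[OF x'(1)]
   by (rule tm[OF _ _ linmap_in[OF l(2) x(1)] linmap_in[OF l(2) x'(1)]])
  fix y'' assume "y'' : carr B"
  then obtain x'' where x'': "x'' : carr A" "y'' = f x''" using surj by auto
  have "dmul D (dmul D x x') x'' = dmul D x (dmul D x' x'')" using dA x(1) x'(1) x''(1) by blast
  then show "dmul E (dmul E y y') y'' = dmul E y (dmul E y' y'')"
   using m(2)[OF xm x''(1)] m(2)[OF x(1) mi[OF x'(1) x''(1)]] m(2)[OF x(1) x'(1)] m(2)[OF x'(1) x''(1)] x x' x'' by simp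
 qed
 show ?thesis
  unfolding double_morphism_def D(2,3) using D(1) E f m u De Ep de ep by simp
qed

end

section \<open>The map \<open>\<pi>\<close>\<close>

locale contraction = nb V + ce P
 for V :: "('k::field, 'v::ab_group_add) nbialg" and P :: "('k, 'p::ab_group_add) ctbialg"
begin

sublocale p: fock_twisted A P
 by (intro fock_twisted.intro colour_species.intro vA tw_species twisted_bialg_axioms)

sublocale c: fock_dtwist V C
 by (intro fock_dtwist.intro nb_axioms dtwist_C fock_twisted.intro colour_species.intro vA species_C
   twisted_bialg.intro twisted_bialgebra_C)

abbreviation "pc X r v \<equiv> pf X (cls r) v"

abbreviation "pg X r v \<equiv> p.gen (quo X r) (pc X r v)"

lemma pc_in: "finite X ==> v : cl X ==> pc X r v : quo X r \<rightarrow> carr A"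
 unfolding quo_cls by (rule pf_in)

lemma scar_lookup: "r : eqvs X ==> x : scar C X ==> lk x r : Cq X r"
 using linmap_in[OF lk_lin] by (simp add: scar_C)

text \<open>The fibre over a class and the fibre over the relabelled class correspond under
  \<open>h\<close>, so the products over them agree.\<close>

lemma pc_map:
 assumes X: "finite X" "inj_on h X" "r : eqvs X" and v: "v : cl (h ` X)" and w: "!!x. x : X ==> v (h x) = w x"
  and c: "c : quo X r"
 shows "pc (h ` X) (eqv_map h r) v (cls_map h c) = pc X r w c"
proof -
 have "pc (h ` X) (eqv_map h r) v (cls_map h c) = pf X (%x. cls (eqv_map h r) (h x)) (v o h) (cls_map h c)"
  by (rule pf_image[OF X(2) v])
 also have "... = pr (v o h) {x : X. cls r x = c}"
 proof -
  have "cls (eqv_map h r) (h x) = cls_map h c \<longleftrightarrow> cls r x = c" if x: "x : X" for x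
   using cls_image[OF X(1,3,2) x] inj_on_eq_iff[OF quo_map(2)[OF X(1,3,2)], of "cls r x" c] c x by (simp add: quo_cls)
  then have "{x : X. cls (eqv_map h r) (h x) = cls_map h c} = {x : X. cls r x = c}" by auto
  then show ?thesis by (simp add: pf_def)
 qed
 also have "... = pc X r w c"
  unfolding pf_def
 proof (rule pr_cong)
  show "v o h : {x : X. cls r x = c} \<rightarrow> carr A" using v by auto
 qed (simp add: w)
 finally show ?thesis .
qed

lemma gen_map:
 assumes X: "finite X" "inj_on h X" "r : eqvs X" and v: "v : cl (h ` X)" and w: "!!x. x : X ==> v (h x) = w x"
  and p: "p : Cq X r"
 shows "pg (h ` X) (eqv_map h r) v (hq h X r p) =
  pg X r w p"
 by (rule fform_nat[OF p.fform_fgen finite_quo[OF X(1)] p quo_map(2)[OF X(1,3,2)] pc_in[OF finite_imageI[OF X(1)] v]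
    quo_map(1)[OF X(1,3,2), symmetric]])
  (rule pc_map[OF X v w])

text \<open>The values of \<pi> on generators, extended to all summands of P'[X], as the universal
  property requires a family linear in the whole element.\<close>

definition pform where
 "pform X v x = (SUM r:eqvs X. pg X r v (lk x r))"

lemma pform_sg:
 assumes "finite X" "v : cl X" "r : eqvs X"
 shows "pform X v (sg r p) = pg X r v p"
 unfolding pform_def
 by (rule sum_lookup_single[OF finite_eqvs[OF assms(1)] assms(3)],
   rule linmap_zero[OF p.fgen_linmap[OF finite_quo[OF assms(1)] pc_in[OF assms(1,2)]] qvs[OF assms(1)]])

lemma pform_lin: "finite X ==> v : cl X ==> linmap (S X) p.F (pform X v)"
 unfolding pform_def[abs_def]
 by (rule linmap_setsum[OF p.vspace_fock], rule linmap_comp[OF p.fgen_linmap lk_lin], simp, rule pc_in)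

lemma pform_fform: "fform A C p.F pform"
 unfolding fform_def
proof (intro allI impI conjI ballI)
 fix X :: "lbl set" assume X: "finite X"
 note vF = p.vspace_fock
 show "mlin A X p.F (%v. pform X v x)" if x: "x : scar C X" for x
  unfolding pform_def
  by (rule mlin_setsum[OF vF], rule mlin_pf[OF X], unfold quo_cls[symmetric],
    rule p.fgen_mlin[OF finite_quo[OF X]], rule scar_lookup[OF _ x])
 show "linmap (sp C X) p.F (pform X v)" if v: "v : cl X" for v
  using pform_lin[OF X v] by (simp only: sp_C)
 fix h :: "lbl => lbl" and v x assume x: "x : scar C X" and h: "inj_on h X" and v: "v : cl (h ` X)"
 note fX = finite_imageI[OF X, of h]
 have v': "v o h : cl X" using v by auto
 show "pform (h ` X) v (smor C X h x) = pform X (v o h) x"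
 proof (rule S_ext[OF X linmap_comp[OF pform_lin[OF fX v] smor_C_lin[OF X h]] pform_lin[OF X v'] _ x[unfolded scar_C]])
  fix r p assume r: "r : eqvs X" and p: "p : Cq X r"
  show "pform (h ` X) v (smor C X h (sg r p)) = pform X (v o h) (sg r p)"
   unfolding smor_C_sg[OF X h r p] pform_sg[OF fX v eqv_map_in[OF r h]] pform_sg[OF X v' r]
   by (rule gen_map[OF X h r v _ p]) simp
 qed
qed

text \<open>The definition of \<pi> multiplies the letters of a class in increasing order, whereas
  \<open>pr\<close> has no order; commutativity and the absence of empty classes reconcile
  them.\<close>

lemma wprod_subword:
 assumes vs: "set vs <= carr A" and X: "X = nset (length vs)" and r: "r : eqvs X" and h: "bij_betw h (quo X r) {1..k}" and j: "j : {1..k}"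
 shows "wprod (nmul V) (subword vs {i:{1..length vs}. h (cls r (At i)) = j}) = pc X r (lab vs) (inv_into (quo X r) h j)"
proof -
 let ?I = "{i:{1..length vs}. h (cls r (At i)) = j}" and ?c = "inv_into (quo X r) h j"
 have c: "?c : quo X r" "h ?c = j"
  using h j by (auto simp: bij_betw_def inv_into_into f_inv_into_f)
 have i: "h (cls r x) = j \<longleftrightarrow> cls r x = ?c" if "x : X" for x
  using inj_on_eq_iff[OF bij_betw_imp_inj_on[OF h], of "cls r x" ?c] c that by (auto simp: quo_cls)
 have "{x:X. cls r x = ?c} = {x:X. h (cls r x) = j}" using i by auto
 also have "... = At ` ?I" unfolding X nset_def by (auto simp del: One_nat_def)
 finally have I: "At ` ?I = {x:X. cls r x = ?c}" ..
 obtain x where "x : X" "cls r x = ?c" using c(1) by (auto simp: quo_cls)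
 then have ne: "?I ~= {}" using I by blast
 let ?xs = "map At (sorted_list_of_set ?I)"
 have "wprod (nmul V) (map (lab vs) ?xs) = pr (lab vs) (set ?xs)"
 proof (rule wprod_pr)
  show "?xs ~= []" using ne by simp
  show "distinct ?xs" by (simp add: distinct_map inj_on_def)
  show "lab vs : set ?xs \<rightarrow> carr A" using lab_in[OF vs refl] by (auto simp: nset_def)
 qed
 then show ?thesis using I by (simp add: subword_def pf_def comp_def)
qed

abbreviation "\<pi> \<equiv> fock_pi V P"

text \<open>\<open>fock_pi\<close> is a choice prescribed for every enumeration of the classes. The
  lift of \<open>pform\<close> meets all these conditions because the generator on
  \<open>quo X r\<close> does not depend on the enumeration.\<close>

lemma pi_lin: "linmap c.F p.F \<pi>"
 and pi_gen: "finite X ==> v : cl X ==> r : eqvs X ==> p : Cq X r ==>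
  \<pi> (c.gen X v (sg r p)) = pg X r v p"
proof -
 obtain f where f: "linmap c.F p.F f" and fg: "!!X v x. finite X ==> v : cl X ==> x : scar C X ==> f (c.gen X v x) = pform X v x"
  by (rule c.fock_lift[OF p.vspace_fock pform_fform]) auto
 let ?rhs = "%vs r p k h. fock_bar A P
     (map (%j. wprod (nmul V) (subword vs {i:{1..length vs}. h (cls r (At i)) = j})) [1..<Suc k])
     (smor P (quo (nset (length vs)) r) (%c. At (h c)) p)"
 let ?P = "%f. linmap c.F p.F f & (\<forall>vs r p k h. let X = nset (length vs) in
    set vs <= carr A --> r : eqvs X --> p : Cq X r --> bij_betw h (quo X r) {1..k} \<longrightarrow>
    f (fock_bar A C vs (sg r p)) = fock_bar A P
     (map (%j. wprod (nmul V) (subword vs {i:{1..length vs}. h (cls r (At i)) = j})) [1..<Suc k])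
     (smor P (quo X r) (%c. At (h c)) p))"
 have f_bar: "f (fock_bar A C vs (sg r p)) = ?rhs vs r p k h"
  if vs: "set vs <= carr A" and r: "r : eqvs (nset (length vs))" and p: "p : Cq (nset (length vs)) r"
   and h: "bij_betw h (quo (nset (length vs)) r) {1..k}" for vs r p k h
 proof -
  let ?X = "nset (length vs)"
  note l = lab_in[OF vs refl] and sgi = sg_in[OF finite_nset r p, folded scar_C]
  have "f (fock_bar A C vs (sg r p)) = pg ?X r (lab vs) p"
   using fg[OF finite_nset l sgi] by (simp add: c.fgen_nset[OF vs refl sgi] pform_sg[OF finite_nset l r])
  also have "... = fock_bar A P (map (pc ?X r (lab vs) o inv_into (quo ?X r) h) [1..<Suc k]) (smor P (quo ?X r) (At o h) p)"
   by (rule p.fgen_eq[OF finite_quo[OF finite_nset] h pc_in[OF finite_nset l] p])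
  also have "map (pc ?X r (lab vs) o inv_into (quo ?X r) h) [1..<Suc k] =
   map (%j. wprod (nmul V) (subword vs {i:{1..length vs}. h (cls r (At i)) = j})) [1..<Suc k]"
   by (rule map_cong[OF refl], unfold comp_def, rule wprod_subword[OF vs refl r h, symmetric])
    (simp add: less_Suc_eq_le del: upt_Suc)
  finally show ?thesis by (simp only: comp_def)
 qed
 have "?P f" unfolding Let_def using f f_bar by blast
 then have P: "?P \<pi>" unfolding fock_pi_def by (rule someI[where P = ?P])
 then show L: "linmap c.F p.F \<pi>" by (rule conjunct1)
 have pi_bar: "\<pi> (fock_bar A C vs (sg r p)) = ?rhs vs r p k h"
  if "set vs <= carr A" "r : eqvs (nset (length vs))" "p : Cq (nset (length vs)) r"
   "bij_betw h (quo (nset (length vs)) r) {1..k}" for vs r p k h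
  using P[THEN conjunct2, unfolded Let_def] that by blast
 \<comment> \<open>The prescription concerns words with an element of one summand; these span, so
   the choice coincides with the lift.\<close>
 have agree: "\<pi> x = f x" if "x : carr c.F" for x
 proof (rule c.fock_ext_word[OF L f _ that])
  fix vs x assume vs: "set vs <= carr A" and x: "x : scar C (nset (length vs))"
  note b = c.fock_bar_lin[OF vs refl, unfolded sp_C]
  show "\<pi> (fock_bar A C vs x) = f (fock_bar A C vs x)"
  proof (rule S_ext[OF finite_nset linmap_comp[OF L b] linmap_comp[OF f b] _ x[unfolded scar_C]])
   fix r p assume r: "r : eqvs (nset (length vs))" "p : Cq (nset (length vs)) r"
   obtain e k where "bij_betw e (quo (nset (length vs)) r) {1..k::nat}"
    by (rule p.obtain_enum[OF finite_quo[OF finite_nset]])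
   then show "\<pi> (fock_bar A C vs (sg r p)) = f (fock_bar A C vs (sg r p))"
    using pi_bar[OF vs r] f_bar[OF vs r] by simp
  qed
 qed
 assume X: "finite X" "v : cl X" "r : eqvs X" "p : Cq X r"
 note sgi = sg_in[OF X(1,3,4), folded scar_C]
 show "\<pi> (c.gen X v (sg r p)) = pg X r v p"
  unfolding agree[OF c.fgen_in[OF X(1,2) sgi]] fg[OF X(1,2) sgi] by (rule pform_sg[OF X(1-3)])
qed

lemma gen_C_lin: "finite X ==> v : cl X ==> linmap (S X) c.F (c.gen X v)"
 using c.fgen_linmap[of X v] by (simp only: sp_C)

lemma fock_C_ext:
 assumes f: "linmap c.F Z f" and g: "linmap c.F Z g"
  and eq: "!!X v r p. finite X ==> v : cl X ==> r : eqvs X ==> p : Cq X r ==>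
   f (c.gen X v (sg r p)) = g (c.gen X v (sg r p))"
  and x: "x : carr c.F"
 shows "f x = g x"
proof (rule c.fock_ext[OF f g _ x])
 fix X v x assume X: "finite X" "v : cl X" and x: "x : scar C X"
 note l = gen_C_lin[OF X]
 show "f (c.gen X v x) = g (c.gen X v x)"
  by (rule S_ext[OF X(1) linmap_comp[OF f l] linmap_comp[OF g l] eq[OF X] x[unfolded scar_C]])
qed

lemma sg_C: "finite X ==> r : eqvs X ==> p : Cq X r ==> sg r p : scar C X"
 unfolding scar_C by (rule sg_in)

lemma pi_surj: "\<pi> ` carr c.F = carr p.F"
proof -
 note vF = p.vspace_fock
 interpret f: vector_space "smul p.F" by (rule vspace_vector_space[OF vF])
 let ?R = "\<pi> ` carr c.F"
 have R: "f.subspace ?R"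
  unfolding f.subspace_def
  using linmap_zero[OF pi_lin c.vspace_fock] linmap_add[OF pi_lin, symmetric] linmap_scale[OF pi_lin, symmetric]
   vspace_zero[OF c.vspace_fock] vspace_add[OF c.vspace_fock] vspace_scale[OF c.vspace_fock]
  by (auto intro: image_eqI[of 0] image_eqI)
 note vs = vspace_vector_space[OF vF]
 have sub: "?R <= carr p.F" using linmap_in[OF pi_lin] by auto
 have "y : ?R" if y: "y : carr p.F" for y
 proof -
  \<comment> \<open>Instead of decomposing \<open>y\<close>, the projection with kernel the image of
    \<pi> is shown to vanish on generators, hence on every element.\<close>
  have "qproj (smul p.F) ?R y = 0"
  proof (rule p.fock_ext[OF linmap_qproj[OF vF R] linmap_0 _ y])
   show "vspace (vquot p.F ?R)" by (rule vspace_vquot[OF vF R])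
   fix X v p assume X: "finite X" "v : cl X" and p: "p : scar P X"
   \<comment> \<open>For the equality relation the quotient is \<open>X\<close> with its labels
     replaced by singletons, and the products over classes are the original colours; so each
     generator is an image.\<close>
   let ?r = "Id_on X" and ?h = "cls (Id_on X)"
   have r: "?r : eqvs X" by (rule eqvsI) auto
   have h: "inj_on ?h X" by (rule inj_onI) (use cls_eq[OF X(1) r] in auto)
   have q: "smor P X ?h p : Cq X ?r" unfolding quo_cls by (rule smor_in[OF tw_species X(1) h p])
   have "p.gen X v p = pg X ?r v (smor P X ?h p)"
    by (rule fform_nat[OF p.fform_fgen X(1) p h pc_in[OF X] quo_cls, symmetric]) (rule pf_inj[OF X(2) h])
   also have "... = \<pi> (c.gen X v (sg ?r (smor P X ?h p)))" by (rule pi_gen[OF X r q, symmetric])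
   finally have "p.gen X v p : ?R" using c.fgen_in[OF X sg_C[OF X(1) r q]] by simp
   then show "qproj (smul p.F) ?R (p.gen X v p) = 0" by (simp add: qproj_eq_0_iff[OF vs R])
  qed
  then show ?thesis by (simp add: qproj_eq_0_iff[OF vs R])
 qed
 then show ?thesis using sub by auto
qed

sublocale surj_lin c.F p.F \<pi>
 by unfold_locales (rule c.vspace_fock p.vspace_fock pi_lin pi_surj)+

section \<open>Compatibility of \<pi> with products, first coproducts and first counits\<close>

lemma pc_Un:
 assumes "finite X" "finite Y" "X Int Y = {}" "r : eqvs X" "s : eqvs Y"
 shows "c : quo X r ==> pc (X Un Y) (r Un s) v c = pc X r v c" "c : quo Y s ==> pc (X Un Y) (r Un s) v c = pc Y s v c"
proof -
 note d = quo_disj[OF assms(1,2,4,5,3)] and cl = cls_Un[OF assms(4,5,3)]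
 have "{x : X Un Y. cls (r Un s) x = c} = {x : X. cls r x = c}" if "c : quo X r"
  using d that cl by (auto simp: quo_cls)
 then show "c : quo X r ==> pc (X Un Y) (r Un s) v c = pc X r v c" by (simp add: pf_def)
 have "{x : X Un Y. cls (r Un s) x = c} = {x : Y. cls s x = c}" if "c : quo Y s"
  using d that cl by (auto simp: quo_cls)
 then show "c : quo Y s ==> pc (X Un Y) (r Un s) v c = pc Y s v c" by (simp add: pf_def)
qed

lemma gen_Un:
 assumes X: "finite X" "finite Y" "X Int Y = {}" "r : eqvs X" "s : eqvs Y" and v: "v : cl (X Un Y)"
 shows "p : Cq X r ==> pg X r v p = p.gen (quo X r) (pc (X Un Y) (r Un s) v) p"
  "p : Cq Y s ==> pg Y s v p = p.gen (quo Y s) (pc (X Un Y) (r Un s) v) p"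
proof -
 have v': "v : cl X" "v : cl Y" using v by auto
 show "p : Cq X r ==> pg X r v p = p.gen (quo X r) (pc (X Un Y) (r Un s) v) p"
  by (rule p.fgen_cong[OF finite_quo[OF X(1)] pc_in[OF X(1) v'(1)]]) (simp_all add: pc_Un[OF X])
 show "p : Cq Y s ==> pg Y s v p = p.gen (quo Y s) (pc (X Un Y) (r Un s) v) p"
  by (rule p.fgen_cong[OF finite_quo[OF X(2)] pc_in[OF X(2) v'(2)]]) (simp_all add: pc_Un[OF X])
qed

lemma pi_mul:
 assumes xy: "x : carr c.F" "y : carr c.F"
 shows "\<pi> (c.mu x y) = p.mu (\<pi> x) (\<pi> y)"
proof -
 note b1 = linmap_bilin[OF pi_lin c.mul_bilin] and b2 = bilin_comp[OF p.mul_bilin pi_lin pi_lin]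
 show ?thesis
 proof (rule c.fock_ext2[OF b1 b2 _ xy])
  fix X Y v and x y :: "(lbl \<times> lbl) set \<Rightarrow>\<^sub>0 'p"
  assume X: "finite X" "finite Y" "X Int Y = {}" and v: "v : cl (X Un Y)" and xy: "x : scar C X" "y : scar C Y"
  have v': "v : cl X" "v : cl Y" using v by auto
  note l = gen_C_lin[OF X(1) v'(1)] gen_C_lin[OF X(2) v'(2)]
  show "\<pi> (c.mu (c.gen X v x) (c.gen Y v y)) = p.mu (\<pi> (c.gen X v x)) (\<pi> (c.gen Y v y))"
  proof (rule S_ext2[OF X(1,2) bilin_comp[OF b1 l] bilin_comp[OF b2 l] _ xy[unfolded scar_C]])
   fix r p s q assume r: "r : eqvs X" and p: "p : Cq X r" and s: "s : eqvs Y" and q: "q : Cq Y s"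
   note fXY = finite_UnI[OF X(1,2)] and qU = quo_Un[OF r s X(3)]
   have "\<pi> (c.mu (c.gen X v (sg r p)) (c.gen Y v (sg s q))) = \<pi> (c.gen (X Un Y) v (sg (r Un s) (Mq X r Y s p q)))"
    unfolding c.mul_gen[OF X v sg_C[OF X(1) r p] sg_C[OF X(2) s q]] tmlt_C_sg[OF X r p s q] ..
   also have "... = pg (X Un Y) (r Un s) v (Mq X r Y s p q)"
    by (rule pi_gen[OF fXY v eqvs_Un[OF r s X(3)] m_quo_in[OF X r p s q]])
   also have "... = p.mu (p.gen (quo X r) (pc (X Un Y) (r Un s) v) p) (p.gen (quo Y s) (pc (X Un Y) (r Un s) v) q)"
    unfolding qU
    by (rule p.mul_gen[OF finite_quo[OF X(1)] finite_quo[OF X(2)] quo_disj[OF X(1,2) r s X(3)] _ p q, symmetric])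
     (rule pc_in[OF fXY v, of "r Un s", unfolded qU])
   also have "... = p.mu (\<pi> (c.gen X v (sg r p))) (\<pi> (c.gen Y v (sg s q)))"
    unfolding pi_gen[OF X(1) v'(1) r p] pi_gen[OF X(2) v'(2) s q] gen_Un(1)[OF X r s v p] gen_Un(2)[OF X r s v q] ..
   finally show "\<pi> (c.mu (c.gen X v (sg r p)) (c.gen Y v (sg s q))) = p.mu (\<pi> (c.gen X v (sg r p))) (\<pi> (c.gen Y v (sg s q)))" .
  qed
 qed
qed

lemma pi_one: "\<pi> (fock_one A C) = fock_one A P"
proof -
 have "fock_one A C = c.gen {} v (sg {} (tone P))" for v
  using c.one_gen by (simp add: com_species_def)
 then show ?thesis
  using pi_gen[of "{}" undefined "{}" "tone P"] one_in by (simp add: eqvs_empty p.one_gen[symmetric])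
qed

text \<open>An equivalence splits along \<open>B\<close> and its complement exactly when
  \<open>B\<close> is a union of classes, and these correspond to the subsets of the
  quotient.\<close>

lemma splits_sum:
 assumes X: "finite X" "r : eqvs X" and f: "!!B. B : Pow X ==> \<not> splits B (X - B) r ==> f B = 0"
  and g: "!!B. B : Pow X ==> splits B (X - B) r ==> f B = g (cls r ` B)"
 shows "(SUM B:Pow X. f B) = (SUM D:Pow (quo X r). g D)"
proof -
 let ?U = "{B:Pow X. splits B (X - B) r}"
 have spl: "splits B (X - B) r \<longleftrightarrow> (ALL x:B. ALL y:X - B. cls r x ~= cls r y)" if B: "B : Pow X" for B
 proof -
  have "splits B (X - B) r \<longleftrightarrow> (ALL x:B. ALL y:X - B. (x, y) ~: r)"
   by (rule splits_disj) (use B X(2) in \<open>auto simp: Un_absorb1\<close>)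
  also have "... \<longleftrightarrow> (ALL x:B. ALL y:X - B. cls r x ~= cls r y)"
   using cls_eq[OF X] B by blast
  finally show ?thesis .
 qed
 have "(SUM B:Pow X. f B) = (SUM B:?U. f B)"
  by (rule sum.mono_neutral_right) (use X f in auto)
 also have "... = (SUM D:Pow (quo X r). g D)"
 proof (rule sum.reindex_bij_witness[of _ "%D. {x:X. cls r x : D}" "%B. cls r ` B"])
  fix B assume B: "B : ?U"
  have "x : B" if x: "x : X" "cls r x : cls r ` B" for x
  proof (rule ccontr)
   assume "x ~: B"
   then have xB: "x : X - B" using x(1) by simp
   obtain y where y: "cls r x = cls r y" "y : B" using x(2) by (rule imageE)
   have "ALL x:B. ALL y:X - B. cls r x ~= cls r y" using B spl[of B] by simp
   from bspec[OF bspec[OF this y(2)] xB] y(1) show False by simp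
  qed
  then show "{x:X. cls r x : cls r ` B} = B" using B by auto
  show "cls r ` B : Pow (quo X r)" using B by (auto simp: quo_cls)
  show "g (cls r ` B) = f B" using B g by simp
 next
  fix D assume D: "D : Pow (quo X r)"
  show "cls r ` {x:X. cls r x : D} = D" using D by (auto simp: quo_cls)
  show "{x:X. cls r x : D} : ?U" using spl[of "{x:X. cls r x : D}"] by auto
 qed
 finally show ?thesis .
qed

text \<open>The coproduct of P' runs over subsets of \<open>X\<close>, that of \<open>P\<close> over
  subsets of X/~; \<open>splits_sum\<close> matches them, and on each part the products over classes
  only involve colours of that part.\<close>

lemma pi_Delta:
 assumes x: "x : carr c.F"
 shows "p.Dl (\<pi> x) = tmap p.F p.F \<pi> \<pi> (c.Dl x)"
proof -
 let ?W = "p.F >< p.F" and ?t = "tens p.F p.F"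
 note W = vspace_tensor[of p.F p.F] and vC = c.vspace_fock and vP = p.vspace_fock
 have b: "bilin c.F c.F ?W (%a b. ?t (\<pi> a) (\<pi> b))" by (rule bilin_comp[OF p.tens_bilin pi_lin pi_lin])
 show ?thesis
 proof (rule fock_C_ext[OF linmap_comp[OF p.fock_Delta_spec pi_lin] linmap_comp[OF linmap_tmap[OF vC vC vP vP pi_lin pi_lin] c.fock_Delta_spec] _ x])
  fix X v r p assume X: "finite X" "v : cl X" "r : eqvs X" and p: "p : Cq X r"
  let ?w = "pc X r v"
  let ?f = "%B a b. ?t (\<pi> (c.gen B v a)) (\<pi> (c.gen (X - B) v b))"
  let ?g = "%D. tL ?W (%a b. ?t (p.gen D ?w a) (p.gen (quo X r - D) ?w b)) (tcop P D (quo X r - D) p)"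
  have "tmap p.F p.F \<pi> \<pi> (c.Dl (c.gen X v (sg r p))) =
   (SUM B:Pow X. tL ?W (?f B) (tcop C B (X - B) (sg r p)))"
   unfolding tmap_def by (rule c.Delta_int[OF W b X(1,2) sg_C[OF X(1,3) p]])
  also have "... = (SUM D:Pow (quo X r). ?g D)"
  proof (rule splits_sum[OF X(1,3)])
   fix B assume B: "B : Pow X"
   note sp = c.Pow_split[OF X(1) B]
   have rU: "r : eqvs (B Un (X - B))" using X(3) by (simp only: sp(4))
   show "tL ?W (?f B) (tcop C B (X - B) (sg r p)) = 0"
    if "\<not> splits B (X - B) r"
    by (rule tlift_tcop_C_0[OF sp(1-3) that rU])
   assume "splits B (X - B) r"
   then obtain s t where st: "s : eqvs B" "t : eqvs (X - B)" "r = s Un t" by (rule splitsE[OF _ rU])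
   have vB: "v : cl B" "v : cl (X - B)" "v : cl (B Un (X - B))" using X(2) B by auto
   have q: "quo B s = cls r ` B" "quo (X - B) t = quo X r - cls r ` B"
   proof -
    note c = cls_Un[OF st(1,2) sp(3), folded st(3)]
    show 1: "quo B s = cls r ` B" unfolding quo_cls by (rule image_cong[OF refl c(1)[symmetric]])
    have "quo X r = quo B s Un quo (X - B) t" using quo_Un[OF st(1,2) sp(3)] by (simp only: sp(4) st(3))
    then show "quo (X - B) t = quo X r - cls r ` B"
     using quo_disj[OF sp(1,2) st(1,2) sp(3)] 1 by auto
   qed
   have p': "p : Cq (B Un (X - B)) (s Un t)" using p by (simp only: sp(4) st(3))
   have bb: "bilin (S B) (S (X - B)) ?W (?f B)"
    by (rule bilin_comp[OF b gen_C_lin[OF sp(1) vB(1)] gen_C_lin[OF sp(2) vB(2)]])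
   have "tL ?W (?f B) (tcop C B (X - B) (sg r p)) =
    tL ?W (%a b. ?t (\<pi> (c.gen B v (sg s a))) (\<pi> (c.gen (X - B) v (sg t b)))) (Dq B s (X - B) t p)"
    unfolding st(3) by (rule tlift_tcop_C[OF sp(1-3) st(1,2) p' W bb])
   also have "... = tL ?W (%a b. ?t (p.gen (quo B s) ?w a) (p.gen (quo (X - B) t) ?w b)) (Dq B s (X - B) t p)"
   proof (rule tlift_cong[OF qvs[OF sp(1)] qvs[OF sp(2)] D_quo_in[OF sp(1-3) st(1,2) p']])
    fix a b assume "a : carr (Sq B s)" "b : carr (Sq (X - B) t)"
    then have ab: "a : Cq B s" "b : Cq (X - B) t" by auto
    have "\<pi> (c.gen B v (sg s a)) = p.gen (quo B s) ?w a"
     unfolding pi_gen[OF sp(1) vB(1) st(1) ab(1)] gen_Un(1)[OF sp(1-3) st(1,2) vB(3) ab(1)] by (simp only: sp(4) st(3))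
    moreover have "\<pi> (c.gen (X - B) v (sg t b)) = p.gen (quo (X - B) t) ?w b"
     unfolding pi_gen[OF sp(2) vB(2) st(2) ab(2)] gen_Un(2)[OF sp(1-3) st(1,2) vB(3) ab(2)] by (simp only: sp(4) st(3))
    ultimately show "?t (\<pi> (c.gen B v (sg s a))) (\<pi> (c.gen (X - B) v (sg t b))) = ?t (p.gen (quo B s) ?w a) (p.gen (quo (X - B) t) ?w b)"
     by simp
   qed
   also have "... = ?g (cls r ` B)" unfolding q ..
   finally show "tL ?W (?f B) (tcop C B (X - B) (sg r p)) = ?g (cls r ` B)" .
  qed
  also have "... = p.Dl (\<pi> (c.gen X v (sg r p)))"
   unfolding pi_gen[OF X p] p.Delta_gen[OF finite_quo[OF X(1)] pc_in[OF X(1,2)] p] p.Dform_def ..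
  finally show "p.Dl (\<pi> (c.gen X v (sg r p))) = tmap p.F p.F \<pi> \<pi> (c.Dl (c.gen X v (sg r p)))" ..
 qed
qed

lemma pi_Eps:
 assumes x: "x : carr c.F"
 shows "p.Ep (\<pi> x) = c.Ep x"
proof (rule fock_C_ext[OF linmap_comp[OF p.fock_Eps_spec pi_lin] c.fock_Eps_spec _ x])
 fix X v r p assume X: "finite X" "v : cl X" "r : eqvs X" and p: "p : Cq X r"
 have "r = {}" if "X = {}" using X(3) that eqvs_empty by simp
 moreover have "quo X r = {} \<longleftrightarrow> X = {}" by (simp add: quo_cls)
 ultimately show "p.Ep (\<pi> (c.gen X v (sg r p))) = c.Ep (c.gen X v (sg r p))"
  unfolding pi_gen[OF X p] p.Eps_gen[OF finite_quo[OF X(1)] pc_in[OF X(1,2)] p] c.Eps_gen[OF X(1,2) sg_C[OF X(1,3) p]]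
  by (auto simp: com_species_def)
qed

end

section \<open>The coproduct \<open>\<delta>\<close> on the Fock space of \<open>P\<close>\<close>

context contraction
begin

lemma mlin_pc_gen: "finite X ==> a : Cq X r ==> mlin A X p.F (%v. pg X r v a)"
 by (rule mlin_pf, assumption, unfold quo_cls[symmetric], rule p.fgen_mlin) auto

text \<open>The integrand of the formula for \<delta>, kept apart from the Sweedler sum because
  \<open>sw_pf\<close> compares sums over letters and over products of letters with one and the same
  integrand.\<close>

definition dint where
 "dint Z be X p v' v'' = (SUM r:eqvs X. tL Z (%a b. be (pg X r v' a) (p.gen X v'' b)) (cdel P X r p))"

lemma dint_bml:
 assumes X: "finite X" "p : scar P X" and Z: "vspace Z" and be: "bilin p.F p.F Z be"
 shows "bml X Z (dint Z be X p)"
 unfolding bml_def dint_def[abs_def]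
proof (intro allI impI conjI mlin_setsum[OF Z] mlin_tlift[OF qvs[OF X(1)] tw_vs[OF X(1)] Z cd_in[OF X(1) _ X(2)]])
 fix w r a b assume w: "w : cl X" and ab: "a : carr (Sq X r)" "b : carr (sp P X)"
 show "mlin A X Z (%v. be (pg X r v a) (p.gen X w b))"
  by (rule linmap_mlin[OF bilin_left[OF be] mlin_pc_gen]) (use X ab w p.fgen_in in auto)
 show "mlin A X Z (%v. be (pg X r w a) (p.gen X v b))"
  by (rule linmap_mlin[OF bilin_right[OF be] p.fgen_mlin[OF X(1)]]) (use p.fgen_in[OF finite_quo[OF X(1)] pc_in[OF X(1) w]] ab in auto)
qed

abbreviation "W \<equiv> p.F >< p.F"

definition dP where
 "dP X v p = sw W X v (dint W (tens p.F p.F) X p)"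

lemma dP_fform: "fform A P W dP"
 unfolding fform_def
proof (intro allI impI conjI ballI)
 fix X :: "lbl set" assume X: "finite X"
 note W = vspace_tensor[of p.F p.F] and b = p.tens_bilin
 show "mlin A X W (%v. dP X v p)" if p: "p : scar P X" for p
  unfolding dP_def by (rule sw_mlin[OF W X dint_bml[OF X p W b]])
 show "linmap (sp P X) W (dP X v)" if v: "v : cl X" for v
  unfolding dP_def[abs_def] dint_def
  by (rule sw_lin[OF W v], rule linmap_setsum[OF W], rule linmap_tlift_arg[OF qvs[OF X] tw_vs[OF X] W _ cd_lin[OF X]])
   (rule p.fgen_bilin2[OF finite_quo[OF X] X pc_in[OF X] _ b], assumption+)
 fix h :: "lbl => lbl" and v p assume p: "p : scar P X" and h: "inj_on h X" and v: "v : cl (h ` X)"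
 note fX = finite_imageI[OF X, of h]
 show "dP (h ` X) v (smor P X h p) = dP X (v o h) p"
  unfolding dP_def
 proof (rule sw_reindex[OF W X h v])
  fix v' v'' w' w'' :: "lbl => 'v"
  assume w: "w' : cl X" "w'' : cl X" and e: "!!x. x : X ==> v' (h x) = w' x" "!!x. x : X ==> v'' (h x) = w'' x"
  have v: "v' : cl (h ` X)" "v'' : cl (h ` X)" using w e by auto
  let ?t = "tens p.F p.F"
  let ?G = "%r. tL W (%a b. ?t (pg (h ` X) r v' a) (p.gen (h ` X) v'' b)) (cdel P (h ` X) r (smor P X h p))"
  have "dint W ?t (h ` X) (smor P X h p) v' v'' = (SUM r:eqvs X. ?G (eqv_map h r))"
   unfolding dint_def by (rule sum.reindex_bij_betw[OF bij_eqv_map[OF h], symmetric])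
  also have "... = dint W ?t X p w' w''"
   unfolding dint_def
  proof (rule sum.cong[OF refl])
   fix r assume r: "r : eqvs X"
   have "?G (eqv_map h r) = tL W (%a b. ?t (pg (h ` X) (eqv_map h r) v' (hq h X r a))
     (p.gen (h ` X) v'' (smor P X h b))) (cdel P X r p)"
    unfolding cd_nat[OF X h r p]
    by (rule tlift_tmap[OF qvs[OF X] tw_vs[OF X] cd_in[OF X r p] qvs[OF fX] tw_vs[OF fX] W
       p.fgen_bilin2[OF finite_quo[OF fX] fX pc_in[OF fX v(1)] v(2) b]])
     (use quo_map_in[OF X h r] smor_in[OF tw_species X h] in auto)
   also have "... = tL W (%a b. ?t (pg X r w' a) (p.gen X w'' b)) (cdel P X r p)"
    by (rule tlift_cong[OF qvs[OF X] tw_vs[OF X] cd_in[OF X r p]])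
     (simp add: gen_map[OF X h r v(1) e(1)] fform_nat[OF p.fform_fgen X _ h v(2) refl e(2)])
   finally show "?G (eqv_map h r) = tL W (%a b. ?t (pg X r w' a) (p.gen X w'' b)) (cdel P X r p)" .
  qed
  finally show "dint W ?t (h ` X) (smor P X h p) v' v'' = dint W ?t X p w' w''" .
 qed
qed

text \<open>Multiplying over the classes of \<open>r\<close> and then over classes of classes is
  multiplying over the classes of \<open>t\<close>, so generators are compatible with the
  flattening.\<close>

lemma gen_flat:
 assumes X: "finite X" "r : eqvs X" "t : E X r" and v: "v : cl X"
  and a: "a : scar P (qqo X r t)"
 shows "pg X t v (flt X r t a) =
  p.gen (qqo X r t) (pc (quo X r) (eqv_quo r t) (pc X r v)) a"
proof -
 let ?s = "eqv_quo r t"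
 note t = ED[OF X(3)] and fb = cls_flat_bij[OF X(1,2) t]
 show ?thesis
 proof (rule fform_nat[OF p.fform_fgen finite_quo[OF finite_quo[OF X(1)]] a fb(2) pc_in[OF X(1) v] fb(1)[symmetric]])
  fix c assume "c : quo (quo X r) ?s"
  then obtain x where x: "x : X" "c = cls ?s (cls r x)" by (auto simp: quo_quo)
  have eq: "cls t y = cls_flat c \<longleftrightarrow> cls ?s (cls r y) = c" if y: "y : X" for y
   using cls_flat[OF X(1,2) t y] inj_on_eq_iff[OF fb(2), of "cls ?s (cls r y)" c] x y by (auto simp: quo_quo)
  have "pc (quo X r) ?s (pc X r v) c = pf X (%x. cls ?s (cls r x)) v c"
   unfolding quo_cls by (rule pf_pf[where q = "cls r" and q' = "cls ?s", OF X(1) v x])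
  also have "... = pc X t v (cls_flat c)"
  proof -
   have "{y : X. cls ?s (cls r y) = c} = {y : X. cls t y = cls_flat c}" using eq by auto
   then show ?thesis by (simp add: pf_def)
  qed
  finally show "pc X t v (cls_flat c) = pc (quo X r) ?s (pc X r v) c" ..
 qed
qed

text \<open>On the summand of \<open>r\<close>, \<delta>' sums over the equivalences coarser than
  \<open>r\<close>. These are all the equivalences of X/r, so \<pi> turns the sum into the integrand
  of \<delta> on that quotient.\<close>

lemma dint_flat:
 assumes X: "finite X" "r : eqvs X" and p: "p : Cq X r" and v: "v' : cl X" "v'' : cl X"
  and Z: "vspace Z" and be: "bilin p.F p.F Z be"
 shows "tL Z (%a b. be (\<pi> (c.gen X v' a)) (\<pi> (c.gen X v'' b))) (tdel C X (sg r p)) =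
  dint Z be (quo X r) p (pc X r v') (pc X r v'')"
proof -
 have b: "bilin (S X) (S X) Z (%a b. be (\<pi> (c.gen X v' a)) (\<pi> (c.gen X v'' b)))"
  by (rule bilin_comp[OF be linmap_comp[OF pi_lin gen_C_lin[OF X(1) v(1)]] linmap_comp[OF pi_lin gen_C_lin[OF X(1) v(2)]]])
 let ?G = "%s. tL Z (%a b. be (pg (quo X r) s (pc X r v') a) (pg X r v'' b)) (cdel P (quo X r) s p)"
 have "tL Z (%a b. be (\<pi> (c.gen X v' a)) (\<pi> (c.gen X v'' b))) (tdel C X (sg r p)) =
  (SUM t:E X r. tL Z (%a b. be (\<pi> (c.gen X v' (sg t a))) (\<pi> (c.gen X v'' (sg r b)))) (dq X r t p))"
  by (rule tlift_tdel_C[OF X p Z b])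
 also have "... = (SUM t:E X r. ?G (eqv_quo r t))"
 proof (rule sum.cong[OF refl])
  fix t assume t: "t : E X r"
  note tX = ED(1)[OF t] and q = qvs[OF X(1)]
  have "tL Z (%a b. be (\<pi> (c.gen X v' (sg t a))) (\<pi> (c.gen X v'' (sg r b)))) (dq X r t p) =
   tL Z (%a b. be (\<pi> (c.gen X v' (sg t (flt X r t a)))) (\<pi> (c.gen X v'' (sg r b)))) (cdq X r t p)"
   by (rule dq_int[OF X t p Z bilin_comp[OF b sg_lin[OF X(1) tX] sg_lin[OF X]]])
  also have "... = ?G (eqv_quo r t)"
  proof (rule tlift_cong[OF qqvs[OF X(1)] q cdq_in[OF X t p]])
   fix a b assume "a : carr (sp P (qqo X r t))" "b : carr (Sq X r)"
   then have ab: "a : scar P (qqo X r t)" "b : Cq X r" by auto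
   show "be (\<pi> (c.gen X v' (sg t (flt X r t a)))) (\<pi> (c.gen X v'' (sg r b))) =
    be (p.gen (qqo X r t) (pc (quo X r) (eqv_quo r t) (pc X r v')) a) (pg X r v'' b)"
    unfolding pi_gen[OF X(1) v(1) tX flt_in[OF X t ab(1)]] pi_gen[OF X(1) v(2) X(2) ab(2)] gen_flat[OF X t v(1) ab(1)] ..
  qed
  finally show "tL Z (%a b. be (\<pi> (c.gen X v' (sg t a))) (\<pi> (c.gen X v'' (sg r b)))) (dq X r t p) = ?G (eqv_quo r t)" .
 qed
 also have "... = dint Z be (quo X r) p (pc X r v') (pc X r v'')"
  unfolding dint_def E_def by (rule sum.reindex_bij_betw[OF bij_eqv_quo[OF X]])
 finally show ?thesis .
qed

text \<open>By \<open>dint_flat\<close> both sides have the same integrand. One sums over components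
  of the letters on \<open>X\<close>, the other over components of their products on X/r;
  \<open>sw_pf\<close> equates the two.\<close>

lemma pi_delta:
 assumes d: "linmap p.F W d" and dg: "!!X v p. finite X ==> v : cl X ==> p : scar P X ==> d (p.gen X v p) = dP X v p"
  and x: "x : carr c.F"
 shows "d (\<pi> x) = tmap p.F p.F \<pi> \<pi> (c.dl x)"
proof -
 note W = vspace_tensor[of p.F p.F] and vC = c.vspace_fock and vP = p.vspace_fock
 note b = bilin_comp[OF p.tens_bilin pi_lin pi_lin]
 show ?thesis
 proof (rule fock_C_ext[OF linmap_comp[OF d pi_lin] linmap_comp[OF linmap_tmap[OF vC vC vP vP pi_lin pi_lin] c.delta_spec] _ x])
  fix X v r p assume X: "finite X" "v : cl X" "r : eqvs X" and p: "p : Cq X r"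
  let ?D = "dint W (tens p.F p.F) (quo X r) p"
  have "tmap p.F p.F \<pi> \<pi> (c.dl (c.gen X v (sg r p))) =
   sw W X v (%v' v''. tL W (%a b. tens p.F p.F (\<pi> (c.gen X v' a)) (\<pi> (c.gen X v'' b))) (tdel C X (sg r p)))"
   unfolding tmap_def by (rule c.delta_int[OF W b X(1,2) sg_C[OF X(1,3) p]])
  also have "... = sw W X v (%v' v''. ?D (pc X r v') (pc X r v''))"
   by (rule sw_cong[OF X(2)], rule dint_flat[OF X(1,3) p _ _ W p.tens_bilin])
  also have "... = sw W (quo X r) (pc X r v) ?D"
   unfolding quo_cls
   by (rule sw_pf[OF W X(1,2) dint_bml[OF finite_imageI[OF X(1)] p[unfolded quo_cls] W p.tens_bilin]])
  also have "... = d (\<pi> (c.gen X v (sg r p)))"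
   unfolding pi_gen[OF X p] dg[OF finite_quo[OF X(1)] pc_in[OF X(1,2)] p] dP_def ..
  finally show "d (\<pi> (c.gen X v (sg r p))) = tmap p.F p.F \<pi> \<pi> (c.dl (c.gen X v (sg r p)))" ..
 qed
qed

lemma eP_fform: "fform A P ground (%X v p. (PROD x:X. cou (v x)) * ceps P X p)"
 by (rule cou_fform) (use ce_lin ce_nat in auto)

text \<open>Multiplicativity of the counit of \<open>V\<close> lets the product over classes of
  products over letters collapse to the product over all letters.\<close>

lemma pi_eps:
 assumes e: "linmap p.F ground e" and eg: "!!X v p. finite X ==> v : cl X ==> p : scar P X ==>
   e (p.gen X v p) = (PROD x:X. cou (v x)) * ceps P X p"
  and x: "x : carr c.F"
 shows "e (\<pi> x) = c.ep x"
proof (rule fock_C_ext[OF linmap_comp[OF e pi_lin] c.eps_spec _ x])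
 fix X v r p assume X: "finite X" "v : cl X" "r : eqvs X" and p: "p : Cq X r"
 have "(PROD y:quo X r. cou (pc X r v y)) = (PROD x:X. cou (v x))"
  unfolding quo_cls by (rule cou_pf[OF X(1,2)])
 then show "e (\<pi> (c.gen X v (sg r p))) = c.ep (c.gen X v (sg r p))"
  unfolding pi_gen[OF X p] eg[OF finite_quo[OF X(1)] pc_in[OF X(1,2)] p] c.eps_gen[OF X(1,2) sg_C[OF X(1,3) p]]
  by (simp add: c.eform_def teps_C_sg[OF X(1,3)])
qed

lemma morphism_exists:
 obtains \<delta> \<epsilon> where "\<delta> : extensional (carr p.F)"
  "double_morphism (fock_dbialg V C c.dl c.ep) (fock_dbialg V P \<delta> \<epsilon>) \<pi>"
proof -
 note vP = p.vspace_fock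
 obtain d where d: "linmap p.F W d" and dg: "!!X v p. finite X ==> v : cl X ==> p : scar P X ==> d (p.gen X v p) = dP X v p"
  by (rule p.fock_lift[OF vspace_tensor dP_fform]) auto
 obtain e where e: "linmap p.F ground e" and eg: "!!X v p. finite X ==> v : cl X ==> p : scar P X ==>
   e (p.gen X v p) = (PROD x:X. cou (v x)) * ceps P X p"
  by (rule p.fock_lift[OF vspace_ground eP_fform]) auto
 \<comment> \<open>Restriction normalises the coproduct outside the carrier without affecting any
   law.\<close>
 let ?d = "restrict d (carr p.F)"
 have rd: "linmap p.F W ?d" by (rule linmap_cong[OF d vP]) simp
 have "double_morphism (fock_dbialg V C c.dl c.ep) (fock_dbialg V P ?d e) \<pi>"
  by (rule double_transport[OF c.double_bialgebra_fock])
   (simp_all add: fock_dbialg_def p.mul_bilin pi_mul pi_one p.fock_Delta_spec pi_Delta p.fock_Eps_spec pi_Eps rd e fi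
    pi_delta[OF d dg] pi_eps[OF e eg])
 then show ?thesis by (rule that[OF restrict_extensional])
qed

end

text \<open>Membership in \<open>extensional\<close> pins down \<delta> outside the carrier, where a
  function on the ambient type would otherwise be arbitrary; uniqueness thus concerns the carrier
  alone.\<close>

theorem proposition3p7:
  fixes V :: "('k::field, 'v::ab_group_add) nbialg"
    and P :: "('k, 'p::ab_group_add) ctbialg"
  assumes "comm_nbialgebra V"
    and "twisted_bialgebra P"
    and "contraction_extraction P"
    and "ce_compatible P"
  shows "\<exists>!\<delta>. \<delta> \<in> extensional (carr (fock (nsp V) P)) \<and>
           (\<exists>\<epsilon>. double_bialgebra (fock_dbialg V P \<delta> \<epsilon>) \<and>
                double_morphism
                  (fock_dbialg V (com_species P) (fock_delta V (com_species P)) (fock_eps V (com_species P)))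
                  (fock_dbialg V P \<delta> \<epsilon>)
                  (fock_pi V P))"
proof -
 interpret contraction V P
  using assms by (intro contraction.intro nb.intro ce.intro com.intro twisted_bialg.intro ce_axioms.intro)
 obtain \<delta> \<epsilon> where \<delta>: "\<delta> : extensional (carr p.F)"
  "double_morphism (fock_dbialg V C c.dl c.ep) (fock_dbialg V P \<delta> \<epsilon>) \<pi>"
  by (rule morphism_exists)
 show ?thesis
 proof (rule ex1I, intro conjI exI)
  show "\<delta> : extensional (carr p.F)" by (rule \<delta>(1))
  show "double_morphism (fock_dbialg V C c.dl c.ep) (fock_dbialg V P \<delta> \<epsilon>) \<pi>" by (rule \<delta>(2))
  then show "double_bialgebra (fock_dbialg V P \<delta> \<epsilon>)" by (simp add: double_morphism_def)
  fix \<delta>' assume *: "\<delta>' : extensional (carr p.F) & (\<exists>\<epsilon>. double_bialgebra (fock_dbialg V P \<delta>' \<epsilon>) \<and>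
   double_morphism (fock_dbialg V C c.dl c.ep) (fock_dbialg V P \<delta>' \<epsilon>) \<pi>)"
  \<comment> \<open>Compatibility of \<pi> with the second coproducts prescribes \<delta> on the
    image of \<pi>, whatever the counit is.\<close>
  have val: "\<gamma> (\<pi> x) = tmap p.F p.F \<pi> \<pi> (c.dl x)"
   if "double_morphism (fock_dbialg V C c.dl c.ep) (fock_dbialg V P \<gamma> e) \<pi>" "x : carr c.F" for \<gamma> e x
   using that unfolding double_morphism_def fock_dbialg_def dbialg.simps by blast
  show "\<delta>' = \<delta>"
  \<comment> \<open>Both coproducts are prescribed on the image of \<pi>, which is the whole
    carrier.\<close>
  proof (rule extensionalityI)
   show "\<delta>' : extensional (carr p.F)" "\<delta> : extensional (carr p.F)" using * \<delta>(1) by auto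
   fix y assume "y : carr p.F"
   then obtain x where x: "x : carr c.F" "y = \<pi> x" using pi_surj by auto
   obtain \<epsilon>' where "double_morphism (fock_dbialg V C c.dl c.ep) (fock_dbialg V P \<delta>' \<epsilon>') \<pi>" using * by blast
   from val[OF this x(1)] val[OF \<delta>(2) x(1)] x(2) show "\<delta>' y = \<delta> y" by simp
  qed
 qed
qed

end
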